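(* Let $n\ge 1$, let $T$ be a Calderón–Zygmund operator on $\mathbb{R}^n$, let $1<p<\infty$ and let $\mu,\lambda\in A_p$. Set $\nu=\mu^{1/p}\lambda^{-1/p}$ and suppose $b\in BMO(\nu)$. Then $$\big\|[b,T]: L^p(\mu)\to L^p(\lambda)\big\|\le c\,\|b\|_{BMO(\nu)},$$ where $c$ is a constant depending only on the dimension $n$, the operator $T$, and on $\mu$, $\lambda$ and $p$ (in particular not on $b$).
   Context: A weight on $\mathbb{R}^n$ is an almost everywhere positive, locally integrable function $w$; $w(Q)=\int_Q w\,dx$, $\langle f\rangle_Q=\frac1{|Q|}\int_Q f\,dx$, and $L^p(w)$ has norm $\|f\|_{L^p(w)}=(\int |f|^p w\,dx)^{1/p}$. For $1<p<\infty$ with Hölder conjugate $q$, $w\in A_p$ means $[w]_{A_p}=\sup_Q\langle w\rangle_Q\langle w^{1-q}\rangle_Q^{p-1}<\infty$, the supremum over all cubes $Q\subset\mathbb{R}^n$ with sides parallel to the axes. $BMO(\nu)$ is the space of locally integrable $b$ with $\|b\|_{BMO(\nu)}=\sup_Q\frac{1}{\nu(Q)}\int_Q|b-\langle b\rangle_Q|\,dx<\infty$, the supremum over all cubes with sides parallel to the axes. A Calderón–Zygmund operator $T$ is an operator bounded on $L^2(\mathbb{R}^n)$ and associated to a kernel $K(x,y)$ in the sense that $Tf(x)=\int_{\mathbb{R}^n}K(x,y)f(y)\,dy$ for $x\notin\operatorname{supp} f$, where $|K(x,y)|\le\frac{C}{|x-y|^n}$ and $|K(x+h,y)-K(x,y)|+|K(x,y+h)-K(x,y)|\le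 C\frac{|h|^\delta}{|x-y|^{n+\delta}}$ for all $|x-y|>2|h|>0$, for some fixed $\delta\in(0,1]$ and constant $C$. The commutator is $[b,T](f)=b\,Tf-T(bf)$, initially defined for bounded, compactly supported $f$; the operator norm is understood with respect to such (dense) $f$. *)

theory Defs
  imports "HOL-Analysis.Analysis"
begin

text \<open>
  Everything is taken with respect to Lebesgue measure on \<open>real ^ 'n\<close>, whose norm is the Euclidean
  one.  Functions are complex-valued, weights are real-valued.  Averages and norms are computed in
  \<^typ>\<open>ennreal\<close>, so that suprema and finiteness conditions have their usual meaning.
\<close>

section \<open>Preliminaries\<close>

text \<open>Used for \<open>a > 0\<close> only.\<close>

definition ennpow :: "ennreal \<Rightarrow> real \<Rightarrow> ennreal" where
  "ennpow x a = (if x = \<infinity> then \<infinity> else ennreal (enn2real x powr a))"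

definition cubes :: "(real ^ 'n) set set" where
  "cubes = {cbox a (\<chi> i. a $ i + l) | a l. l > 0}"

definition locally_integrable :: "(real ^ 'n \<Rightarrow> 'b::euclidean_space) \<Rightarrow> bool" where
  "locally_integrable f \<longleftrightarrow> (\<forall>S. compact S \<longrightarrow> set_integrable lebesgue S f)"

definition average :: "(real ^ 'n) set \<Rightarrow> (real ^ 'n \<Rightarrow> 'b::euclidean_space) \<Rightarrow> 'b" where
  "average Q f = (LINT x:Q|lebesgue. f x) /\<^sub>R measure lebesgue Q"

text \<open>The complement of the largest open set on which \<open>f\<close> vanishes almost everywhere; unlike the
  closure of \<open>{x. f x \<noteq> 0}\<close> it does not depend on the representative of \<open>f\<close>.\<close>

definition ess_support :: "(real ^ 'n \<Rightarrow> complex) \<Rightarrow> (real ^ 'n) set" where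
  "ess_support f = {x. \<forall>U. open U \<and> x \<in> U \<longrightarrow> \<not> (AE y in lebesgue. y \<in> U \<longrightarrow> f y = 0)}"

section \<open>Weights\<close>

definition weight :: "(real ^ 'n \<Rightarrow> real) \<Rightarrow> bool" where
  "weight w \<longleftrightarrow> locally_integrable w \<and> (AE x in lebesgue. w x > 0)"

definition wmass :: "(real ^ 'n \<Rightarrow> real) \<Rightarrow> (real ^ 'n) set \<Rightarrow> ennreal" where
  "wmass w Q = (\<integral>\<^sup>+x\<in>Q. ennreal (w x) \<partial>lebesgue)"

definition wavg :: "(real ^ 'n \<Rightarrow> real) \<Rightarrow> (real ^ 'n) set \<Rightarrow> ennreal" where
  "wavg w Q = wmass w Q / emeasure lebesgue Q"

definition conj_exp :: "real \<Rightarrow> real" where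
  "conj_exp p = p / (p - 1)"

definition Ap_char :: "real \<Rightarrow> (real ^ 'n \<Rightarrow> real) \<Rightarrow> ennreal" where
  "Ap_char p w =
     (SUP Q\<in>cubes. wavg w Q * ennpow (wavg (\<lambda>x. w x powr (1 - conj_exp p)) Q) (p - 1))"

definition Ap :: "real \<Rightarrow> (real ^ 'n \<Rightarrow> real) set" where
  "Ap p = {w. weight w \<and> Ap_char p w < \<infinity>}"

definition Lp_norm :: "real \<Rightarrow> (real ^ 'n \<Rightarrow> real) \<Rightarrow> (real ^ 'n \<Rightarrow> complex) \<Rightarrow> ennreal" where
  "Lp_norm p w f = ennpow (\<integral>\<^sup>+x. ennreal (norm (f x) powr p * w x) \<partial>lebesgue) (1 / p)"

definition Lp_space :: "real \<Rightarrow> (real ^ 'n \<Rightarrow> real) \<Rightarrow> (real ^ 'n \<Rightarrow> complex) set" where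
  "Lp_space p w = {f \<in> borel_measurable lebesgue. Lp_norm p w f < \<infinity>}"

section \<open>Weighted BMO\<close>

definition BMO_norm :: "(real ^ 'n \<Rightarrow> real) \<Rightarrow> (real ^ 'n \<Rightarrow> complex) \<Rightarrow> ennreal" where
  "BMO_norm \<nu> b =
     (SUP Q\<in>cubes. (\<integral>\<^sup>+x\<in>Q. ennreal (norm (b x - average Q b)) \<partial>lebesgue) / wmass \<nu> Q)"

definition BMO :: "(real ^ 'n \<Rightarrow> real) \<Rightarrow> (real ^ 'n \<Rightarrow> complex) set" where
  "BMO \<nu> = {b. locally_integrable b \<and> BMO_norm \<nu> b < \<infinity>}"

section \<open>Calderon-Zygmund operators\<close>

text \<open>
  An operator acts on representatives, and linearity is required almost everywhere only.  Together
  with the norm bound this implies that functions equal almost everywhere have images equal almost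
  everywhere, so that the operator is well defined on \<open>L\<^sup>2\<close> classes.
\<close>

definition bounded_operator_L2 ::
    "((real ^ 'n \<Rightarrow> complex) \<Rightarrow> (real ^ 'n \<Rightarrow> complex)) \<Rightarrow> bool" where
  "bounded_operator_L2 T \<longleftrightarrow>
     (\<forall>f\<in>Lp_space 2 (\<lambda>_. 1). T f \<in> Lp_space 2 (\<lambda>_. 1)) \<and>
     (\<forall>f\<in>Lp_space 2 (\<lambda>_. 1). \<forall>g\<in>Lp_space 2 (\<lambda>_. 1). \<forall>\<alpha> \<beta>.
        AE x in lebesgue. T (\<lambda>y. \<alpha> * f y + \<beta> * g y) x = \<alpha> * T f x + \<beta> * T g x) \<and>
     (\<exists>B::real. \<forall>f\<in>Lp_space 2 (\<lambda>_. 1).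
        Lp_norm 2 (\<lambda>_. 1) (T f) \<le> ennreal B * Lp_norm 2 (\<lambda>_. 1) f)"

text \<open>The values of \<open>K\<close> on the diagonal are irrelevant.  Off the diagonal these conditions make \<open>K\<close>
  continuous, so no measurability assumption is needed.\<close>

definition CZ_kernel :: "(real ^ 'n \<Rightarrow> real ^ 'n \<Rightarrow> complex) \<Rightarrow> bool" where
  "CZ_kernel K \<longleftrightarrow> (\<exists>(C::real) \<delta>. 0 < \<delta> \<and> \<delta> \<le> 1 \<and>
     (\<forall>x y. x \<noteq> y \<longrightarrow> norm (K x y) \<le> C / norm (x - y) ^ CARD('n)) \<and>
     (\<forall>x y h. norm (x - y) > 2 * norm h \<and> 2 * norm h > 0 \<longrightarrow>
        norm (K (x + h) y - K x y) + norm (K x (y + h) - K x y)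
          \<le> C * (norm h powr \<delta> / norm (x - y) powr (real CARD('n) + \<delta>))))"

definition CZ_operator ::
    "((real ^ 'n \<Rightarrow> complex) \<Rightarrow> (real ^ 'n \<Rightarrow> complex)) \<Rightarrow> bool" where
  "CZ_operator T \<longleftrightarrow> bounded_operator_L2 T \<and>
     (\<exists>K. CZ_kernel K \<and>
       (\<forall>f\<in>Lp_space 2 (\<lambda>_. 1). AE x in lebesgue.
          x \<notin> ess_support f \<longrightarrow> T f x = (LINT y|lebesgue. K x y * f y)))"

section \<open>Commutators\<close>

text \<open>
  For \<open>b\<close> in a weighted BMO space and \<open>f\<close> bounded with compact support, the product \<open>b f\<close> is
  integrable but need not belong to \<open>L\<^sup>2\<close>, where \<open>T\<close> is given.  As usual, \<open>T (b f)\<close> refers to the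
  continuous extension of \<open>T\<close> from \<open>L\<^sup>1 \<inter> L\<^sup>2\<close> to \<open>L\<^sup>1\<close> that the weak type (1,1) estimate provides:
  \<open>extends_to T g h\<close> says that \<open>h\<close> is the limit in measure of \<open>T (G k)\<close> for every sequence \<open>G\<close> in
  \<open>L\<^sup>1 \<inter> L\<^sup>2\<close> converging to \<open>g\<close> in \<open>L\<^sup>1\<close>.  This determines \<open>h\<close> almost everywhere, and \<open>h = T g\<close>
  almost everywhere if \<open>g \<in> L\<^sup>1 \<inter> L\<^sup>2\<close>.
\<close>

definition extends_to ::
    "((real ^ 'n \<Rightarrow> complex) \<Rightarrow> (real ^ 'n \<Rightarrow> complex)) \<Rightarrow>
     (real ^ 'n \<Rightarrow> complex) \<Rightarrow> (real ^ 'n \<Rightarrow> complex) \<Rightarrow> bool" where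
  "extends_to T g h \<longleftrightarrow> h \<in> borel_measurable lebesgue \<and>
     (\<forall>G :: nat \<Rightarrow> real ^ 'n \<Rightarrow> complex.
        (\<forall>k. G k \<in> Lp_space 1 (\<lambda>_. 1) \<inter> Lp_space 2 (\<lambda>_. 1)) \<and>
        (\<lambda>k. Lp_norm 1 (\<lambda>_. 1) (\<lambda>x. G k x - g x)) \<longlonglongrightarrow> 0 \<longrightarrow>
        (\<forall>\<epsilon>>0. (\<lambda>k. emeasure lebesgue {x. norm (T (G k) x - h x) > \<epsilon>}) \<longlonglongrightarrow> 0))"

definition L1_extension ::
    "((real ^ 'n \<Rightarrow> complex) \<Rightarrow> (real ^ 'n \<Rightarrow> complex)) \<Rightarrow>
     (real ^ 'n \<Rightarrow> complex) \<Rightarrow> (real ^ 'n \<Rightarrow> complex)" where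
  "L1_extension T g = (SOME h. extends_to T g h)"

definition commutator ::
    "(real ^ 'n \<Rightarrow> complex) \<Rightarrow> ((real ^ 'n \<Rightarrow> complex) \<Rightarrow> (real ^ 'n \<Rightarrow> complex)) \<Rightarrow>
     (real ^ 'n \<Rightarrow> complex) \<Rightarrow> (real ^ 'n \<Rightarrow> complex)" where
  "commutator b T f = (\<lambda>x. b x * T f x - L1_extension T (\<lambda>y. b y * f y) x)"

definition bounded_compact_support :: "(real ^ 'n \<Rightarrow> complex) set" where
  "bounded_compact_support =
     {f \<in> borel_measurable lebesgue. bounded (range f) \<and> (\<exists>S. compact S \<and> (\<forall>x. x \<notin> S \<longrightarrow> f x = 0))}"

definition operator_norm ::
    "real \<Rightarrow> (real ^ 'n \<Rightarrow> real) \<Rightarrow> (real ^ 'n \<Rightarrow> real) \<Rightarrow>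
     ((real ^ 'n \<Rightarrow> complex) \<Rightarrow> (real ^ 'n \<Rightarrow> complex)) \<Rightarrow> ennreal" where
  "operator_norm p \<mu> \<kappa> S =
     Inf {C. \<forall>f\<in>bounded_compact_support. Lp_norm p \<kappa> (S f) \<le> C * Lp_norm p \<mu> f}"

end

theory Submission
  imports Defs
begin

text \<open>
  Let \<open>g = \<bar>[b, T] f\<bar>\<^bsup>p - 1\<^esup> \<kappa>\<close>, cut off to a bounded set, so that it suffices to bound
  \<open>\<integral> \<bar>[b, T] f\<bar> g\<close>. The weak type (1,1) bound and the kernel smoothness control \<open>[b, T] f\<close> on a cube
  \<open>Q\<close>, outside stopping cubes covering at most half of \<open>Q\<close>, by
  \<open>\<bar>b - b\<^sub>R\<bar> \<langle>\<bar>f\<bar>\<rangle>\<^sub>R + \<langle>\<bar>b - b\<^sub>R\<bar> \<bar>f\<bar>\<rangle>\<^sub>R\<close>, with \<open>R\<close> a dilate of \<open>Q\<close>, and on every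
  stopping cube up to such an error by the commutator applied to the restriction of \<open>f\<close> to the dilate
  of that cube. Iterating gives a sparse form. Since \<open>\<nu> \<in> A\<^sub>2\<close>, a further stopping argument yields
  \<open>\<integral>\<^sub>R \<bar>b - b\<^sub>R\<bar> g \<le> C \<parallel>b\<parallel> \<integral>\<^sub>R (M g) \<nu>\<close>. Then sparseness turns the form into
  \<open>\<integral> M f M\<^sub>\<mu> (\<nu> M g / \<mu>) \<mu>\<close> and its dual, and Hoelder's inequality and the weighted bounds for
  maximal functions finish the proof.
\<close>

section \<open>Powers in the extended nonnegative reals\<close>

text \<open>The exponents in \<nu> are those for which multiplication by
  \<open>\<nu> / \<mu>\<close> maps L^q(\<open>\<kappa>^(1-q)\<close>), the space of the test
  function \<open>g\<close>, isometrically onto L^q(\<mu>). Trading the oscillation of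
  \<open>b\<close> for \<nu> thus bridges exactly the gap between the two weights. The obstacle is
  that \<open>b f\<close> need not be square integrable. The commutator contains the L1 extension of
  \<open>T\<close>, known only through limits in measure. Its linearity and its kernel formula have
  to be re-established almost everywhere from estimates off small sets, and they can be used at a
  point only after that point has been chosen off the null sets involved. Sparseness enters through
  one fact about A_p weights: a set filling half of a cube carries a fixed share of the weight of
  the cube and of its dilates. An error spread over a whole cube can therefore be paid on the part
  of the cube that later generations do not touch.\<close>

lemma ennpow_ennreal: "0 \<le> r \<Longrightarrow> ennpow (ennreal r) a = ennreal (r powr a)"
  by (simp add: ennpow_def)

lemma ennpow_top [simp]: "ennpow top a = top"
  by (simp add: ennpow_def)

lemma ennpow_0 [simp]: "ennpow 0 a = 0"
  by (simp add: ennpow_def)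

lemma ennpow_1 [simp]: "ennpow x 1 = x"
  by (cases x) (auto simp: ennpow_ennreal)

lemma ennpow_one [simp]: "ennpow 1 a = 1"
  by (simp add: ennpow_def)

lemma ennpow_eq_0_iff [simp]: "ennpow x a = 0 \<longleftrightarrow> x = 0"
  by (cases x) (auto simp: ennpow_ennreal)

lemma ennpow_eq_top_iff [simp]: "ennpow x a = top \<longleftrightarrow> x = top"
  by (cases x) (auto simp: ennpow_ennreal)

lemma ennpow_less_top [simp]: "ennpow x a < top \<longleftrightarrow> x < top"
  by (simp add: less_top[symmetric])

lemma ennpow_mult: "ennpow (x * y) a = ennpow x a * ennpow y a"
proof (cases "x = 0 \<or> y = 0")
  case False
  consider "x = top" | "y = top" | r s where "x = ennreal r" "0 \<le> r" "y = ennreal s" "0 \<le> s"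
    by (cases x; cases y) auto
  then show ?thesis
  proof cases
    case 3
    then show ?thesis
      by (simp add: ennpow_ennreal ennreal_mult[symmetric] powr_mult)
  qed (use False in \<open>simp_all add: ennreal_mult_top ennreal_top_mult\<close>)
qed auto

lemma ennpow_add: "ennpow x (a + b) = ennpow x a * ennpow x b"
  by (cases x) (auto simp: ennpow_ennreal ennreal_mult[symmetric] powr_add)

lemma ennpow_ennpow: "ennpow (ennpow x a) b = ennpow x (a * b)"
  by (cases x) (auto simp: ennpow_ennreal powr_powr)

lemma ennpow_mono: "0 < a \<Longrightarrow> x \<le> y \<Longrightarrow> ennpow x a \<le> ennpow y a"
  by (cases x; cases y) (auto simp: ennpow_ennreal powr_mono2 top_unique)

lemma ennpow_inverse: "0 < a \<Longrightarrow> ennpow (inverse x) a = inverse (ennpow x a)"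
proof (cases x)
  case (real r)
  then show ?thesis
    by (cases "r = 0") (auto simp: ennpow_ennreal inverse_ennreal powr_gt_zero inverse_powr)
qed auto

lemma ennpow_divide: "0 < a \<Longrightarrow> ennpow (x / y) a = ennpow x a / ennpow y a"
  by (simp add: divide_ennreal_def ennpow_mult ennpow_inverse)

lemma measurable_ennpow [measurable]:
  assumes "f \<in> borel_measurable M" shows "(\<lambda>x. ennpow (f x) a) \<in> borel_measurable M"
proof -
  have "(\<lambda>x. ennpow x a) \<in> borel_measurable borel"
    unfolding ennpow_def by measurable
  from measurable_compose[OF assms this] show ?thesis .
qed

lemma ennreal_Young:
  assumes "1 < p" "1 / p + 1 / q = 1"
  shows "x * y \<le> ennreal (1 / p) * ennpow x p + ennreal (1 / q) * ennpow y q"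
proof -
  have q: "1 < q"
  proof -
    have "1 / q = 1 - 1 / p" using assms by simp
    moreover have "1 - 1 / p < 1" "1 - 1 / p > 0" using assms by auto
    ultimately have "1 / q < 1" "1 / q > 0" by auto
    then show ?thesis by (simp add: field_simps split: if_splits)
  qed
  show ?thesis
  proof (cases "x = top \<or> y = top")
    case True
    have "ennreal (1 / p) * ennpow x p + ennreal (1 / q) * ennpow y q = top"
      using True q assms by (auto simp: ennreal_mult_top)
    then show ?thesis by (simp only: top_greatest)
  next
    case False
    then obtain r s where "x = ennreal r" "0 \<le> r" "y = ennreal s" "0 \<le> s"
      by (cases x; cases y) auto
    moreover have "r * s \<le> r powr p / p + s powr q / q"
      using Youngs_inequality[of p q r s] assms q calculation by auto
    ultimately show ?thesis using q assms
      by (simp add: ennpow_ennreal ennreal_mult[symmetric] ennreal_plus[symmetric] del: ennreal_plus)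
  qed
qed

text \<open>Normalising both factors to norm one reduces the claim to Young's inequality. Dividing
  requires norms that are neither zero nor infinite: a zero norm makes the integrand vanish almost
  everywhere, and two nonzero norms of which one is infinite make the right-hand side
  infinite.\<close>

lemma nn_integral_Holder:
  assumes "1 < p" "1 / p + 1 / q = 1"
    and [measurable]: "f \<in> borel_measurable M" "g \<in> borel_measurable M"
  shows "(\<integral>\<^sup>+x. f x * g x \<partial>M) \<le>
    ennpow (\<integral>\<^sup>+x. ennpow (f x) p \<partial>M) (1 / p) * ennpow (\<integral>\<^sup>+x. ennpow (g x) q \<partial>M) (1 / q)"
    (is "_ \<le> ?A * ?B")
proof -
  have q: "0 < q"
  proof -
    have "1 / q = 1 - 1 / p" using assms by simp
    moreover have "1 - 1 / p > 0" using assms by auto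
    ultimately have "1 / q > 0" by auto
    then show ?thesis by (simp add: field_simps split: if_splits)
  qed
  consider "?A = 0" | "?B = 0" | "?A \<noteq> 0" "?B \<noteq> 0" "?A = top \<or> ?B = top"
    | "?A \<noteq> 0" "?B \<noteq> 0" "?A \<noteq> top" "?B \<noteq> top" by blast
  then show ?thesis
  proof cases
    case 1
    then have "AE x in M. f x = 0" by (simp add: nn_integral_0_iff_AE)
    then have "(\<integral>\<^sup>+x. f x * g x \<partial>M) = (\<integral>\<^sup>+x. 0 \<partial>M)"
      by (intro nn_integral_cong_AE) auto
    then show ?thesis by simp
  next
    case 2
    then have "AE x in M. g x = 0" by (simp add: nn_integral_0_iff_AE)
    then have "(\<integral>\<^sup>+x. f x * g x \<partial>M) = (\<integral>\<^sup>+x. 0 \<partial>M)"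
      by (intro nn_integral_cong_AE) auto
    then show ?thesis by simp
  next
    case 3
    then have "?A * ?B = top" by (auto simp: ennreal_mult_eq_top_iff)
    then show ?thesis by simp
  next
    case 4
    have A: "(\<integral>\<^sup>+x. ennpow (f x / ?A) p \<partial>M) = 1"
    proof -
      have "(\<integral>\<^sup>+x. ennpow (f x / ?A) p \<partial>M) = (\<integral>\<^sup>+x. ennpow (f x) p / ennpow ?A p \<partial>M)"
        using assms by (simp add: ennpow_divide)
      also have "\<dots> = (\<integral>\<^sup>+x. ennpow (f x) p \<partial>M) / ennpow ?A p"
        by (rule nn_integral_divide) measurable
      also have "ennpow ?A p = (\<integral>\<^sup>+x. ennpow (f x) p \<partial>M)"
        using assms by (simp add: ennpow_ennpow)
      finally show ?thesis using 4 by (simp add: ennreal_divide_self less_top[symmetric])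
    qed
    have B: "(\<integral>\<^sup>+x. ennpow (g x / ?B) q \<partial>M) = 1"
    proof -
      have "(\<integral>\<^sup>+x. ennpow (g x / ?B) q \<partial>M) = (\<integral>\<^sup>+x. ennpow (g x) q / ennpow ?B q \<partial>M)"
        using q by (simp add: ennpow_divide)
      also have "\<dots> = (\<integral>\<^sup>+x. ennpow (g x) q \<partial>M) / ennpow ?B q"
        by (rule nn_integral_divide) measurable
      also have "ennpow ?B q = (\<integral>\<^sup>+x. ennpow (g x) q \<partial>M)"
        using q by (simp add: ennpow_ennpow)
      finally show ?thesis using 4 by (simp add: ennreal_divide_self less_top[symmetric])
    qed
    have canc: "c * (y / c) = y" if "c \<noteq> 0" "c \<noteq> top" for c y :: ennreal
      using that mult_divide_eq_ennreal[of c y] by (simp add: ennreal_times_divide mult.commute)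
    have eq: "f x * g x = ?A * ?B * ((f x / ?A) * (g x / ?B))" for x
    proof -
      have "?A * ?B * ((f x / ?A) * (g x / ?B)) = (?A * (f x / ?A)) * (?B * (g x / ?B))"
        by (simp only: mult_ac)
      then show ?thesis by (simp only: canc[OF 4(1,3)] canc[OF 4(2,4)])
    qed
    have fg: "(\<integral>\<^sup>+x. f x * g x \<partial>M) = ?A * ?B * (\<integral>\<^sup>+x. (f x / ?A) * (g x / ?B) \<partial>M)"
      by (subst nn_integral_cmult[symmetric], measurable) (rule nn_integral_cong, rule eq)
    have "(\<integral>\<^sup>+x. (f x / ?A) * (g x / ?B) \<partial>M) \<le>
      (\<integral>\<^sup>+x. ennreal (1 / p) * ennpow (f x / ?A) p + ennreal (1 / q) * ennpow (g x / ?B) q \<partial>M)"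
      by (intro nn_integral_mono ennreal_Young assms)
    also have "\<dots> = ennreal (1 / p) + ennreal (1 / q)"
      by (subst nn_integral_add, measurable) (simp add: nn_integral_cmult A B)
    also have "\<dots> = 1" using assms q by (simp add: ennreal_plus[symmetric] del: ennreal_plus)
    finally have "?A * ?B * (\<integral>\<^sup>+x. (f x / ?A) * (g x / ?B) \<partial>M) \<le> ?A * ?B * 1"
      by (rule mult_left_mono) simp
    then show ?thesis unfolding fg by simp
  qed
qed

section \<open>Cubes\<close>

text \<open>As simp rules these would trade \<open>lebesgue\<close> for \<open>lborel\<close> in the
  middle of a proof.\<close>

declare emeasure_completion [simp del] measure_completion [simp del] AE_completion_iff [simp del]

text \<open>Open cubes serve the maximal functions, whose superlevel sets then are open. The
  half-open \<open>hcube\<close> serves the dyadic constructions, where the cubes of one generation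
  have to be disjoint and to cover. Both differ from the closed cube by a null set.\<close>

definition ocube :: "real ^ 'n \<Rightarrow> real \<Rightarrow> (real ^ 'n) set" where
  "ocube a l = {x. \<forall>i. a $ i < x $ i \<and> x $ i < a $ i + l}"

definition hcube :: "real ^ 'n \<Rightarrow> real \<Rightarrow> (real ^ 'n) set" where
  "hcube a l = {x. \<forall>i. a $ i \<le> x $ i \<and> x $ i < a $ i + l}"

text \<open>The margin is \<open>m * l\<close> on each side, so for \<open>m \<ge> 0\<close> a point
  outside has distance at least \<open>m * l\<close> from every point of the cube.\<close>

definition dil :: "real \<Rightarrow> real ^ 'n \<Rightarrow> real \<Rightarrow> (real ^ 'n) set" where
  "dil m a l = ocube (\<chi> i. a $ i - m * l) ((2 * m + 1) * l)"

lemma ocube_eq_box: "ocube a l = box a (\<chi> i. a $ i + l)"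
  by (auto simp: ocube_def mem_box_cart)

lemma open_ocube [intro, simp]: "open (ocube a l)"
  by (simp add: ocube_eq_box open_box)

lemma ocube_borel [measurable, simp]: "ocube a l \<in> sets borel"
  by (simp add: borel_open)

lemma ocube_lebesgue [measurable, simp]: "ocube a l \<in> sets lebesgue"
  by (simp add: sets_completionI_sets)

lemma content_cube: "0 < l \<Longrightarrow> measure lborel (cbox a (\<chi> i. a $ i + l)) = l ^ CARD('n)"
  for a :: "real ^ 'n"
  by (subst content_cbox_cart) (auto simp: interval_ne_empty_cart less_imp_le)

lemma emeasure_ccube: "0 < l \<Longrightarrow> emeasure lebesgue (cbox a (\<chi> i. a $ i + l)) = ennreal (l ^ CARD('n))"
  for a :: "real ^ 'n"
  using content_cube[of l a] emeasure_eq_ennreal_measure[of lborel "cbox a (\<chi> i. a $ i + l)"]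
    emeasure_lborel_cbox_finite[of a "\<chi> i. a $ i + l"]
  by (simp add: emeasure_completion del: emeasure_lborel_cbox measure_lborel_cbox)

lemma emeasure_ocube: "0 < l \<Longrightarrow> emeasure lebesgue (ocube a l) = ennreal (l ^ CARD('n))"
  for a :: "real ^ 'n"
proof -
  assume l: "0 < l"
  have "emeasure lebesgue (ocube a l) = emeasure lborel (box a (\<chi> i. a $ i + l))"
    by (simp add: ocube_eq_box emeasure_completion)
  also have "\<dots> = emeasure lborel (cbox a (\<chi> i. a $ i + l))"
    by (simp add: emeasure_lborel_box_eq emeasure_lborel_cbox_eq)
  also have "\<dots> = emeasure lebesgue (cbox a (\<chi> i. a $ i + l))" by (simp add: emeasure_completion)
  finally show ?thesis using emeasure_ccube[OF l] by simp
qed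

lemma ccube_diff_ocube_null: "cbox a (\<chi> i. a $ i + l) - ocube a l \<in> null_sets lebesgue"
proof (cases "0 < l")
  case True
  have "emeasure lebesgue (cbox a (\<chi> i. a $ i + l) - ocube a l) = emeasure lebesgue (cbox a (\<chi> i. a $ i + l)) - emeasure lebesgue (ocube a l)"
    using emeasure_ocube[OF True, of a]
    by (intro emeasure_Diff) (auto simp: ocube_eq_box intro: box_subset_cbox[THEN subsetD])
  then show ?thesis
    by (simp add: null_sets_def emeasure_ocube emeasure_ccube True)
next
  case False
  show ?thesis
  proof (cases "l = 0")
    case True
    have "cbox a (\<chi> i. a $ i + l) - ocube a l \<subseteq> {a}"
      using True by (auto simp: mem_box_cart vec_eq_iff intro: antisym)
    then show ?thesis
      by (metis finite.emptyI finite.insertI finite_subset negligible_finite negligible_iff_null_sets)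
  next
    case F: False
    have "cbox a (\<chi> i. a $ i + l) = {}"
      using False F by (auto simp: interval_eq_empty_cart)
    then show ?thesis by simp
  qed
qed

lemma hcube_borel [measurable, simp]: "hcube a l \<in> sets borel"
proof -
  have "hcube a l = (\<Inter>i. {x. a $ i \<le> x $ i} \<inter> {x. x $ i < a $ i + l})"
    by (auto simp: hcube_def)
  also have "\<dots> \<in> sets borel"
    by (intro sets.finite_INT sets.Int) auto
  finally show ?thesis .
qed

lemma hcube_lebesgue [measurable, simp]: "hcube a l \<in> sets lebesgue"
  by (simp add: sets_completionI_sets)

lemma ocube_subset_hcube: "ocube a l \<subseteq> hcube a l"
  by (auto simp: ocube_def hcube_def less_imp_le)

lemma hcube_subset_ccube: "hcube a l \<subseteq> cbox a (\<chi> i. a $ i + l)"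
  by (auto simp: hcube_def mem_box_cart less_imp_le)

lemma AE_ccube_hcube_ocube:
  "AE x in lebesgue. (x \<in> cbox a (\<chi> i. a $ i + l) \<longleftrightarrow> x \<in> ocube a l) \<and> (x \<in> hcube a l \<longleftrightarrow> x \<in> ocube a l)"
  using AE_not_in[OF ccube_diff_ocube_null[of a l]]
  by eventually_elim (use ocube_subset_hcube hcube_subset_ccube in blast)

lemma emeasure_hcube: "0 < l \<Longrightarrow> emeasure lebesgue (hcube a l) = ennreal (l ^ CARD('n))"
  for a :: "real ^ 'n"
  by (subst emeasure_ocube[symmetric, of l a])
    (auto intro!: emeasure_eq_AE eventually_mono[OF AE_ccube_hcube_ocube])

lemma emeasure_dil: "0 < l \<Longrightarrow> 0 \<le> m \<Longrightarrow> emeasure lebesgue (dil m a l) = ennreal (((2 * m + 1) * l) ^ CARD('n))"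
  for a :: "real ^ 'n"
  unfolding dil_def by (subst emeasure_ocube) (auto intro: mult_pos_pos)

lemma open_dil [simp]: "open (dil m a l)"
  by (simp add: dil_def)

lemma dil_lebesgue [measurable, simp]: "dil m a l \<in> sets lebesgue"
  by (simp add: dil_def)

lemma hcube_subset_dil: "0 < l \<Longrightarrow> 0 < m \<Longrightarrow> hcube a l \<subseteq> dil m a l"
proof (auto simp: hcube_def dil_def ocube_def algebra_simps)
  fix x :: "real ^ 'a" and i
  assume a: "0 < l" "0 < m" "\<forall>i. a $ i \<le> x $ i \<and> x $ i < l + a $ i"
  then have "0 < l * m" "a $ i \<le> x $ i" "x $ i < l + a $ i" by auto
  then show "a $ i < x $ i + l * m" "x $ i < l + (a $ i + l * m)"
    by linarith+
qed

lemma ocube_subset_dil_1: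
  assumes "ocube a l \<inter> ocube a' l' \<noteq> {}" "l' \<le> l"
  shows "ocube a' l' \<subseteq> dil 1 a l"
proof
  fix x assume x: "x \<in> ocube a' l'"
  obtain z where z: "z \<in> ocube a l" "z \<in> ocube a' l'" using assms by auto
  show "x \<in> dil 1 a l"
    unfolding dil_def ocube_def
  proof safe
    fix i
    have "a' $ i < x $ i" "x $ i < a' $ i + l'" "a' $ i < z $ i" "z $ i < a' $ i + l'"
      "a $ i < z $ i" "z $ i < a $ i + l"
      using x z by (auto simp: ocube_def)
    then show "(\<chi> i. a $ i - 1 * l) $ i < x $ i" "x $ i < (\<chi> i. a $ i - 1 * l) $ i + (2 * 1 + 1) * l"
      using assms(2) by (auto simp: algebra_simps)
  qed
qed

section \<open>Maximal functions for doubling measures\<close>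

text \<open>Greedy choice: keep a cube of maximal side and discard all cubes that meet it. A
  discarded cube is no larger than the kept one and hence lies in its triple.\<close>

lemma Vitali_finite_cubes:
  assumes "finite \<R>" "\<And>a l. (a, l) \<in> \<R> \<Longrightarrow> 0 < l"
  shows "\<exists>\<S>\<subseteq>\<R>. disjoint_family_on (\<lambda>(a, l). ocube a l) \<S> \<and>
    (\<Union>(a, l)\<in>\<R>. ocube a l) \<subseteq> (\<Union>(a, l)\<in>\<S>. dil 1 a l)"
  using assms
proof (induction "card \<R>" arbitrary: \<R> rule: less_induct)
  case less
  show ?case
  proof (cases "\<R> = {}")
    case True
    then show ?thesis by (auto simp: disjoint_family_on_def)
  next
    case False
    have "\<exists>c\<in>\<R>. \<forall>d\<in>\<R>. snd d \<le> snd c"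
    proof -
      have "Max (snd ` \<R>) \<in> snd ` \<R>" using less.prems(1) False by simp
      then obtain c where "c \<in> \<R>" "snd c = Max (snd ` \<R>)" by auto
      then show ?thesis using less.prems(1) by (intro bexI[of _ c]) auto
    qed
    then obtain a l where al: "(a, l) \<in> \<R>" "\<And>a' l'. (a', l') \<in> \<R> \<Longrightarrow> l' \<le> l"
      by force
    have l: "0 < l" using less.prems(2) al by blast
    define \<R>' where "\<R>' = {c \<in> \<R>. ocube a l \<inter> ocube (fst c) (snd c) = {}}"
    have ne: "ocube a l \<noteq> {}"
      using emeasure_ocube[OF l, of a] l by (metis emeasure_empty ennreal_eq_0_iff not_less zero_less_power)
    have "(a, l) \<notin> \<R>'" using ne by (simp add: \<R>'_def)
    moreover have "\<R>' \<subseteq> \<R>" by (auto simp: \<R>'_def)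
    ultimately have "\<R>' \<subset> \<R>" using al(1) by blast
    then have "card \<R>' < card \<R>" using less.prems(1) by (rule psubset_card_mono[rotated])
    moreover have "finite \<R>'" "\<And>a l. (a, l) \<in> \<R>' \<Longrightarrow> 0 < l"
      using less.prems by (auto simp: \<R>'_def)
    ultimately obtain \<S> where S: "\<S> \<subseteq> \<R>'" "disjoint_family_on (\<lambda>(a, l). ocube a l) \<S>"
      "(\<Union>(a, l)\<in>\<R>'. ocube a l) \<subseteq> (\<Union>(a, l)\<in>\<S>. dil 1 a l)"
      using less.hyps by meson
    show ?thesis
    proof (intro exI[of _ "insert (a, l) \<S>"] conjI)
      show "insert (a, l) \<S> \<subseteq> \<R>" using S(1) al by (auto simp: \<R>'_def)
      show "disjoint_family_on (\<lambda>(a, l). ocube a l) (insert (a, l) \<S>)"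
        using S(1,2) unfolding disjoint_family_on_def \<R>'_def by fastforce
      show "(\<Union>(a, l)\<in>\<R>. ocube a l) \<subseteq> (\<Union>(a, l)\<in>insert (a, l) \<S>. dil 1 a l)"
      proof
        fix x assume "x \<in> (\<Union>(a, l)\<in>\<R>. ocube a l)"
        then obtain a' l' where c: "(a', l') \<in> \<R>" "x \<in> ocube a' l'" by auto
        show "x \<in> (\<Union>(a, l)\<in>insert (a, l) \<S>. dil 1 a l)"
        proof (cases "(a', l') \<in> \<R>'")
          case True
          then show ?thesis using c S(3) by auto
        next
          case False
          then have "ocube a l \<inter> ocube a' l' \<noteq> {}" using c by (auto simp: \<R>'_def)
          then have "ocube a' l' \<subseteq> dil 1 a l" using ocube_subset_dil_1 al(2) c(1) by blast
          then show ?thesis using c by auto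
        qed
      qed
    qed
  qed
qed

text \<open>Positive and finite mass of cubes is part of the notion, so that averages can be formed
  and multiplied out again and the measure is sigma-finite.\<close>

definition doubling :: "(real ^ 'n) measure \<Rightarrow> real \<Rightarrow> bool" where
  "doubling N D \<longleftrightarrow> sets N = sets lebesgue \<and> 0 < D \<and>
    (\<forall>a l. 0 < l \<longrightarrow> 0 < emeasure N (ocube a l) \<and> emeasure N (ocube a l) < top \<and>
       emeasure N (dil 1 a l) \<le> ennreal D * emeasure N (ocube a l))"

text \<open>The uncentred maximal operator of the measure \<open>N\<close>: the average over a cube
  is a lower bound at all points of the cube simultaneously.\<close>

definition Mx :: "(real ^ 'n) measure \<Rightarrow> (real ^ 'n \<Rightarrow> ennreal) \<Rightarrow> real ^ 'n \<Rightarrow> ennreal" where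
  "Mx N h x = (SUP (a, l) \<in> {(a, l). 0 < l \<and> x \<in> ocube a l}.
     (\<integral>\<^sup>+y\<in>ocube a l. h y \<partial>N) / emeasure N (ocube a l))"

lemma Mx_ge: "0 < l \<Longrightarrow> x \<in> ocube a l \<Longrightarrow>
    (\<integral>\<^sup>+y\<in>ocube a l. h y \<partial>N) / emeasure N (ocube a l) \<le> Mx N h x"
  unfolding Mx_def by (rule SUP_upper2[of "(a, l)"]) auto

lemma Mx_le: "(\<And>a l. 0 < l \<Longrightarrow> x \<in> ocube a l \<Longrightarrow>
    (\<integral>\<^sup>+y\<in>ocube a l. h y \<partial>N) / emeasure N (ocube a l) \<le> c) \<Longrightarrow> Mx N h x \<le> c"
  unfolding Mx_def by (rule SUP_least) auto

lemma Mx_superlevel: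
  "{x. t < Mx N h x} = (\<Union>(a, l)\<in>{(a, l). 0 < l \<and> t < (\<integral>\<^sup>+y\<in>ocube a l. h y \<partial>N) / emeasure N (ocube a l)}. ocube a l)"
  by (auto simp: Mx_def less_SUP_iff)

lemma open_Mx_superlevel: "open {x. t < Mx N h x}"
  unfolding Mx_superlevel by auto

lemma measurable_Mx_lebesgue [measurable]: "Mx N h \<in> borel_measurable lebesgue"
proof (rule borel_measurableI_greater)
  fix t
  have "{x. t < Mx N h x} \<in> sets lebesgue"
    using open_Mx_superlevel borel_open by (intro sets_completionI_sets) auto
  then show "{x \<in> space lebesgue. t < Mx N h x} \<in> sets lebesgue" by simp
qed

text \<open>By Lindelof countably many of the cubes with average above \<open>t\<close> cover the
  superlevel set. Among finitely many of them a disjoint subfamily with covering triples is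
  selected; doubling bounds the triples by the cubes themselves, and the integrals of
  \<open>h\<close> over disjoint cubes add up to at most the whole integral. Continuity from below
  then passes to the countable family.\<close>

lemma Mx_weak_type:
  assumes D: "doubling N D" and h: "h \<in> borel_measurable N"
  shows "t * emeasure N {x. t < Mx N h x} \<le> ennreal D * (\<integral>\<^sup>+x. h x \<partial>N)"
proof -
  have N [measurable_cong, simp]: "sets N = sets lebesgue" using D by (simp add: doubling_def)
  note [measurable] = h
  define P where "P = {(a, l). 0 < l \<and> t < (\<integral>\<^sup>+y\<in>ocube a l. h y \<partial>N) / emeasure N (ocube a l)}"
  have "\<And>S. S \<in> (\<lambda>(a, l). ocube a l) ` P \<Longrightarrow> open S" by auto
  from Lindelof[OF this] obtain \<F> where F: "\<F> \<subseteq> (\<lambda>(a, l). ocube a l) ` P" "countable \<F>"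
    "\<Union>\<F> = (\<Union>c\<in>P. (\<lambda>(a, l). ocube a l) c)"
    by blast
  obtain P' where P': "countable P'" "P' \<subseteq> P" "\<F> = (\<lambda>(a, l). ocube a l) ` P'"
    using F(1,2) by (metis countable_subset_image)
  have U: "{x. t < Mx N h x} = (\<Union>(a, l)\<in>P'. ocube a l)"
    using F(3) P'(3) unfolding Mx_superlevel P_def[symmetric] by simp
  have fin: "t * emeasure N (\<Union>(a, l)\<in>R. ocube a l) \<le> ennreal D * (\<integral>\<^sup>+x. h x \<partial>N)"
    if R: "finite R" "R \<subseteq> P" for R
  proof -
    have pos: "0 < l" if "(a, l) \<in> R" for a l using that R by (auto simp: P_def)
    then obtain S where S: "S \<subseteq> R" "disjoint_family_on (\<lambda>(a, l). ocube a l) S"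
      "(\<Union>(a, l)\<in>R. ocube a l) \<subseteq> (\<Union>(a, l)\<in>S. dil 1 a l)"
      using Vitali_finite_cubes[OF R(1)] by auto
    have fS: "finite S" using S R finite_subset by blast
    have "emeasure N (\<Union>(a, l)\<in>R. ocube a l) \<le> emeasure N (\<Union>(a, l)\<in>S. dil 1 a l)"
      by (intro emeasure_mono S) (use fS in auto)
    also have "\<dots> \<le> (\<Sum>c\<in>S. emeasure N ((\<lambda>(a, l). dil 1 a l) c))"
      by (intro emeasure_subadditive_finite fS) auto
    finally have "t * emeasure N (\<Union>(a, l)\<in>R. ocube a l) \<le> (\<Sum>c\<in>S. t * emeasure N ((\<lambda>(a, l). dil 1 a l) c))"
      by (simp only: sum_distrib_left[symmetric]) (rule mult_left_mono, auto)
    also have "\<dots> \<le> (\<Sum>c\<in>S. ennreal D * (\<integral>\<^sup>+x\<in>(\<lambda>(a, l). ocube a l) c. h x \<partial>N))"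
    proof (intro sum_mono, clarify)
      fix a l assume "(a, l) \<in> S"
      then have al: "(a, l) \<in> P" using S R by auto
      then have l: "0 < l" by (simp add: P_def)
      have N0: "0 < emeasure N (ocube a l)" "emeasure N (ocube a l) < top"
        "emeasure N (dil 1 a l) \<le> ennreal D * emeasure N (ocube a l)"
        using D l by (auto simp: doubling_def)
      have "t * emeasure N (ocube a l) \<le> (\<integral>\<^sup>+y\<in>ocube a l. h y \<partial>N) / emeasure N (ocube a l) * emeasure N (ocube a l)"
        using al by (intro mult_right_mono) (auto simp: P_def)
      also have "\<dots> = (\<integral>\<^sup>+y\<in>ocube a l. h y \<partial>N)"
        using N0 by (simp add: ennreal_divide_times mult_divide_eq_ennreal)
      finally have *: "t * emeasure N (ocube a l) \<le> (\<integral>\<^sup>+y\<in>ocube a l. h y \<partial>N)" .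
      have "t * emeasure N (dil 1 a l) \<le> t * (ennreal D * emeasure N (ocube a l))"
        by (intro mult_left_mono N0) auto
      also have "\<dots> = ennreal D * (t * emeasure N (ocube a l))" by (simp add: mult_ac)
      also have "\<dots> \<le> ennreal D * (\<integral>\<^sup>+y\<in>ocube a l. h y \<partial>N)" by (intro mult_left_mono *) auto
      finally show "t * emeasure N (dil 1 a l) \<le> ennreal D * (\<integral>\<^sup>+y\<in>ocube a l. h y \<partial>N)" .
    qed
    also have "\<dots> = ennreal D * (\<Sum>c\<in>S. (\<integral>\<^sup>+x. h x * indicator ((\<lambda>(a, l). ocube a l) c) x \<partial>N))"
      by (simp add: sum_distrib_left)
    also have "(\<Sum>c\<in>S. (\<integral>\<^sup>+x. h x * indicator ((\<lambda>(a, l). ocube a l) c) x \<partial>N)) =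
       (\<integral>\<^sup>+x. (\<Sum>c\<in>S. h x * indicator ((\<lambda>(a, l). ocube a l) c) x) \<partial>N)"
      by (rule nn_integral_sum[symmetric]) (auto split: prod.splits)
    also have "\<dots> \<le> (\<integral>\<^sup>+x. h x \<partial>N)"
    proof (intro nn_integral_mono)
      fix x
      have "(\<Sum>c\<in>S. h x * indicator ((\<lambda>(a, l). ocube a l) c) x) = h x * indicator (\<Union>c\<in>S. (\<lambda>(a, l). ocube a l) c) x"
        by (simp add: sum_distrib_left[symmetric] indicator_UN_disjoint[OF fS S(2)])
      also have "\<dots> \<le> h x" by (simp split: split_indicator)
      finally show "(\<Sum>c\<in>S. h x * indicator ((\<lambda>(a, l). ocube a l) c) x) \<le> h x" .
    qed
    finally show ?thesis by (simp add: mult_left_mono)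
  qed
  show ?thesis
  proof (cases "P' = {}")
    case True
    then show ?thesis using U by simp
  next
    case False
    define e where "e = from_nat_into P'"
    have e: "range e = P'" using False P' by (simp add: e_def range_from_nat_into)
    define A where "A k = (\<Union>c\<in>e ` {..k}. (\<lambda>(a, l). ocube a l) c)" for k :: nat
    have UA: "{x. t < Mx N h x} = (\<Union>k. A k)"
    proof -
      have "(\<Union>c\<in>range e. f c) = (\<Union>k. \<Union>c\<in>e ` {..k}. f c)" for f :: "_ \<Rightarrow> (real ^ 'n) set"
        by auto
      then show ?thesis unfolding U A_def e[symmetric] .
    qed
    have "incseq A" unfolding A_def by (intro monoI UN_mono image_mono) auto
    moreover have "range A \<subseteq> sets N"
      by (auto simp: A_def split: prod.splits intro!: sets.finite_UN)
    ultimately have "emeasure N {x. t < Mx N h x} = (SUP k. emeasure N (A k))"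
      unfolding UA by (metis SUP_emeasure_incseq)
    then have "t * emeasure N {x. t < Mx N h x} = (SUP k. t * emeasure N (A k))"
      by (simp add: SUP_mult_left_ennreal)
    also have "\<dots> \<le> ennreal D * (\<integral>\<^sup>+x. h x \<partial>N)"
    proof (rule SUP_least)
      fix k
      have "finite (e ` {..k})" "e ` {..k} \<subseteq> P" using e P'(2) by auto
      from fin[OF this] show "t * emeasure N (A k) \<le> ennreal D * (\<integral>\<^sup>+x. h x \<partial>N)"
        by (simp add: A_def)
    qed
    finally show ?thesis .
  qed
qed

text \<open>Makes Fubini's theorem available in the layer-cake argument.\<close>

lemma doubling_sigma_finite:
  assumes "doubling N D" shows "sigma_finite_measure N"
proof
  let ?c = "\<lambda>k::nat. ocube (\<chi> i. - real (Suc k)) (2 * real (Suc k)) :: (real ^ 'n) set"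
  have sN: "sets N = sets lebesgue" using assms by (simp add: doubling_def)
  then have sp: "space N = UNIV" by (metis sets_eq_imp_space_eq space_completion space_lborel space_borel)
  have "x \<in> (\<Union>k. ?c k)" for x :: "real ^ 'n"
  proof -
    obtain k :: nat where k: "norm x \<le> real k" using real_arch_simple by blast
    have "\<bar>x $ i\<bar> < real (Suc k)" for i using component_le_norm_cart[of x i] k by simp
    then have "x \<in> ?c k"
      unfolding ocube_def by (auto simp: abs_less_iff minus_less_iff simp del: of_nat_Suc)
    then show ?thesis by blast
  qed
  then have "(\<Union>k. ?c k) = space N" using sp by blast
  then show "\<exists>A. countable A \<and> A \<subseteq> sets N \<and> \<Union> A = space N \<and> (\<forall>a\<in>A. emeasure N a \<noteq> \<infinity>)"
    using assms sN by (intro exI[of _ "range ?c"]) (auto simp: doubling_def less_top[symmetric])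
qed

section \<open>The strong type inequality for maximal functions\<close>

text \<open>Serves twice in the strong type bound: with \<open>a = p\<close> as the layer-cake
  formula, and with \<open>a = p - 1\<close>, possibly below 1 so that the integrand is singular at
  the origin, for the inner integral after Fubini.\<close>

lemma nn_integral_powr_layer:
  assumes a: "0 < a"
  shows "(\<integral>\<^sup>+t. (if 0 < t \<and> ennreal t < u then ennreal (t powr (a - 1)) else 0) \<partial>lborel) = ennpow u a / ennreal a"
proof -
  have layer: "(\<integral>\<^sup>+t. (if 0 < t \<and> ennreal t < ennreal r then ennreal (t powr (a - 1)) else 0) \<partial>lborel) = ennreal (r powr a / a)"
    if "0 \<le> r" for r
  proof -
    have "((\<lambda>t. t powr (a - 1)) has_integral (r powr (a - 1 + 1) / (a - 1 + 1))) {0..r}"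
      by (rule has_integral_powr_from_0) (use a that in auto)
    then have "(\<integral>\<^sup>+t. ennreal (indicator {0..r} t * t powr (a - 1)) \<partial>lborel) = ennreal (r powr a / a)"
      by (subst nn_integral_has_integral_lebesgue[of "{0..r}" "\<lambda>t. t powr (a - 1)"]) auto
    also have "(\<integral>\<^sup>+t. ennreal (indicator {0..r} t * t powr (a - 1)) \<partial>lborel) =
      (\<integral>\<^sup>+t. (if 0 < t \<and> ennreal t < ennreal r then ennreal (t powr (a - 1)) else 0) \<partial>lborel)"
    proof (rule nn_integral_cong_AE)
      show "AE t in lborel. ennreal (indicator {0..r} t * t powr (a - 1)) = (if 0 < t \<and> ennreal t < ennreal r then ennreal (t powr (a - 1)) else 0)"
        using AE_lborel_singleton[of r] AE_lborel_singleton[of 0]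
        by eventually_elim (use that in \<open>auto simp: indicator_def ennreal_less_iff\<close>)
    qed
    finally show ?thesis by simp
  qed
  show ?thesis
  proof (cases u)
    case (real r)
    then show ?thesis using layer[of r] a by (simp add: ennpow_ennreal divide_ennreal)
  next
    case top
    have "ennreal (r powr a / a) \<le> (\<integral>\<^sup>+t. (if 0 < t \<and> ennreal t < u then ennreal (t powr (a - 1)) else 0) \<partial>lborel)" if "0 \<le> r" for r
      unfolding layer[OF that, symmetric] by (intro nn_integral_mono) (auto simp: top)
    then have le: "ennreal s \<le> (\<integral>\<^sup>+t. (if 0 < t \<and> ennreal t < u then ennreal (t powr (a - 1)) else 0) \<partial>lborel)" if "0 \<le> s" for s
    proof -
      \<comment> \<open>The \<open>r\<close> for which \<open>r powr a / a\<close> is a prescribed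
        \<open>s\<close>. For infinite \<open>u\<close> the integral therefore exceeds every finite
        value.\<close>
      have "((a * s) powr (1 / a)) powr a / a = s"
        using a that by (simp add: powr_powr)
      then show ?thesis using \<open>\<And>r. 0 \<le> r \<Longrightarrow> ennreal (r powr a / a) \<le> _\<close>[of "(a * s) powr (1 / a)"] by simp
    qed
    have "(\<integral>\<^sup>+t. (if 0 < t \<and> ennreal t < u then ennreal (t powr (a - 1)) else 0) \<partial>lborel) = top"
    proof (rule ccontr)
      assume "\<not> ?thesis"
      then obtain s where s: "0 \<le> s" "(\<integral>\<^sup>+t. (if 0 < t \<and> ennreal t < u then ennreal (t powr (a - 1)) else 0) \<partial>lborel) = ennreal s"
        by (cases rule: ennreal_cases) auto
      from le[of "s + 1"] s show False by simp
    qed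
    then show ?thesis by (simp add: top ennreal_top_divide)
  qed
qed

text \<open>The values of \<open>h\<close> up to \<open>s\<close> contribute at most
  \<open>s\<close> to any average, so an average above \<open>2 * s\<close> leaves more than
  \<open>s\<close> to the values beyond \<open>s\<close>.\<close>

lemma Mx_truncate:
  assumes D: "doubling N D" and h: "h \<in> borel_measurable N" and s: "2 * s < Mx N h x"
  shows "s < Mx N (\<lambda>y. if s < h y then h y else 0) x"
proof (rule ccontr)
  assume "\<not> ?thesis"
  then have le: "Mx N (\<lambda>y. if s < h y then h y else 0) x \<le> s" by simp
  have sN [measurable_cong]: "sets N = sets lebesgue" using D by (simp add: doubling_def)
  note [measurable] = h
  have "Mx N h x \<le> s + s"
  proof (rule Mx_le)
    fix a l assume l: "0 < l" and x: "x \<in> ocube a l"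
    have N0: "0 < emeasure N (ocube a l)" "emeasure N (ocube a l) < top"
      using D l by (auto simp: doubling_def)
    have "(\<integral>\<^sup>+y\<in>ocube a l. h y \<partial>N) \<le> (\<integral>\<^sup>+y\<in>ocube a l. (if s < h y then h y else 0) + s \<partial>N)"
      by (intro nn_integral_mono mult_right_mono) auto
    also have "\<dots> = (\<integral>\<^sup>+y\<in>ocube a l. (if s < h y then h y else 0) \<partial>N) + s * emeasure N (ocube a l)"
      by (simp add: distrib_right nn_integral_add nn_integral_cmult sN)
    finally have "(\<integral>\<^sup>+y\<in>ocube a l. h y \<partial>N) / emeasure N (ocube a l) \<le>
        ((\<integral>\<^sup>+y\<in>ocube a l. (if s < h y then h y else 0) \<partial>N) + s * emeasure N (ocube a l)) / emeasure N (ocube a l)"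
      by (rule divide_right_mono_ennreal)
    also have "\<dots> = (\<integral>\<^sup>+y\<in>ocube a l. (if s < h y then h y else 0) \<partial>N) / emeasure N (ocube a l) + s"
      using N0 by (simp add: add_divide_distrib_ennreal mult_divide_eq_ennreal)
    also have "\<dots> \<le> s + s"
      by (intro add_right_mono order_trans[OF Mx_ge[OF l x] le])
    finally show "(\<integral>\<^sup>+y\<in>ocube a l. h y \<partial>N) / emeasure N (ocube a l) \<le> s + s" .
  qed
  also have "s + s = 2 * s" by (rule mult_2[symmetric])
  finally show False using s by simp
qed

text \<open>Layer-cake formula, the weak type bound applied to the part of \<open>h\<close> above \<open>t / 2\<close>, and Fubini.\<close>

lemma Mx_strong_type:
  assumes D: "doubling N D" and h [measurable]: "h \<in> borel_measurable N" and p: "1 < p"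
  shows "(\<integral>\<^sup>+x. ennpow (Mx N h x) p \<partial>N) \<le> ennreal (D * 2 powr p * p / (p - 1)) * (\<integral>\<^sup>+x. ennpow (h x) p \<partial>N)"
proof -
  interpret N: sigma_finite_measure N by (rule doubling_sigma_finite[OF D])
  interpret pair_sigma_finite N lborel ..
  have sN [measurable_cong, simp]: "sets N = sets lebesgue" using D by (simp add: doubling_def)
  have sp [simp]: "space N = UNIV" using sets_eq_imp_space_eq[OF sN] by simp
  have D0: "0 < D" using D by (simp add: doubling_def)
  have eq: "ennpow u p = ennreal p * (\<integral>\<^sup>+t. (if 0 < t \<and> ennreal t < u then ennreal (t powr (p - 1)) else 0) \<partial>lborel)" for u
    using p by (subst nn_integral_powr_layer) (auto simp: ennreal_times_divide mult_divide_eq_ennreal mult.commute[of "ennreal p"])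
  have weak: "N {x. ennreal t < Mx N h x} * ennreal (t powr (p - 1)) \<le>
      ennreal (2 * D) * (\<integral>\<^sup>+x. (if ennreal t < 2 * h x then ennreal (t powr (p - 2)) * h x else 0) \<partial>N)"
    if t: "0 < t" for t :: real
  proof -
    define s where "s = ennreal (t / 2)"
    have s2: "2 * s = ennreal t" using t by (simp add: s_def ennreal_mult'[symmetric] ennreal_numeral[symmetric] del: ennreal_numeral)
    have iff: "s < u \<longleftrightarrow> ennreal t < 2 * u" for u
      unfolding s2[symmetric] using ennreal_mult_le_mult_iff[of 2 u s] by (auto simp: not_le[symmetric])
    have "emeasure N {x. ennreal t < Mx N h x} \<le> emeasure N {x. s < Mx N (\<lambda>y. if s < h y then h y else 0) x}"
      using Mx_truncate[OF D h, of s] open_Mx_superlevel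
      by (intro emeasure_mono) (auto simp: s2 intro!: sets_completionI_sets borel_open)
    then have "s * emeasure N {x. ennreal t < Mx N h x} \<le> s * emeasure N {x. s < Mx N (\<lambda>y. if s < h y then h y else 0) x}"
      by (rule mult_left_mono) simp
    also have "\<dots> \<le> ennreal D * (\<integral>\<^sup>+x. (if s < h x then h x else 0) \<partial>N)"
      by (rule Mx_weak_type[OF D]) measurable
    finally have *: "s * emeasure N {x. ennreal t < Mx N h x} \<le> ennreal D * (\<integral>\<^sup>+x. (if s < h x then h x else 0) \<partial>N)" .
    have "N {x. ennreal t < Mx N h x} * ennreal (t powr (p - 1)) = ennreal (2 * t powr (p - 2)) * (s * emeasure N {x. ennreal t < Mx N h x})"
    proof -
      \<comment> \<open>One factor \<open>s = t / 2\<close> of the density is spent on the weak type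
        inequality.\<close>
      have "ennreal (2 * t powr (p - 2)) * s = ennreal (t powr (p - 1))"
        using t unfolding s_def by (subst ennreal_mult[symmetric]) (auto simp: powr_diff power2_eq_square field_simps powr_numeral)
      then show ?thesis by (simp only: mult.assoc[symmetric]) (rule mult.commute)
    qed
    also have "\<dots> \<le> ennreal (2 * t powr (p - 2)) * (ennreal D * (\<integral>\<^sup>+x. (if s < h x then h x else 0) \<partial>N))"
      by (intro mult_left_mono *) simp
    also have "\<dots> = ennreal (2 * D) * (\<integral>\<^sup>+x. ennreal (t powr (p - 2)) * (if s < h x then h x else 0) \<partial>N)"
      using D0 by (simp add: nn_integral_cmult ennreal_mult mult_ac)
    also have "(\<lambda>x. ennreal (t powr (p - 2)) * (if s < h x then h x else 0)) = (\<lambda>x. (if ennreal t < 2 * h x then ennreal (t powr (p - 2)) * h x else 0))"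
      by (auto simp: iff)
    finally show ?thesis .
  qed
  have "(\<integral>\<^sup>+x. ennpow (Mx N h x) p \<partial>N) = ennreal p * (\<integral>\<^sup>+x. (\<integral>\<^sup>+t. (if 0 < t \<and> ennreal t < Mx N h x then ennreal (t powr (p - 1)) else 0) \<partial>lborel) \<partial>N)"
    unfolding eq by (rule nn_integral_cmult) measurable
  also have "(\<integral>\<^sup>+x. (\<integral>\<^sup>+t. (if 0 < t \<and> ennreal t < Mx N h x then ennreal (t powr (p - 1)) else 0) \<partial>lborel) \<partial>N) =
     (\<integral>\<^sup>+t. (\<integral>\<^sup>+x. (if 0 < t \<and> ennreal t < Mx N h x then ennreal (t powr (p - 1)) else 0) \<partial>N) \<partial>lborel)"
    by (rule Fubini'[symmetric]) measurable
  also have "\<dots> \<le> (\<integral>\<^sup>+t. ennreal (2 * D) * (\<integral>\<^sup>+x. (if 0 < t \<and> ennreal t < 2 * h x then ennreal (t powr (p - 2)) * h x else 0) \<partial>N) \<partial>lborel)"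
  proof (rule nn_integral_mono)
    fix t :: real
    show "(\<integral>\<^sup>+x. (if 0 < t \<and> ennreal t < Mx N h x then ennreal (t powr (p - 1)) else 0) \<partial>N) \<le>
       ennreal (2 * D) * (\<integral>\<^sup>+x. (if 0 < t \<and> ennreal t < 2 * h x then ennreal (t powr (p - 2)) * h x else 0) \<partial>N)"
    proof (cases "0 < t")
      case True
      have "(\<integral>\<^sup>+x. (if 0 < t \<and> ennreal t < Mx N h x then ennreal (t powr (p - 1)) else 0) \<partial>N) =
        (\<integral>\<^sup>+x. ennreal (t powr (p - 1)) * indicator {x. ennreal t < Mx N h x} x \<partial>N)"
        using True by (intro nn_integral_cong) auto
      also have "\<dots> = N {x. ennreal t < Mx N h x} * ennreal (t powr (p - 1))"
        using open_Mx_superlevel[of "ennreal t" N h]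
        by (subst nn_integral_cmult_indicator) (auto simp: mult.commute intro!: sets_completionI_sets borel_open)
      finally show ?thesis using weak[OF True] True by simp
    qed simp
  qed
  also have "\<dots> = ennreal (2 * D) * (\<integral>\<^sup>+t. (\<integral>\<^sup>+x. (if 0 < t \<and> ennreal t < 2 * h x then ennreal (t powr (p - 2)) * h x else 0) \<partial>N) \<partial>lborel)"
    by (rule nn_integral_cmult) measurable
  also have "(\<integral>\<^sup>+t. (\<integral>\<^sup>+x. (if 0 < t \<and> ennreal t < 2 * h x then ennreal (t powr (p - 2)) * h x else 0) \<partial>N) \<partial>lborel) =
     (\<integral>\<^sup>+x. (\<integral>\<^sup>+t. (if 0 < t \<and> ennreal t < 2 * h x then ennreal (t powr (p - 2)) * h x else 0) \<partial>lborel) \<partial>N)"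
    by (rule Fubini') measurable
  also have "\<dots> = (\<integral>\<^sup>+x. ennreal (2 powr (p - 1) / (p - 1)) * ennpow (h x) p \<partial>N)"
  proof (rule nn_integral_cong)
    fix x
    have "(\<integral>\<^sup>+t. (if 0 < t \<and> ennreal t < 2 * h x then ennreal (t powr (p - 2)) * h x else 0) \<partial>lborel) =
      (\<integral>\<^sup>+t. (if 0 < t \<and> ennreal t < 2 * h x then ennreal (t powr ((p - 1) - 1)) else 0) * h x \<partial>lborel)"
      by (intro nn_integral_cong) auto
    also have "\<dots> = (\<integral>\<^sup>+t. (if 0 < t \<and> ennreal t < 2 * h x then ennreal (t powr ((p - 1) - 1)) else 0) \<partial>lborel) * h x"
      by (rule nn_integral_multc) measurable
    also have "\<dots> = ennpow (2 * h x) (p - 1) / ennreal (p - 1) * h x"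
      using p by (subst nn_integral_powr_layer) auto
    also have "\<dots> = ennreal (2 powr (p - 1)) / ennreal (p - 1) * (ennpow (h x) (p - 1) * ennpow (h x) 1)"
      by (simp add: ennpow_mult ennreal_numeral[symmetric] ennpow_ennreal divide_ennreal_def mult_ac del: ennreal_numeral)
    also have "\<dots> = ennreal (2 powr (p - 1) / (p - 1)) * ennpow (h x) p"
      using p by (simp only: ennpow_add[symmetric]) (simp add: divide_ennreal)
    finally show "(\<integral>\<^sup>+t. (if 0 < t \<and> ennreal t < 2 * h x then ennreal (t powr (p - 2)) * h x else 0) \<partial>lborel) = ennreal (2 powr (p - 1) / (p - 1)) * ennpow (h x) p" .
  qed
  also have "\<dots> = ennreal (2 powr (p - 1) / (p - 1)) * (\<integral>\<^sup>+x. ennpow (h x) p \<partial>N)"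
    by (rule nn_integral_cmult) measurable
  finally have "(\<integral>\<^sup>+x. ennpow (Mx N h x) p \<partial>N) \<le> ennreal p * (ennreal (2 * D) * (ennreal (2 powr (p - 1) / (p - 1)) * (\<integral>\<^sup>+x. ennpow (h x) p \<partial>N)))"
    by (simp add: mult_left_mono)
  also have "\<dots> = ennreal (p * ((2 * D) * (2 powr (p - 1) / (p - 1)))) * (\<integral>\<^sup>+x. ennpow (h x) p \<partial>N)"
    using p D0 by (simp only: ennreal_mult'' ennreal_mult' mult.assoc)
  also have "p * ((2 * D) * (2 powr (p - 1) / (p - 1))) = D * 2 powr p * p / (p - 1)"
  proof -
    have "2 powr p = 2 * 2 powr (p - 1)" by (simp add: powr_diff)
    then show ?thesis by simp
  qed
  finally show ?thesis .
qed

section \<open>Muckenhoupt weights\<close>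

definition wms :: "(real ^ 'n \<Rightarrow> real) \<Rightarrow> (real ^ 'n) measure" where
  "wms w = density lebesgue (\<lambda>x. ennreal (w x))"

text \<open>The exponent is \<open>1 - q\<close> with q conjugate to \<open>p\<close>; in this form
  taking the dual twice is a multiplication of exponents.\<close>

definition dual_weight :: "real \<Rightarrow> (real ^ 'n \<Rightarrow> real) \<Rightarrow> real ^ 'n \<Rightarrow> real" where
  "dual_weight p w x = w x powr (- (1 / (p - 1)))"

text \<open>Multiplied by the p-th power of the volume, the A_p condition involves no quotients.
  Both masses are demanded to be finite because they are cancelled later. Positivity at every point,
  rather than almost every point, allows powers of the weight to be inverted pointwise;
  \<open>Ap_imp_strict_Ap\<close> brings a weight into this form.\<close>

definition strict_Ap :: "real \<Rightarrow> real \<Rightarrow> (real ^ 'n \<Rightarrow> real) \<Rightarrow> bool" where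
  "strict_Ap p C w \<longleftrightarrow> w \<in> borel_measurable lebesgue \<and> (\<forall>x. 0 < w x) \<and> 0 < C \<and>
    (\<forall>a l. 0 < l \<longrightarrow> emeasure (wms w) (ocube a l) < top \<and> emeasure (wms (dual_weight p w)) (ocube a l) < top \<and>
      emeasure (wms w) (ocube a l) * ennpow (emeasure (wms (dual_weight p w)) (ocube a l)) (p - 1)
        \<le> ennreal C * ennpow (emeasure lebesgue (ocube a l)) p)"

lemma sets_wms [simp, measurable_cong]: "sets (wms w) = sets lebesgue"
  by (simp add: wms_def)

lemma nn_integral_wms:
  assumes "w \<in> borel_measurable lebesgue" "f \<in> borel_measurable lebesgue"
  shows "(\<integral>\<^sup>+x. f x \<partial>wms w) = (\<integral>\<^sup>+x. f x * ennreal (w x) \<partial>lebesgue)"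
  using assms unfolding wms_def by (subst nn_integral_density) (auto simp: mult.commute)

lemma emeasure_wms:
  assumes "w \<in> borel_measurable lebesgue" "E \<in> sets lebesgue"
  shows "emeasure (wms w) E = (\<integral>\<^sup>+x\<in>E. ennreal (w x) \<partial>lebesgue)"
  using assms unfolding wms_def by (subst emeasure_density) auto

lemma emeasure_wms_pos:
  assumes w: "w \<in> borel_measurable lebesgue" "\<And>x. 0 < w x" and E: "E \<in> sets lebesgue" "emeasure lebesgue E \<noteq> 0"
  shows "0 < emeasure (wms w) E"
proof -
  have "emeasure (wms w) E \<noteq> 0"
  proof
    assume "emeasure (wms w) E = 0"
    then have "AE x in lebesgue. ennreal (w x) * indicator E x = 0"
      using w E by (subst (asm) emeasure_wms) (auto simp: nn_integral_0_iff_AE)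
    then have "AE x in lebesgue. x \<notin> E"
    proof eventually_elim
      case (elim x)
      then show ?case using w(2)[of x] by (auto simp: indicator_def ennreal_eq_0_iff split: if_splits)
    qed
    then have "E \<in> null_sets lebesgue" using E(1) by (simp add: AE_iff_null_sets)
    then show False using E(2) by auto
  qed
  then show ?thesis by (simp add: zero_less_iff_neq_zero)
qed

lemma dual_weight_pos [simp]: "0 < w x \<Longrightarrow> 0 < dual_weight p w x"
  by (simp add: dual_weight_def)

lemma measurable_dual_weight [measurable]:
  "w \<in> borel_measurable M \<Longrightarrow> dual_weight p w \<in> borel_measurable M"
  unfolding dual_weight_def by measurable

lemma conj_exp_props:
  assumes "1 < p"
  shows "1 < conj_exp p" "1 / p + 1 / conj_exp p = 1" "(p - 1) * conj_exp p = p" "conj_exp (conj_exp p) = p"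
    "conj_exp p * (p - 1) = p" "(p - 1) * (conj_exp p - 1) = 1" "conj_exp p / p = 1 / (p - 1)" "1 - conj_exp p = - (1 / (p - 1))"
    "p / conj_exp p = p - 1" "1 / (conj_exp p - 1) = p - 1"
  using assms by (auto simp: conj_exp_def field_simps)

lemma dual_dual_weight: "1 < p \<Longrightarrow> (\<And>x. 0 < w x) \<Longrightarrow> dual_weight (conj_exp p) (dual_weight p w) = w"
proof -
  assume p: "1 < p" and w: "\<And>x. 0 < w x"
  have "- (1 / (p - 1)) * - (1 / (conj_exp p - 1)) = 1"
    using p unfolding minus_mult_minus conj_exp_props(10)[OF p] by simp
  then show ?thesis using w by (intro ext) (simp only: dual_weight_def powr_powr powr_one less_imp_le)
qed

text \<open>Raising the condition to the power \<open>q - 1 = 1 / (p - 1)\<close> exchanges the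
  roles of the two masses, and the volume gets the right exponent because
  \<open>p * (q - 1) = q\<close>.\<close>

lemma strict_Ap_dual:
  assumes "1 < p" "strict_Ap p C w"
  shows "strict_Ap (conj_exp p) (C powr (conj_exp p - 1)) (dual_weight p w)"
proof -
  have w: "w \<in> borel_measurable lebesgue" "\<And>x. 0 < w x" "0 < C" using assms(2) by (auto simp: strict_Ap_def)
  note q = conj_exp_props[OF assms(1)]
  have dd: "dual_weight (conj_exp p) (dual_weight p w) = w" by (rule dual_dual_weight) (use assms w in auto)
  show ?thesis
    unfolding strict_Ap_def dd
  proof (intro conjI allI impI)
    show "0 < C powr (conj_exp p - 1)" using w by simp
    fix a :: "real ^ 'a" and l :: real assume l: "0 < l"
    show "emeasure (wms (dual_weight p w)) (ocube a l) < top" "emeasure (wms w) (ocube a l) < top"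
      using assms l by (auto simp: strict_Ap_def)
    have "emeasure (wms w) (ocube a l) * ennpow (emeasure (wms (dual_weight p w)) (ocube a l)) (p - 1)
        \<le> ennreal C * ennpow (emeasure lebesgue (ocube a l)) p"
      using assms l by (auto simp: strict_Ap_def)
    then have "ennpow (emeasure (wms w) (ocube a l) * ennpow (emeasure (wms (dual_weight p w)) (ocube a l)) (p - 1)) (conj_exp p - 1)
        \<le> ennpow (ennreal C * ennpow (emeasure lebesgue (ocube a l)) p) (conj_exp p - 1)"
      using q by (intro ennpow_mono) auto
    moreover have "p * (conj_exp p - 1) = conj_exp p" using assms(1) by (simp add: conj_exp_def field_simps)
    ultimately show "emeasure (wms (dual_weight p w)) (ocube a l) * ennpow (emeasure (wms w) (ocube a l)) (conj_exp p - 1)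
       \<le> ennreal (C powr (conj_exp p - 1)) * ennpow (emeasure lebesgue (ocube a l)) (conj_exp p)"
      using w q by (simp add: ennpow_mult ennpow_ennpow ennpow_ennreal mult.commute)
  qed (use w in auto)
qed

text \<open>Hoelder's inequality for the factorisation \<open>1 = w^(1/p) * w^(-1/p)\<close> on
  \<open>E\<close>. It is the converse of the A_p inequality and holds on every measurable
  set.\<close>

lemma weight_Holder:
  assumes p: "1 < p" and w: "w \<in> borel_measurable lebesgue" "\<And>x. 0 < w x" and [measurable]: "E \<in> sets lebesgue"
  shows "ennpow (emeasure lebesgue E) p \<le> emeasure (wms w) E * ennpow (emeasure (wms (dual_weight p w)) E) (p - 1)"
proof -
  note [measurable] = w(1)
  note q = conj_exp_props[OF p]
  have "emeasure lebesgue E = (\<integral>\<^sup>+x. indicator E x \<partial>lebesgue)" by simp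
  also have "\<dots> = (\<integral>\<^sup>+x. (ennreal (w x powr (1 / p)) * indicator E x) * (ennreal (w x powr (- (1 / p))) * indicator E x) \<partial>lebesgue)"
    using w(2) by (intro nn_integral_cong) (auto simp: indicator_def ennreal_mult[symmetric] powr_add[symmetric] less_imp_neq[THEN not_sym])
  also have "\<dots> \<le> ennpow (\<integral>\<^sup>+x. ennpow (ennreal (w x powr (1 / p)) * indicator E x) p \<partial>lebesgue) (1 / p) *
    ennpow (\<integral>\<^sup>+x. ennpow (ennreal (w x powr (- (1 / p))) * indicator E x) (conj_exp p) \<partial>lebesgue) (1 / conj_exp p)"
    by (rule nn_integral_Holder) (use p q in auto)
  also have "(\<lambda>x. ennpow (ennreal (w x powr (1 / p)) * indicator E x) p) = (\<lambda>x. ennreal (w x) * indicator E x)"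
    using p w(2) by (auto simp: indicator_def ennpow_ennreal powr_powr less_imp_le)
  also have "(\<lambda>x. ennpow (ennreal (w x powr (- (1 / p))) * indicator E x) (conj_exp p)) = (\<lambda>x. ennreal (dual_weight p w x) * indicator E x)"
    using q(7) by (auto simp: indicator_def ennpow_ennreal powr_powr dual_weight_def)
  finally have "emeasure lebesgue E \<le> ennpow (emeasure (wms w) E) (1 / p) * ennpow (emeasure (wms (dual_weight p w)) E) (1 / conj_exp p)"
    using w by (simp add: emeasure_wms)
  then have "ennpow (emeasure lebesgue E) p \<le> ennpow (ennpow (emeasure (wms w) E) (1 / p) * ennpow (emeasure (wms (dual_weight p w)) E) (1 / conj_exp p)) p"
    using p by (intro ennpow_mono) auto
  also have "\<dots> = emeasure (wms w) E * ennpow (emeasure (wms (dual_weight p w)) E) (p - 1)"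
    using p q(9) by (simp add: ennpow_mult ennpow_ennpow)
  finally show ?thesis .
qed

text \<open>The A_p condition on the cube and Hoelder's inequality on \<open>E\<close> bound the
  products of the two masses from opposite sides, and the dual mass, positive and finite, cancels. A
  subset with a fixed share of the volume thus carries a fixed share of the weight; doubling and
  sparseness are both used in this form.\<close>

lemma strict_Ap_comparable:
  assumes p: "1 < p" and A: "strict_Ap p C w" and l: "0 < l"
    and E: "E \<in> sets lebesgue" "E \<subseteq> ocube a l" and \<theta>: "0 < \<theta>"
    and le: "emeasure lebesgue (ocube a l) \<le> ennreal \<theta> * emeasure lebesgue E"
  shows "emeasure (wms w) (ocube a l) \<le> ennreal (C * \<theta> powr p) * emeasure (wms w) E"
proof -
  have w: "w \<in> borel_measurable lebesgue" "\<And>x. 0 < w x" "0 < C" using A by (auto simp: strict_Ap_def)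
  let ?S = "\<lambda>E. ennpow (emeasure (wms (dual_weight p w)) E) (p - 1)"
  have "emeasure (wms w) (ocube a l) * ?S (ocube a l) \<le> ennreal C * ennpow (emeasure lebesgue (ocube a l)) p"
    using A l by (auto simp: strict_Ap_def)
  also have "\<dots> \<le> ennreal C * ennpow (ennreal \<theta> * emeasure lebesgue E) p"
    by (intro mult_left_mono ennpow_mono le) (use p in auto)
  also have "\<dots> = ennreal (C * \<theta> powr p) * ennpow (emeasure lebesgue E) p"
    using w \<theta> by (simp add: ennpow_mult ennpow_ennreal ennreal_mult mult.assoc)
  also have "\<dots> \<le> ennreal (C * \<theta> powr p) * (emeasure (wms w) E * ?S E)"
    by (intro mult_left_mono weight_Holder) (use p w E in auto)
  also have "\<dots> \<le> ennreal (C * \<theta> powr p) * (emeasure (wms w) E * ?S (ocube a l))"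
    by (intro mult_left_mono ennpow_mono emeasure_mono) (use p w E in auto)
  finally have "?S (ocube a l) * emeasure (wms w) (ocube a l) \<le> ?S (ocube a l) * (ennreal (C * \<theta> powr p) * emeasure (wms w) E)"
    by (simp only: mult_ac)
  moreover have "emeasure (wms (dual_weight p w)) (ocube a l) < top"
    using l A by (auto simp: strict_Ap_def)
  then have "?S (ocube a l) \<noteq> 0" "?S (ocube a l) \<noteq> top"
    using emeasure_wms_pos[of "dual_weight p w" "ocube a l"] w l emeasure_ocube[OF l, of a]
    by auto
  ultimately show ?thesis by (simp add: ennreal_mult_le_mult_iff)
qed

lemma doubling_lebesgue: "doubling (lebesgue :: (real ^ 'n) measure) (3 ^ CARD('n))"
  by (auto simp: doubling_def emeasure_ocube emeasure_dil power_mult_distrib ennreal_mult)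

text \<open>A cube fills the share \<open>3^(-n)\<close> of its triple, so the comparison of masses
  on the triple is doubling.\<close>

lemma strict_Ap_doubling:
  fixes w :: "real ^ 'n \<Rightarrow> real"
  assumes p: "1 < p" and A: "strict_Ap p C w"
  shows "doubling (wms w) (C * (3 ^ CARD('n)) powr p)"
  unfolding doubling_def
proof (intro conjI allI impI)
  have w: "w \<in> borel_measurable lebesgue" "\<And>x. 0 < w x" "0 < C" using A by (auto simp: strict_Ap_def)
  show "0 < C * (3 ^ CARD('n)) powr p" using w by simp
  fix a :: "real ^ 'n" and l :: real assume l: "0 < l"
  show "0 < emeasure (wms w) (ocube a l)"
    using emeasure_wms_pos[of w "ocube a l"] w emeasure_ocube[OF l, of a] l by auto
  show "emeasure (wms w) (ocube a l) < top" using A l by (auto simp: strict_Ap_def)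
  show "emeasure (wms w) (dil 1 a l) \<le> ennreal (C * (3 ^ CARD('n)) powr p) * emeasure (wms w) (ocube a l)"
    unfolding dil_def
  proof (rule strict_Ap_comparable[OF p A])
    show "ocube a l \<subseteq> ocube (\<chi> i. a $ i - 1 * l) ((2 * 1 + 1) * l)"
      using ocube_subset_hcube hcube_subset_dil[OF l, of 1] unfolding dil_def by fastforce
    show "emeasure lebesgue (ocube (\<chi> i. a $ i - 1 * l) ((2 * 1 + 1) * l)) \<le> ennreal (3 ^ CARD('n)) * emeasure lebesgue (ocube a l)"
      using l by (simp add: emeasure_ocube power_mult_distrib ennreal_mult)
  qed (use l in auto)
qed simp

text \<open>Muckenhoupt's theorem without reverse Hoelder: with \<open>\<sigma>\<close> the dual weight, the \<open>A\<^sub>p\<close> condition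
  gives \<open>(M f)\<^bsup>p - 1\<^esup> \<le> C M\<^sub>w ((M\<^sub>\<sigma> (f / \<sigma>))\<^bsup>p - 1\<^esup> / w)\<close>, and both weighted maximal operators
  are bounded because \<open>w\<close> and \<open>\<sigma>\<close> are doubling.\<close>

lemma Muckenhoupt_pointwise:
  assumes p: "1 < p" and A: "strict_Ap p C w" and f [measurable]: "f \<in> borel_measurable lebesgue"
  defines "s \<equiv> dual_weight p w"
  shows "ennpow (Mx lebesgue f x) (p - 1) \<le>
    ennreal C * Mx (wms w) (\<lambda>y. ennpow (Mx (wms s) (\<lambda>z. f z / ennreal (s z)) y) (p - 1) / ennreal (w y)) x"
proof -
  have w [measurable]: "w \<in> borel_measurable lebesgue" and wpos: "\<And>x. 0 < w x" and C: "0 < C" using A by (auto simp: strict_Ap_def)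
  have spos: "\<And>x. 0 < s x" using wpos by (simp add: s_def)
  have sm [measurable]: "s \<in> borel_measurable lebesgue" by (simp add: s_def)
  define h where "h = (\<lambda>z. f z / ennreal (s z))"
  have hm [measurable]: "h \<in> borel_measurable lebesgue" by (simp add: h_def)
  define k where "k = (\<lambda>y. ennpow (Mx (wms s) h y) (p - 1) / ennreal (w y))"
  have km [measurable]: "k \<in> borel_measurable lebesgue" by (simp add: k_def)
  have hs: "h z * ennreal (s z) = f z" for z
    using spos[of z] by (simp add: h_def ennreal_divide_times mult_divide_eq_ennreal)
  have kw: "k y * ennreal (w y) = ennpow (Mx (wms s) h y) (p - 1)" for y
    using wpos[of y] by (simp add: k_def ennreal_divide_times mult_divide_eq_ennreal)
  have "Mx lebesgue f x \<le> ennpow (ennreal C * Mx (wms w) k x) (1 / (p - 1))"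
  proof (rule Mx_le)
    fix a l assume l: "0 < l" and x: "x \<in> ocube a l"
    define r where "r = l ^ CARD('a)"
    have r: "0 < r" "emeasure lebesgue (ocube a l) = ennreal r" using l by (auto simp: r_def emeasure_ocube)
    have "0 < emeasure (wms s) (ocube a l)" "emeasure (wms s) (ocube a l) < top"
      using emeasure_wms_pos[of s "ocube a l"] sm spos r A l by (auto simp: strict_Ap_def s_def)
    then obtain \<sigma> where \<sigma>: "0 < \<sigma>" "emeasure (wms s) (ocube a l) = ennreal \<sigma>"
      by (cases "emeasure (wms s) (ocube a l)") auto
    have "0 < emeasure (wms w) (ocube a l)" "emeasure (wms w) (ocube a l) < top"
      using emeasure_wms_pos[of w "ocube a l"] wpos r A l by (auto simp: strict_Ap_def)
    then obtain \<omega> where \<omega>: "0 < \<omega>" "emeasure (wms w) (ocube a l) = ennreal \<omega>"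
      by (cases "emeasure (wms w) (ocube a l)") auto
    have "emeasure (wms w) (ocube a l) * ennpow (emeasure (wms s) (ocube a l)) (p - 1)
        \<le> ennreal C * ennpow (emeasure lebesgue (ocube a l)) p"
      using A l by (auto simp: strict_Ap_def s_def)
    then have Ap: "\<omega> * \<sigma> powr (p - 1) \<le> C * r powr p"
      using \<sigma> \<omega> r C by (simp add: ennpow_ennreal ennreal_mult[symmetric])
    \<comment> \<open>The average of \<open>f / s\<close> with respect to the dual weight. It is at
      most \<open>Mx (wms s) h\<close> at every point of the cube, hence its power is at most the
      average of \<open>k * w\<close> over the cube; this is how the second maximal function
      enters.\<close>
    define m where "m = (\<integral>\<^sup>+y\<in>ocube a l. h y \<partial>wms s) / ennreal \<sigma>"
    have mM: "m \<le> Mx (wms s) h y" if "y \<in> ocube a l" for y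
      unfolding m_def \<sigma>(2)[symmetric] by (rule Mx_ge) (use that l in auto)
    have "(\<integral>\<^sup>+y\<in>ocube a l. f y \<partial>lebesgue) = (\<integral>\<^sup>+y. (h y * indicator (ocube a l) y) * ennreal (s y) \<partial>lebesgue)"
      by (intro nn_integral_cong) (simp add: hs[symmetric] mult_ac)
    also have "\<dots> = (\<integral>\<^sup>+y\<in>ocube a l. h y \<partial>wms s)"
      by (rule nn_integral_wms[symmetric]) auto
    also have "\<dots> = m * ennreal \<sigma>"
      using \<sigma> by (simp add: m_def ennreal_divide_times mult_divide_eq_ennreal)
    finally have fm: "(\<integral>\<^sup>+y\<in>ocube a l. f y \<partial>lebesgue) = m * ennreal \<sigma>" .
    define I where "I = (\<integral>\<^sup>+y\<in>ocube a l. k y \<partial>wms w)"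
    have "ennpow m (p - 1) * ennreal r = (\<integral>\<^sup>+y\<in>ocube a l. ennpow m (p - 1) \<partial>lebesgue)"
      using r by (simp add: nn_integral_cmult_indicator)
    also have "\<dots> \<le> (\<integral>\<^sup>+y\<in>ocube a l. ennpow (Mx (wms s) h y) (p - 1) \<partial>lebesgue)"
      by (intro nn_integral_mono) (use mM p in \<open>auto simp: indicator_def intro: ennpow_mono\<close>)
    also have "\<dots> = (\<integral>\<^sup>+y. (k y * indicator (ocube a l) y) * ennreal (w y) \<partial>lebesgue)"
      by (intro nn_integral_cong) (simp add: kw[symmetric] mult_ac)
    also have "\<dots> = I" unfolding I_def by (rule nn_integral_wms[symmetric]) auto
    finally have mI: "ennpow m (p - 1) * ennreal r \<le> I" .
    have "ennpow m (p - 1) = (ennpow m (p - 1) * ennreal r) * ennreal (1 / r)"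
      using r by (simp add: mult.assoc ennreal_mult[symmetric])
    also have "\<dots> \<le> I * ennreal (1 / r)" by (intro mult_right_mono mI) auto
    finally have mI': "ennpow m (p - 1) \<le> I * ennreal (1 / r)" .
    have "ennpow ((\<integral>\<^sup>+y\<in>ocube a l. f y \<partial>lebesgue) / emeasure lebesgue (ocube a l)) (p - 1) = ennpow (m * ennreal (\<sigma> / r)) (p - 1)"
      using r \<sigma> by (simp add: fm divide_ennreal_def inverse_ennreal ennreal_mult[symmetric] mult.assoc divide_inverse)
    also have "\<dots> = ennpow m (p - 1) * ennreal ((\<sigma> / r) powr (p - 1))"
      using r \<sigma> by (simp add: ennpow_mult ennpow_ennreal)
    also have "\<dots> \<le> I * ennreal (1 / r) * ennreal ((\<sigma> / r) powr (p - 1))"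
      by (intro mult_right_mono mI') auto
    also have "\<dots> = I * ennreal (1 / r * (\<sigma> / r) powr (p - 1))"
      using r by (simp add: mult.assoc ennreal_mult[symmetric])
    also have "\<dots> \<le> I * ennreal (C / \<omega>)"
    \<comment> \<open>The fact \<open>Ap\<close> divided by
      \<open>\<omega> * r powr p\<close>.\<close>
    proof (intro mult_left_mono ennreal_leI)
      have "1 / r * (\<sigma> / r) powr (p - 1) = \<sigma> powr (p - 1) / r powr p"
        using r \<sigma> by (simp add: powr_divide powr_diff)
      also have "\<dots> \<le> C / \<omega>" using Ap r \<omega> by (simp add: field_simps)
      finally show "1 / r * (\<sigma> / r) powr (p - 1) \<le> C / \<omega>" .
    qed auto
    also have "\<dots> = ennreal C * (I / emeasure (wms w) (ocube a l))"
      using \<omega> C by (simp add: divide_ennreal_def inverse_ennreal ennreal_mult divide_inverse mult_ac)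
    also have "\<dots> \<le> ennreal C * Mx (wms w) k x"
      unfolding I_def by (intro mult_left_mono Mx_ge l x) auto
    finally have "ennpow (ennpow ((\<integral>\<^sup>+y\<in>ocube a l. f y \<partial>lebesgue) / emeasure lebesgue (ocube a l)) (p - 1)) (1 / (p - 1))
       \<le> ennpow (ennreal C * Mx (wms w) k x) (1 / (p - 1))"
      using p by (intro ennpow_mono) auto
    then show "(\<integral>\<^sup>+y\<in>ocube a l. f y \<partial>lebesgue) / emeasure lebesgue (ocube a l) \<le> ennpow (ennreal C * Mx (wms w) k x) (1 / (p - 1))"
      using p by (simp add: ennpow_ennpow)
  qed
  then have "ennpow (Mx lebesgue f x) (p - 1) \<le> ennpow (ennpow (ennreal C * Mx (wms w) k x) (1 / (p - 1))) (p - 1)"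
    using p by (intro ennpow_mono) auto
  then show ?thesis using p by (simp add: ennpow_ennpow k_def h_def)
qed

text \<open>The pointwise bound is raised to the power q, where \<open>(p - 1) * q = p\<close>. The
  bound for \<open>Mx (wms w)\<close> on L^q(w) and then that for \<open>Mx (wms s)\<close> on
  L^p(s) apply in succession, because \<open>w powr (- q) * w = s\<close> and
  \<open>s powr (- p) * s = w\<close> convert one weighted norm into the next.\<close>

lemma Muckenhoupt:
  fixes w :: "real ^ 'n \<Rightarrow> real"
  assumes p: "1 < p" and A: "strict_Ap p C w"
  shows "\<exists>K\<ge>0. \<forall>f\<in>borel_measurable lebesgue.
    (\<integral>\<^sup>+x. ennpow (Mx lebesgue f x) p * ennreal (w x) \<partial>lebesgue) \<le> ennreal K * (\<integral>\<^sup>+x. ennpow (f x) p * ennreal (w x) \<partial>lebesgue)"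
proof -
  have w [measurable]: "w \<in> borel_measurable lebesgue" and wpos: "\<And>x. 0 < w x" and C: "0 < C" using A by (auto simp: strict_Ap_def)
  define s where "s = dual_weight p w"
  define q where "q = conj_exp p"
  note q = conj_exp_props[OF p, folded q_def]
  have spos: "\<And>x. 0 < s x" using wpos by (simp add: s_def)
  have sm [measurable]: "s \<in> borel_measurable lebesgue" by (simp add: s_def)
  have A': "strict_Ap q (C powr (q - 1)) s" using strict_Ap_dual[OF p A] by (simp add: s_def q_def)
  note Dw = strict_Ap_doubling[OF p A] note Ds = strict_Ap_doubling[OF q(1) A']
  obtain K1 K2 where K: "0 \<le> K1" "0 \<le> K2"
    and K1: "\<And>h. h \<in> borel_measurable lebesgue \<Longrightarrow> (\<integral>\<^sup>+x. ennpow (Mx (wms w) h x) q \<partial>wms w) \<le> ennreal K1 * (\<integral>\<^sup>+x. ennpow (h x) q \<partial>wms w)"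
    and K2: "\<And>h. h \<in> borel_measurable lebesgue \<Longrightarrow> (\<integral>\<^sup>+x. ennpow (Mx (wms s) h x) p \<partial>wms s) \<le> ennreal K2 * (\<integral>\<^sup>+x. ennpow (h x) p \<partial>wms s)"
  proof (rule that)
    show "0 \<le> C * (3 ^ CARD('n)) powr p * 2 powr q * q / (q - 1)" "0 \<le> C powr (q - 1) * (3 ^ CARD('n)) powr q * 2 powr p * p / (p - 1)"
      using C p q(1) by auto
  qed (use Mx_strong_type[OF Dw _ q(1)] Mx_strong_type[OF Ds _ p] measurable_cong_sets[OF sets_wms refl] in blast)+
  show ?thesis
  proof (intro exI[of _ "C powr q * K1 * K2"] conjI ballI)
    show "0 \<le> C powr q * K1 * K2" using K by simp
    fix f :: "real ^ 'n \<Rightarrow> ennreal" assume f [measurable]: "f \<in> borel_measurable lebesgue"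
    define h where "h = (\<lambda>z. f z / ennreal (s z))"
    have hm [measurable]: "h \<in> borel_measurable lebesgue" by (simp add: h_def)
    define k where "k = (\<lambda>y. ennpow (Mx (wms s) h y) (p - 1) / ennreal (w y))"
    have km [measurable]: "k \<in> borel_measurable lebesgue" by (simp add: k_def)
    have "(\<integral>\<^sup>+x. ennpow (Mx lebesgue f x) p * ennreal (w x) \<partial>lebesgue) = (\<integral>\<^sup>+x. ennpow (Mx lebesgue f x) p \<partial>wms w)"
      by (subst nn_integral_wms) auto
    also have "\<dots> \<le> (\<integral>\<^sup>+x. ennpow (ennreal C) q * ennpow (Mx (wms w) k x) q \<partial>wms w)"
    proof (rule nn_integral_mono)
      fix x
      have "ennpow (Mx lebesgue f x) p = ennpow (ennpow (Mx lebesgue f x) (p - 1)) q"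
        by (simp add: ennpow_ennpow q)
      also have "\<dots> \<le> ennpow (ennreal C * Mx (wms w) k x) q"
        using Muckenhoupt_pointwise[OF p A f, of x] q(1) by (intro ennpow_mono) (auto simp: k_def h_def s_def)
      finally show "ennpow (Mx lebesgue f x) p \<le> ennpow (ennreal C) q * ennpow (Mx (wms w) k x) q" by (simp add: ennpow_mult)
    qed
    also have "\<dots> = ennreal (C powr q) * (\<integral>\<^sup>+x. ennpow (Mx (wms w) k x) q \<partial>wms w)"
      using C by (subst nn_integral_cmult) (auto simp: ennpow_ennreal cong: measurable_cong_sets)
    also have "\<dots> \<le> ennreal (C powr q) * (ennreal K1 * (\<integral>\<^sup>+x. ennpow (k x) q \<partial>wms w))"
      by (intro mult_left_mono K1) auto
    also have "(\<integral>\<^sup>+x. ennpow (k x) q \<partial>wms w) = (\<integral>\<^sup>+x. ennpow (Mx (wms s) h x) p \<partial>wms s)"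
    proof -
      have "(\<integral>\<^sup>+x. ennpow (k x) q * ennreal (w x) \<partial>lebesgue) = (\<integral>\<^sup>+x. ennpow (Mx (wms s) h x) p * ennreal (s x) \<partial>lebesgue)"
      proof (rule nn_integral_cong)
        fix x
        have "k x = ennpow (Mx (wms s) h x) (p - 1) * ennreal (1 / w x)"
          using wpos[of x] by (simp add: k_def divide_ennreal_def inverse_ennreal divide_inverse)
        then have "ennpow (k x) q * ennreal (w x) = ennpow (Mx (wms s) h x) p * (ennreal ((1 / w x) powr q) * ennreal (w x))"
          using wpos[of x] q by (simp add: ennpow_mult ennpow_ennpow ennpow_ennreal mult.assoc)
        also have "ennreal ((1 / w x) powr q) * ennreal (w x) = ennreal (s x)"
        proof -
          have "(1 / w x) powr q * w x = w x powr (- q) * w x powr 1"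
            using wpos[of x] by (simp add: powr_divide powr_minus_divide)
          also have "\<dots> = w x powr (1 - q)" by (simp only: powr_add[symmetric]) simp
          also have "\<dots> = s x" using q(8) by (simp add: s_def dual_weight_def)
          finally show ?thesis using wpos[of x] by (simp add: ennreal_mult[symmetric])
        qed
        finally show "ennpow (k x) q * ennreal (w x) = ennpow (Mx (wms s) h x) p * ennreal (s x)" .
      qed
      then show ?thesis by (subst (1 2) nn_integral_wms) auto
    qed
    also have "\<dots> \<le> ennreal K2 * (\<integral>\<^sup>+x. ennpow (h x) p \<partial>wms s)" by (rule K2) auto
    also have "(\<integral>\<^sup>+x. ennpow (h x) p \<partial>wms s) = (\<integral>\<^sup>+x. ennpow (f x) p * ennreal (w x) \<partial>lebesgue)"
    proof (subst nn_integral_wms)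
      show "(\<integral>\<^sup>+x. ennpow (h x) p * ennreal (s x) \<partial>lebesgue) = (\<integral>\<^sup>+x. ennpow (f x) p * ennreal (w x) \<partial>lebesgue)"
      proof (rule nn_integral_cong)
        fix x
        have "h x = f x * ennreal (1 / s x)"
          using spos[of x] by (simp add: h_def divide_ennreal_def inverse_ennreal divide_inverse)
        then have "ennpow (h x) p * ennreal (s x) = ennpow (f x) p * (ennreal ((1 / s x) powr p) * ennreal (s x))"
          using spos[of x] by (simp add: ennpow_mult ennpow_ennreal mult.assoc)
        also have "ennreal ((1 / s x) powr p) * ennreal (s x) = ennreal (w x)"
        proof -
          have "(1 / s x) powr p * s x = s x powr (- p) * s x powr 1"
            using spos[of x] by (simp add: powr_divide powr_minus_divide)
          also have "\<dots> = s x powr (1 - p)" by (simp only: powr_add[symmetric]) simp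
          also have "\<dots> = w x powr (- (1 / (p - 1)) * (1 - p))"
            by (simp only: s_def dual_weight_def powr_powr)
          also have "- (1 / (p - 1)) * (1 - p) = 1" using p by (simp add: field_simps)
          also have "w x powr 1 = w x" using wpos[of x] by simp
          finally show ?thesis using spos[of x] by (simp add: ennreal_mult[symmetric])
        qed
        finally show "ennpow (h x) p * ennreal (s x) = ennpow (f x) p * ennreal (w x)" .
      qed
    qed auto
    finally have "(\<integral>\<^sup>+x. ennpow (Mx lebesgue f x) p * ennreal (w x) \<partial>lebesgue) \<le>
       ennreal (C powr q) * (ennreal K1 * (ennreal K2 * (\<integral>\<^sup>+x. ennpow (f x) p * ennreal (w x) \<partial>lebesgue)))"
      by (simp add: mult_left_mono)
    then show "(\<integral>\<^sup>+x. ennpow (Mx lebesgue f x) p * ennreal (w x) \<partial>lebesgue) \<le> ennreal (C powr q * K1 * K2) * (\<integral>\<^sup>+x. ennpow (f x) p * ennreal (w x) \<partial>lebesgue)"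
      using K by (simp add: ennreal_mult mult.assoc)
  qed
qed

section \<open>Dyadic cubes and sparse iteration\<close>

text \<open>The dyadic grid generated by the cube with corner \<open>a\<close> and side
  \<open>l\<close>. A dyadic cube is addressed by its generation and any point in it, so the same
  cube has many addresses.\<close>

definition dcorner :: "real ^ 'n \<Rightarrow> real \<Rightarrow> nat \<Rightarrow> real ^ 'n \<Rightarrow> real ^ 'n" where
  "dcorner a l k x = (\<chi> i. a $ i + l / 2 ^ k * real_of_int \<lfloor>(x $ i - a $ i) * 2 ^ k / l\<rfloor>)"

definition dcube :: "real ^ 'n \<Rightarrow> real \<Rightarrow> nat \<Rightarrow> real ^ 'n \<Rightarrow> (real ^ 'n) set" where
  "dcube a l k x = hcube (dcorner a l k x) (l / 2 ^ k)"

lemma mem_dcube_iff: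
  assumes "0 < l"
  shows "y \<in> dcube a l k x \<longleftrightarrow> (\<forall>i. \<lfloor>(y $ i - a $ i) * 2 ^ k / l\<rfloor> = \<lfloor>(x $ i - a $ i) * 2 ^ k / l\<rfloor>)"
proof -
  have "(a $ i + l / 2 ^ k * real_of_int z \<le> y $ i \<and> y $ i < a $ i + l / 2 ^ k * real_of_int z + l / 2 ^ k) \<longleftrightarrow>
      \<lfloor>(y $ i - a $ i) * 2 ^ k / l\<rfloor> = z" for i and z :: int
    unfolding floor_eq_iff using assms by (auto simp: field_simps)
  then show ?thesis unfolding dcube_def hcube_def dcorner_def by simp
qed

lemma dcube_self: "0 < l \<Longrightarrow> x \<in> dcube a l k x"
  by (simp add: mem_dcube_iff)

lemma dcorner_eq: "0 < l \<Longrightarrow> y \<in> dcube a l k x \<Longrightarrow> dcorner a l k y = dcorner a l k x"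
  by (simp add: mem_dcube_iff dcorner_def)

lemma dcube_eq: "0 < l \<Longrightarrow> y \<in> dcube a l k x \<Longrightarrow> dcube a l k y = dcube a l k x"
  by (simp add: dcube_def dcorner_eq)

lemma dcube_Suc: "0 < l \<Longrightarrow> dcube a l (Suc k) x \<subseteq> dcube a l k x"
proof
  fix y assume l: "0 < l" and y: "y \<in> dcube a l (Suc k) x"
  \<comment> \<open>The integer index of the parent is half that of the child, rounded down.\<close>
  have half: "\<lfloor>t * 2 ^ k / l\<rfloor> = \<lfloor>t * 2 ^ Suc k / l\<rfloor> div 2" for t
    using floor_divide_real_eq_div[of 2 "t * 2 ^ Suc k / l"] by simp
  show "y \<in> dcube a l k x"
    using y l unfolding mem_dcube_iff[OF l] half by simp
qed

lemma dcube_antimono: "0 < l \<Longrightarrow> j \<le> k \<Longrightarrow> dcube a l k x \<subseteq> dcube a l j x"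
proof -
  assume l: "0 < l" and "j \<le> k"
  from this(2) show ?thesis
    by (induction k rule: dec_induct) (use dcube_Suc[OF l] in blast)+
qed

lemma dcube_0: "0 < l \<Longrightarrow> x \<in> hcube a l \<Longrightarrow> dcube a l 0 x = hcube a l"
proof -
  assume l: "0 < l" and x: "x \<in> hcube a l"
  have "\<lfloor>(x $ i - a $ i) / l\<rfloor> = 0" for i
    unfolding floor_eq_iff using l x by (auto simp: hcube_def field_simps)
  then show ?thesis by (simp add: dcube_def dcorner_def)
qed

lemma dcube_subset: "0 < l \<Longrightarrow> x \<in> hcube a l \<Longrightarrow> dcube a l k x \<subseteq> hcube a l"
  using dcube_antimono[of l 0 k a x] dcube_0[of l x a] by simp

lemma dcube_small:
  fixes x :: "real ^ 'n"
  assumes l: "0 < l" and U: "open U" "x \<in> U"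
  shows "\<exists>k. dcube a l k x \<subseteq> U"
proof -
  obtain e where e: "0 < e" "ball x e \<subseteq> U" using U open_contains_ball by blast
  \<comment> \<open>The Euclidean norm is estimated by the sum of the coordinates, whence the factor
    \<open>CARD('n)\<close>.\<close>
  obtain k where k: "CARD('n) * l / e < 2 ^ k" using real_arch_pow[of 2 "CARD('n) * l / e"] by auto
  have "dcube a l k x \<subseteq> ball x e"
  proof
    fix y assume "y \<in> dcube a l k x"
    moreover have "x \<in> dcube a l k x" by (rule dcube_self[OF l])
    ultimately have *: "\<bar>(x - y) $ i\<bar> \<le> l / 2 ^ k" for i
    proof -
      let ?c = "dcorner a l k x $ i"
      have "?c \<le> x $ i" "x $ i < ?c + l / 2 ^ k" "?c \<le> y $ i" "y $ i < ?c + l / 2 ^ k"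
        using \<open>y \<in> dcube a l k x\<close> \<open>x \<in> dcube a l k x\<close> unfolding dcube_def hcube_def by auto
      then show ?thesis by (simp add: abs_le_iff)
    qed
    have "norm (x - y) \<le> (\<Sum>i\<in>UNIV. \<bar>(x - y) $ i\<bar>)" by (rule norm_le_l1_cart)
    also have "\<dots> \<le> (\<Sum>i\<in>(UNIV::'n set). l / 2 ^ k)" by (intro sum_mono *)
    also have "\<dots> = CARD('n) * l / 2 ^ k" by simp
    also have "\<dots> < e" using k e l by (simp add: field_simps)
    finally show "y \<in> ball x e" by (simp add: dist_norm)
  qed
  then show ?thesis using e by blast
qed

section \<open>Stopping cubes and dyadic differentiation\<close>

text \<open>Modelled on the maximal dyadic subcubes with the property \<open>bad\<close>. The clause
  on parents assumes a good top cube, since a bad one is selected itself and has no parent inside. A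
  parent is recorded only as some good cube of twice the side, which suffices to compare volumes and
  averages.\<close>

definition stopping_family ::
    "real ^ 'n \<Rightarrow> real \<Rightarrow> ((real ^ 'n) set \<Rightarrow> bool) \<Rightarrow> ((real ^ 'n) \<times> real) set \<Rightarrow> bool" where
  "stopping_family a l bad \<G> \<longleftrightarrow> countable \<G> \<and> disjoint_family_on (\<lambda>(c, s). hcube c s) \<G> \<and>
    (\<forall>(c, s)\<in>\<G>. 0 < s \<and> hcube c s \<subseteq> hcube a l \<and> bad (hcube c s)) \<and>
    (\<forall>(c, s)\<in>\<G>. \<not> bad (hcube a l) \<longrightarrow>
      (\<exists>c'. hcube c s \<subseteq> hcube c' (2 * s) \<and> hcube c' (2 * s) \<subseteq> hcube a l \<and> \<not> bad (hcube c' (2 * s)))) \<and>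
    (\<forall>x\<in>hcube a l - (\<Union>(c, s)\<in>\<G>. hcube c s). \<forall>k. \<not> bad (dcube a l k x))"

lemma stopping_familyD:
  assumes "stopping_family a l bad \<G>"
  shows "countable \<G>" "disjoint_family_on (\<lambda>(c, s). hcube c s) \<G>"
    "\<And>c s. (c, s) \<in> \<G> \<Longrightarrow> 0 < s" "\<And>c s. (c, s) \<in> \<G> \<Longrightarrow> hcube c s \<subseteq> hcube a l"
    "\<And>c s. (c, s) \<in> \<G> \<Longrightarrow> bad (hcube c s)"
    "\<And>c s. (c, s) \<in> \<G> \<Longrightarrow> \<not> bad (hcube a l) \<Longrightarrow>
       \<exists>c'. hcube c s \<subseteq> hcube c' (2 * s) \<and> hcube c' (2 * s) \<subseteq> hcube a l \<and> \<not> bad (hcube c' (2 * s))"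
    "\<And>x k. x \<in> hcube a l \<Longrightarrow> x \<notin> (\<Union>(c, s)\<in>\<G>. hcube c s) \<Longrightarrow> \<not> bad (dcube a l k x)"
  using assms unfolding stopping_family_def by blast+

text \<open>Around each point take the bad cube of least generation. Dyadic cubes that meet are
  nested, so two selected cubes that meet have the same generation and coincide. Integer corner
  indices make the family countable.\<close>

lemma stopping_cubes:
  fixes a :: "real ^ 'n" and bad :: "(real ^ 'n) set \<Rightarrow> bool"
  assumes l: "0 < l"
  shows "\<exists>\<G>. stopping_family a l bad \<G>"
proof -
  define \<G> where "\<G> = {(dcorner a l k x, l / 2 ^ k) |k x. x \<in> hcube a l \<and> bad (dcube a l k x) \<and> (\<forall>j<k. \<not> bad (dcube a l j x))}"
  have mem: "\<exists>k x. x \<in> hcube a l \<and> bad (dcube a l k x) \<and> (\<forall>j<k. \<not> bad (dcube a l j x)) \<and>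
    c = dcorner a l k x \<and> s = l / 2 ^ k \<and> hcube c s = dcube a l k x"
    if "(c, s) \<in> \<G>" for c s
    using that unfolding \<G>_def dcube_def by auto
  have "\<G> \<subseteq> range (\<lambda>(k::nat, z :: 'n \<Rightarrow> int). (\<chi> i. a $ i + l / 2 ^ k * real_of_int (z i), l / 2 ^ k))"
  proof -
    have "(dcorner a l k x, l / 2 ^ k) \<in> range (\<lambda>(k::nat, z :: 'n \<Rightarrow> int). (\<chi> i. a $ i + l / 2 ^ k * real_of_int (z i), l / 2 ^ k))" for k x
      by (rule range_eqI[of _ _ "(k, \<lambda>i. \<lfloor>(x $ i - a $ i) * 2 ^ k / l\<rfloor>)"]) (simp add: dcorner_def)
    then show ?thesis unfolding \<G>_def by blast
  qed
  then have cnt: "countable \<G>" by (rule countable_subset) auto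
  \<comment> \<open>The members of the family are pairs of a corner and a side, so disjointness has
    to identify these data and not merely the sets.\<close>
  have same: "k = k' \<and> dcorner a l k x = dcorner a l k' x'"
    if kx: "bad (dcube a l k x)" "\<forall>j<k. \<not> bad (dcube a l j x)"
    and kx': "bad (dcube a l k' x')" "\<forall>j<k'. \<not> bad (dcube a l j x')"
    and y: "y \<in> dcube a l k x" "y \<in> dcube a l k' x'" for k k' x x' y
  proof -
    have 1: "\<not> k < k'"
    proof
      assume k: "k < k'"
      have "y \<in> dcube a l k x'" using dcube_antimono[OF l, of k k'] k y by auto
      then have "dcube a l k x' = dcube a l k x" using dcube_eq[OF l] y(1) by metis
      then show False using kx kx' k by auto
    qed
    have 2: "\<not> k' < k"
    proof
      assume k: "k' < k"
      have "y \<in> dcube a l k' x" using dcube_antimono[OF l, of k' k] k y by auto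
      then have "dcube a l k' x' = dcube a l k' x" using dcube_eq[OF l] y(2) by metis
      then show False using kx kx' k by auto
    qed
    from 1 2 have "k = k'" by simp
    then show ?thesis using dcorner_eq[OF l] y by metis
  qed
  have disj: "disjoint_family_on (\<lambda>(c, s). hcube c s) \<G>"
    unfolding disjoint_family_on_def
  proof (clarify, rule ccontr)
    fix c s c' s' assume G: "(c, s) \<in> \<G>" "(c', s') \<in> \<G>" and ne: "\<not> (c = c' \<and> s = s')" "hcube c s \<inter> hcube c' s' \<noteq> {}"
    then obtain y where "y \<in> hcube c s" "y \<in> hcube c' s'" by auto
    then show False using mem[OF G(1)] mem[OF G(2)] same ne(1) by metis
  qed
  have in_cube: "0 < s \<and> hcube c s \<subseteq> hcube a l \<and> bad (hcube c s)" if cs: "(c, s) \<in> \<G>" for c s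
  proof -
    obtain k x where kx: "x \<in> hcube a l" "bad (dcube a l k x)" "s = l / 2 ^ k" "hcube c s = dcube a l k x"
      using mem[OF cs] by blast
    then show ?thesis using l dcube_subset[OF l kx(1), of k] by simp
  qed
  have parent: "\<exists>c'. hcube c s \<subseteq> hcube c' (2 * s) \<and> hcube c' (2 * s) \<subseteq> hcube a l \<and> \<not> bad (hcube c' (2 * s))"
    if cs: "(c, s) \<in> \<G>" and nb: "\<not> bad (hcube a l)" for c s
  proof -
    obtain k x where kx: "x \<in> hcube a l" "bad (dcube a l k x)" "\<forall>j<k. \<not> bad (dcube a l j x)" "s = l / 2 ^ k" "hcube c s = dcube a l k x"
      using mem[OF cs] by blast
    have "k \<noteq> 0" using kx(1,2) dcube_0[OF l] nb by (metis (full_types))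
    then obtain j where j: "k = Suc j" using not0_implies_Suc by blast
    have "hcube (dcorner a l j x) (2 * s) = dcube a l j x" using kx(4) j by (simp add: dcube_def)
    then show ?thesis using kx j dcube_Suc[OF l, of a j x] dcube_subset[OF l kx(1)] by (intro exI[of _ "dcorner a l j x"]) auto
  qed
  have off: "\<not> bad (dcube a l k x)" if x: "x \<in> hcube a l" "x \<notin> (\<Union>(c, s)\<in>\<G>. hcube c s)" for x k
  proof
    assume b: "bad (dcube a l k x)"
    define m where "m = (LEAST m. bad (dcube a l m x))"
    have m: "bad (dcube a l m x)" "\<forall>j<m. \<not> bad (dcube a l j x)"
      unfolding m_def using LeastI[of "\<lambda>m. bad (dcube a l m x)", OF b] not_less_Least by auto
    then have "(dcorner a l m x, l / 2 ^ m) \<in> \<G>" using x unfolding \<G>_def by blast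
    then show False using x dcube_self[OF l, of x a m] unfolding dcube_def by auto
  qed
  show ?thesis unfolding stopping_family_def using cnt disj in_cube parent off by (intro exI[of _ \<G>]) auto
qed

text \<open>One half of Lebesgue's differentiation theorem for the dyadic grid. Let \<open>g\<close>
  exceed \<open>t + \<epsilon>\<close> on \<open>E\<close>, and cover \<open>E\<close> by maximal
  dyadic cubes around its points inside an open set of measure at most
  \<open>\<bar>E\<bar> + \<eta>\<close>. The averages over these cubes are at most \<open>t\<close>,
  so \<open>(t + \<epsilon>) \<bar>E\<bar> \<le> t (\<bar>E\<bar> + \<eta>)\<close> for every
  positive \<eta>, and \<open>E\<close> is null.\<close>

lemma dyadic_differentiation:
  assumes l: "0 < l" and g [measurable]: "g \<in> borel_measurable lebesgue" and t: "0 \<le> t"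
    and F [measurable]: "F \<in> sets lebesgue" and Fs: "F \<subseteq> hcube a l"
    and avg: "\<And>x k. x \<in> F \<Longrightarrow> (\<integral>\<^sup>+y\<in>dcube a l k x. g y \<partial>lebesgue) \<le> ennreal t * emeasure lebesgue (dcube a l k x)"
  shows "AE x in lebesgue. x \<in> F \<longrightarrow> g x \<le> ennreal t"
proof -
  let ?N = "density lebesgue g"
  have N: "emeasure ?N A = (\<integral>\<^sup>+y\<in>A. g y \<partial>lebesgue)" if "A \<in> sets lebesgue" for A
    using that by (simp add: emeasure_density)
  have null: "emeasure lebesgue {x \<in> F. ennreal (t + \<epsilon>) < g x} = 0" if e: "0 < \<epsilon>" for \<epsilon>
  proof -
    define E where "E = {x \<in> F. ennreal (t + \<epsilon>) < g x}"
    have Em [measurable]: "E \<in> sets lebesgue" unfolding E_def by measurable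
    have "emeasure lebesgue E \<le> emeasure lebesgue (hcube a l)"
      using Fs by (intro emeasure_mono) (auto simp: E_def)
    then have Efin: "emeasure lebesgue E < top" using l by (simp add: emeasure_hcube le_less_trans)
    have *: "ennreal (t + \<epsilon>) * emeasure lebesgue E \<le> ennreal t * emeasure lebesgue E + ennreal (t * \<eta>)" if h: "0 < \<eta>" for \<eta>
    proof -
      obtain U where U: "open U" "E \<subseteq> U" "emeasure lebesgue (U - E) < ennreal \<eta>"
        using sets_lebesgue_outer_open[OF Em h] by metis
      have Um [measurable]: "U \<in> sets lebesgue" using U by (simp add: borel_open)
      \<comment> \<open>Every point of \<open>E\<close> has such a cube, since its dyadic cubes
        shrink into the open set \<open>U\<close>.\<close>
      define bad where "bad = (\<lambda>P. P \<subseteq> U \<and> (\<exists>x\<in>E. \<exists>k. P = dcube a l k x))"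
      obtain \<G> where SG: "stopping_family a l bad \<G>"
        using stopping_cubes[OF l] by blast
      note G = stopping_familyD[OF SG]
      define h where "h = (\<lambda>(c, s). hcube c s :: (real ^ 'a) set)"
      have hm: "h P \<in> sets lebesgue" for P by (simp add: h_def split: prod.splits)
      have EG: "E \<subseteq> (\<Union>P\<in>\<G>. h P)"
      proof
        fix x assume x: "x \<in> E"
        then obtain k where k: "dcube a l k x \<subseteq> U" using dcube_small[OF l U(1)] U(2) by blast
        show "x \<in> (\<Union>P\<in>\<G>. h P)"
          using G(7)[of x k] x k Fs unfolding h_def E_def bad_def by blast
      qed
      have "ennreal (t + \<epsilon>) * emeasure lebesgue E = (\<integral>\<^sup>+y\<in>E. ennreal (t + \<epsilon>) \<partial>lebesgue)"
        by (simp add: nn_integral_cmult_indicator)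
      also have "\<dots> \<le> (\<integral>\<^sup>+y\<in>E. g y \<partial>lebesgue)"
        by (intro nn_integral_mono) (auto simp: E_def indicator_def)
      also have "\<dots> = emeasure ?N E" by (simp add: N)
      also have "\<dots> \<le> emeasure ?N (\<Union>P\<in>\<G>. h P)"
        using G(1) hm by (intro emeasure_mono EG) (auto intro!: sets.countable_UN')
      also have "\<dots> = (\<integral>\<^sup>+P. emeasure ?N (h P) \<partial>count_space \<G>)"
        using G(1,2) hm by (intro emeasure_UN_countable) (auto simp: h_def)
      also have "\<dots> \<le> (\<integral>\<^sup>+P. ennreal t * emeasure lebesgue (h P) \<partial>count_space \<G>)"
      proof (rule nn_integral_mono)
        fix P assume "P \<in> space (count_space \<G>)"
        then obtain x k where "x \<in> E" "h P = dcube a l k x"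
          using G(5)[of "fst P" "snd P"] unfolding h_def case_prod_beta bad_def by auto
        then show "emeasure ?N (h P) \<le> ennreal t * emeasure lebesgue (h P)"
          using avg[of x k] hm[of P] by (simp add: N E_def)
      qed
      also have "\<dots> = ennreal t * emeasure lebesgue (\<Union>P\<in>\<G>. h P)"
        using G(1,2) hm by (subst emeasure_UN_countable) (auto simp: h_def nn_integral_cmult)
      also have "\<dots> \<le> ennreal t * emeasure lebesgue U"
        using G(5) by (intro mult_left_mono emeasure_mono) (auto simp: h_def bad_def)
      also have "emeasure lebesgue U \<le> emeasure lebesgue E + ennreal \<eta>"
      proof -
        have "emeasure lebesgue U = emeasure lebesgue E + emeasure lebesgue (U - E)"
          using U(2) by (subst plus_emeasure) (auto simp: Un_absorb1)
        then show ?thesis using U(3) by (simp add: add_left_mono)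
      qed
      finally show ?thesis using t h by (simp add: distrib_left ennreal_mult mult_left_mono)
    qed
    obtain r where r: "emeasure lebesgue E = ennreal r" "0 \<le> r" using Efin by (cases "emeasure lebesgue E") auto
    have "\<epsilon> * r \<le> t * \<eta>" if "0 < \<eta>" for \<eta>
      using *[OF that] that t e r
      by (simp add: ennreal_mult[symmetric] ennreal_plus[symmetric] algebra_simps del: ennreal_plus)
    then have "\<epsilon> * r \<le> 0 + \<eta>" if "0 < \<eta>" for \<eta>
    proof -
      have "\<epsilon> * r \<le> t * (\<eta> / (t + 1))" using \<open>\<And>\<eta>. 0 < \<eta> \<Longrightarrow> \<epsilon> * r \<le> t * \<eta>\<close>[of "\<eta> / (t + 1)"] that t by simp
      also have "\<dots> \<le> \<eta>" using that t by (simp add: field_simps)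
      finally show ?thesis by simp
    qed
    then have "\<epsilon> * r \<le> 0" by (rule field_le_epsilon)
    then have "r = 0" using e r by (simp add: mult_le_0_iff)
    then show ?thesis using r unfolding E_def by simp
  qed
  have "(\<Union>k. {x \<in> F. ennreal (t + 1 / real (Suc k)) < g x}) \<in> null_sets lebesgue"
    using null by (intro null_sets_UN) (auto simp: null_sets_def)
  then have "AE x in lebesgue. x \<notin> (\<Union>k. {x \<in> F. ennreal (t + 1 / real (Suc k)) < g x})"
    by (rule AE_not_in)
  then show ?thesis
  proof eventually_elim
    case (elim x)
    show ?case
    proof
      assume x: "x \<in> F"
      then have le: "g x \<le> ennreal (t + 1 / real (Suc k))" for k using elim by (auto simp: not_less)
      have "(\<lambda>k. ennreal (t + 1 / real (Suc k))) \<longlonglongrightarrow> ennreal (t + 0)"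
        by (intro tendsto_ennrealI tendsto_add tendsto_const LIMSEQ_inverse_real_of_nat[unfolded inverse_eq_divide])
      then show "g x \<le> ennreal t"
        using le by (intro LIMSEQ_le_const[of "\<lambda>k. ennreal (t + 1 / real (Suc k))"]) auto
    qed
  qed
qed

text \<open>Iterating the recursion \<open>k\<close> times bounds the integral outside a set of measure
  \<open>2\<^bsup>-k\<^esup> \<bar>Q\<bar>\<close>; no a priori bound on the family \<open>F\<close> is needed.\<close>

lemma sparse_iteration:
  fixes F A :: "real ^ 'n \<Rightarrow> real \<Rightarrow> real ^ 'n \<Rightarrow> ennreal" and \<psi> :: "real ^ 'n \<Rightarrow> ennreal"
  assumes F [measurable]: "\<And>a l. 0 < l \<Longrightarrow> F a l \<in> borel_measurable lebesgue"
    and A [measurable]: "\<And>a l. 0 < l \<Longrightarrow> A a l \<in> borel_measurable lebesgue"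
    and \<psi> [measurable]: "\<psi> \<in> borel_measurable lebesgue"
    and step: "\<And>a l. 0 < l \<Longrightarrow> \<exists>\<G>. countable \<G> \<and> disjoint_family_on (\<lambda>(c, s). hcube c s) \<G> \<and>
      (\<forall>(c, s)\<in>\<G>. 0 < s \<and> hcube c s \<subseteq> hcube a l) \<and>
      2 * emeasure lebesgue (\<Union>(c, s)\<in>\<G>. hcube c s) \<le> emeasure lebesgue (hcube a l) \<and>
      (AE x in lebesgue. x \<in> hcube a l - (\<Union>(c, s)\<in>\<G>. hcube c s) \<longrightarrow> F a l x \<le> A a l x) \<and>
      (\<forall>(c, s)\<in>\<G>. AE x in lebesgue. x \<in> hcube c s \<longrightarrow> F a l x \<le> A a l x + F c s x) \<and>
      (\<integral>\<^sup>+x\<in>hcube a l. A a l x \<partial>lebesgue) \<le> (\<integral>\<^sup>+x\<in>hcube a l - (\<Union>(c, s)\<in>\<G>. hcube c s). \<psi> x \<partial>lebesgue)"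
    and l: "0 < l"
  shows "(\<integral>\<^sup>+x\<in>hcube a l. F a l x \<partial>lebesgue) \<le> (\<integral>\<^sup>+x\<in>hcube a l. \<psi> x \<partial>lebesgue)"
proof -
  let ?N = "\<lambda>g. density lebesgue g"
  have N: "(\<integral>\<^sup>+y\<in>S. g y \<partial>lebesgue) = emeasure (?N g) S" if "S \<in> sets lebesgue" "g \<in> borel_measurable lebesgue" for S g
    using that by (simp add: emeasure_density)
  \<comment> \<open>Induction over generations: each use of the recursion at least halves the
    exceptional set, while the integral off it stays below one and the same bound. In the base case
    the whole cube is exceptional.\<close>
  have claim: "\<forall>a l. 0 < l \<longrightarrow> (\<exists>U\<in>sets lebesgue. U \<subseteq> hcube a l \<and> 2 ^ k * emeasure lebesgue U \<le> emeasure lebesgue (hcube a l) \<and>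
     (\<integral>\<^sup>+x\<in>hcube a l - U. F a l x \<partial>lebesgue) \<le> (\<integral>\<^sup>+x\<in>hcube a l. \<psi> x \<partial>lebesgue))" for k :: nat
  proof (induction k)
    case 0
    show ?case by (intro allI impI bexI[of _ "hcube _ _"]) auto
  next
    case (Suc k)
    show ?case
    proof (intro allI impI)
      fix a :: "real ^ 'n" and l :: real assume l: "0 < l"
      obtain \<G> where G: "countable \<G>" "disjoint_family_on (\<lambda>(c, s). hcube c s) \<G>"
        "\<forall>(c, s)\<in>\<G>. 0 < s \<and> hcube c s \<subseteq> hcube a l"
        "2 * emeasure lebesgue (\<Union>(c, s)\<in>\<G>. hcube c s) \<le> emeasure lebesgue (hcube a l)"
        "AE x in lebesgue. x \<in> hcube a l - (\<Union>(c, s)\<in>\<G>. hcube c s) \<longrightarrow> F a l x \<le> A a l x"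
        "\<forall>(c, s)\<in>\<G>. AE x in lebesgue. x \<in> hcube c s \<longrightarrow> F a l x \<le> A a l x + F c s x"
        "(\<integral>\<^sup>+x\<in>hcube a l. A a l x \<partial>lebesgue) \<le> (\<integral>\<^sup>+x\<in>hcube a l - (\<Union>(c, s)\<in>\<G>. hcube c s). \<psi> x \<partial>lebesgue)"
        using step[OF l] by blast
      define h where "h = (\<lambda>(c, s). hcube c s :: (real ^ 'n) set)"
      define V where "V = (\<Union>P\<in>\<G>. h P)"
      have hm [measurable]: "h P \<in> sets lebesgue" for P by (simp add: h_def split: prod.splits)
      have Vm [measurable]: "V \<in> sets lebesgue" unfolding V_def using G(1) by (intro sets.countable_UN') auto
      have VQ: "V \<subseteq> hcube a l" using G(3) by (auto simp: V_def h_def)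
      have "\<forall>P\<in>\<G>. \<exists>U. U \<in> sets lebesgue \<and> U \<subseteq> h P \<and> 2 ^ k * emeasure lebesgue U \<le> emeasure lebesgue (h P) \<and>
         (\<integral>\<^sup>+x\<in>h P - U. F (fst P) (snd P) x \<partial>lebesgue) \<le> (\<integral>\<^sup>+x\<in>h P. \<psi> x \<partial>lebesgue)"
        using Suc.IH G(3) unfolding h_def by fastforce
      from bchoice[OF this] obtain u where u: "\<And>P. P \<in> \<G> \<Longrightarrow> u P \<in> sets lebesgue" "\<And>P. P \<in> \<G> \<Longrightarrow> u P \<subseteq> h P"
        "\<And>P. P \<in> \<G> \<Longrightarrow> 2 ^ k * emeasure lebesgue (u P) \<le> emeasure lebesgue (h P)"
        "\<And>P. P \<in> \<G> \<Longrightarrow> (\<integral>\<^sup>+x\<in>h P - u P. F (fst P) (snd P) x \<partial>lebesgue) \<le> (\<integral>\<^sup>+x\<in>h P. \<psi> x \<partial>lebesgue)"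
        by blast
      have hdisj: "disjoint_family_on h \<G>" using G(2) by (simp add: h_def)
      have udisj: "disjoint_family_on u \<G>" "disjoint_family_on (\<lambda>P. h P - u P) \<G>"
        using hdisj u(2) unfolding disjoint_family_on_def by blast+
      define U where "U = (\<Union>P\<in>\<G>. u P)"
      have Um [measurable]: "U \<in> sets lebesgue" unfolding U_def using G(1) u(1) by (intro sets.countable_UN') auto
      have sumeq: "emeasure M (\<Union>P\<in>\<G>. B P) = (\<integral>\<^sup>+P. emeasure M (B P) \<partial>count_space \<G>)"
        if "disjoint_family_on B \<G>" "\<And>P. P \<in> \<G> \<Longrightarrow> B P \<in> sets M" for M :: "(real ^ 'n) measure" and B
        using that G(1) by (intro emeasure_UN_countable) auto
      show "\<exists>U\<in>sets lebesgue. U \<subseteq> hcube a l \<and> 2 ^ Suc k * emeasure lebesgue U \<le> emeasure lebesgue (hcube a l) \<and>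
         (\<integral>\<^sup>+x\<in>hcube a l - U. F a l x \<partial>lebesgue) \<le> (\<integral>\<^sup>+x\<in>hcube a l. \<psi> x \<partial>lebesgue)"
      proof (intro bexI[of _ U] conjI Um)
        show "U \<subseteq> hcube a l" using u(2) VQ unfolding U_def V_def by blast
        have "2 ^ k * emeasure lebesgue U = (\<integral>\<^sup>+P. 2 ^ k * emeasure lebesgue (u P) \<partial>count_space \<G>)"
          unfolding U_def by (subst sumeq[OF udisj(1)]) (auto simp: u(1) nn_integral_cmult)
        also have "\<dots> \<le> (\<integral>\<^sup>+P. emeasure lebesgue (h P) \<partial>count_space \<G>)"
          by (intro nn_integral_mono u(3)) simp
        also have "\<dots> = emeasure lebesgue V" unfolding V_def by (subst sumeq[OF hdisj]) auto
        finally have "2 * (2 ^ k * emeasure lebesgue U) \<le> 2 * emeasure lebesgue V" by (rule mult_left_mono) simp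
        also have "\<dots> \<le> emeasure lebesgue (hcube a l)" using G(4) by (simp add: V_def h_def)
        finally show "2 ^ Suc k * emeasure lebesgue U \<le> emeasure lebesgue (hcube a l)" by (simp add: mult.assoc)
        \<comment> \<open>As the stopping cubes are disjoint, removing \<open>U\<close> takes from
          each of them only its own exceptional set.\<close>
        have split: "hcube a l - U = (hcube a l - V) \<union> (\<Union>P\<in>\<G>. h P - u P)"
        proof -
          have uP: "x \<in> u P" if "x \<in> h P" "P \<in> \<G>" "x \<in> u P'" "P' \<in> \<G>" for x P P'
          proof -
            have "x \<in> h P'" using u(2) that by blast
            then have "P = P'" using hdisj[unfolded disjoint_family_on_def] that by blast
            then show ?thesis using that by simp
          qed
          have "h P \<subseteq> hcube a l" if "P \<in> \<G>" for P using VQ that unfolding V_def by blast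
          with uP u(2) show ?thesis unfolding U_def V_def
            by (intro set_eqI iffI) (auto, blast+)
        qed
        have plus: "emeasure (?N g) (hcube a l - V) + emeasure (?N g) V = emeasure (?N g) (hcube a l)" for g
        proof -
          have "(hcube a l - V) \<union> V = hcube a l" using VQ by blast
          moreover have "emeasure (?N g) (hcube a l - V) + emeasure (?N g) V = emeasure (?N g) ((hcube a l - V) \<union> V)"
            by (rule plus_emeasure) auto
          ultimately show ?thesis by simp
        qed
        have "(\<integral>\<^sup>+x\<in>hcube a l - U. F a l x \<partial>lebesgue) = emeasure (?N (F a l)) (hcube a l - U)"
          using l by (intro N) auto
        also have "\<dots> \<le> emeasure (?N (F a l)) (hcube a l - V) + emeasure (?N (F a l)) (\<Union>P\<in>\<G>. h P - u P)"
          unfolding split using G(1) u(1) by (intro emeasure_subadditive) (auto intro!: sets.countable_UN')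
        also have "\<dots> \<le> emeasure (?N (A a l)) (hcube a l - V) + (emeasure (?N (A a l)) V + emeasure (?N \<psi>) V)"
        proof (rule add_mono)
          have "(\<integral>\<^sup>+x\<in>hcube a l - V. F a l x \<partial>lebesgue) \<le> (\<integral>\<^sup>+x\<in>hcube a l - V. A a l x \<partial>lebesgue)"
            by (rule nn_integral_mono_AE) (use G(5) in \<open>auto simp: V_def h_def indicator_def elim!: eventually_mono\<close>)
          then show "emeasure (?N (F a l)) (hcube a l - V) \<le> emeasure (?N (A a l)) (hcube a l - V)"
            using l by (simp add: N)
          have "emeasure (?N (F a l)) (\<Union>P\<in>\<G>. h P - u P) = (\<integral>\<^sup>+P. emeasure (?N (F a l)) (h P - u P) \<partial>count_space \<G>)"
            by (rule sumeq[OF udisj(2)]) (use u(1) in auto)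
          also have "\<dots> \<le> (\<integral>\<^sup>+P. emeasure (?N (A a l)) (h P) + emeasure (?N \<psi>) (h P) \<partial>count_space \<G>)"
          proof (rule nn_integral_mono)
            fix P assume "P \<in> space (count_space \<G>)"
            then have P: "P \<in> \<G>" by simp
            then have sP: "0 < snd P" and ae: "AE x in lebesgue. x \<in> h P \<longrightarrow> F a l x \<le> A a l x + F (fst P) (snd P) x"
              using bspec[OF G(3) P] bspec[OF G(6) P] unfolding h_def case_prod_beta by auto
            note [measurable] = u(1)[OF P]
            have "emeasure (?N (F a l)) (h P - u P) = (\<integral>\<^sup>+x\<in>h P - u P. F a l x \<partial>lebesgue)"
              using l by (intro N[symmetric]) auto
            also have "\<dots> \<le> (\<integral>\<^sup>+x. A a l x * indicator (h P) x + F (fst P) (snd P) x * indicator (h P - u P) x \<partial>lebesgue)"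
              by (rule nn_integral_mono_AE) (use ae in \<open>auto simp: indicator_def elim!: eventually_mono\<close>)
            also have "\<dots> = (\<integral>\<^sup>+x\<in>h P. A a l x \<partial>lebesgue) + (\<integral>\<^sup>+x\<in>h P - u P. F (fst P) (snd P) x \<partial>lebesgue)"
              using l sP by (intro nn_integral_add) auto
            also have "\<dots> \<le> (\<integral>\<^sup>+x\<in>h P. A a l x \<partial>lebesgue) + (\<integral>\<^sup>+x\<in>h P. \<psi> x \<partial>lebesgue)"
              by (intro add_left_mono u(4) P)
            also have "\<dots> = emeasure (?N (A a l)) (h P) + emeasure (?N \<psi>) (h P)"
              using l by (simp add: N)
            finally show "emeasure (?N (F a l)) (h P - u P) \<le> emeasure (?N (A a l)) (h P) + emeasure (?N \<psi>) (h P)" .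
          qed
          also have "\<dots> = (\<integral>\<^sup>+P. emeasure (?N (A a l)) (h P) \<partial>count_space \<G>) + (\<integral>\<^sup>+P. emeasure (?N \<psi>) (h P) \<partial>count_space \<G>)"
            by (rule nn_integral_add) auto
          also have "\<dots> = emeasure (?N (A a l)) V + emeasure (?N \<psi>) V"
            unfolding V_def by (subst (1 2) sumeq[OF hdisj]) auto
          finally show "emeasure (?N (F a l)) (\<Union>P\<in>\<G>. h P - u P) \<le> emeasure (?N (A a l)) V + emeasure (?N \<psi>) V" .
        qed
        \<comment> \<open>The error over the whole cube is paid by \<psi> on the part off
          \<open>V\<close>, whereas the induction hypothesis has used \<psi> on \<open>V\<close>
          only. So \<psi> is spent once at every point.\<close>
        also have "\<dots> = emeasure (?N (A a l)) (hcube a l) + emeasure (?N \<psi>) V"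
          by (simp add: add.assoc[symmetric] plus)
        also have "\<dots> \<le> emeasure (?N \<psi>) (hcube a l - V) + emeasure (?N \<psi>) V"
          using G(7) l by (intro add_right_mono) (simp add: N V_def[unfolded h_def, symmetric] h_def)
        also have "\<dots> = emeasure (?N \<psi>) (hcube a l)"
          by (rule plus)
        also have "\<dots> = (\<integral>\<^sup>+x\<in>hcube a l. \<psi> x \<partial>lebesgue)" by (rule N[symmetric]) auto
        finally show "(\<integral>\<^sup>+x\<in>hcube a l - U. F a l x \<partial>lebesgue) \<le> (\<integral>\<^sup>+x\<in>hcube a l. \<psi> x \<partial>lebesgue)" .
      qed
    qed
  qed
  have "\<forall>k. \<exists>U. U \<in> sets lebesgue \<and> U \<subseteq> hcube a l \<and> 2 ^ k * emeasure lebesgue U \<le> emeasure lebesgue (hcube a l) \<and>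
     (\<integral>\<^sup>+x\<in>hcube a l - U. F a l x \<partial>lebesgue) \<le> (\<integral>\<^sup>+x\<in>hcube a l. \<psi> x \<partial>lebesgue)"
    (is "\<forall>k. ?P k")
  proof
    show "?P k" for k using claim[of k, rule_format, OF l, of a] unfolding Bex_def .
  qed
  from choice[OF this] obtain U where "\<forall>k. U k \<in> sets lebesgue \<and> U k \<subseteq> hcube a l \<and> 2 ^ k * emeasure lebesgue (U k) \<le> emeasure lebesgue (hcube a l) \<and>
     (\<integral>\<^sup>+x\<in>hcube a l - U k. F a l x \<partial>lebesgue) \<le> (\<integral>\<^sup>+x\<in>hcube a l. \<psi> x \<partial>lebesgue)" ..
  then have U: "\<And>k. U k \<in> sets lebesgue" "\<And>k. 2 ^ k * emeasure lebesgue (U k) \<le> emeasure lebesgue (hcube a l)"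
    "\<And>k. (\<integral>\<^sup>+x\<in>hcube a l - U k. F a l x \<partial>lebesgue) \<le> (\<integral>\<^sup>+x\<in>hcube a l. \<psi> x \<partial>lebesgue)"
    by auto
  define r where "r = l ^ CARD('n)"
  have r: "0 < r" "emeasure lebesgue (hcube a l) = ennreal r" using l by (auto simp: r_def emeasure_hcube)
  have Uk: "emeasure lebesgue (U k) \<le> ennreal (r * (1 / 2) ^ k)" for k
  proof -
    have "emeasure lebesgue (U k) = ennreal ((1 / 2) ^ k) * (2 ^ k * emeasure lebesgue (U k))"
    proof -
      have "ennreal ((1 / 2) ^ k) * ennreal (2 ^ k) = ennreal ((1 / 2) ^ k * 2 ^ k)"
        by (rule ennreal_mult[symmetric]) auto
      also have "(1 / 2) ^ k * 2 ^ k = (1::real)" by (simp add: power_mult_distrib[symmetric])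
      finally have "ennreal ((1 / 2) ^ k) * 2 ^ k = 1" by (simp add: ennreal_power[symmetric] del: ennreal_half)
      then show ?thesis by (simp only: mult.assoc[symmetric] mult_1)
    qed
    also have "\<dots> \<le> ennreal ((1 / 2) ^ k) * ennreal r"
      using U(2)[of k] r by (intro mult_left_mono) auto
    finally show ?thesis using r by (simp add: ennreal_mult mult.commute)
  qed
  \<comment> \<open>The measures of the exceptional sets are summable, so almost every point lies in
    only finitely many of them. Fatou's lemma then recovers the integral over the whole
    cube.\<close>
  have "AE x in lebesgue. \<forall>\<^sub>F k in sequentially. x \<in> space lebesgue - U k"
  proof (rule borel_cantelli_AE1)
    show "emeasure lebesgue (U k) < \<infinity>" for k using Uk[of k] le_less_trans[OF _ ennreal_less_top] by simp
    show "summable (\<lambda>k. measure lebesgue (U k))"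
    proof (rule summable_comparison_test')
      show "summable (\<lambda>k. r * (1 / 2) ^ k)" by (intro summable_mult summable_geometric) auto
      show "norm (measure lebesgue (U k)) \<le> r * (1 / 2) ^ k" for k
        using Uk[of k] r by (simp add: measure_def enn2real_leI)
    qed
  qed (rule U(1))
  then have ae: "AE x in lebesgue. F a l x * indicator (hcube a l) x \<le> liminf (\<lambda>k. F a l x * indicator (hcube a l - U k) x)"
  proof eventually_elim
    case (elim x)
    have "\<forall>\<^sub>F k in sequentially. F a l x * indicator (hcube a l) x \<le> F a l x * indicator (hcube a l - U k) x"
      using elim by eventually_elim (auto simp: indicator_def)
    then show ?case by (rule Liminf_bounded)
  qed
  have "(\<integral>\<^sup>+x\<in>hcube a l. F a l x \<partial>lebesgue) \<le> (\<integral>\<^sup>+x. liminf (\<lambda>k. F a l x * indicator (hcube a l - U k) x) \<partial>lebesgue)"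
    by (rule nn_integral_mono_AE[OF ae])
  also have "\<dots> \<le> liminf (\<lambda>k. \<integral>\<^sup>+x\<in>hcube a l - U k. F a l x \<partial>lebesgue)"
    using U(1) l by (intro nn_integral_liminf) auto
  also have "\<dots> \<le> (\<integral>\<^sup>+x\<in>hcube a l. \<psi> x \<partial>lebesgue)"
    using U(3) by (intro Liminf_le) auto
  finally show ?thesis .
qed

section \<open>Mean oscillation\<close>

lemma emeasure_wms_hcube: "w \<in> borel_measurable lebesgue \<Longrightarrow> emeasure (wms w) (hcube a l) = emeasure (wms w) (ocube a l)"
  by (simp add: emeasure_wms) (rule nn_integral_cong_AE, use AE_ccube_hcube_ocube[of a l] in eventually_elim, auto simp: indicator_def)

lemma strict_Ap_comparable_hcube:
  assumes p: "1 < p" and A: "strict_Ap p C w" and l: "0 < l"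
    and E: "E \<in> sets lebesgue" "E \<subseteq> hcube a l" and \<theta>: "0 < \<theta>"
    and le: "emeasure lebesgue (hcube a l) \<le> ennreal \<theta> * emeasure lebesgue E"
  shows "emeasure (wms w) (hcube a l) \<le> ennreal (C * \<theta> powr p) * emeasure (wms w) E"
proof -
  have w: "w \<in> borel_measurable lebesgue" using A by (auto simp: strict_Ap_def)
  have "emeasure lebesgue E = emeasure lebesgue (E \<inter> ocube a l)"
    by (rule emeasure_eq_AE, use AE_ccube_hcube_ocube[of a l] in eventually_elim) (use E in auto)
  then have "emeasure lebesgue (ocube a l) \<le> ennreal \<theta> * emeasure lebesgue (E \<inter> ocube a l)"
    using le l by (simp add: emeasure_hcube emeasure_ocube)
  then have "emeasure (wms w) (ocube a l) \<le> ennreal (C * \<theta> powr p) * emeasure (wms w) (E \<inter> ocube a l)"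
    by (intro strict_Ap_comparable[OF p A l _ _ \<theta>]) (use E in auto)
  also have "\<dots> \<le> ennreal (C * \<theta> powr p) * emeasure (wms w) E"
    by (intro mult_left_mono emeasure_mono) (use E in auto)
  finally show ?thesis using emeasure_wms_hcube[OF w] by simp
qed

lemma emeasure_remainder:
  assumes l: "0 < l" and V: "V \<in> sets lebesgue" "V \<subseteq> hcube a l"
    and half: "2 * emeasure lebesgue V \<le> emeasure lebesgue (hcube a l)"
  shows "emeasure lebesgue (hcube a l) \<le> ennreal 2 * emeasure lebesgue (hcube a l - V)"
proof -
  have "emeasure lebesgue V \<le> emeasure lebesgue (hcube a l)" by (intro emeasure_mono V) auto
  then obtain v where v: "emeasure lebesgue V = ennreal v" "0 \<le> v"
    using l by (cases "emeasure lebesgue V") (auto simp: emeasure_hcube top_unique)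
  have "emeasure lebesgue (hcube a l - V) = emeasure lebesgue (hcube a l) - emeasure lebesgue V"
    using V v by (intro emeasure_Diff) auto
  moreover have "2 * v \<le> l ^ CARD('a)"
    using half l v by (simp add: emeasure_hcube ennreal_numeral[symmetric] ennreal_mult[symmetric] del: ennreal_numeral)
  ultimately show ?thesis
    using l v by (simp add: emeasure_hcube ennreal_minus ennreal_numeral[symmetric] ennreal_mult[symmetric] del: ennreal_numeral)
qed

definition integrable_on_cubes :: "(real ^ 'n \<Rightarrow> complex) \<Rightarrow> bool" where
  "integrable_on_cubes b \<longleftrightarrow> b \<in> borel_measurable lebesgue \<and> (\<forall>a l. set_integrable lebesgue (hcube a l) b)"

text \<open>In the application \<open>B\<close> is \<open>BMO_norm\<close>. This form avoids
  dividing by the weight of a cube.\<close>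

definition bmo_le :: "(real ^ 'n \<Rightarrow> real) \<Rightarrow> ennreal \<Rightarrow> (real ^ 'n \<Rightarrow> complex) \<Rightarrow> bool" where
  "bmo_le \<nu> B b \<longleftrightarrow> integrable_on_cubes b \<and>
    (\<forall>a l. 0 < l \<longrightarrow> (\<integral>\<^sup>+x\<in>hcube a l. ennreal (norm (b x - average (hcube a l) b)) \<partial>lebesgue) \<le> B * emeasure (wms \<nu>) (hcube a l))"

lemma average_diff_bound:
  fixes b :: "real ^ 'n \<Rightarrow> complex"
  assumes l: "0 < l" and b: "set_integrable lebesgue (hcube a l) b"
  shows "ennreal (norm (average (hcube a l) b - c)) * emeasure lebesgue (hcube a l) \<le>
    (\<integral>\<^sup>+x\<in>hcube a l. ennreal (norm (b x - c)) \<partial>lebesgue)"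
proof -
  define r where "r = l ^ CARD('n)"
  have r: "0 < r" "emeasure lebesgue (hcube a l) = ennreal r" "measure lebesgue (hcube a l) = r"
    using l by (auto simp: r_def emeasure_hcube measure_def)
  have c: "set_integrable lebesgue (hcube a l) (\<lambda>_. c)"
    unfolding set_integrable_def using r by (intro integrable_scaleR_left) (auto simp: integrable_indicator_iff)
  have "(LINT x:hcube a l|lebesgue. b x - c) = (LINT x:hcube a l|lebesgue. b x) - (LINT x:hcube a l|lebesgue. c)"
    using b c by (rule set_integral_diff)
  also have "(LINT x:hcube a l|lebesgue. c) = r *\<^sub>R c"
    unfolding set_lebesgue_integral_def using r by (subst integral_scaleR_left) (auto simp: integrable_indicator_iff)
  also have "(LINT x:hcube a l|lebesgue. b x) = r *\<^sub>R average (hcube a l) b"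
    unfolding average_def using r by simp
  finally have eq: "(LINT x:hcube a l|lebesgue. b x - c) = r *\<^sub>R (average (hcube a l) b - c)"
    by (simp add: scaleR_diff_right)
  have "ennreal (norm (average (hcube a l) b - c)) * emeasure lebesgue (hcube a l) = ennreal (norm (LINT x:hcube a l|lebesgue. b x - c))"
    using r unfolding eq by (simp add: ennreal_mult[symmetric] mult.commute)
  also have "\<dots> \<le> (\<integral>\<^sup>+x. ennreal (norm (indicator (hcube a l) x *\<^sub>R (b x - c))) \<partial>lebesgue)"
    unfolding set_lebesgue_integral_def using set_integral_diff(1)[OF b c]
    by (intro integral_norm_bound_ennreal) (simp add: set_integrable_def)
  also have "\<dots> = (\<integral>\<^sup>+x\<in>hcube a l. ennreal (norm (b x - c)) \<partial>lebesgue)"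
    by (intro nn_integral_cong) (auto simp: indicator_def)
  finally show ?thesis .
qed

lemma osc_finite:
  fixes b :: "real ^ 'n \<Rightarrow> complex"
  assumes l: "0 < l" and b: "set_integrable lebesgue (hcube a l) b"
  shows "(\<integral>\<^sup>+x\<in>hcube a l. ennreal (norm (b x - c)) \<partial>lebesgue) < top"
proof -
  have c: "set_integrable lebesgue (hcube a l) (\<lambda>_. c)"
    unfolding set_integrable_def using l by (intro integrable_scaleR_left) (auto simp: integrable_indicator_iff emeasure_hcube)
  have "integrable lebesgue (\<lambda>x. indicator (hcube a l) x *\<^sub>R (b x - c))"
    using set_integral_diff(1)[OF b c] by (simp add: set_integrable_def)
  then have "(\<integral>\<^sup>+x. ennreal (norm (indicator (hcube a l) x *\<^sub>R (b x - c))) \<partial>lebesgue) < \<infinity>"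
    by (simp add: integrable_iff_bounded)
  also have "(\<integral>\<^sup>+x. ennreal (norm (indicator (hcube a l) x *\<^sub>R (b x - c))) \<partial>lebesgue) = (\<integral>\<^sup>+x\<in>hcube a l. ennreal (norm (b x - c)) \<partial>lebesgue)"
    by (intro nn_integral_cong) (auto simp: indicator_def)
  finally show ?thesis by simp
qed

lemma average_le_Mx:
  fixes g :: "real ^ 'n \<Rightarrow> ennreal"
  assumes l: "0 < l" and x: "x \<in> hcube a l"
  shows "(\<integral>\<^sup>+y\<in>hcube a l. g y \<partial>lebesgue) \<le> ennreal (3 ^ CARD('n)) * Mx lebesgue g x * emeasure lebesgue (hcube a l)"
proof -
  have "(\<integral>\<^sup>+y\<in>hcube a l. g y \<partial>lebesgue) \<le> (\<integral>\<^sup>+y\<in>dil 1 a l. g y \<partial>lebesgue)"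
    by (intro nn_set_integral_set_mono hcube_subset_dil l) simp
  also have "\<dots> = (\<integral>\<^sup>+y\<in>dil 1 a l. g y \<partial>lebesgue) / emeasure lebesgue (dil 1 a l) * emeasure lebesgue (dil 1 a l)"
    using l by (simp add: emeasure_dil ennreal_divide_times mult_divide_eq_ennreal)
  also have "\<dots> \<le> Mx lebesgue g x * emeasure lebesgue (dil 1 a l)"
    using x hcube_subset_dil[OF l, of 1 a] l unfolding dil_def
    by (intro mult_right_mono Mx_ge) auto
  also have "emeasure lebesgue (dil 1 a l) = ennreal (3 ^ CARD('n)) * emeasure lebesgue (hcube a l)"
    using l by (simp add: emeasure_dil emeasure_hcube power_mult_distrib ennreal_mult)
  finally show ?thesis by (simp add: mult_ac)
qed

text \<open>The sparse iteration, stopping at the dyadic cubes where the average of \<open>\<bar>b - b\<^sub>Q\<bar>\<close>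
  is more than twice the mean oscillation on \<open>Q\<close>.\<close>

lemma oscillation_bound:
  fixes b :: "real ^ 'n \<Rightarrow> complex" and g :: "real ^ 'n \<Rightarrow> ennreal"
  assumes A: "strict_Ap 2 C \<nu>" and b: "bmo_le \<nu> B b" and g [measurable]: "g \<in> borel_measurable lebesgue" and l: "0 < l"
  shows "(\<integral>\<^sup>+x\<in>hcube a l. ennreal (norm (b x - average (hcube a l) b)) * g x \<partial>lebesgue) \<le>
    ennreal (8 * 2 ^ CARD('n) * 3 ^ CARD('n) * C) * B * (\<integral>\<^sup>+x\<in>hcube a l. Mx lebesgue g x * ennreal (\<nu> x) \<partial>lebesgue)"
proof -
  have \<nu> [measurable]: "\<nu> \<in> borel_measurable lebesgue" and C: "0 < C" using A by (auto simp: strict_Ap_def)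
  have bm [measurable]: "b \<in> borel_measurable lebesgue" and bi: "\<And>a l. set_integrable lebesgue (hcube a l) b"
    using b by (auto simp: bmo_le_def integrable_on_cubes_def)
  define avg where "avg a l = average (hcube a l) b" for a l
  define osc where "osc a l = (\<integral>\<^sup>+x\<in>hcube a l. ennreal (norm (b x - avg a l)) \<partial>lebesgue)" for a l
  define t where "t a l = 2 * (enn2real (osc a l) / l ^ CARD('n))" for a l
  define F where "F a l x = ennreal (norm (b x - avg a l)) * g x" for a l x
  \<comment> \<open>The factor \<open>2 ^ CARD('n)\<close> is the volume ratio of parent and child:
    the parent of a stopping cube is not bad, which bounds the distance between the averages of
    \<open>b\<close> over the cube and over the stopping cube.\<close>
  define AA where "AA a l x = ennreal (2 ^ CARD('n) * t a l) * g x" for a l x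
  \<comment> \<open>Here 8 is the factor 2 in \<open>t\<close> times the factor
    \<open>2 powr 2\<close> from the A_2 comparison with the part off \<open>V\<close>;
    \<open>2 ^ CARD('n)\<close> is inherited from \<open>AA\<close>, and \<open>3 ^ CARD('n)\<close>
    comes from \<open>average_le_Mx\<close>.\<close>
  define K where "K = ennreal (8 * 2 ^ CARD('n) * 3 ^ CARD('n) * C) * B"
  define \<psi> where "\<psi> x = K * (Mx lebesgue g x * ennreal (\<nu> x))" for x
  have "(\<integral>\<^sup>+x\<in>hcube a l. F a l x \<partial>lebesgue) \<le> (\<integral>\<^sup>+x\<in>hcube a l. \<psi> x \<partial>lebesgue)"
  proof (rule sparse_iteration[where A = AA])
    show "F a l \<in> borel_measurable lebesgue" "AA a l \<in> borel_measurable lebesgue" for a l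
      unfolding F_def AA_def by measurable
    show "\<psi> \<in> borel_measurable lebesgue" unfolding \<psi>_def by measurable
    show "0 < l" by (rule l)
    fix a :: "real ^ 'n" and l :: real assume l: "0 < l"
    let ?Q = "hcube a l"
    define r where "r = l ^ CARD('n)"
    have r: "0 < r" "emeasure lebesgue ?Q = ennreal r" using l by (auto simp: r_def emeasure_hcube)
    have of: "osc a l < top" unfolding osc_def by (rule osc_finite[OF l bi])
    then obtain o' where o': "osc a l = ennreal o'" "0 \<le> o'" by (cases "osc a l") auto
    have t: "t a l = 2 * o' / r" "0 \<le> t a l" using o' r by (auto simp: t_def r_def)
    define bad where "bad P \<longleftrightarrow> \<not> (\<integral>\<^sup>+x\<in>P. ennreal (norm (b x - avg a l)) \<partial>lebesgue) \<le> ennreal (t a l) * emeasure lebesgue P" for P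
    have nb: "\<not> bad ?Q" unfolding bad_def osc_def[symmetric] using o' r t by (simp add: ennreal_mult[symmetric])
    obtain \<G> where SG: "stopping_family a l bad \<G>" using stopping_cubes[OF l] by blast
    note G = stopping_familyD[OF SG]
    define h where "h = (\<lambda>(c, s). hcube c s :: (real ^ 'n) set)"
    define V where "V = (\<Union>P\<in>\<G>. h P)"
    have Vh: "(\<Union>(c, s)\<in>\<G>. hcube c s) = V" by (simp add: V_def h_def)
    have hm [measurable]: "h P \<in> sets lebesgue" for P by (simp add: h_def split: prod.splits)
    have Vm [measurable]: "V \<in> sets lebesgue" unfolding V_def using G(1) by (intro sets.countable_UN') auto
    have VQ: "V \<subseteq> ?Q" using G(4) by (auto simp: V_def h_def)
    have hdisj: "disjoint_family_on h \<G>" using G(2) by (simp add: h_def)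
    let ?N = "density lebesgue (\<lambda>x. ennreal (norm (b x - avg a l)))"
    have N: "emeasure ?N S = (\<integral>\<^sup>+x\<in>S. ennreal (norm (b x - avg a l)) \<partial>lebesgue)" if "S \<in> sets lebesgue" for S
      using that by (simp add: emeasure_density)
    have tV: "ennreal (t a l) * emeasure lebesgue V \<le> osc a l"
    proof -
      have "ennreal (t a l) * emeasure lebesgue V = (\<integral>\<^sup>+P. ennreal (t a l) * emeasure lebesgue (h P) \<partial>count_space \<G>)"
        unfolding V_def using G(1) hdisj by (subst emeasure_UN_countable) (auto simp: nn_integral_cmult)
      also have "\<dots> \<le> (\<integral>\<^sup>+P. emeasure ?N (h P) \<partial>count_space \<G>)"
      proof (rule nn_integral_mono)
        fix P assume "P \<in> space (count_space \<G>)"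
        then have "bad (h P)" using G(5)[of "fst P" "snd P"] unfolding h_def case_prod_beta by simp
        then show "ennreal (t a l) * emeasure lebesgue (h P) \<le> emeasure ?N (h P)"
          by (simp add: N bad_def less_imp_le not_le)
      qed
      also have "\<dots> = emeasure ?N V"
        unfolding V_def using G(1) hdisj by (subst emeasure_UN_countable) auto
      also have "\<dots> \<le> emeasure ?N ?Q" by (intro emeasure_mono VQ) auto
      also have "\<dots> = osc a l" by (simp add: N osc_def)
      finally show ?thesis .
    qed
    have half: "2 * emeasure lebesgue V \<le> emeasure lebesgue ?Q"
    \<comment> \<open>With zero oscillation the threshold is zero and Chebyshev's argument cannot
      divide by it; but then no subcube is bad.\<close>
    proof (cases "o' = 0")
      case True
      have "\<G> = {}"
      proof (rule ccontr)
        assume "\<G> \<noteq> {}"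
        then obtain c s where cs: "(c, s) \<in> \<G>" by auto
        have "(\<integral>\<^sup>+x\<in>hcube c s. ennreal (norm (b x - avg a l)) \<partial>lebesgue) \<le> osc a l"
          unfolding osc_def by (intro nn_set_integral_set_mono G(4)[OF cs])
        then show False using G(5)[OF cs] o' True by (simp add: bad_def)
      qed
      then show ?thesis by (simp add: V_def)
    next
      case False
      have "emeasure lebesgue V \<le> emeasure lebesgue ?Q" by (intro emeasure_mono VQ) auto
      then obtain v where v: "emeasure lebesgue V = ennreal v" "0 \<le> v"
        using r by (cases "emeasure lebesgue V") (auto simp: top_unique)
      have "2 * o' / r * v \<le> o'" using tV t o' v by (simp add: ennreal_mult[symmetric])
      then have "2 * v \<le> r" using False o' r by (simp add: field_simps)
      then show ?thesis using v r by (simp add: ennreal_numeral[symmetric] ennreal_mult[symmetric] del: ennreal_numeral)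
    qed
    have rem: "emeasure lebesgue ?Q \<le> ennreal 2 * emeasure lebesgue (?Q - V)"
      by (rule emeasure_remainder[OF l Vm VQ half])
    have off: "AE x in lebesgue. x \<in> ?Q - V \<longrightarrow> F a l x \<le> AA a l x"
    proof -
      have "AE x in lebesgue. x \<in> ?Q - V \<longrightarrow> ennreal (norm (b x - avg a l)) \<le> ennreal (t a l)"
      proof (rule dyadic_differentiation[OF l _ t(2)])
        fix x k assume "x \<in> ?Q - V"
        then show "(\<integral>\<^sup>+y\<in>dcube a l k x. ennreal (norm (b y - avg a l)) \<partial>lebesgue) \<le> ennreal (t a l) * emeasure lebesgue (dcube a l k x)"
          using G(7)[of x k] unfolding bad_def Vh by simp
      qed auto
      then show ?thesis
      proof eventually_elim
        case (elim x)
        have "t a l \<le> 2 ^ CARD('n) * t a l" using t(2) by (simp add: mult_le_cancel_right1)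
        then show ?case using elim unfolding F_def AA_def
          by (auto intro!: mult_right_mono elim: order_trans intro: ennreal_leI)
      qed
    qed
    have on: "F a l x \<le> AA a l x + F c s x" if cs: "(c, s) \<in> \<G>" for c s x
    proof -
      have s: "0 < s" using G(3)[OF cs] .
      obtain c' where c': "hcube c s \<subseteq> hcube c' (2 * s)" "hcube c' (2 * s) \<subseteq> ?Q" "\<not> bad (hcube c' (2 * s))"
        using G(6)[OF cs nb] by blast
      have "ennreal (norm (avg c s - avg a l)) * emeasure lebesgue (hcube c s) \<le> (\<integral>\<^sup>+x\<in>hcube c s. ennreal (norm (b x - avg a l)) \<partial>lebesgue)"
        unfolding avg_def by (rule average_diff_bound[OF s bi])
      also have "\<dots> \<le> (\<integral>\<^sup>+x\<in>hcube c' (2 * s). ennreal (norm (b x - avg a l)) \<partial>lebesgue)"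
        by (intro nn_set_integral_set_mono c')
      also have "\<dots> \<le> ennreal (t a l) * emeasure lebesgue (hcube c' (2 * s))"
        using c'(3) by (simp add: bad_def)
      finally have "norm (avg c s - avg a l) * s ^ CARD('n) \<le> t a l * (2 * s) ^ CARD('n)"
        using s t(2) by (simp add: emeasure_hcube ennreal_mult[symmetric])
      then have "norm (avg c s - avg a l) \<le> 2 ^ CARD('n) * t a l"
        using s by (simp add: power_mult_distrib mult.commute)
      then have "norm (b x - avg a l) \<le> 2 ^ CARD('n) * t a l + norm (b x - avg c s)"
        using norm_triangle_ineq[of "avg c s - avg a l" "b x - avg c s"] by simp
      then have "ennreal (norm (b x - avg a l)) \<le> ennreal (2 ^ CARD('n) * t a l) + ennreal (norm (b x - avg c s))"
        using t(2) by (simp add: ennreal_plus[symmetric] del: ennreal_plus)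
      from mult_right_mono[OF this, of "g x"] show ?thesis
        unfolding F_def AA_def by (simp add: distrib_right)
    qed
    have int: "(\<integral>\<^sup>+x\<in>?Q. AA a l x \<partial>lebesgue) \<le> (\<integral>\<^sup>+x\<in>?Q - V. \<psi> x \<partial>lebesgue)"
    proof -
      define G where "G = (\<integral>\<^sup>+x\<in>?Q. g x \<partial>lebesgue)"
      have "(\<integral>\<^sup>+x\<in>?Q. AA a l x \<partial>lebesgue) = ennreal (2 ^ CARD('n) * t a l) * G"
        unfolding AA_def G_def by (subst nn_integral_cmult[symmetric]) (auto simp: mult_ac)
      also have "ennreal (2 ^ CARD('n) * t a l) = ennreal (2 * 2 ^ CARD('n) / r) * osc a l"
        using t o' r by (simp add: ennreal_mult[symmetric] field_simps)
      also have "ennreal (2 * 2 ^ CARD('n) / r) * osc a l \<le> ennreal (2 * 2 ^ CARD('n) / r) * (B * emeasure (wms \<nu>) ?Q)"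
        using b l unfolding osc_def avg_def bmo_le_def by (intro mult_left_mono) auto
      also have "\<dots> \<le> ennreal (2 * 2 ^ CARD('n) / r) * (B * (ennreal (C * 2 powr 2) * emeasure (wms \<nu>) (?Q - V)))"
        by (intro mult_left_mono strict_Ap_comparable_hcube[OF _ A l _ _ _ rem]) auto
      finally have "(\<integral>\<^sup>+x\<in>?Q. AA a l x \<partial>lebesgue) \<le>
          (ennreal (2 * 2 ^ CARD('n) / r) * (B * (ennreal (C * 2 powr 2) * emeasure (wms \<nu>) (?Q - V)))) * G"
        by (simp add: mult_right_mono)
      also have "\<dots> = (ennreal (8 * 2 ^ CARD('n) * C / r) * B * G) * emeasure (wms \<nu>) (?Q - V)"
      proof -
        have "ennreal (8 * 2 ^ CARD('n) * C / r) = ennreal (2 * 2 ^ CARD('n) / r) * ennreal (C * 2 powr 2)"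
          using C r by (subst ennreal_mult[symmetric]) auto
        then show ?thesis by (simp only: mult_ac)
      qed
      also have "\<dots> = (\<integral>\<^sup>+x. (ennreal (8 * 2 ^ CARD('n) * C / r) * B * G) * (ennreal (\<nu> x) * indicator (?Q - V) x) \<partial>lebesgue)"
        by (subst emeasure_wms) (auto simp: nn_integral_cmult)
      also have "\<dots> \<le> (\<integral>\<^sup>+x\<in>?Q - V. \<psi> x \<partial>lebesgue)"
      proof (intro nn_integral_mono)
        fix x
        show "(ennreal (8 * 2 ^ CARD('n) * C / r) * B * G) * (ennreal (\<nu> x) * indicator (?Q - V) x) \<le> \<psi> x * indicator (?Q - V) x"
        proof (cases "x \<in> ?Q - V")
          case True
          have "ennreal (8 * 2 ^ CARD('n) * C / r) * B * G \<le> ennreal (8 * 2 ^ CARD('n) * C / r) * B * (ennreal (3 ^ CARD('n)) * Mx lebesgue g x * ennreal r)"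
            unfolding G_def r(2)[symmetric] using True by (intro mult_left_mono average_le_Mx l) auto
          also have "\<dots> = K * Mx lebesgue g x"
          proof -
            have "ennreal (8 * 2 ^ CARD('n) * 3 ^ CARD('n) * C) = ennreal (8 * 2 ^ CARD('n) * C / r) * (ennreal (3 ^ CARD('n)) * ennreal r)"
              using C r by (simp only: ennreal_mult[symmetric] zero_le_power zero_le_numeral less_imp_le) (subst ennreal_mult[symmetric], auto)
            then show ?thesis unfolding K_def by (simp only: mult_ac)
          qed
          finally have "(ennreal (8 * 2 ^ CARD('n) * C / r) * B * G) * ennreal (\<nu> x) \<le> K * Mx lebesgue g x * ennreal (\<nu> x)"
            by (rule mult_right_mono) simp
          then show ?thesis using True by (simp add: \<psi>_def mult.assoc)
        qed simp
      qed
      finally show ?thesis .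
    qed
    show "\<exists>\<G>. countable \<G> \<and> disjoint_family_on (\<lambda>(c, s). hcube c s) \<G> \<and>
      (\<forall>(c, s)\<in>\<G>. 0 < s \<and> hcube c s \<subseteq> hcube a l) \<and>
      2 * emeasure lebesgue (\<Union>(c, s)\<in>\<G>. hcube c s) \<le> emeasure lebesgue (hcube a l) \<and>
      (AE x in lebesgue. x \<in> hcube a l - (\<Union>(c, s)\<in>\<G>. hcube c s) \<longrightarrow> F a l x \<le> AA a l x) \<and>
      (\<forall>(c, s)\<in>\<G>. AE x in lebesgue. x \<in> hcube c s \<longrightarrow> F a l x \<le> AA a l x + F c s x) \<and>
      (\<integral>\<^sup>+x\<in>hcube a l. AA a l x \<partial>lebesgue) \<le> (\<integral>\<^sup>+x\<in>hcube a l - (\<Union>(c, s)\<in>\<G>. hcube c s). \<psi> x \<partial>lebesgue)"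
    proof -
      have "\<forall>(c, s)\<in>\<G>. 0 < s \<and> hcube c s \<subseteq> hcube a l" using G(3,4) by blast
      moreover have "\<forall>(c, s)\<in>\<G>. AE x in lebesgue. x \<in> hcube c s \<longrightarrow> F a l x \<le> AA a l x + F c s x"
        using on by auto
      ultimately show ?thesis using G(1,2) half off int
        by (intro exI[of _ \<G>], unfold Vh, intro conjI) assumption+
    qed
  qed
  also have "\<dots> = K * (\<integral>\<^sup>+x\<in>hcube a l. Mx lebesgue g x * ennreal (\<nu> x) \<partial>lebesgue)"
    unfolding \<psi>_def by (subst nn_integral_cmult[symmetric]) (auto simp: mult.assoc)
  finally show ?thesis unfolding F_def avg_def K_def .
qed

section \<open>The Bloom form\<close>

definition hdil :: "real \<Rightarrow> real ^ 'n \<Rightarrow> real \<Rightarrow> (real ^ 'n) set" where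
  "hdil m a l = hcube (\<chi> i. a $ i - m * l) ((2 * m + 1) * l)"

text \<open>By Hoelder's inequality the mass of \<nu> is at most the product of the mass of \<mu> to
  the power \<open>1 / p\<close> and that of the dual weight of \<kappa> to the power
  \<open>1 / q\<close>. The same with \<mu> and \<kappa> exchanged holds for
  \<open>1 / \<nu>\<close>, the dual weight at exponent 2. The product of the two bounds regroups
  into the A_p products of \<mu> and \<kappa>, both to the power \<open>1 / p\<close>.\<close>

lemma Bloom_weight_A2:
  assumes p: "1 < p" and \<mu>: "strict_Ap p C1 \<mu>" and \<kappa>: "strict_Ap p C2 \<kappa>"
  shows "strict_Ap 2 ((C1 * C2) powr (1 / p)) (\<lambda>x. \<mu> x powr (1 / p) * \<kappa> x powr (- (1 / p)))" (is "strict_Ap 2 _ ?\<nu>")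
proof -
  have [measurable]: "\<mu> \<in> borel_measurable lebesgue" "\<kappa> \<in> borel_measurable lebesgue"
    and pos: "\<And>x. 0 < \<mu> x" "\<And>x. 0 < \<kappa> x" "0 < C1" "0 < C2"
    using \<mu> \<kappa> by (auto simp: strict_Ap_def)
  define q where "q = conj_exp p"
  note q = conj_exp_props[OF p, folded q_def]
  have H: "emeasure (wms (\<lambda>x. u x powr (1 / p) * v x powr (- (1 / p)))) R \<le>
      ennpow (emeasure (wms u) R) (1 / p) * ennpow (emeasure (wms (dual_weight p v)) R) (1 / q)"
    if [measurable]: "u \<in> borel_measurable lebesgue" "v \<in> borel_measurable lebesgue" "R \<in> sets lebesgue"
      and up: "\<And>x. 0 < u x" "\<And>x. 0 < v x" for u v :: "real ^ 'a \<Rightarrow> real" and R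
  proof -
    have "emeasure (wms (\<lambda>x. u x powr (1 / p) * v x powr (- (1 / p)))) R =
      (\<integral>\<^sup>+x. (ennreal (u x powr (1 / p)) * indicator R x) * (ennreal (v x powr (- (1 / p))) * indicator R x) \<partial>lebesgue)"
      by (subst emeasure_wms) (auto intro!: nn_integral_cong simp: indicator_def ennreal_mult)
    also have "\<dots> \<le> ennpow (\<integral>\<^sup>+x. ennpow (ennreal (u x powr (1 / p)) * indicator R x) p \<partial>lebesgue) (1 / p) *
      ennpow (\<integral>\<^sup>+x. ennpow (ennreal (v x powr (- (1 / p))) * indicator R x) q \<partial>lebesgue) (1 / q)"
      by (rule nn_integral_Holder) (use p q in auto)
    also have "(\<lambda>x. ennpow (ennreal (u x powr (1 / p)) * indicator R x) p) = (\<lambda>x. ennreal (u x) * indicator R x)"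
      using p up by (auto simp: indicator_def ennpow_ennreal powr_powr less_imp_le)
    also have "(\<lambda>x. ennpow (ennreal (v x powr (- (1 / p))) * indicator R x) q) = (\<lambda>x. ennreal (dual_weight p v x) * indicator R x)"
      using q(7) by (auto simp: indicator_def ennpow_ennreal powr_powr dual_weight_def)
    finally show ?thesis by (simp add: emeasure_wms)
  qed
  have dual: "dual_weight 2 ?\<nu> = (\<lambda>x. \<kappa> x powr (1 / p) * \<mu> x powr (- (1 / p)))"
    using pos by (auto simp: dual_weight_def powr_mult powr_powr powr_minus field_simps)
  show ?thesis
    unfolding strict_Ap_def dual
  proof (intro conjI allI impI)
    show "?\<nu> \<in> borel_measurable lebesgue" by measurable
    show "0 < ?\<nu> x" for x using pos(1)[of x] pos(2)[of x] by simp
    show "0 < (C1 * C2) powr (1 / p)" using pos(3,4) by simp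
    fix a :: "real ^ 'a" and l :: real assume l: "0 < l"
    let ?R = "ocube a l"
    let ?m = "emeasure (wms \<mu>) ?R" let ?m' = "emeasure (wms (dual_weight p \<mu>)) ?R"
    let ?k = "emeasure (wms \<kappa>) ?R" let ?k' = "emeasure (wms (dual_weight p \<kappa>)) ?R"
    have fin: "?m < top" "?m' < top" "?k < top" "?k' < top"
      and Ap: "?m * ennpow ?m' (p - 1) \<le> ennreal C1 * ennpow (emeasure lebesgue ?R) p" "?k * ennpow ?k' (p - 1) \<le> ennreal C2 * ennpow (emeasure lebesgue ?R) p"
      using \<mu> \<kappa> l unfolding strict_Ap_def by auto
    have H1: "emeasure (wms ?\<nu>) ?R \<le> ennpow ?m (1 / p) * ennpow ?k' (1 / q)"
      by (rule H) (use pos in auto)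
    have H2: "emeasure (wms (\<lambda>x. \<kappa> x powr (1 / p) * \<mu> x powr (- (1 / p)))) ?R \<le> ennpow ?k (1 / p) * ennpow ?m' (1 / q)"
      by (rule H) (use pos in auto)
    show "emeasure (wms ?\<nu>) ?R < top" using fin by (intro le_less_trans[OF H1]) (auto simp: ennreal_mult_less_top)
    show "emeasure (wms (\<lambda>x. \<kappa> x powr (1 / p) * \<mu> x powr (- (1 / p)))) ?R < top"
      using fin by (intro le_less_trans[OF H2]) (auto simp: ennreal_mult_less_top)
    have e: "ennpow (ennpow x (p - 1)) (1 / p) = ennpow x (1 / q)" for x
    proof -
      have "(p - 1) * (1 / p) = 1 / q" using p by (simp add: q(9)[symmetric])
      then show ?thesis by (simp add: ennpow_ennpow)
    qed
    have "emeasure (wms ?\<nu>) ?R * emeasure (wms (\<lambda>x. \<kappa> x powr (1 / p) * \<mu> x powr (- (1 / p)))) ?R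
      \<le> (ennpow ?m (1 / p) * ennpow ?k' (1 / q)) * (ennpow ?k (1 / p) * ennpow ?m' (1 / q))"
      by (intro mult_mono H1 H2) auto
    also have "\<dots> = ennpow (?m * ennpow ?m' (p - 1)) (1 / p) * ennpow (?k * ennpow ?k' (p - 1)) (1 / p)"
      by (simp only: ennpow_mult e mult_ac)
    also have "\<dots> \<le> ennpow (ennreal C1 * ennpow (emeasure lebesgue ?R) p) (1 / p) * ennpow (ennreal C2 * ennpow (emeasure lebesgue ?R) p) (1 / p)"
      using p by (intro mult_mono ennpow_mono Ap) auto
    also have "\<dots> = ennpow (ennreal C1 * ennreal C2) (1 / p) * (emeasure lebesgue ?R * emeasure lebesgue ?R)"
      using p by (simp add: ennpow_mult ennpow_ennpow mult_ac)
    also have "ennpow (ennreal C1 * ennreal C2) (1 / p) = ennreal ((C1 * C2) powr (1 / p))"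
      using pos(3,4) by (simp add: ennreal_mult[symmetric] ennpow_ennreal)
    also have "emeasure lebesgue ?R * emeasure lebesgue ?R = ennpow (emeasure lebesgue ?R) 2"
      using ennpow_add[of _ 1 1] by simp
    finally show "emeasure (wms ?\<nu>) ?R * ennpow (emeasure (wms (\<lambda>x. \<kappa> x powr (1 / p) * \<mu> x powr (- (1 / p)))) ?R) (2 - 1)
      \<le> ennreal ((C1 * C2) powr (1 / p)) * ennpow (emeasure lebesgue ?R) 2" by simp
  qed
qed

text \<open>With \<open>k = \<nu> M g / \<mu>\<close>, the left-hand side is at most the average of \<open>f\<close> times
  \<open>\<integral> k d\<mu>\<close> over the dilated cube, hence bounded by the product of \<open>M f\<close>, \<open>M\<^sub>\<mu> k\<close> and \<open>\<mu>(E)\<close>.\<close>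

lemma Bloom_form:
  fixes \<mu> \<kappa> :: "real ^ 'n \<Rightarrow> real"
  assumes p: "1 < p" and \<mu>: "strict_Ap p C1 \<mu>" and \<kappa>: "strict_Ap p C2 \<kappa>" and m: "0 < m"
  defines "\<nu> \<equiv> (\<lambda>x. \<mu> x powr (1 / p) * \<kappa> x powr (- (1 / p)))"
  shows "\<exists>K\<ge>0. \<forall>f\<in>borel_measurable lebesgue. \<forall>g\<in>borel_measurable lebesgue. \<exists>\<psi>\<in>borel_measurable lebesgue.
    (\<forall>B b a l E. bmo_le \<nu> B b \<longrightarrow> 0 < l \<longrightarrow> E \<in> sets lebesgue \<longrightarrow> E \<subseteq> hcube a l \<longrightarrow>
       emeasure lebesgue (hcube a l) \<le> 2 * emeasure lebesgue E \<longrightarrow>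
       (\<integral>\<^sup>+x\<in>hdil m a l. f x \<partial>lebesgue) * (\<integral>\<^sup>+x\<in>hdil m a l. ennreal (norm (b x - average (hdil m a l) b)) * g x \<partial>lebesgue)
         \<le> ennreal K * B * emeasure lebesgue (hcube a l) * (\<integral>\<^sup>+x\<in>E. \<psi> x \<partial>lebesgue)) \<and>
    (\<integral>\<^sup>+x. \<psi> x \<partial>lebesgue) \<le> ennreal K * (ennpow (\<integral>\<^sup>+x. ennpow (f x) p * ennreal (\<mu> x) \<partial>lebesgue) (1 / p) *
       ennpow (\<integral>\<^sup>+x. ennpow (g x) (conj_exp p) * ennreal (dual_weight p \<kappa> x) \<partial>lebesgue) (1 / conj_exp p))"
proof -
  have [measurable]: "\<mu> \<in> borel_measurable lebesgue" "\<kappa> \<in> borel_measurable lebesgue"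
    and pos: "\<And>x. 0 < \<mu> x" "\<And>x. 0 < \<kappa> x" "0 < C1" "0 < C2"
    using \<mu> \<kappa> by (auto simp: strict_Ap_def)
  define q where "q = conj_exp p"
  note q = conj_exp_props[OF p, folded q_def]
  define C where "C = (C1 * C2) powr (1 / p)"
  have A2: "strict_Ap 2 C \<nu>" unfolding \<nu>_def C_def by (rule Bloom_weight_A2[OF p \<mu> \<kappa>])
  have [measurable]: "\<nu> \<in> borel_measurable lebesgue" using A2 by (simp add: strict_Ap_def)
  have \<nu>pos: "0 < \<nu> x" for x using A2 by (simp add: strict_Ap_def)
  have C: "0 < C" using A2 by (simp add: strict_Ap_def)
  have A': "strict_Ap q (C2 powr (q - 1)) (dual_weight p \<kappa>)" using strict_Ap_dual[OF p \<kappa>] by (simp add: q_def)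
  obtain K1 where K1: "0 \<le> K1" "\<And>f. f \<in> borel_measurable lebesgue \<Longrightarrow>
    (\<integral>\<^sup>+x. ennpow (Mx lebesgue f x) p * ennreal (\<mu> x) \<partial>lebesgue) \<le> ennreal K1 * (\<integral>\<^sup>+x. ennpow (f x) p * ennreal (\<mu> x) \<partial>lebesgue)"
    using Muckenhoupt[OF p \<mu>] by auto
  obtain K2 where K2: "0 \<le> K2" "\<And>f. f \<in> borel_measurable lebesgue \<Longrightarrow>
    (\<integral>\<^sup>+x. ennpow (Mx lebesgue f x) q * ennreal (dual_weight p \<kappa> x) \<partial>lebesgue) \<le> ennreal K2 * (\<integral>\<^sup>+x. ennpow (f x) q * ennreal (dual_weight p \<kappa> x) \<partial>lebesgue)"
    using Muckenhoupt[OF q(1) A'] by auto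
  \<comment> \<open>The constant of \<open>Mx_strong_type\<close> at the exponent \<open>q\<close>,
    with the doubling constant of \<mu>.\<close>
  define K3 where "K3 = C1 * (3 ^ CARD('n)) powr p * 2 powr q * q / (q - 1)"
  have K3: "0 \<le> K3" "\<And>h. h \<in> borel_measurable lebesgue \<Longrightarrow> (\<integral>\<^sup>+x. ennpow (Mx (wms \<mu>) h x) q \<partial>wms \<mu>) \<le> ennreal K3 * (\<integral>\<^sup>+x. ennpow (h x) q \<partial>wms \<mu>)"
  proof -
    show "0 \<le> K3" using pos(3) q(1) by (auto simp: K3_def)
    fix h :: "real ^ 'n \<Rightarrow> ennreal" assume "h \<in> borel_measurable lebesgue"
    then have "h \<in> borel_measurable (wms \<mu>)" using measurable_cong_sets[OF sets_wms refl] by blast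
    from Mx_strong_type[OF strict_Ap_doubling[OF p \<mu>] this q(1)]
    show "(\<integral>\<^sup>+x. ennpow (Mx (wms \<mu>) h x) q \<partial>wms \<mu>) \<le> ennreal K3 * (\<integral>\<^sup>+x. ennpow (h x) q \<partial>wms \<mu>)"
      by (simp add: K3_def)
  qed
  define M where "M = 2 * m + 1"
  have M: "1 < M" using m by (simp add: M_def)
  define K0 where "K0 = 8 * 2 ^ CARD('n) * 3 ^ CARD('n) * C"
  define K5 where "K5 = C1 * (2 * M ^ CARD('n)) powr p"
  define Ka where "Ka = K0 * K5 * M ^ CARD('n)"
  define Kb where "Kb = K1 powr (1 / p) * (K3 * K2) powr (1 / q)"
  have K: "0 < K0" "0 < K5" "0 < Ka" "0 \<le> Kb" using C pos(3) M by (auto simp: K0_def K5_def Ka_def Kb_def)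
  show ?thesis unfolding q_def[symmetric]
  proof (intro exI[of _ "max Ka Kb"] conjI ballI)
    show "0 \<le> max Ka Kb" using K by simp
    fix f g :: "real ^ 'n \<Rightarrow> ennreal" assume [measurable]: "f \<in> borel_measurable lebesgue" "g \<in> borel_measurable lebesgue"
    \<comment> \<open>Chosen for two identities: \<open>k * \<mu>\<close> is
      \<open>Mx lebesgue g * \<nu>\<close>, and \<open>k^q * \<mu>\<close> is
      \<open>(Mx lebesgue g)^q\<close> times the dual weight of \<kappa>.\<close>
    define k where "k x = Mx lebesgue g x * ennreal (\<nu> x / \<mu> x)" for x
    have [measurable]: "k \<in> borel_measurable lebesgue" unfolding k_def by measurable
    define \<phi> where "\<phi> x = Mx lebesgue f x * Mx (wms \<mu>) k x" for x
    have [measurable]: "\<phi> \<in> borel_measurable lebesgue" unfolding \<phi>_def by measurable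
    show "\<exists>\<psi>\<in>borel_measurable lebesgue.
      (\<forall>B b a l E. bmo_le \<nu> B b \<longrightarrow> 0 < l \<longrightarrow> E \<in> sets lebesgue \<longrightarrow> E \<subseteq> hcube a l \<longrightarrow>
       emeasure lebesgue (hcube a l) \<le> 2 * emeasure lebesgue E \<longrightarrow>
       (\<integral>\<^sup>+x\<in>hdil m a l. f x \<partial>lebesgue) * (\<integral>\<^sup>+x\<in>hdil m a l. ennreal (norm (b x - average (hdil m a l) b)) * g x \<partial>lebesgue)
         \<le> ennreal (max Ka Kb) * B * emeasure lebesgue (hcube a l) * (\<integral>\<^sup>+x\<in>E. \<psi> x \<partial>lebesgue)) \<and>
      (\<integral>\<^sup>+x. \<psi> x \<partial>lebesgue) \<le> ennreal (max Ka Kb) * (ennpow (\<integral>\<^sup>+x. ennpow (f x) p * ennreal (\<mu> x) \<partial>lebesgue) (1 / p) *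
       ennpow (\<integral>\<^sup>+x. ennpow (g x) q * ennreal (dual_weight p \<kappa> x) \<partial>lebesgue) (1 / q))"
    \<comment> \<open>This witness depends neither on \<open>b\<close> nor on the cube, so its
      integrals over the disjoint remainders of a sparse family add up to at most its total
      integral.\<close>
    proof (intro bexI[of _ "\<lambda>x. \<phi> x * ennreal (\<mu> x)"] conjI allI impI)
      fix B b l E and a :: "real ^ 'n" assume b: "bmo_le \<nu> B b" and l: "0 < l" and [measurable]: "E \<in> sets lebesgue" and E: "E \<subseteq> hcube a l"
        and le: "emeasure lebesgue (hcube a l) \<le> 2 * emeasure lebesgue E"
      define c :: "real ^ 'n" where "c = (\<chi> i. a $ i - m * l)"
      define s where "s = (2 * m + 1) * l"
      have s: "0 < s" using l m by (simp add: s_def)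
      have R: "hdil m a l = hcube c s" "dil m a l = ocube c s" by (simp_all add: hdil_def dil_def c_def s_def)
      have EO: "E \<subseteq> ocube c s" using E hcube_subset_dil[OF l m, of a] R by auto
      have oh: "(\<integral>\<^sup>+y\<in>hcube c s. u y \<partial>lebesgue) = (\<integral>\<^sup>+y\<in>ocube c s. u y \<partial>lebesgue)" for u :: "real ^ 'n \<Rightarrow> ennreal"
        by (rule nn_integral_cong_AE, use AE_ccube_hcube_ocube[of c s] in eventually_elim) (auto simp: indicator_def)
      have sM: "s ^ CARD('n) = M ^ CARD('n) * l ^ CARD('n)" by (simp add: s_def M_def power_mult_distrib)
      define I where "I = (\<integral>\<^sup>+y\<in>ocube c s. k y \<partial>wms \<mu>)"
      have "(\<integral>\<^sup>+x\<in>hcube c s. ennreal (norm (b x - average (hcube c s) b)) * g x \<partial>lebesgue)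
        \<le> ennreal K0 * B * (\<integral>\<^sup>+x\<in>hcube c s. Mx lebesgue g x * ennreal (\<nu> x) \<partial>lebesgue)"
        unfolding K0_def by (rule oscillation_bound[OF A2 b _ s]) measurable
      also have "(\<integral>\<^sup>+x\<in>hcube c s. Mx lebesgue g x * ennreal (\<nu> x) \<partial>lebesgue) = I"
      proof -
        have "Mx lebesgue g x * ennreal (\<nu> x) = k x * ennreal (\<mu> x)" for x
          using pos(1)[of x] \<nu>pos[of x] unfolding k_def by (simp add: mult.assoc ennreal_mult[symmetric])
        then have "(\<integral>\<^sup>+x\<in>hcube c s. Mx lebesgue g x * ennreal (\<nu> x) \<partial>lebesgue) = (\<integral>\<^sup>+x. (k x * indicator (ocube c s) x) * ennreal (\<mu> x) \<partial>lebesgue)"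
          unfolding oh by (intro nn_integral_cong) (simp add: mult_ac)
        then show ?thesis unfolding I_def by (subst nn_integral_wms) auto
      qed
      finally have b1: "(\<integral>\<^sup>+x\<in>hcube c s. ennreal (norm (b x - average (hcube c s) b)) * g x \<partial>lebesgue) \<le> ennreal K0 * B * I" .
      have m0: "0 < emeasure (wms \<mu>) (ocube c s)" "emeasure (wms \<mu>) (ocube c s) < top"
        using strict_Ap_doubling[OF p \<mu>] s by (auto simp: doubling_def)
      \<comment> \<open>\<open>E\<close> fills at least half of the cube, hence at least the share
        \<open>1 / (2 * M ^ CARD('n))\<close> of the dilate; so the mass of \<mu> on the dilate is
        controlled by that on \<open>E\<close>.\<close>
      have "emeasure lebesgue (ocube c s) \<le> ennreal (2 * M ^ CARD('n)) * emeasure lebesgue E"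
      proof -
        have "emeasure lebesgue (ocube c s) = ennreal (M ^ CARD('n)) * emeasure lebesgue (hcube a l)"
          using s l M by (simp add: emeasure_ocube emeasure_hcube sM ennreal_mult)
        also have "\<dots> \<le> ennreal (M ^ CARD('n)) * (2 * emeasure lebesgue E)" by (intro mult_left_mono le) simp
        also have "\<dots> = ennreal (2 * M ^ CARD('n)) * emeasure lebesgue E" using M by (simp add: ennreal_mult mult_ac)
        finally show ?thesis .
      qed
      then have mu: "emeasure (wms \<mu>) (ocube c s) \<le> ennreal K5 * emeasure (wms \<mu>) E"
        unfolding K5_def using M by (intro strict_Ap_comparable[OF p \<mu> s _ EO]) auto
      let ?X = "\<integral>\<^sup>+x\<in>ocube c s. f x \<partial>lebesgue"
      have pt: "?X * I \<le> \<phi> x * emeasure lebesgue (ocube c s) * emeasure (wms \<mu>) (ocube c s)" if "x \<in> E" for x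
      proof -
        have "?X = ?X / emeasure lebesgue (ocube c s) * emeasure lebesgue (ocube c s)"
          using s by (simp add: emeasure_ocube ennreal_divide_times mult_divide_eq_ennreal)
        also have "\<dots> \<le> Mx lebesgue f x * emeasure lebesgue (ocube c s)"
          using that EO s by (intro mult_right_mono Mx_ge) auto
        finally have 1: "?X \<le> Mx lebesgue f x * emeasure lebesgue (ocube c s)" .
        have "I = I / emeasure (wms \<mu>) (ocube c s) * emeasure (wms \<mu>) (ocube c s)"
          using m0 by (simp add: ennreal_divide_times mult_divide_eq_ennreal)
        also have "\<dots> \<le> Mx (wms \<mu>) k x * emeasure (wms \<mu>) (ocube c s)"
          unfolding I_def using that EO s by (intro mult_right_mono Mx_ge) auto
        finally have "I \<le> Mx (wms \<mu>) k x * emeasure (wms \<mu>) (ocube c s)" .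
        from mult_mono[OF 1 this] show ?thesis unfolding \<phi>_def by (simp add: mult_ac)
      qed
      have "(?X * I) * emeasure (wms \<mu>) (ocube c s) \<le> (?X * I) * (ennreal K5 * emeasure (wms \<mu>) E)"
        by (intro mult_left_mono mu) simp
      also have "\<dots> = ennreal K5 * (\<integral>\<^sup>+x. (?X * I) * (ennreal (\<mu> x) * indicator E x) \<partial>lebesgue)"
        by (subst nn_integral_cmult) (auto simp: emeasure_wms mult_ac)
      also have "\<dots> \<le> ennreal K5 * (\<integral>\<^sup>+x. (emeasure lebesgue (ocube c s) * emeasure (wms \<mu>) (ocube c s)) * (\<phi> x * ennreal (\<mu> x) * indicator E x) \<partial>lebesgue)"
      proof (intro mult_left_mono nn_integral_mono)
        fix x show "(?X * I) * (ennreal (\<mu> x) * indicator E x) \<le> (emeasure lebesgue (ocube c s) * emeasure (wms \<mu>) (ocube c s)) * (\<phi> x * ennreal (\<mu> x) * indicator E x)"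
          using mult_right_mono[OF pt[of x], of "ennreal (\<mu> x)"] by (simp add: indicator_def mult_ac)
      qed simp
      also have "\<dots> = ennreal K5 * ((emeasure lebesgue (ocube c s) * emeasure (wms \<mu>) (ocube c s)) * (\<integral>\<^sup>+x\<in>E. \<phi> x * ennreal (\<mu> x) \<partial>lebesgue))"
        by (subst nn_integral_cmult) auto
      finally have "emeasure (wms \<mu>) (ocube c s) * (?X * I) \<le> emeasure (wms \<mu>) (ocube c s) * (ennreal K5 * emeasure lebesgue (ocube c s) * (\<integral>\<^sup>+x\<in>E. \<phi> x * ennreal (\<mu> x) \<partial>lebesgue))"
        by (simp only: mult_ac)
      then have b2: "?X * I \<le> ennreal K5 * emeasure lebesgue (ocube c s) * (\<integral>\<^sup>+x\<in>E. \<phi> x * ennreal (\<mu> x) \<partial>lebesgue)"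
        using m0 by (subst (asm) ennreal_mult_le_mult_iff) auto
      have "?X * (\<integral>\<^sup>+x\<in>hcube c s. ennreal (norm (b x - average (hcube c s) b)) * g x \<partial>lebesgue) \<le> ?X * (ennreal K0 * B * I)"
        by (intro mult_left_mono b1) simp
      also have "\<dots> = ennreal K0 * B * (?X * I)" by (simp only: mult_ac)
      also have "\<dots> \<le> ennreal K0 * B * (ennreal K5 * emeasure lebesgue (ocube c s) * (\<integral>\<^sup>+x\<in>E. \<phi> x * ennreal (\<mu> x) \<partial>lebesgue))"
        by (intro mult_left_mono b2) simp
      also have "emeasure lebesgue (ocube c s) = ennreal (M ^ CARD('n)) * emeasure lebesgue (hcube a l)"
        using s l M by (simp add: emeasure_ocube emeasure_hcube sM ennreal_mult)
      also have "ennreal K0 * B * (ennreal K5 * (ennreal (M ^ CARD('n)) * emeasure lebesgue (hcube a l)) * (\<integral>\<^sup>+x\<in>E. \<phi> x * ennreal (\<mu> x) \<partial>lebesgue))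
        = ennreal Ka * B * emeasure lebesgue (hcube a l) * (\<integral>\<^sup>+x\<in>E. \<phi> x * ennreal (\<mu> x) \<partial>lebesgue)"
      proof -
        have "ennreal Ka = ennreal K0 * (ennreal K5 * ennreal (M ^ CARD('n)))"
          unfolding Ka_def using K M by (simp add: ennreal_mult mult.assoc)
        then show ?thesis by (simp only: mult_ac)
      qed
      also have "\<dots> \<le> ennreal (max Ka Kb) * B * emeasure lebesgue (hcube a l) * (\<integral>\<^sup>+x\<in>E. \<phi> x * ennreal (\<mu> x) \<partial>lebesgue)"
        by (intro mult_right_mono ennreal_leI) auto
      finally show "(\<integral>\<^sup>+x\<in>hdil m a l. f x \<partial>lebesgue) * (\<integral>\<^sup>+x\<in>hdil m a l. ennreal (norm (b x - average (hdil m a l) b)) * g x \<partial>lebesgue)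
         \<le> ennreal (max Ka Kb) * B * emeasure lebesgue (hcube a l) * (\<integral>\<^sup>+x\<in>E. \<phi> x * ennreal (\<mu> x) \<partial>lebesgue)"
        unfolding R oh[of f] .
    next
      have "(\<integral>\<^sup>+x. \<phi> x * ennreal (\<mu> x) \<partial>lebesgue) = (\<integral>\<^sup>+x. Mx lebesgue f x * Mx (wms \<mu>) k x \<partial>wms \<mu>)"
        unfolding \<phi>_def by (subst nn_integral_wms) auto
      also have "\<dots> \<le> ennpow (\<integral>\<^sup>+x. ennpow (Mx lebesgue f x) p \<partial>wms \<mu>) (1 / p) * ennpow (\<integral>\<^sup>+x. ennpow (Mx (wms \<mu>) k x) q \<partial>wms \<mu>) (1 / q)"
        by (rule nn_integral_Holder[OF p q(2)]) auto
      also have "\<dots> \<le> ennpow (ennreal K1 * (\<integral>\<^sup>+x. ennpow (f x) p * ennreal (\<mu> x) \<partial>lebesgue)) (1 / p) * ennpow (ennreal K3 * (ennreal K2 * (\<integral>\<^sup>+x. ennpow (g x) q * ennreal (dual_weight p \<kappa> x) \<partial>lebesgue))) (1 / q)"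
      proof (intro mult_mono ennpow_mono)
        show "(\<integral>\<^sup>+x. ennpow (Mx lebesgue f x) p \<partial>wms \<mu>) \<le> ennreal K1 * (\<integral>\<^sup>+x. ennpow (f x) p * ennreal (\<mu> x) \<partial>lebesgue)"
          using K1(2)[of f] by (subst nn_integral_wms) auto
        have "(\<integral>\<^sup>+x. ennpow (Mx (wms \<mu>) k x) q \<partial>wms \<mu>) \<le> ennreal K3 * (\<integral>\<^sup>+x. ennpow (k x) q \<partial>wms \<mu>)"
          by (rule K3(2)) measurable
        also have "(\<integral>\<^sup>+x. ennpow (k x) q \<partial>wms \<mu>) = (\<integral>\<^sup>+x. ennpow (Mx lebesgue g x) q * ennreal (dual_weight p \<kappa> x) \<partial>lebesgue)"
        proof (subst nn_integral_wms)
          show "(\<integral>\<^sup>+x. ennpow (k x) q * ennreal (\<mu> x) \<partial>lebesgue) = (\<integral>\<^sup>+x. ennpow (Mx lebesgue g x) q * ennreal (dual_weight p \<kappa> x) \<partial>lebesgue)"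
          proof (rule nn_integral_cong)
            fix x
            \<comment> \<open>The exponents of \<mu> add up to \<open>q / p - q + 1 = 0\<close>, so
              that only a power of \<kappa> survives.\<close>
            have "(\<nu> x / \<mu> x) powr q * \<mu> x = (\<mu> x powr (q / p) * \<kappa> x powr (- (q / p))) * \<mu> x powr (- q) * \<mu> x powr 1"
              using pos(1)[of x] pos(2)[of x] by (simp add: \<nu>_def powr_divide powr_mult powr_powr powr_minus_divide)
            also have "\<dots> = (\<mu> x powr (q / p) * \<mu> x powr (- q) * \<mu> x powr 1) * \<kappa> x powr (- (q / p))" by (simp only: mult_ac)
            also have "\<mu> x powr (q / p) * \<mu> x powr (- q) * \<mu> x powr 1 = \<mu> x powr (q / p + - q + 1)" by (simp only: powr_add)
            also have "q / p + - q + 1 = 0" using q(7,8) by simp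
            also have "\<mu> x powr 0 * \<kappa> x powr (- (q / p)) = dual_weight p \<kappa> x" using pos(1)[of x] q(7) by (simp add: dual_weight_def)
            finally have *: "(\<nu> x / \<mu> x) powr q * \<mu> x = dual_weight p \<kappa> x" .
            show "ennpow (k x) q * ennreal (\<mu> x) = ennpow (Mx lebesgue g x) q * ennreal (dual_weight p \<kappa> x)"
              unfolding k_def *[symmetric] using pos(1)[of x] \<nu>pos[of x] by (simp add: ennpow_mult ennpow_ennreal ennreal_mult mult.assoc)
          qed
        qed auto
        also have "ennreal K3 * (\<integral>\<^sup>+x. ennpow (Mx lebesgue g x) q * ennreal (dual_weight p \<kappa> x) \<partial>lebesgue) \<le>
          ennreal K3 * (ennreal K2 * (\<integral>\<^sup>+x. ennpow (g x) q * ennreal (dual_weight p \<kappa> x) \<partial>lebesgue))"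
          by (intro mult_left_mono K2(2)) auto
        finally show "(\<integral>\<^sup>+x. ennpow (Mx (wms \<mu>) k x) q \<partial>wms \<mu>) \<le> ennreal K3 * (ennreal K2 * (\<integral>\<^sup>+x. ennpow (g x) q * ennreal (dual_weight p \<kappa> x) \<partial>lebesgue))" .
      qed (use p q(1) in auto)
      also have "\<dots> = ennreal Kb * (ennpow (\<integral>\<^sup>+x. ennpow (f x) p * ennreal (\<mu> x) \<partial>lebesgue) (1 / p) * ennpow (\<integral>\<^sup>+x. ennpow (g x) q * ennreal (dual_weight p \<kappa> x) \<partial>lebesgue) (1 / q))"
        unfolding Kb_def using K1(1) K2(1) K3(1) by (simp add: ennpow_mult ennpow_ennreal ennreal_mult powr_mult mult_ac)
      also have "\<dots> \<le> ennreal (max Ka Kb) * (ennpow (\<integral>\<^sup>+x. ennpow (f x) p * ennreal (\<mu> x) \<partial>lebesgue) (1 / p) * ennpow (\<integral>\<^sup>+x. ennpow (g x) q * ennreal (dual_weight p \<kappa> x) \<partial>lebesgue) (1 / q))"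
        by (intro mult_right_mono ennreal_leI) auto
      finally show "(\<integral>\<^sup>+x. \<phi> x * ennreal (\<mu> x) \<partial>lebesgue) \<le> ennreal (max Ka Kb) * (ennpow (\<integral>\<^sup>+x. ennpow (f x) p * ennreal (\<mu> x) \<partial>lebesgue) (1 / p) *
         ennpow (\<integral>\<^sup>+x. ennpow (g x) q * ennreal (dual_weight p \<kappa> x) \<partial>lebesgue) (1 / q))" .
    qed measurable
  qed
qed

section \<open>Geometry of dilates and tails of kernels\<close>

lemma norm_ge_outside_dil:
  fixes x y :: "real ^ 'n"
  assumes x: "x \<in> hcube a l" and y: "y \<notin> dil m a l" and m: "0 \<le> m" "0 < l"
  shows "m * l \<le> norm (x - y)"
proof -
  obtain i where i: "\<not> (a $ i - m * l < y $ i \<and> y $ i < a $ i - m * l + (2 * m + 1) * l)"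
    using y unfolding dil_def ocube_def by auto
  have "a $ i \<le> x $ i" "x $ i < a $ i + l" using x unfolding hcube_def by auto
  then have "m * l \<le> \<bar>(x - y) $ i\<bar>" using i m by (auto simp: algebra_simps abs_if)
  also have "\<dots> \<le> norm (x - y)" by (rule component_le_norm_cart)
  finally show ?thesis .
qed

lemma norm_diff_le_in_cube:
  fixes x y :: "real ^ 'n" and l :: real
  assumes "x \<in> hcube a l" "y \<in> hcube a l"
  shows "norm (x - y) \<le> CARD('n) * l"
proof -
  have "norm (x - y) \<le> (\<Sum>i\<in>UNIV. \<bar>(x - y) $ i\<bar>)" by (rule norm_le_l1_cart)
  also have "\<dots> \<le> (\<Sum>i\<in>(UNIV::'n set). l)"
  proof (rule sum_mono)
    fix i
    have "a $ i \<le> x $ i" "x $ i < a $ i + l" "a $ i \<le> y $ i" "y $ i < a $ i + l" using assms unfolding hcube_def by auto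
    then show "\<bar>(x - y) $ i\<bar> \<le> l" by (simp add: abs_le_iff)
  qed
  finally show ?thesis by simp
qed

lemma corner_in_hcube: "0 < l \<Longrightarrow> a \<in> hcube a l"
  by (simp add: hcube_def)

lemma measurable_lebesgue_continuous:
  fixes f :: "'a::euclidean_space \<Rightarrow> 'b::topological_space"
  shows "continuous_on UNIV f \<Longrightarrow> f \<in> borel_measurable lebesgue"
  by (intro measurable_completion) (simp add: borel_measurable_continuous_onI)

text \<open>The complement is split into annuli between dilates of doubling size. On the k-th
  annulus the decaying factor is of the order \<open>(2 powr (- \<delta>)) ^ k\<close> over the
  volume of the outer dilate, and the average of \<open>G\<close> over that dilate is at most the
  maximal function at any point of the cube, so a geometric series remains. The maximal function is
  taken at a second point \<open>x'\<close> because only a selected point of the cube will have a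
  controlled maximal function.\<close>

lemma annuli_bound:
  fixes x :: "real ^ 'n" and G :: "real ^ 'n \<Rightarrow> ennreal" and l m \<delta> :: real
  assumes l: "0 < l" and m: "1 \<le> m" and \<delta>: "0 < \<delta>" and x: "x \<in> hcube a l" "x' \<in> hcube a l"
    and G [measurable]: "G \<in> borel_measurable lebesgue"
  shows "(\<integral>\<^sup>+y\<in>- dil m a l. ennreal (l powr \<delta> / norm (x - y) powr (CARD('n) + \<delta>)) * G y \<partial>lebesgue) \<le>
    ennreal ((5 * m) ^ CARD('n) / (1 - 2 powr (- \<delta>))) * Mx lebesgue G x'"
proof -
  define R where "R k = dil (m * 2 ^ k) a l" for k :: nat
  have cover: "\<exists>k. y \<in> R k" for y
  proof -
    obtain k where k: "norm (y - a) / l < 2 ^ k" using real_arch_pow[of 2] by auto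
    have "norm (a - y) < m * 2 ^ k * l"
    proof -
      have "norm (a - y) < 2 ^ k * l" using k l by (simp add: field_simps norm_minus_commute)
      also have "\<dots> \<le> m * 2 ^ k * l" using m l by simp
      finally show ?thesis .
    qed
    then show ?thesis
      unfolding R_def using norm_ge_outside_dil[OF corner_in_hcube[OF l], of y "m * 2 ^ k" a] m l by (intro exI[of _ k]) auto
  qed
  define f where "f y = ennreal (l powr \<delta> / norm (x - y) powr (CARD('n) + \<delta>)) * G y" for y
  have fm [measurable]: "f \<in> borel_measurable lebesgue"
  proof -
    have [measurable]: "(\<lambda>y. norm (x - y)) \<in> borel_measurable lebesgue"
      by (intro measurable_lebesgue_continuous continuous_intros)
    show ?thesis unfolding f_def by measurable
  qed
  have [measurable]: "R k \<in> sets lebesgue" for k by (simp add: R_def)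
  have "(\<integral>\<^sup>+y\<in>- R 0. f y \<partial>lebesgue) \<le> (\<integral>\<^sup>+y. (\<Sum>k. f y * indicator (R (Suc k) - R k) y) \<partial>lebesgue)"
  proof (rule nn_integral_mono)
    fix y
    show "f y * indicator (- R 0) y \<le> (\<Sum>k. f y * indicator (R (Suc k) - R k) y)"
    proof (cases "y \<in> R 0")
      case False
      define k where "k = (LEAST k. y \<in> R k)"
      have k: "y \<in> R k" "\<And>j. j < k \<Longrightarrow> y \<notin> R j"
        unfolding k_def using cover[of y] by (auto intro: LeastI_ex dest: not_less_Least)
      then obtain j where j: "k = Suc j" using False by (cases k) auto
      have "f y * indicator (- R 0) y = (\<Sum>k\<in>{j}. f y * indicator (R (Suc k) - R k) y)" using k j False by auto
      also have "\<dots> \<le> (\<Sum>k. f y * indicator (R (Suc k) - R k) y)"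
        by (rule sum_le_suminf) auto
      finally show ?thesis .
    qed simp
  qed
  also have "\<dots> = (\<Sum>k. \<integral>\<^sup>+y\<in>R (Suc k) - R k. f y \<partial>lebesgue)"
    by (rule nn_integral_suminf) measurable
  also have "\<dots> \<le> (\<Sum>k. ennreal ((5 * m) ^ CARD('n) * (2 powr (- \<delta>)) ^ k) * Mx lebesgue G x')"
  proof (intro suminf_le)
    fix k
    define u where "u = 2 ^ k * l"
    have u: "0 < u" using l by (simp add: u_def)
    have c: "f y \<le> ennreal (l powr \<delta> / u powr (CARD('n) + \<delta>)) * G y" if "y \<notin> R k" for y
    proof -
      have "u \<le> m * 2 ^ k * l" unfolding u_def using m l by simp
      also have "\<dots> \<le> norm (x - y)"
        using that m l x unfolding R_def by (intro norm_ge_outside_dil) auto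
      finally have "u powr (CARD('n) + \<delta>) \<le> norm (x - y) powr (CARD('n) + \<delta>)"
        using u \<delta> by (intro powr_mono2) auto
      then show ?thesis unfolding f_def using u l
        by (intro mult_right_mono ennreal_leI divide_left_mono mult_pos_pos) (auto intro: less_le_trans[of 0 "u powr _"])
    qed
    have "(\<integral>\<^sup>+y\<in>R (Suc k) - R k. f y \<partial>lebesgue) \<le> (\<integral>\<^sup>+y. ennreal (l powr \<delta> / u powr (CARD('n) + \<delta>)) * (G y * indicator (R (Suc k)) y) \<partial>lebesgue)"
      using c by (intro nn_integral_mono) (auto simp: indicator_def)
    also have "\<dots> = ennreal (l powr \<delta> / u powr (CARD('n) + \<delta>)) * (\<integral>\<^sup>+y\<in>R (Suc k). G y \<partial>lebesgue)"
      by (rule nn_integral_cmult) measurable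
    also have "\<dots> \<le> ennreal (l powr \<delta> / u powr (CARD('n) + \<delta>)) * (ennreal ((5 * m * u) ^ CARD('n)) * Mx lebesgue G x')"
    proof (intro mult_left_mono)
      define s where "s = (2 * (m * 2 ^ Suc k) + 1) * l"
      have s: "0 < s" "s \<le> 5 * m * u"
      proof -
        show "0 < s" unfolding s_def using m l by (intro mult_pos_pos add_nonneg_pos) auto
        \<comment> \<open>Absorbs the summand 1 of the side length, whence the constant 5 = 4 +
          1.\<close>
        have "1 * 1 \<le> m * 2 ^ k" using m by (intro mult_mono) auto
        then have "2 * (m * 2 ^ Suc k) + 1 \<le> 5 * (m * 2 ^ k)" by simp
        from mult_right_mono[OF this, of l] show "s \<le> 5 * m * u" using l unfolding s_def u_def by (simp add: mult_ac)
      qed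
      have Rs: "R (Suc k) = ocube (\<chi> i. a $ i - (m * 2 ^ Suc k) * l) s" by (simp add: R_def dil_def s_def)
      have "x' \<in> R (Suc k)" using hcube_subset_dil[OF l, of "m * 2 ^ Suc k" a] x m unfolding R_def by auto
      have "(\<integral>\<^sup>+y\<in>R (Suc k). G y \<partial>lebesgue) = (\<integral>\<^sup>+y\<in>R (Suc k). G y \<partial>lebesgue) / emeasure lebesgue (R (Suc k)) * emeasure lebesgue (R (Suc k))"
        using s unfolding Rs by (simp add: emeasure_ocube ennreal_divide_times mult_divide_eq_ennreal)
      also have "\<dots> \<le> Mx lebesgue G x' * ennreal ((5 * m * u) ^ CARD('n))"
        using s \<open>x' \<in> R (Suc k)\<close> unfolding Rs
        by (intro mult_mono Mx_ge) (auto simp: emeasure_ocube intro!: ennreal_leI power_mono)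
      finally show "(\<integral>\<^sup>+y\<in>R (Suc k). G y \<partial>lebesgue) \<le> ennreal ((5 * m * u) ^ CARD('n)) * Mx lebesgue G x'"
        by (simp add: mult.commute)
    qed simp
    also have "\<dots> = ennreal ((5 * m) ^ CARD('n) * (2 powr (- \<delta>)) ^ k) * Mx lebesgue G x'"
    proof -
      have "l powr \<delta> / u powr (CARD('n) + \<delta>) * (5 * m * u) ^ CARD('n) = (5 * m) ^ CARD('n) * (l / u) powr \<delta>"
        using u l by (simp add: powr_add powr_realpow powr_divide power_mult_distrib)
      also have "(l / u) powr \<delta> = (2 powr (- \<delta>)) ^ k"
        using l by (simp add: u_def powr_divide powr_minus_divide power_one_over powr_realpow[symmetric] powr_powr mult.commute power_divide powr_power)
      finally show ?thesis using m u by (simp add: mult.assoc[symmetric] ennreal_mult[symmetric])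
    qed
    finally show "(\<integral>\<^sup>+y\<in>R (Suc k) - R k. f y \<partial>lebesgue) \<le> ennreal ((5 * m) ^ CARD('n) * (2 powr (- \<delta>)) ^ k) * Mx lebesgue G x'" .
  qed auto
  also have "\<dots> = (\<Sum>k. ennreal ((5 * m) ^ CARD('n) * (2 powr (- \<delta>)) ^ k)) * Mx lebesgue G x'"
    by simp
  also have "(\<Sum>k. ennreal ((5 * m) ^ CARD('n) * (2 powr (- \<delta>)) ^ k)) = ennreal ((5 * m) ^ CARD('n) / (1 - 2 powr (- \<delta>)))"
  proof (rule suminf_ennreal_eq)
    have lt: "2 powr (- \<delta>) < 1" using \<delta> by (simp add: powr_less_one)
    show "(\<lambda>k. (5 * m) ^ CARD('n) * (2 powr (- \<delta>)) ^ k) sums ((5 * m) ^ CARD('n) / (1 - 2 powr (- \<delta>)))"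
      using sums_mult[OF geometric_sums[of "2 powr (- \<delta>)"], of "(5 * m) ^ CARD('n)"] lt by simp
  qed (use m in auto)
  finally show ?thesis unfolding f_def R_def by simp
qed

lemma Mx_one_le: "doubling N D \<Longrightarrow> Mx N (\<lambda>_. 1) x \<le> 1"
proof (rule Mx_le)
  fix a and l :: real assume D: "doubling N D" and l: "0 < l"
  have "ocube a l \<in> sets N" using D by (simp add: doubling_def)
  then have "(\<integral>\<^sup>+y\<in>ocube a l. 1 \<partial>N) = emeasure N (ocube a l)" by simp
  moreover have "emeasure N (ocube a l) \<noteq> 0" "emeasure N (ocube a l) < top"
    using D l by (auto simp: doubling_def zero_less_iff_neq_zero)
  ultimately show "(\<integral>\<^sup>+y\<in>ocube a l. 1 \<partial>N) / emeasure N (ocube a l) \<le> 1"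
    by (simp add: ennreal_divide_self)
qed

text \<open>What is left after the first members of an enumeration decreases to the empty set, and
  finite total mass gives continuity from above. In the Calderon-Zygmund decomposition the measure
  is \<open>\<bar>f\<bar>^2 dx\<close>.\<close>

lemma finite_subfamily:
  assumes G: "countable \<G>" and h: "\<And>P. P \<in> \<G> \<Longrightarrow> h P \<in> sets M" and fin: "emeasure M (\<Union>P\<in>\<G>. h P) < top" and e: "0 < e"
  shows "\<exists>\<H>\<subseteq>\<G>. finite \<H> \<and> emeasure M ((\<Union>P\<in>\<G>. h P) - (\<Union>P\<in>\<H>. h P)) < e"
proof (cases "\<G> = {}")
  case True
  then show ?thesis using e by auto
next
  case False
  define f where "f = from_nat_into \<G>"
  have f: "range f = \<G>" using False G by (simp add: f_def range_from_nat_into)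
  define A where "A k = (\<Union>P\<in>\<G>. h P) - (\<Union>P\<in>f ` {..k}. h P)" for k :: nat
  have sub: "(\<Union>P\<in>\<G>. h P) \<in> sets M" using G h by (intro sets.countable_UN') auto
  have "(\<lambda>k. emeasure M (A k)) \<longlonglongrightarrow> emeasure M (\<Inter>k. A k)"
  proof (rule Lim_emeasure_decseq)
    show "range A \<subseteq> sets M"
      unfolding A_def using h f sub by (auto intro!: sets.Diff sets.finite_UN)
    show "decseq A" unfolding A_def by (intro decseq_SucI Diff_mono UN_mono image_mono) auto
    show "emeasure M (A k) \<noteq> \<infinity>" for k
    proof -
      have "emeasure M (A k) \<le> emeasure M (\<Union>P\<in>\<G>. h P)" by (intro emeasure_mono sub) (auto simp: A_def)
      then show ?thesis using fin by auto
    qed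
  qed
  moreover have "(\<Inter>k. A k) = {}" unfolding A_def f[symmetric] by auto
  ultimately have "(\<lambda>k. emeasure M (A k)) \<longlonglongrightarrow> 0" by simp
  then have "\<forall>\<^sub>F k in sequentially. emeasure M (A k) < e" using e by (rule order_tendstoD)
  then obtain k where "emeasure M (A k) < e" by (auto simp: eventually_sequentially)
  then show ?thesis unfolding A_def using f by (intro exI[of _ "f ` {..k}"]) auto
qed

section \<open>Square integrable and integrable functions\<close>

definition L2 :: "(real ^ 'n \<Rightarrow> complex) \<Rightarrow> bool" where
  "L2 f \<longleftrightarrow> f \<in> borel_measurable lebesgue \<and> (\<integral>\<^sup>+x. ennreal ((norm (f x))\<^sup>2) \<partial>lebesgue) < top"

definition L1norm :: "(real ^ 'n \<Rightarrow> complex) \<Rightarrow> ennreal" where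
  "L1norm f = (\<integral>\<^sup>+x. ennreal (norm (f x)) \<partial>lebesgue)"

lemma Lp_norm_2: "Lp_norm 2 (\<lambda>_. 1) f = ennpow (\<integral>\<^sup>+x. ennreal ((norm (f x))\<^sup>2) \<partial>lebesgue) (1 / 2)"
  unfolding Lp_norm_def by (simp add: powr_numeral)

lemma Lp_norm_1: "Lp_norm 1 (\<lambda>_. 1) f = L1norm f"
  unfolding Lp_norm_def L1norm_def by simp

lemma Lp_space_2_iff: "f \<in> Lp_space 2 (\<lambda>_. 1) \<longleftrightarrow> L2 f"
  by (simp add: Lp_space_def Lp_norm_2 L2_def)

lemma L2_lincomb:
  assumes "L2 f" "L2 g" shows "L2 (\<lambda>y. \<alpha> * f y + \<beta> * g y)"
proof -
  have [measurable]: "f \<in> borel_measurable lebesgue" "g \<in> borel_measurable lebesgue" using assms by (auto simp: L2_def)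
  have "(norm (\<alpha> * f x + \<beta> * g x))\<^sup>2 \<le> 2 * (norm \<alpha>)\<^sup>2 * (norm (f x))\<^sup>2 + 2 * (norm \<beta>)\<^sup>2 * (norm (g x))\<^sup>2" for x
  proof -
    have "norm (\<alpha> * f x + \<beta> * g x) \<le> norm \<alpha> * norm (f x) + norm \<beta> * norm (g x)"
      by (metis norm_mult norm_triangle_ineq)
    then have "(norm (\<alpha> * f x + \<beta> * g x))\<^sup>2 \<le> (norm \<alpha> * norm (f x) + norm \<beta> * norm (g x))\<^sup>2"
      by (intro power_mono) auto
    also have "\<dots> \<le> 2 * (norm \<alpha> * norm (f x))\<^sup>2 + 2 * (norm \<beta> * norm (g x))\<^sup>2"
      using sum_squares_bound[of "norm \<alpha> * norm (f x)" "norm \<beta> * norm (g x)"] by (simp add: power2_sum)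
    finally show ?thesis by (simp add: power_mult_distrib)
  qed
  then have "(\<integral>\<^sup>+x. ennreal ((norm (\<alpha> * f x + \<beta> * g x))\<^sup>2) \<partial>lebesgue) \<le>
    (\<integral>\<^sup>+x. ennreal (2 * (norm \<alpha>)\<^sup>2) * ennreal ((norm (f x))\<^sup>2) + ennreal (2 * (norm \<beta>)\<^sup>2) * ennreal ((norm (g x))\<^sup>2) \<partial>lebesgue)"
    by (intro nn_integral_mono) (simp add: ennreal_mult[symmetric] ennreal_plus[symmetric] del: ennreal_plus)
  also have "\<dots> = ennreal (2 * (norm \<alpha>)\<^sup>2) * (\<integral>\<^sup>+x. ennreal ((norm (f x))\<^sup>2) \<partial>lebesgue) + ennreal (2 * (norm \<beta>)\<^sup>2) * (\<integral>\<^sup>+x. ennreal ((norm (g x))\<^sup>2) \<partial>lebesgue)"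
    by (simp add: nn_integral_add nn_integral_cmult)
  also have "\<dots> < top" using assms by (auto simp: L2_def ennreal_mult_less_top)
  finally show ?thesis by (simp add: L2_def)
qed

lemma L2_diff: "L2 f \<Longrightarrow> L2 g \<Longrightarrow> L2 (\<lambda>y. f y - g y)"
  using L2_lincomb[of f g 1 "-1"] by simp

lemma L2_mono: "L2 f \<Longrightarrow> g \<in> borel_measurable lebesgue \<Longrightarrow> (\<And>x. norm (g x) \<le> norm (f x)) \<Longrightarrow> L2 g"
proof -
  assume f: "L2 f" and g: "g \<in> borel_measurable lebesgue" and le: "\<And>x. norm (g x) \<le> norm (f x)"
  have "(\<integral>\<^sup>+x. ennreal ((norm (g x))\<^sup>2) \<partial>lebesgue) \<le> (\<integral>\<^sup>+x. ennreal ((norm (f x))\<^sup>2) \<partial>lebesgue)"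
    by (intro nn_integral_mono ennreal_leI power_mono le) auto
  then show "L2 g" using f g unfolding L2_def by (auto intro: le_less_trans)
qed

lemma superlevel_sets [measurable]:
  fixes f :: "'a::euclidean_space \<Rightarrow> 'b::{second_countable_topology, real_normed_vector}"
  assumes [measurable]: "f \<in> borel_measurable lebesgue" shows "{x. \<alpha> < norm (f x)} \<in> sets lebesgue"
proof -
  have "{x \<in> space lebesgue. \<alpha> < norm (f x)} \<in> sets lebesgue" by measurable
  then show ?thesis by simp
qed

lemma superlevel_sets_ennreal [measurable]:
  fixes f :: "'a::euclidean_space \<Rightarrow> ennreal"
  assumes [measurable]: "f \<in> borel_measurable lebesgue" shows "{x. \<alpha> < f x} \<in> sets lebesgue"
proof -
  have "{x \<in> space lebesgue. \<alpha> < f x} \<in> sets lebesgue" by measurable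
  then show ?thesis by simp
qed

lemma L2_bounded_integrable:
  assumes "f \<in> borel_measurable lebesgue" "L1norm f < top" "\<And>x. norm (f x) \<le> c"
  shows "L2 f"
proof -
  have [measurable]: "f \<in> borel_measurable lebesgue" using assms by simp
  have c: "0 \<le> c" using assms(3)[of 0] norm_ge_zero order_trans by blast
  have "(\<integral>\<^sup>+x. ennreal ((norm (f x))\<^sup>2) \<partial>lebesgue) \<le> (\<integral>\<^sup>+x. ennreal c * ennreal (norm (f x)) \<partial>lebesgue)"
    using assms(3) c by (intro nn_integral_mono) (auto simp: ennreal_mult[symmetric] power2_eq_square mult_right_mono)
  also have "\<dots> = ennreal c * L1norm f" unfolding L1norm_def by (rule nn_integral_cmult) measurable
  finally show ?thesis using assms by (auto simp: L2_def ennreal_mult_less_top intro: le_less_trans)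
qed

lemma Chebyshev_L2:
  fixes f :: "real ^ 'n \<Rightarrow> complex"
  assumes [measurable]: "f \<in> borel_measurable lebesgue" and \<alpha>: "0 < \<alpha>"
  shows "emeasure lebesgue {x. \<alpha> < norm (f x)} \<le> ennreal (1 / \<alpha>\<^sup>2) * (\<integral>\<^sup>+x. ennreal ((norm (f x))\<^sup>2) \<partial>lebesgue)"
proof -
  have "emeasure lebesgue {x. \<alpha> < norm (f x)} = (\<integral>\<^sup>+x. indicator {x. \<alpha> < norm (f x)} x \<partial>lebesgue)"
    by (rule nn_integral_indicator[symmetric]) measurable
  also have "\<dots> \<le> (\<integral>\<^sup>+x. ennreal (1 / \<alpha>\<^sup>2) * ennreal ((norm (f x))\<^sup>2) \<partial>lebesgue)"
  proof (rule nn_integral_mono)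
    fix x
    show "indicator {x. \<alpha> < norm (f x)} x \<le> ennreal (1 / \<alpha>\<^sup>2) * ennreal ((norm (f x))\<^sup>2)"
    proof (cases "\<alpha> < norm (f x)")
      case True
      then have "\<alpha>\<^sup>2 \<le> (norm (f x))\<^sup>2" using \<alpha> by (intro power_mono) auto
      then have "1 \<le> 1 / \<alpha>\<^sup>2 * (norm (f x))\<^sup>2" using \<alpha> by (simp add: field_simps)
      then have "ennreal 1 \<le> ennreal (1 / \<alpha>\<^sup>2 * (norm (f x))\<^sup>2)" by (rule ennreal_leI)
      then show ?thesis using True by (simp add: ennreal_mult[symmetric])
    qed simp
  qed
  also have "\<dots> = ennreal (1 / \<alpha>\<^sup>2) * (\<integral>\<^sup>+x. ennreal ((norm (f x))\<^sup>2) \<partial>lebesgue)"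
    by (rule nn_integral_cmult) measurable
  finally show ?thesis .
qed

lemma Chebyshev_L1:
  fixes f :: "real ^ 'n \<Rightarrow> ennreal"
  assumes [measurable]: "f \<in> borel_measurable lebesgue" and \<alpha>: "0 < \<alpha>"
  shows "emeasure lebesgue {x. ennreal \<alpha> < f x} \<le> ennreal (1 / \<alpha>) * (\<integral>\<^sup>+x. f x \<partial>lebesgue)"
proof -
  have "emeasure lebesgue {x. ennreal \<alpha> < f x} = (\<integral>\<^sup>+x. indicator {x. ennreal \<alpha> < f x} x \<partial>lebesgue)"
    by (rule nn_integral_indicator[symmetric]) measurable
  also have "\<dots> \<le> (\<integral>\<^sup>+x. ennreal (1 / \<alpha>) * f x \<partial>lebesgue)"
  proof (rule nn_integral_mono)
    fix x
    show "indicator {x. ennreal \<alpha> < f x} x \<le> ennreal (1 / \<alpha>) * f x"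
    proof (cases "ennreal \<alpha> < f x")
      case True
      have "1 = ennreal (1 / \<alpha>) * ennreal \<alpha>" using \<alpha> by (simp add: ennreal_mult[symmetric])
      also have "\<dots> \<le> ennreal (1 / \<alpha>) * f x" using True by (intro mult_left_mono) auto
      finally show ?thesis using True by simp
    qed simp
  qed
  also have "\<dots> = ennreal (1 / \<alpha>) * (\<integral>\<^sup>+x. f x \<partial>lebesgue)"
    by (rule nn_integral_cmult) measurable
  finally show ?thesis .
qed

lemma superlevel_add:
  fixes f g h :: "real ^ 'n \<Rightarrow> complex"
  assumes [measurable]: "f \<in> borel_measurable lebesgue" "g \<in> borel_measurable lebesgue" "h \<in> borel_measurable lebesgue"
    and ae: "AE x in lebesgue. norm (h x) \<le> norm (f x) + norm (g x :: complex)"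
  shows "emeasure lebesgue {x. 2 * \<alpha> < norm (h x :: complex)} \<le> emeasure lebesgue {x. \<alpha> < norm (f x :: complex)} + emeasure lebesgue {x. \<alpha> < norm (g x)}"
proof -
  have "emeasure lebesgue {x. 2 * \<alpha> < norm (h x)} \<le> emeasure lebesgue ({x. \<alpha> < norm (f x)} \<union> {x. \<alpha> < norm (g x)})"
    by (rule emeasure_mono_AE[OF _ sets.Un]) (use ae in \<open>auto elim!: eventually_mono\<close>)
  also have "\<dots> \<le> emeasure lebesgue {x. \<alpha> < norm (f x)} + emeasure lebesgue {x. \<alpha> < norm (g x)}"
    by (rule emeasure_subadditive) measurable
  finally show ?thesis .
qed

text \<open>Weak type bounds and limits in measure provide exceptional sets of arbitrarily small
  measure only; the intersection of a sequence of them is null.\<close>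

lemma AE_not_if_small_cover:
  assumes "\<And>e::real. 0 < e \<Longrightarrow> \<exists>Z\<in>sets M. emeasure M Z \<le> ennreal e \<and> (AE x in M. P x \<longrightarrow> x \<in> Z)"
  shows "AE x in M. \<not> P x"
proof -
  have "\<forall>n::nat. \<exists>Z. Z \<in> sets M \<and> emeasure M Z \<le> ennreal (1 / Suc n) \<and> (AE x in M. P x \<longrightarrow> x \<in> Z)"
    using assms[of "1 / Suc _"] unfolding Bex_def by simp
  from choice[OF this] obtain Z where Z: "\<And>n. Z n \<in> sets M" "\<And>n. emeasure M (Z n) \<le> ennreal (1 / Suc n)"
    "\<And>n. AE x in M. P x \<longrightarrow> x \<in> Z n" by blast
  have "emeasure M (\<Inter>n. Z n) \<le> 0 + ennreal e" if "0 < e" for e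
  proof -
    obtain n where n: "1 / real (Suc n) < e" using nat_approx_posE[OF \<open>0 < e\<close>] by blast
    have "emeasure M (\<Inter>n. Z n) \<le> emeasure M (Z n)" using Z(1) by (intro emeasure_mono) auto
    also have "\<dots> \<le> ennreal e" using n by (intro order_trans[OF Z(2)] ennreal_leI) simp
    finally show ?thesis by simp
  qed
  then have "emeasure M (\<Inter>n. Z n) \<le> 0" by (rule ennreal_le_epsilon)
  then have "(\<Inter>n. Z n) \<in> null_sets M" using Z(1) by (auto intro!: null_setsI)
  from AE_not_in[OF this] have *: "AE x in M. x \<notin> (\<Inter>n. Z n)" .
  have "AE x in M. \<forall>n. P x \<longrightarrow> x \<in> Z n" unfolding AE_all_countable using Z(3) by blast
  with * show ?thesis by eventually_elim auto
qed

text \<open>Two values that differ do so by more than some \<open>1 / (n + 1)\<close>, which leaves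
  countably many instances of the preceding lemma.\<close>

lemma AE_eq_if_small_cover:
  fixes u v :: "'a \<Rightarrow> complex"
  assumes "\<And>\<epsilon> e::real. 0 < \<epsilon> \<Longrightarrow> 0 < e \<Longrightarrow>
    \<exists>Z\<in>sets M. emeasure M Z \<le> ennreal e \<and> (AE x in M. Q x \<longrightarrow> \<epsilon> < norm (u x - v x) \<longrightarrow> x \<in> Z)"
  shows "AE x in M. Q x \<longrightarrow> u x = v x"
proof -
  have "AE x in M. \<not> (Q x \<and> 1 / real (Suc n) < norm (u x - v x))" for n
    by (rule AE_not_if_small_cover) (use assms[of "1 / real (Suc n)"] in \<open>auto simp: imp_conjL\<close>)
  then have "AE x in M. \<forall>n. \<not> (Q x \<and> 1 / real (Suc n) < norm (u x - v x))" unfolding AE_all_countable by blast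
  then show ?thesis
  proof eventually_elim
    case (elim x)
    show ?case
    proof (intro impI, rule ccontr)
      assume "Q x" "u x \<noteq> v x"
      then obtain n where "1 / real (Suc n) < norm (u x - v x)" using nat_approx_posE[of "norm (u x - v x)"] by auto
      then show False using elim \<open>Q x\<close> by blast
    qed
  qed
qed

lemma geometric_Cauchy_limit:
  fixes f :: "nat \<Rightarrow> complex"
  assumes "\<And>k. m \<le> k \<Longrightarrow> norm (f (Suc k) - f k) \<le> (1 / 2) ^ k"
  shows "norm (lim f - f m) \<le> 2 * (1 / 2) ^ m"
proof -
  \<comment> \<open>The subtracted power is what makes the telescoping induction close.\<close>
  have step: "norm (f j - f i) \<le> 2 * (1 / 2) ^ i - 2 * (1 / 2) ^ j" if "m \<le> i" "i \<le> j" for i j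
    using that(2)
  proof (induction j rule: dec_induct)
    case (step j)
    have "norm (f (Suc j) - f i) \<le> norm (f (Suc j) - f j) + norm (f j - f i)"
      using norm_triangle_ineq[of "f (Suc j) - f j" "f j - f i"] by simp
    also have "\<dots> \<le> (1 / 2) ^ j + (2 * (1 / 2) ^ i - 2 * (1 / 2) ^ j)"
      using step that by (intro add_mono assms) auto
    finally show ?case by simp
  qed simp
  then have le: "norm (f j - f i) \<le> 2 * (1 / 2) ^ i" if "m \<le> i" "i \<le> j" for i j
    using step[OF that] zero_le_power[of "1 / 2 :: real" j] by linarith
  have "Cauchy f"
  proof (rule CauchyI')
    fix e :: real assume "0 < e"
    then obtain N where N: "(1 / 2) ^ N < e / 2" using real_arch_pow_inv[of "e / 2" "1 / 2"] by auto
    show "\<exists>M. \<forall>i\<ge>M. \<forall>n>i. dist (f i) (f n) < e"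
      unfolding dist_norm
    proof (intro exI[of _ "max m N"] allI impI)
      fix i n assume i: "max m N \<le> i" "i < n"
      have "norm (f i - f n) \<le> 2 * (1 / 2) ^ i" using le[of i n] i by (simp add: norm_minus_commute)
      also have "\<dots> \<le> 2 * (1 / 2) ^ N" using i by (intro mult_left_mono power_decreasing) auto
      finally show "norm (f i - f n) < e" using N by simp
    qed
  qed
  then have "f \<longlonglongrightarrow> lim f" by (simp add: Cauchy_convergent_iff convergent_LIMSEQ_iff)
  then have "(\<lambda>j. norm (f j - f m)) \<longlonglongrightarrow> norm (lim f - f m)" by (intro tendsto_intros)
  then show ?thesis by (rule LIMSEQ_le_const2) (use le in \<open>auto intro!: exI[of _ m]\<close>)
qed

lemma L1norm_triangle:
  assumes [measurable]: "f \<in> borel_measurable lebesgue" "g \<in> borel_measurable lebesgue" "h \<in> borel_measurable lebesgue"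
  shows "L1norm (\<lambda>x. f x - h x) \<le> L1norm (\<lambda>x. f x - g x) + L1norm (\<lambda>x. g x - h x)"
proof -
  have "L1norm (\<lambda>x. f x - h x) \<le> (\<integral>\<^sup>+x. ennreal (norm (f x - g x)) + ennreal (norm (g x - h x)) \<partial>lebesgue)"
    unfolding L1norm_def
  proof (rule nn_integral_mono)
    fix x show "ennreal (norm (f x - h x)) \<le> ennreal (norm (f x - g x)) + ennreal (norm (g x - h x))"
      using norm_triangle_ineq[of "f x - g x" "g x - h x"] by (simp add: ennreal_plus[symmetric] del: ennreal_plus)
  qed
  also have "\<dots> = L1norm (\<lambda>x. f x - g x) + L1norm (\<lambda>x. g x - h x)"
    unfolding L1norm_def by (rule nn_integral_add) measurable
  finally show ?thesis .
qed

lemma L1norm_commute: "L1norm (\<lambda>x. f x - g x) = L1norm (\<lambda>x. g x - f x)"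
  by (simp add: L1norm_def norm_minus_commute)

lemma integrable_iff_L1norm: "integrable lebesgue f \<longleftrightarrow> f \<in> borel_measurable lebesgue \<and> L1norm f < top"
  by (simp add: integrable_iff_bounded L1norm_def)

text \<open>Continuity from above of the finite measure with density \<open>w\<close>. It provides
  the truncation in height for \<open>L1_approx\<close> and the truncation in space for
  \<open>weak_type_L2\<close>.\<close>

lemma emeasure_density_vanishing:
  assumes w: "w \<in> borel_measurable lebesgue" "(\<integral>\<^sup>+x. w x \<partial>lebesgue) < top"
    and A: "\<And>k::nat. A k \<in> sets lebesgue" "decseq A" "(\<Inter>k. A k) = {}"
  shows "(\<lambda>k. \<integral>\<^sup>+x\<in>A k. w x \<partial>lebesgue) \<longlonglongrightarrow> 0"
proof -
  have "(\<lambda>k. emeasure (density lebesgue w) (A k)) \<longlonglongrightarrow> emeasure (density lebesgue w) (\<Inter>k. A k)"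
  proof (rule Lim_emeasure_decseq)
    show "emeasure (density lebesgue w) (A k) \<noteq> \<infinity>" for k
    proof -
      have "emeasure (density lebesgue w) (A k) \<le> (\<integral>\<^sup>+x. w x \<partial>lebesgue)"
        using w A(1) by (subst emeasure_density) (auto intro!: nn_integral_mono simp: indicator_def)
      then show ?thesis using w(2) by auto
    qed
  qed (use A in auto)
  then show ?thesis using w A by (simp add: emeasure_density)
qed

text \<open>The approximants vanish wherever the function does, so that the kernel representation survives
  the passage from \<open>L\<^sup>1 \<inter> L\<^sup>2\<close> to \<open>L\<^sup>1\<close>.\<close>

lemma L1_approx:
  assumes g: "integrable lebesgue g" and e: "0 < e"
  shows "\<exists>G. L2 G \<and> integrable lebesgue G \<and> L1norm (\<lambda>x. G x - g x) < ennreal e \<and> (\<forall>x. g x = 0 \<longrightarrow> G x = 0)"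
proof -
  have gm [measurable]: "g \<in> borel_measurable lebesgue" using g by auto
  define A where "A k = {x. real k < norm (g x)}" for k
  have [measurable]: "A k \<in> sets lebesgue" for k unfolding A_def by measurable
  have "(\<lambda>k. \<integral>\<^sup>+x\<in>A k. ennreal (norm (g x)) \<partial>lebesgue) \<longlonglongrightarrow> 0"
  proof (rule emeasure_density_vanishing)
    show "(\<integral>\<^sup>+x. ennreal (norm (g x)) \<partial>lebesgue) < top" using g by (simp add: integrable_iff_bounded)
    show "decseq A" by (rule decseq_SucI) (auto simp: A_def)
    show "(\<Inter>k. A k) = {}"
    proof -
      have "\<exists>k. \<not> real k < norm (g x)" for x using real_arch_simple[of "norm (g x)"] by (auto simp: not_less)
      then show ?thesis by (auto simp: A_def)
    qed
  qed measurable
  then have "\<forall>\<^sub>F k in sequentially. (\<integral>\<^sup>+x\<in>A k. ennreal (norm (g x)) \<partial>lebesgue) < ennreal e"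
    using e by (intro order_tendstoD) auto
  then obtain k where k: "(\<integral>\<^sup>+x\<in>A k. ennreal (norm (g x)) \<partial>lebesgue) < ennreal e" by (auto simp: eventually_sequentially)
  define G where "G x = indicator (- A k) x *\<^sub>R g x" for x
  have [measurable]: "G \<in> borel_measurable lebesgue" unfolding G_def by measurable
  have Gi: "integrable lebesgue G" unfolding G_def by (intro integrable_mult_indicator g) (simp add: Compl_in_sets_lebesgue)
  moreover have "L2 G"
  proof (rule L2_bounded_integrable)
    show "L1norm G < top" using Gi by (simp add: integrable_iff_L1norm)
    show "norm (G x) \<le> real k" for x by (auto simp: G_def A_def indicator_def)
  qed measurable
  moreover have "L1norm (\<lambda>x. G x - g x) = (\<integral>\<^sup>+x\<in>A k. ennreal (norm (g x)) \<partial>lebesgue)"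
    unfolding L1norm_def G_def by (intro nn_integral_cong) (auto simp: indicator_def)
  ultimately show ?thesis using k by (intro exI[of _ G]) (auto simp: G_def)
qed

section \<open>Calderon-Zygmund operators\<close>

text \<open>Fixing a kernel and all constants of \<open>T\<close> ensures that whatever is built
  from them is independent of \<open>b\<close>. The bound is for integrals of squares, so
  \<open>B\<close> is the square of a norm bound.\<close>

locale CZ_setup =
  fixes T :: "(real ^ 'n \<Rightarrow> complex) \<Rightarrow> (real ^ 'n \<Rightarrow> complex)" and K :: "real ^ 'n \<Rightarrow> real ^ 'n \<Rightarrow> complex"
    and B C \<delta> :: real
  assumes T_L2: "L2 f \<Longrightarrow> L2 (T f)"
    and T_lin: "L2 f \<Longrightarrow> L2 g \<Longrightarrow> AE x in lebesgue. T (\<lambda>y. \<alpha> * f y + \<beta> * g y) x = \<alpha> * T f x + \<beta> * T g x"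
    and B: "0 \<le> B"
    and T_bound: "L2 f \<Longrightarrow> (\<integral>\<^sup>+x. ennreal ((norm (T f x))\<^sup>2) \<partial>lebesgue) \<le> ennreal B * (\<integral>\<^sup>+x. ennreal ((norm (f x))\<^sup>2) \<partial>lebesgue)"
    and \<delta>: "0 < \<delta>" and C: "0 \<le> C"
    and K_size: "x \<noteq> y \<Longrightarrow> norm (K x y) \<le> C / norm (x - y) ^ CARD('n)"
    and K_smooth: "2 * norm h < norm (x - y) \<Longrightarrow> h \<noteq> 0 \<Longrightarrow>
      norm (K (x + h) y - K x y) + norm (K x (y + h) - K x y) \<le> C * (norm h powr \<delta> / norm (x - y) powr (real CARD('n) + \<delta>))"
    and T_kernel: "L2 f \<Longrightarrow> AE x in lebesgue. x \<notin> ess_support f \<longrightarrow> T f x = (LINT y|lebesgue. K x y * f y)"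
begin

text \<open>Two points of a cube of side \<open>l\<close> are at distance at most
  \<open>CARD('n) * l\<close>, and a point outside \<open>dil m a l\<close> is at distance at least
  \<open>m * l\<close> from both. The summand 1 makes \<open>m * l\<close> strictly larger than
  twice the former, as the smoothness condition on the kernel demands.\<close>

definition m :: real where "m = 2 * real CARD('n) + 1"

lemma m: "1 \<le> m" "0 < m" by (auto simp: m_def)

text \<open>Allows the displacement in the smoothness condition, at most
  \<open>CARD('n) * l\<close>, to be replaced by the side \<open>l\<close>.\<close>

definition C' :: real where "C' = C * real CARD('n) powr \<delta>"

lemma C': "0 \<le> C'" using C by (simp add: C'_def)

lemma cube_separation:
  fixes x :: "real ^ 'n"
  assumes l: "0 < l" and x: "x \<in> hcube a l" "x' \<in> hcube a l" and y: "y \<notin> dil m a l"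
  shows "2 * norm (x' - x) < norm (x - y)"
proof -
  have "2 * norm (x' - x) \<le> 2 * (CARD('n) * l)" using norm_diff_le_in_cube[OF x(2,1)] by simp
  also have "\<dots> < m * l" using l by (simp add: m_def algebra_simps)
  also have "\<dots> \<le> norm (x - y)" using norm_ge_outside_dil[OF x(1) y] m l by simp
  finally show ?thesis .
qed

text \<open>The first estimate serves the variation of an image over a cube, the second the
  cancellation in pieces of mean zero. Equal points are treated apart since the smoothness condition
  concerns nonzero displacements.\<close>

lemma kernel_oscillation:
  assumes l: "0 < l" and x: "x \<in> hcube a l" "x' \<in> hcube a l" and y: "y \<notin> dil m a l"
  shows "norm (K x' y - K x y) \<le> C' * (l powr \<delta> / norm (x - y) powr (real CARD('n) + \<delta>))"
    and "norm (K y x' - K y x) \<le> C' * (l powr \<delta> / norm (x - y) powr (real CARD('n) + \<delta>))"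
proof -
  have sep: "2 * norm (x' - x) < norm (x - y)" by (rule cube_separation[OF l x y])
  have "norm (x' - x) powr \<delta> \<le> (CARD('n) * l) powr \<delta>"
    using norm_diff_le_in_cube[OF x(2,1)] \<delta> by (intro powr_mono2) auto
  then have "C * (norm (x' - x) powr \<delta> / norm (x - y) powr (real CARD('n) + \<delta>)) \<le> C * ((CARD('n) * l) powr \<delta> / norm (x - y) powr (real CARD('n) + \<delta>))"
    using C by (intro mult_left_mono divide_right_mono) auto
  also have "\<dots> = C' * (l powr \<delta> / norm (x - y) powr (real CARD('n) + \<delta>))"
    using l by (simp add: C'_def powr_mult)
  finally have le: "C * (norm (x' - x) powr \<delta> / norm (x - y) powr (real CARD('n) + \<delta>)) \<le> C' * (l powr \<delta> / norm (x - y) powr (real CARD('n) + \<delta>))" .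
  show "norm (K x' y - K x y) \<le> C' * (l powr \<delta> / norm (x - y) powr (real CARD('n) + \<delta>))"
  proof (cases "x' = x")
    case True then show ?thesis using C' by simp
  next
    case False
    have "norm (K (x + (x' - x)) y - K x y) \<le> C * (norm (x' - x) powr \<delta> / norm (x - y) powr (real CARD('n) + \<delta>))"
    proof -
      have "x' - x \<noteq> 0" using False by simp
      from K_smooth[OF sep this] show ?thesis
        using norm_ge_zero[of "K x (y + (x' - x)) - K x y"] by linarith
    qed
    then show ?thesis using le by simp
  qed
  show "norm (K y x' - K y x) \<le> C' * (l powr \<delta> / norm (x - y) powr (real CARD('n) + \<delta>))"
  proof (cases "x' = x")
    case True then show ?thesis using C' by simp
  next
    case False
    have "2 * norm (x' - x) < norm (y - x)" using sep by (simp add: norm_minus_commute)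
    from K_smooth[OF this] False have "norm (K (y + (x' - x)) x - K y x) + norm (K y (x + (x' - x)) - K y x) \<le> C * (norm (x' - x) powr \<delta> / norm (y - x) powr (real CARD('n) + \<delta>))" by simp
    then have "norm (K y (x + (x' - x)) - K y x) \<le> C * (norm (x' - x) powr \<delta> / norm (y - x) powr (real CARD('n) + \<delta>))"
      using norm_ge_zero[of "K (y + (x' - x)) x - K y x"] by linarith
    then show ?thesis using le by (simp add: norm_minus_commute)
  qed
qed

lemma kernel_size_outside:
  assumes l: "0 < l" and x: "x \<in> hcube a l" and y: "y \<notin> dil m a l"
  shows "norm (K x y) \<le> C / l ^ CARD('n)" "norm (K y x) \<le> C / l ^ CARD('n)"
proof -
  have "1 * l \<le> m * l" using m l by (intro mult_right_mono) auto
  then have le: "l \<le> norm (x - y)" using norm_ge_outside_dil[OF x y] m l by linarith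
  then have ne: "x \<noteq> y" "y \<noteq> x" using l by auto
  have "C / norm (x - y) ^ CARD('n) \<le> C / l ^ CARD('n)"
    using le l C by (intro divide_left_mono power_mono mult_pos_pos zero_less_power) auto
  then show "norm (K x y) \<le> C / l ^ CARD('n)" "norm (K y x) \<le> C / l ^ CARD('n)"
    using K_size[OF ne(1)] K_size[OF ne(2)] by (auto simp: norm_minus_commute)
qed

text \<open>By smoothness \<open>K x\<close> is continuous except at \<open>x\<close>, where its
  value is arbitrary; this single point is split off.\<close>

lemma measurable_kernel [measurable]: "K x \<in> borel_measurable lebesgue"
proof -
  have "isCont (K x) y" if ne: "y \<noteq> x" for y
  proof -
    have "((\<lambda>h. K x (y + h) - K x y) \<longlongrightarrow> 0) (at 0)"
    proof (rule Lim_null_comparison)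
      show "\<forall>\<^sub>F h in at 0. norm (K x (y + h) - K x y) \<le> C * (norm h powr \<delta> / norm (x - y) powr (real CARD('n) + \<delta>))"
        unfolding eventually_at
      proof (intro exI[of _ "norm (x - y) / 2"] conjI ballI impI)
        show "0 < norm (x - y) / 2" using ne by simp
        fix h :: "real ^ 'n" assume "h \<noteq> 0 \<and> dist h 0 < norm (x - y) / 2"
        then have "2 * norm h < norm (x - y)" "h \<noteq> 0" by auto
        from K_smooth[OF this] show "norm (K x (y + h) - K x y) \<le> C * (norm h powr \<delta> / norm (x - y) powr (real CARD('n) + \<delta>))"
          using norm_ge_zero[of "K (x + h) y - K x y"] by linarith
      qed
      have "((\<lambda>h::real ^ 'n. norm h powr \<delta>) \<longlongrightarrow> norm (0::real ^ 'n) powr \<delta>) (at 0)"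
        using \<delta> by (intro tendsto_powr' tendsto_intros) auto
      then have "((\<lambda>h. C * (norm h powr \<delta> / norm (x - y) powr (real CARD('n) + \<delta>))) \<longlongrightarrow> C * (0 / norm (x - y) powr (real CARD('n) + \<delta>))) (at (0::real ^ 'n))"
        using ne by (intro tendsto_intros) auto
      then show "((\<lambda>h. C * (norm h powr \<delta> / norm (x - y) powr (real CARD('n) + \<delta>))) \<longlongrightarrow> 0) (at (0::real ^ 'n))" by simp
    qed
    then have "((\<lambda>h. K x (y + h)) \<longlongrightarrow> K x y) (at 0)" by (rule LIM_zero_cancel)
    then show ?thesis by (simp add: isCont_iff)
  qed
  then have "continuous_on (- {x}) (K x)" by (simp add: continuous_at_imp_continuous_on)
  then have "(\<lambda>y. indicator (- {x}) y *\<^sub>R K x y) \<in> borel_measurable borel"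
    by (intro borel_measurable_continuous_on_indicator) auto
  then have [measurable]: "(\<lambda>y. indicator (- {x}) y *\<^sub>R K x y) \<in> borel_measurable lebesgue"
    by (intro measurable_completion) simp
  have "(\<lambda>y. indicator (- {x}) y *\<^sub>R K x y + indicator {x} y *\<^sub>R K x x) \<in> borel_measurable lebesgue"
    by (intro borel_measurable_add borel_measurable_scaleR borel_measurable_indicator borel_measurable_const
       \<open>(\<lambda>y. indicator (- {x}) y *\<^sub>R K x y) \<in> borel_measurable lebesgue\<close>) simp
  also have "(\<lambda>y. indicator (- {x}) y *\<^sub>R K x y + indicator {x} y *\<^sub>R K x x) = K x"
    by (auto simp: indicator_def)
  finally show ?thesis .
qed

lemma T_measurable [measurable]: "L2 f \<Longrightarrow> T f \<in> borel_measurable lebesgue"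
  using T_L2 by (simp add: L2_def)

lemma T_diff: "L2 f \<Longrightarrow> L2 g \<Longrightarrow> AE x in lebesgue. T (\<lambda>y. f y - g y) x = T f x - T g x"
  using T_lin[of f g 1 "-1"] by simp

lemma T_null:
  assumes f: "L2 f" and ae: "AE x in lebesgue. f x = 0" shows "AE x in lebesgue. T f x = 0"
proof -
  have "AE x in lebesgue. ennreal ((norm (f x))\<^sup>2) = 0" using ae by eventually_elim simp
  then have "(\<integral>\<^sup>+x. ennreal ((norm (f x))\<^sup>2) \<partial>lebesgue) = 0"
    using f by (subst nn_integral_0_iff_AE) (auto simp: L2_def)
  then have "(\<integral>\<^sup>+x. ennreal ((norm (T f x))\<^sup>2) \<partial>lebesgue) = 0" using T_bound[OF f] by simp
  then show ?thesis
    using T_measurable[OF f] by (subst (asm) nn_integral_0_iff_AE) (auto elim!: eventually_mono)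
qed

definition annC :: real where "annC = (5 * m) ^ CARD('n) / (1 - 2 powr (- \<delta>))"

lemma annC: "0 < annC"
  using m \<delta> by (auto simp: annC_def powr_less_one)

text \<open>The kernel is bounded as long as \<open>x\<close> stays outside the dilate, which gives
  integrability. For \<open>u\<close> of mean zero, \<open>K x y\<close> may be replaced by
  \<open>K x y - K x c\<close>, with \<open>c\<close> in the cube that carries
  \<open>u\<close>.\<close>

lemma integral_kernel_outside:
  assumes s: "0 < s" and x: "x \<notin> dil m c s" and u: "integrable lebesgue u" and supp: "\<And>y. y \<notin> hcube c s \<Longrightarrow> u y = 0"
  shows "integrable lebesgue (\<lambda>y. K x y * u y)"
    and "(\<integral>y. u y \<partial>lebesgue) = 0 \<Longrightarrow> ennreal (norm (\<integral>y. K x y * u y \<partial>lebesgue)) \<le>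
      ennreal (C' * (s powr \<delta> / norm (c - x) powr (real CARD('n) + \<delta>))) * L1norm u"
proof -
  have [measurable]: "u \<in> borel_measurable lebesgue" using u by auto
  show int: "integrable lebesgue (\<lambda>y. K x y * u y)"
  proof (rule Bochner_Integration.integrable_bound[where f = "\<lambda>y. of_real (C / s ^ CARD('n)) * u y"])
    show "integrable lebesgue (\<lambda>y. of_real (C / s ^ CARD('n)) * u y)" using u by (rule integrable_mult_right)
    show "AE y in lebesgue. norm (K x y * u y) \<le> norm (of_real (C / s ^ CARD('n)) * u y)"
    proof (rule AE_I2)
      fix y
      show "norm (K x y * u y) \<le> norm (of_real (C / s ^ CARD('n)) * u y)"
      proof (cases "y \<in> hcube c s")
        case True
        have "norm (K x y) \<le> C / s ^ CARD('n)" by (rule kernel_size_outside(2)[OF s True x])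
        also have "\<dots> = norm (of_real (C / s ^ CARD('n)) :: complex)" using C s by (subst norm_of_real) simp
        finally show ?thesis by (simp only: norm_mult) (rule mult_right_mono, auto)
      qed (simp add: supp)
    qed
  qed measurable
  assume 0: "(\<integral>y. u y \<partial>lebesgue) = 0"
  have "(\<integral>y. K x y * u y \<partial>lebesgue) = (\<integral>y. K x y * u y - K x c * u y \<partial>lebesgue)"
    using u int 0 by (subst Bochner_Integration.integral_diff) auto
  then have "ennreal (norm (\<integral>y. K x y * u y \<partial>lebesgue)) \<le> (\<integral>\<^sup>+y. ennreal (norm (K x y * u y - K x c * u y)) \<partial>lebesgue)"
    using u int by (simp only:) (intro integral_norm_bound_ennreal Bochner_Integration.integrable_diff integrable_mult_right)
  also have "\<dots> \<le> (\<integral>\<^sup>+y. ennreal (C' * (s powr \<delta> / norm (c - x) powr (real CARD('n) + \<delta>))) * ennreal (norm (u y)) \<partial>lebesgue)"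
  proof (rule nn_integral_mono)
    fix y
    show "ennreal (norm (K x y * u y - K x c * u y)) \<le> ennreal (C' * (s powr \<delta> / norm (c - x) powr (real CARD('n) + \<delta>))) * ennreal (norm (u y))"
    proof (cases "y \<in> hcube c s")
      case True
      have "norm (K x y * u y - K x c * u y) = norm (K x y - K x c) * norm (u y)" by (simp add: norm_mult[symmetric] left_diff_distrib)
      also have "\<dots> \<le> C' * (s powr \<delta> / norm (c - x) powr (real CARD('n) + \<delta>)) * norm (u y)"
        by (intro mult_right_mono kernel_oscillation(2)[OF s corner_in_hcube[OF s] True x]) simp
      finally show ?thesis using C' by (subst ennreal_mult[symmetric]) (auto intro: ennreal_leI)
    qed (simp add: supp)
  qed
  also have "\<dots> = ennreal (C' * (s powr \<delta> / norm (c - x) powr (real CARD('n) + \<delta>))) * L1norm u"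
    unfolding L1norm_def by (rule nn_integral_cmult) measurable
  finally show "ennreal (norm (\<integral>y. K x y * u y \<partial>lebesgue)) \<le>
      ennreal (C' * (s powr \<delta> / norm (c - x) powr (real CARD('n) + \<delta>))) * L1norm u" .
qed

section \<open>The weak type (1,1) inequality\<close>

text \<open>The summands belong to the good part (Chebyshev's inequality in L2 at height
  \<open>\<alpha> / 2\<close>), to the measure of the dilated stopping cubes, and to the bad part
  off these dilates (Chebyshev's inequality in L1 at height \<open>\<alpha> / 2\<close>).\<close>

definition wkC0 :: real where
  "wkC0 = 4 * B * (2 + 4 ^ CARD('n)) + (2 * m + 1) ^ CARD('n) + 4 * C' * annC"

lemma wkC0: "0 < wkC0"
  unfolding wkC0_def using B C' annC m by (intro add_nonneg_pos add_pos_nonneg) (auto intro!: zero_less_power add_nonneg_nonneg)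

text \<open>Calderon-Zygmund decomposition at height \<open>\<alpha>\<close> on a cube so large that the average of \<open>\<bar>f\<bar>\<close>
  is at most \<open>\<alpha>\<close>. Only finitely many stopping cubes enter the bad part, chosen so that the
  \<open>L\<^sup>2\<close> mass of \<open>f\<close> on the remaining ones is negligible; then the bad part has
  compact support away from the exceptional set and the kernel representation applies to it at once.\<close>

lemma weak_type_local:
  assumes f: "L2 f" and l: "0 < l" and supp: "\<And>x. x \<notin> hcube a l \<Longrightarrow> f x = 0" and \<alpha>: "0 < \<alpha>"
    and avg: "L1norm f \<le> ennreal \<alpha> * emeasure lebesgue (hcube a l)"
  shows "ennreal \<alpha> * emeasure lebesgue {x. \<alpha> < norm (T f x)} \<le> ennreal wkC0 * L1norm f"
\<comment> \<open>A positive norm \<open>F\<close> is what allows the neglected stopping cubes to be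
  chosen with L2 mass below \<open>\<alpha> * F\<close>.\<close>
proof (cases "L1norm f = 0")
  case True
  have [measurable]: "f \<in> borel_measurable lebesgue" using f by (simp add: L2_def)
  have "AE x in lebesgue. f x = 0" using True unfolding L1norm_def by (subst (asm) nn_integral_0_iff_AE) auto
  from T_null[OF f this] have "AE x in lebesgue. x \<notin> {x. \<alpha> < norm (T f x)}" by eventually_elim (use \<alpha> in auto)
  moreover have "{x. \<alpha> < norm (T f x)} \<in> sets lebesgue" using T_measurable[OF f] by measurable
  ultimately have "emeasure lebesgue {x. \<alpha> < norm (T f x)} = 0" by (simp add: AE_iff_null_sets null_setsD1)
  then show ?thesis by simp
next
  case False
  have fm [measurable]: "f \<in> borel_measurable lebesgue" using f by (simp add: L2_def)
  define r where "r = l ^ CARD('n)"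
  have r: "0 < r" "emeasure lebesgue (hcube a l) = ennreal r" using l by (auto simp: r_def emeasure_hcube)
  have "L1norm f < top" using avg r \<alpha> by (auto intro: le_less_trans simp: ennreal_mult[symmetric])
  then obtain F where F: "0 < F" "L1norm f = ennreal F" using False by (cases "L1norm f") auto
  have fint: "integrable lebesgue f" using F unfolding L1norm_def by (simp add: integrable_iff_bounded)
  have fint': "set_integrable lebesgue S f" if "S \<in> sets lebesgue" for S
    unfolding set_integrable_def using fint that by (intro integrable_mult_indicator)
  define bad where "bad P \<longleftrightarrow> \<not> (\<integral>\<^sup>+x\<in>P. ennreal (norm (f x)) \<partial>lebesgue) \<le> ennreal \<alpha> * emeasure lebesgue P" for P
  have leF: "(\<integral>\<^sup>+x\<in>S. ennreal (norm (f x)) \<partial>lebesgue) \<le> L1norm f" for S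
    unfolding L1norm_def by (intro nn_integral_mono) (auto simp: indicator_def)
  have nb: "\<not> bad (hcube a l)" unfolding bad_def using avg leF order_trans by blast
  obtain \<G> where SG: "stopping_family a l bad \<G>" using stopping_cubes[OF l] by blast
  note G = stopping_familyD[OF SG]
  define h where "h = (\<lambda>(c, s). hcube c s :: (real ^ 'n) set)"
  define V where "V = (\<Union>P\<in>\<G>. h P)"
  have Vh: "(\<Union>(c, s)\<in>\<G>. hcube c s) = V" by (simp add: V_def h_def)
  have hm [measurable]: "h P \<in> sets lebesgue" for P by (simp add: h_def split: prod.splits)
  have Vm [measurable]: "V \<in> sets lebesgue" unfolding V_def using G(1) by (intro sets.countable_UN') auto
  have hdisj: "disjoint_family_on h \<G>" using G(2) by (simp add: h_def)
  let ?N = "density lebesgue (\<lambda>x. ennreal (norm (f x)))"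
  have N: "emeasure ?N S = (\<integral>\<^sup>+x\<in>S. ennreal (norm (f x)) \<partial>lebesgue)" if "S \<in> sets lebesgue" for S
    using that by (simp add: emeasure_density)
  have \<alpha>V: "ennreal \<alpha> * emeasure lebesgue V \<le> ennreal F"
  proof -
    have "ennreal \<alpha> * emeasure lebesgue V = (\<integral>\<^sup>+P. ennreal \<alpha> * emeasure lebesgue (h P) \<partial>count_space \<G>)"
      unfolding V_def using G(1) hdisj by (subst emeasure_UN_countable) (auto simp: nn_integral_cmult)
    also have "\<dots> \<le> (\<integral>\<^sup>+P. emeasure ?N (h P) \<partial>count_space \<G>)"
    proof (rule nn_integral_mono)
      fix P assume "P \<in> space (count_space \<G>)"
      then have "bad (h P)" using G(5)[of "fst P" "snd P"] unfolding h_def case_prod_beta by simp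
      then show "ennreal \<alpha> * emeasure lebesgue (h P) \<le> emeasure ?N (h P)"
        by (simp add: N bad_def less_imp_le not_le)
    qed
    also have "\<dots> = emeasure ?N V"
      unfolding V_def using G(1) hdisj by (subst emeasure_UN_countable) auto
    also have "\<dots> \<le> ennreal F" using leF[of V] F by (simp add: N)
    finally show ?thesis .
  qed
  have off: "AE x in lebesgue. x \<notin> V \<longrightarrow> norm (f x) \<le> \<alpha>"
  proof -
    have "AE x in lebesgue. x \<in> hcube a l - V \<longrightarrow> ennreal (norm (f x)) \<le> ennreal \<alpha>"
    proof (rule dyadic_differentiation[OF l])
      fix x k assume "x \<in> hcube a l - V"
      then show "(\<integral>\<^sup>+y\<in>dcube a l k x. ennreal (norm (f y)) \<partial>lebesgue) \<le> ennreal \<alpha> * emeasure lebesgue (dcube a l k x)"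
        using G(7)[of x k] unfolding bad_def Vh by simp
    qed (use \<alpha> in auto)
    then show ?thesis
    proof eventually_elim
      case (elim x)
      then show ?case using supp[of x] \<alpha> by (cases "x \<in> hcube a l") auto
    qed
  qed
  let ?N2 = "density lebesgue (\<lambda>x. ennreal ((norm (f x))\<^sup>2))"
  have N2: "emeasure ?N2 S = (\<integral>\<^sup>+x\<in>S. ennreal ((norm (f x))\<^sup>2) \<partial>lebesgue)" if "S \<in> sets lebesgue" for S
    using that by (simp add: emeasure_density)
  have "emeasure ?N2 (\<Union>P\<in>\<G>. h P) < top"
  proof -
    have "emeasure ?N2 V \<le> (\<integral>\<^sup>+x. ennreal ((norm (f x))\<^sup>2) \<partial>lebesgue)"
      unfolding N2[OF Vm] by (intro nn_integral_mono) (auto simp: indicator_def)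
    then show ?thesis using f unfolding V_def L2_def by (auto intro: le_less_trans)
  qed
  \<comment> \<open>The square integral of the good part is of the order \<open>\<alpha> * F\<close>
    in any case, so the stopping cubes outside \<H> may stay in the good part.\<close>
  then obtain \<H> where H: "\<H> \<subseteq> \<G>" "finite \<H>" "emeasure ?N2 ((\<Union>P\<in>\<G>. h P) - (\<Union>P\<in>\<H>. h P)) < ennreal (\<alpha> * F)"
    using finite_subfamily[OF G(1), of h ?N2 "ennreal (\<alpha> * F)"] \<alpha> F by auto
  define W where "W = (\<Union>P\<in>\<H>. h P)"
  have Wm [measurable]: "W \<in> sets lebesgue" unfolding W_def using H(2) by (intro sets.finite_UN) auto
  have WV: "W \<subseteq> V" using H(1) by (auto simp: W_def V_def)
  define av where "av P = average (h P) f" for P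
  define u where "u P y = indicator (h P) y *\<^sub>R (f y - av P)" for P y
  define \<beta> where "\<beta> y = (\<Sum>P\<in>\<H>. u P y)" for y
  define g where "g y = f y - \<beta> y" for y
  have [measurable]: "u P \<in> borel_measurable lebesgue" for P unfolding u_def by measurable
  have [measurable]: "\<beta> \<in> borel_measurable lebesgue" unfolding \<beta>_def by measurable
  have [measurable]: "g \<in> borel_measurable lebesgue" unfolding g_def by measurable
  have Hs: "0 < snd P" "h P = hcube (fst P) (snd P)" if "P \<in> \<H>" for P
    using that H(1) G(3)[of "fst P" "snd P"] by (auto simp: h_def case_prod_beta)
  have av1: "ennreal (norm (av P)) * emeasure lebesgue (h P) \<le> (\<integral>\<^sup>+x\<in>h P. ennreal (norm (f x)) \<partial>lebesgue)" if "P \<in> \<H>" for P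
    using average_diff_bound[OF Hs(1)[OF that] fint', of "fst P" 0] unfolding av_def Hs(2)[OF that] by simp
  \<comment> \<open>The parent of a stopping cube is not bad and has \<open>2 ^ CARD('n)\<close>
    times its volume.\<close>
  have av2: "norm (av P) \<le> 2 ^ CARD('n) * \<alpha>" if P: "P \<in> \<H>" for P
  proof -
    define s where "s = snd P"
    have s: "0 < s" "h P = hcube (fst P) s" using Hs[OF P] by (auto simp: s_def)
    have "(fst P, s) \<in> \<G>" using P H(1) by (auto simp: s_def)
    from G(6)[OF this nb] obtain c' where c': "hcube (fst P) s \<subseteq> hcube c' (2 * s)" "\<not> bad (hcube c' (2 * s))" by blast
    have "ennreal (norm (av P)) * emeasure lebesgue (h P) \<le> (\<integral>\<^sup>+x\<in>h P. ennreal (norm (f x)) \<partial>lebesgue)" by (rule av1[OF P])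
    also have "\<dots> \<le> (\<integral>\<^sup>+x\<in>hcube c' (2 * s). ennreal (norm (f x)) \<partial>lebesgue)"
      unfolding s(2) by (intro nn_set_integral_set_mono c')
    also have "\<dots> \<le> ennreal \<alpha> * emeasure lebesgue (hcube c' (2 * s))" using c'(2) by (simp add: bad_def)
    finally have "norm (av P) * s ^ CARD('n) \<le> \<alpha> * (2 * s) ^ CARD('n)"
      using s \<alpha> by (simp add: emeasure_hcube ennreal_mult[symmetric])
    then show ?thesis using s by (simp add: power_mult_distrib mult.commute)
  qed
  have \<beta>_off: "\<beta> y = 0" if "y \<notin> W" for y
    unfolding \<beta>_def u_def using that by (intro sum.neutral) (auto simp: W_def)
  have \<beta>_on: "\<beta> y = f y - av P" if "y \<in> h P" "P \<in> \<H>" for y P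
  proof -
    have "\<beta> y = (\<Sum>P'\<in>{P}. u P' y)"
      unfolding \<beta>_def
    proof (rule sum.mono_neutral_right)
      show "\<forall>P'\<in>\<H> - {P}. u P' y = 0"
        using that H(1) hdisj unfolding disjoint_family_on_def u_def by (auto simp: indicator_def)
    qed (use that H(2) in auto)
    then show ?thesis using that by (simp add: u_def)
  qed
  have g_bound: "AE x in lebesgue. ennreal ((norm (g x))\<^sup>2) \<le> ennreal \<alpha> * ennreal (norm (f x)) +
      (ennreal ((norm (f x))\<^sup>2) * indicator (V - W) x + ennreal (4 ^ CARD('n) * \<alpha>\<^sup>2) * indicator V x)"
    using off
  proof eventually_elim
    case (elim x)
    consider "x \<notin> V" | "x \<in> V - W" | "x \<in> W" by blast
    then show ?case
    proof cases
      case 1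
      then have "g x = f x" using \<beta>_off WV by (auto simp: g_def)
      moreover have "(norm (f x))\<^sup>2 \<le> \<alpha> * norm (f x)" using elim 1 by (simp add: power2_eq_square mult_right_mono)
      ultimately show ?thesis using 1 \<alpha> by (simp add: ennreal_mult[symmetric])
    next
      case 2
      then have "g x = f x" using \<beta>_off by (auto simp: g_def)
      then show ?thesis using 2 by (simp add: add_increasing add_increasing2)
    next
      case 3
      then obtain P where P: "P \<in> \<H>" "x \<in> h P" by (auto simp: W_def)
      then have "norm (g x) \<le> 2 ^ CARD('n) * \<alpha>" using av2[OF P(1)] \<beta>_on[OF P(2,1)] by (simp add: g_def)
      then have "(norm (g x))\<^sup>2 \<le> (2 ^ CARD('n) * \<alpha>)\<^sup>2" by (intro power_mono) auto
      also have "\<dots> = 4 ^ CARD('n) * \<alpha>\<^sup>2" by (simp add: power_mult_distrib power_mult[symmetric] mult.commute[of _ 2]) (simp add: power_mult)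
      finally show ?thesis using 3 WV by (auto simp: add_increasing intro: ennreal_leI)
    qed
  qed
  \<comment> \<open>The 2 collects the set off \<open>V\<close>, where
    \<open>\<bar>f\<bar> \<le> \<alpha>\<close>, and the neglected cubes \<open>V - W\<close>;
    \<open>4 ^ CARD('n)\<close> is the square of the constant in \<open>av2\<close>.\<close>
  have g2: "(\<integral>\<^sup>+x. ennreal ((norm (g x))\<^sup>2) \<partial>lebesgue) \<le> ennreal ((2 + 4 ^ CARD('n)) * \<alpha> * F)"
  proof -
    have "(\<integral>\<^sup>+x. ennreal ((norm (g x))\<^sup>2) \<partial>lebesgue) \<le> (\<integral>\<^sup>+x. ennreal \<alpha> * ennreal (norm (f x)) +
      (ennreal ((norm (f x))\<^sup>2) * indicator (V - W) x + ennreal (4 ^ CARD('n) * \<alpha>\<^sup>2) * indicator V x) \<partial>lebesgue)"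
      by (rule nn_integral_mono_AE[OF g_bound])
    also have "\<dots> = ennreal \<alpha> * L1norm f + (emeasure ?N2 (V - W) + ennreal (4 ^ CARD('n) * \<alpha>\<^sup>2) * emeasure lebesgue V)"
      by (subst nn_integral_add, measurable)+ (simp add: N2 L1norm_def nn_integral_cmult nn_integral_cmult_indicator)
    also have "\<dots> \<le> ennreal \<alpha> * ennreal F + (ennreal (\<alpha> * F) + ennreal (4 ^ CARD('n) * \<alpha>) * ennreal F)"
    proof (intro add_mono)
      show "ennreal \<alpha> * L1norm f \<le> ennreal \<alpha> * ennreal F" using F by simp
      show "emeasure ?N2 (V - W) \<le> ennreal (\<alpha> * F)" using H(3) by (simp add: V_def W_def)
      have "ennreal (4 ^ CARD('n) * \<alpha>\<^sup>2) * emeasure lebesgue V = ennreal (4 ^ CARD('n) * \<alpha>) * (ennreal \<alpha> * emeasure lebesgue V)"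
        using \<alpha> by (simp add: mult.assoc[symmetric] ennreal_mult[symmetric] power2_eq_square)
      also have "\<dots> \<le> ennreal (4 ^ CARD('n) * \<alpha>) * ennreal F" by (intro mult_left_mono \<alpha>V) simp
      finally show "ennreal (4 ^ CARD('n) * \<alpha>\<^sup>2) * emeasure lebesgue V \<le> ennreal (4 ^ CARD('n) * \<alpha>) * ennreal F" .
    qed
    also have "\<dots> = ennreal ((2 + 4 ^ CARD('n)) * \<alpha> * F)"
      using \<alpha> F by (simp add: ennreal_mult[symmetric] ennreal_plus[symmetric] algebra_simps del: ennreal_plus)
    finally show ?thesis .
  qed
  have gL2: "L2 g" using g2 by (simp add: L2_def le_less_trans[OF _ ennreal_less_top])
  have \<beta>L2: "L2 \<beta>" using L2_diff[OF f gL2] by (simp add: g_def)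
  have good: "emeasure lebesgue {x. \<alpha> / 2 < norm (T g x)} \<le> ennreal (4 * B * (2 + 4 ^ CARD('n)) * F / \<alpha>)"
  proof -
    have "emeasure lebesgue {x. \<alpha> / 2 < norm (T g x)} \<le> ennreal (1 / (\<alpha> / 2)\<^sup>2) * (\<integral>\<^sup>+x. ennreal ((norm (T g x))\<^sup>2) \<partial>lebesgue)"
      using \<alpha> T_measurable[OF gL2] by (intro Chebyshev_L2) auto
    also have "\<dots> \<le> ennreal (1 / (\<alpha> / 2)\<^sup>2) * (ennreal B * ennreal ((2 + 4 ^ CARD('n)) * \<alpha> * F))"
      by (intro mult_left_mono order_trans[OF T_bound[OF gL2]] g2) auto
    also have "\<dots> = ennreal (4 * B * (2 + 4 ^ CARD('n)) * F / \<alpha>)"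
      using \<alpha> F B by (subst ennreal_mult[symmetric], simp, simp)+ (simp add: power2_eq_square field_simps)
    finally show ?thesis .
  qed
  define D where "D = (\<Union>P\<in>\<H>. dil m (fst P) (snd P))"
  have Dm [measurable]: "D \<in> sets lebesgue" unfolding D_def using H(2) by (intro sets.finite_UN) auto
  have sumH: "(\<Sum>P\<in>\<H>. emeasure M (h P)) = emeasure M W" if "sets M = sets lebesgue" for M
  proof -
    have "h ` \<H> \<subseteq> sets M" using hm unfolding that by blast
    then show ?thesis unfolding W_def by (rule sum_emeasure[OF _ disjoint_family_on_mono[OF H(1) hdisj] H(2)])
  qed
  have Dbound: "emeasure lebesgue D \<le> ennreal ((2 * m + 1) ^ CARD('n) * F / \<alpha>)"
  proof -
    have "emeasure lebesgue D \<le> (\<Sum>P\<in>\<H>. emeasure lebesgue (dil m (fst P) (snd P)))"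
      unfolding D_def using H(2) by (intro emeasure_subadditive_finite) auto
    also have "\<dots> = (\<Sum>P\<in>\<H>. ennreal ((2 * m + 1) ^ CARD('n)) * emeasure lebesgue (h P))"
    proof (rule sum.cong[OF refl])
      fix P assume P: "P \<in> \<H>"
      show "emeasure lebesgue (dil m (fst P) (snd P)) = ennreal ((2 * m + 1) ^ CARD('n)) * emeasure lebesgue (h P)"
        using Hs[OF P] m by (simp add: emeasure_dil emeasure_hcube power_mult_distrib ennreal_mult)
    qed
    also have "\<dots> = ennreal ((2 * m + 1) ^ CARD('n)) * emeasure lebesgue W" by (simp add: sum_distrib_left[symmetric] sumH)
    also have "\<dots> \<le> ennreal ((2 * m + 1) ^ CARD('n)) * emeasure lebesgue V" by (intro mult_left_mono emeasure_mono WV) auto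
    also have "\<dots> = ennreal ((2 * m + 1) ^ CARD('n) / \<alpha>) * (ennreal \<alpha> * emeasure lebesgue V)"
      using \<alpha> m by (simp add: mult.assoc[symmetric] ennreal_mult[symmetric])
    also have "\<dots> \<le> ennreal ((2 * m + 1) ^ CARD('n) / \<alpha>) * ennreal F" by (intro mult_left_mono \<alpha>V) simp
    also have "\<dots> = ennreal ((2 * m + 1) ^ CARD('n) * F / \<alpha>)" using \<alpha> m F by (simp add: ennreal_mult[symmetric])
    finally show ?thesis .
  qed
  have uL1: "L1norm (u P) \<le> 2 * (\<integral>\<^sup>+x\<in>h P. ennreal (norm (f x)) \<partial>lebesgue)" if P: "P \<in> \<H>" for P
  proof -
    have "L1norm (u P) \<le> (\<integral>\<^sup>+x. ennreal (norm (f x)) * indicator (h P) x + ennreal (norm (av P)) * indicator (h P) x \<partial>lebesgue)"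
      unfolding L1norm_def u_def
      by (intro nn_integral_mono) (auto simp: indicator_def ennreal_plus[symmetric] norm_triangle_ineq4 simp del: ennreal_plus)
    also have "\<dots> = (\<integral>\<^sup>+x\<in>h P. ennreal (norm (f x)) \<partial>lebesgue) + ennreal (norm (av P)) * emeasure lebesgue (h P)"
      by (subst nn_integral_add) (auto simp: nn_integral_cmult_indicator)
    also have "\<dots> \<le> (\<integral>\<^sup>+x\<in>h P. ennreal (norm (f x)) \<partial>lebesgue) + (\<integral>\<^sup>+x\<in>h P. ennreal (norm (f x)) \<partial>lebesgue)"
      by (intro add_left_mono av1 P)
    finally show ?thesis by (simp add: mult_2)
  qed
  have u_int: "integrable lebesgue (u P)" if P: "P \<in> \<H>" for P
  proof -
    have "L1norm (u P) < top"
      using uL1[OF P] leF[of "h P"] F by (auto intro!: le_less_trans[OF uL1[OF P]] simp: ennreal_mult_less_top le_less_trans)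
    then show ?thesis unfolding L1norm_def by (simp add: integrable_iff_bounded)
  qed
  have u_0: "(\<integral>y. u P y \<partial>lebesgue) = 0" if P: "P \<in> \<H>" for P
  proof -
    have e: "emeasure lebesgue (h P) = ennreal (snd P ^ CARD('n))" using Hs[OF P] by (simp add: emeasure_hcube)
    then have me: "measure lebesgue (h P) = snd P ^ CARD('n)" using Hs(1)[OF P] by (simp add: measure_def)
    have c: "integrable lebesgue (\<lambda>y. indicator (h P) y *\<^sub>R av P)"
      using e by (intro integrable_scaleR_left) (auto simp: integrable_indicator_iff)
    have "(\<integral>y. u P y \<partial>lebesgue) = (\<integral>y. indicator (h P) y *\<^sub>R f y - indicator (h P) y *\<^sub>R av P \<partial>lebesgue)"
      unfolding u_def by (simp add: scaleR_diff_right)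
    also have "\<dots> = (\<integral>y. indicator (h P) y *\<^sub>R f y \<partial>lebesgue) - (\<integral>y. indicator (h P) y *\<^sub>R av P \<partial>lebesgue)"
      using fint'[of "h P"] c by (intro Bochner_Integration.integral_diff) (auto simp: set_integrable_def)
    also have "(\<integral>y. indicator (h P) y *\<^sub>R av P \<partial>lebesgue) = measure lebesgue (h P) *\<^sub>R av P"
      using e by (subst integral_scaleR_left) (auto simp: integrable_indicator_iff)
    also have "\<dots> = (\<integral>y. indicator (h P) y *\<^sub>R f y \<partial>lebesgue)"
      using me Hs(1)[OF P] by (simp add: av_def average_def set_lebesgue_integral_def)
    finally show ?thesis by simp
  qed
  define w where "w P x = ennreal (C' * (snd P powr \<delta> / norm (fst P - x) powr (real CARD('n) + \<delta>)))" for P :: "(real ^ 'n) \<times> real" and x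
  \<comment> \<open>A measurable majorant of the bad part off \<open>D\<close>. Each summand is cut
    off inside its own dilate, where the decay estimate says nothing.\<close>
  define q where "q x = (\<Sum>P\<in>\<H>. w P x * L1norm (u P) * indicator (- dil m (fst P) (snd P)) x)" for x
  have w_meas: "w P \<in> borel_measurable lebesgue" for P
  proof -
    have [measurable]: "(\<lambda>x. norm (fst P - x)) \<in> borel_measurable lebesgue"
      by (intro measurable_lebesgue_continuous continuous_intros)
    show ?thesis unfolding w_def by measurable
  qed
  have q_term: "(\<lambda>x. w P x * L1norm (u P) * indicator (- dil m (fst P) (snd P)) x) \<in> borel_measurable lebesgue" for P
    by (intro borel_measurable_times_ennreal borel_measurable_indicator borel_measurable_const w_meas) auto
  have q_meas [measurable]: "q \<in> borel_measurable lebesgue"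
    unfolding q_def by (intro borel_measurable_sum q_term)
  have bad_pt: "AE x in lebesgue. x \<notin> D \<longrightarrow> ennreal (norm (T \<beta> x)) \<le> q x"
    using T_kernel[OF \<beta>L2]
  proof eventually_elim
    case (elim x)
    show ?case
    proof
      assume x: "x \<notin> D"
      have xP: "x \<notin> dil m (fst P) (snd P)" if "P \<in> \<H>" for P using x that by (auto simp: D_def)
      \<comment> \<open>The complement of finitely many closed cubes is open, contains
        \<open>x\<close>, and \<beta> vanishes on it; hence \<open>x\<close> is outside the
        essential support of \<beta>.\<close>
      define U where "U = - (\<Union>P\<in>\<H>. cbox (fst P) (\<chi> i. fst P $ i + snd P))"
      have "open U" unfolding U_def using H(2) by (intro open_Compl closed_UN) auto
      moreover have "x \<in> U"
      proof -
        have "x \<notin> cbox (fst P) (\<chi> i. fst P $ i + snd P)" if P: "P \<in> \<H>" for P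
        proof
          assume "x \<in> cbox (fst P) (\<chi> i. fst P $ i + snd P)"
          then have "fst P $ i - m * snd P < x $ i" "x $ i < fst P $ i - m * snd P + (2 * m + 1) * snd P" for i
            using mult_pos_pos[OF m(2) Hs(1)[OF P]] unfolding mem_box_cart by (auto simp: algebra_simps elim!: allE[of _ i])
          then show False using xP[OF P] unfolding dil_def ocube_def by auto
        qed
        then show ?thesis by (auto simp: U_def)
      qed
      moreover have "AE y in lebesgue. y \<in> U \<longrightarrow> \<beta> y = 0"
      proof (intro AE_I2 impI \<beta>_off)
        fix y assume "y \<in> U"
        then show "y \<notin> W" using Hs(2) hcube_subset_ccube unfolding U_def W_def by blast
      qed
      ultimately have "x \<notin> ess_support \<beta>" unfolding ess_support_def by blast
      then have "T \<beta> x = (\<integral>y. K x y * \<beta> y \<partial>lebesgue)" using elim by simp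
      also have "\<dots> = (\<integral>y. (\<Sum>P\<in>\<H>. K x y * u P y) \<partial>lebesgue)" unfolding \<beta>_def by (simp add: sum_distrib_left)
      also have "\<dots> = (\<Sum>P\<in>\<H>. \<integral>y. K x y * u P y \<partial>lebesgue)"
      proof (rule Bochner_Integration.integral_sum)
        fix P assume P: "P \<in> \<H>"
        show "integrable lebesgue (\<lambda>y. K x y * u P y)"
          by (rule integral_kernel_outside(1)[OF Hs(1)[OF P] xP[OF P] u_int[OF P]]) (simp add: u_def Hs(2)[OF P])
      qed
      finally have "ennreal (norm (T \<beta> x)) \<le> (\<Sum>P\<in>\<H>. ennreal (norm (\<integral>y. K x y * u P y \<partial>lebesgue)))"
        by (simp add: ennreal_leI norm_sum)
      also have "\<dots> \<le> q x"
        unfolding q_def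
      proof (rule sum_mono)
        fix P assume P: "P \<in> \<H>"
        have "ennreal (norm (\<integral>y. K x y * u P y \<partial>lebesgue)) \<le> w P x * L1norm (u P)"
          unfolding w_def by (rule integral_kernel_outside(2)[OF Hs(1)[OF P] xP[OF P] u_int[OF P] _ u_0[OF P]]) (simp add: u_def Hs(2)[OF P])
        then show "ennreal (norm (\<integral>y. K x y * u P y \<partial>lebesgue)) \<le> w P x * L1norm (u P) * indicator (- dil m (fst P) (snd P)) x"
          using xP[OF P] by simp
      qed
      finally show "ennreal (norm (T \<beta> x)) \<le> q x" .
    qed
  qed
  have qint: "(\<integral>\<^sup>+x. q x \<partial>lebesgue) \<le> ennreal (2 * C' * annC * F)"
  proof -
    have "(\<integral>\<^sup>+x. q x \<partial>lebesgue) = (\<Sum>P\<in>\<H>. \<integral>\<^sup>+x. w P x * L1norm (u P) * indicator (- dil m (fst P) (snd P)) x \<partial>lebesgue)"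
      unfolding q_def by (rule nn_integral_sum) (rule q_term)
    also have "\<dots> \<le> (\<Sum>P\<in>\<H>. ennreal (2 * C' * annC) * emeasure ?N (h P))"
    proof (rule sum_mono)
      fix P assume P: "P \<in> \<H>"
      \<comment> \<open>The tail estimate for the constant function 1, whose maximal function is at
        most 1: the kernel decay is integrable off the dilate with a bound independent of the
        cube.\<close>
      have ann: "(\<integral>\<^sup>+x\<in>- dil m (fst P) (snd P). ennreal (snd P powr \<delta> / norm (fst P - x) powr (CARD('n) + \<delta>)) * 1 \<partial>lebesgue) \<le> ennreal annC * 1"
      proof (rule order_trans)
        show "(\<integral>\<^sup>+x\<in>- dil m (fst P) (snd P). ennreal (snd P powr \<delta> / norm (fst P - x) powr (CARD('n) + \<delta>)) * 1 \<partial>lebesgue) \<le> ennreal annC * Mx lebesgue (\<lambda>_. 1) (fst P)"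
          unfolding annC_def by (rule annuli_bound[OF Hs(1)[OF P] m(1) \<delta> corner_in_hcube[OF Hs(1)[OF P]] corner_in_hcube[OF Hs(1)[OF P]]]) simp
        show "ennreal annC * Mx lebesgue (\<lambda>_. 1) (fst P) \<le> ennreal annC * 1"
          by (intro mult_left_mono Mx_one_le[OF doubling_lebesgue]) simp
      qed
      have "(\<integral>\<^sup>+x. w P x * L1norm (u P) * indicator (- dil m (fst P) (snd P)) x \<partial>lebesgue)
        = (\<integral>\<^sup>+x. (ennreal C' * L1norm (u P)) * (ennreal (snd P powr \<delta> / norm (fst P - x) powr (CARD('n) + \<delta>)) * 1 * indicator (- dil m (fst P) (snd P)) x) \<partial>lebesgue)"
        by (intro nn_integral_cong) (simp only: w_def ennreal_mult'[OF C'] mult_1_left mult_1_right mult_ac)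
      also have "\<dots> = (ennreal C' * L1norm (u P)) * (\<integral>\<^sup>+x\<in>- dil m (fst P) (snd P). ennreal (snd P powr \<delta> / norm (fst P - x) powr (CARD('n) + \<delta>)) * 1 \<partial>lebesgue)"
      proof (rule nn_integral_cmult)
        have [measurable]: "(\<lambda>x. norm (fst P - x)) \<in> borel_measurable lebesgue"
          by (intro measurable_lebesgue_continuous continuous_intros)
        show "(\<lambda>x. ennreal (snd P powr \<delta> / norm (fst P - x) powr (CARD('n) + \<delta>)) * 1 * indicator (- dil m (fst P) (snd P)) x) \<in> borel_measurable lebesgue"
          by measurable
      qed
      also have "\<dots> \<le> (ennreal C' * (2 * (\<integral>\<^sup>+x\<in>h P. ennreal (norm (f x)) \<partial>lebesgue))) * (ennreal annC * 1)"
        by (intro mult_mono ann uL1 P) auto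
      also have "\<dots> = ennreal (2 * C' * annC) * emeasure ?N (h P)"
        using C' annC by (simp add: N ennreal_mult mult_ac)
      finally show "(\<integral>\<^sup>+x. w P x * L1norm (u P) * indicator (- dil m (fst P) (snd P)) x \<partial>lebesgue)
        \<le> ennreal (2 * C' * annC) * emeasure ?N (h P)" .
    qed
    also have "\<dots> = ennreal (2 * C' * annC) * emeasure ?N W" by (simp add: sum_distrib_left[symmetric] sumH)
    also have "\<dots> \<le> ennreal (2 * C' * annC) * ennreal F" using leF[of W] F by (intro mult_left_mono) (auto simp: N)
    also have "\<dots> = ennreal (2 * C' * annC * F)" using C' annC F by (simp add: ennreal_mult[symmetric])
    finally show ?thesis .
  qed
  have bad: "emeasure lebesgue {x. \<alpha> / 2 < norm (T \<beta> x)} \<le> ennreal ((2 * m + 1) ^ CARD('n) * F / \<alpha>) + ennreal (4 * C' * annC * F / \<alpha>)"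
  proof -
    have "emeasure lebesgue {x. \<alpha> / 2 < norm (T \<beta> x)} \<le> emeasure lebesgue (D \<union> {x. ennreal (\<alpha> / 2) < q x})"
    proof (rule emeasure_mono_AE)
      show "AE x in lebesgue. x \<in> {x. \<alpha> / 2 < norm (T \<beta> x)} \<longrightarrow> x \<in> D \<union> {x. ennreal (\<alpha> / 2) < q x}"
        using bad_pt
      proof eventually_elim
        case (elim x)
        have "ennreal (\<alpha> / 2) < ennreal (norm (T \<beta> x))" if "\<alpha> / 2 < norm (T \<beta> x)" using that \<alpha> by (intro ennreal_lessI) auto
        then show ?case using elim by (auto intro: less_le_trans)
      qed
    qed measurable
    also have "\<dots> \<le> emeasure lebesgue D + emeasure lebesgue {x. ennreal (\<alpha> / 2) < q x}"
      by (rule emeasure_subadditive) measurable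
    also have "\<dots> \<le> ennreal ((2 * m + 1) ^ CARD('n) * F / \<alpha>) + ennreal (1 / (\<alpha> / 2)) * ennreal (2 * C' * annC * F)"
      using \<alpha> by (intro add_mono Dbound order_trans[OF Chebyshev_L1] mult_left_mono qint) auto
    also have "ennreal (1 / (\<alpha> / 2)) * ennreal (2 * C' * annC * F) = ennreal (4 * C' * annC * F / \<alpha>)"
      using \<alpha> C' annC F by (subst ennreal_mult[symmetric]) auto
    finally show ?thesis .
  qed
  have "emeasure lebesgue {x. 2 * (\<alpha> / 2) < norm (T f x)} \<le> emeasure lebesgue {x. \<alpha> / 2 < norm (T g x)} + emeasure lebesgue {x. \<alpha> / 2 < norm (T \<beta> x)}"
  proof (rule superlevel_add)
    show "AE x in lebesgue. norm (T f x) \<le> norm (T g x) + norm (T \<beta> x)"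
      using T_diff[OF f gL2]
    proof eventually_elim
      case (elim x)
      have "(\<lambda>y. f y - g y) = \<beta>" by (simp add: g_def fun_eq_iff)
      then have "T f x = T g x + T \<beta> x" using elim by simp
      then show ?case by (simp add: norm_triangle_ineq)
    qed
  qed (use T_measurable f gL2 \<beta>L2 in auto)
  also have "\<dots> \<le> ennreal (4 * B * (2 + 4 ^ CARD('n)) * F / \<alpha>) + (ennreal ((2 * m + 1) ^ CARD('n) * F / \<alpha>) + ennreal (4 * C' * annC * F / \<alpha>))"
    by (intro add_mono good bad)
  also have "\<dots> = ennreal (wkC0 * F / \<alpha>)"
    using \<alpha> B C' annC F m unfolding wkC0_def
    by (simp add: ennreal_plus[symmetric] add_divide_distrib[symmetric] distrib_right[symmetric] del: ennreal_plus)
  finally have "ennreal \<alpha> * emeasure lebesgue {x. \<alpha> < norm (T f x)} \<le> ennreal \<alpha> * ennreal (wkC0 * F / \<alpha>)"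
    by (intro mult_left_mono) auto
  also have "\<dots> = ennreal wkC0 * L1norm f" using \<alpha> F wkC0 by (simp add: ennreal_mult[symmetric])
  finally show ?thesis .
qed

text \<open>Restrict \<open>f\<close> to a centred cube so large that the average of
  \<open>\<bar>f\<bar>\<close> is at most \<open>\<alpha> / 2\<close> and the L2 mass outside is
  negligible. The local bound treats the restriction, Chebyshev's inequality in L2 the remainder;
  halving the height accounts for the factor 2.\<close>

lemma weak_type_L2:
  assumes f: "L2 f" and fi: "integrable lebesgue f" and \<alpha>: "0 < \<alpha>"
  shows "emeasure lebesgue {x. \<alpha> < norm (T f x)} \<le> ennreal (2 * wkC0 / \<alpha>) * L1norm f"
proof (rule ennreal_le_epsilon)
  fix e :: real assume e: "0 < e"
  have fm [measurable]: "f \<in> borel_measurable lebesgue" using f by (simp add: L2_def)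
  define Q :: "nat \<Rightarrow> (real ^ 'n) set" where "Q k = hcube (\<chi> i. - real (Suc k)) (2 * real (Suc k))" for k
  have [measurable]: "Q k \<in> sets lebesgue" for k by (simp add: Q_def)
  obtain F where F: "L1norm f = ennreal F" "0 \<le> F" using fi by (cases "L1norm f") (auto simp: integrable_iff_L1norm)
  have van: "(\<lambda>k. \<integral>\<^sup>+x\<in>- Q k. ennreal ((norm (f x))\<^sup>2) \<partial>lebesgue) \<longlonglongrightarrow> 0"
  proof (rule emeasure_density_vanishing)
    show "(\<integral>\<^sup>+x. ennreal ((norm (f x))\<^sup>2) \<partial>lebesgue) < top" using f by (simp add: L2_def)
    have "Q k \<subseteq> Q (Suc k)" for k
    proof
      fix x assume "x \<in> Q k"
      then have "- real (Suc k) \<le> x $ i" "x $ i < - real (Suc k) + 2 * real (Suc k)" for i unfolding Q_def hcube_def by auto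
      then have "- real (Suc (Suc k)) \<le> x $ i \<and> x $ i < - real (Suc (Suc k)) + 2 * real (Suc (Suc k))" for i
        unfolding of_nat_Suc by (auto dest!: meta_spec[of _ i])
      then show "x \<in> Q (Suc k)" unfolding Q_def hcube_def by simp
    qed
    then show "decseq (\<lambda>k. - Q k)" by (intro decseq_SucI) auto
    have "\<exists>k. x \<in> Q k" for x
    proof -
      obtain k :: nat where k: "norm x \<le> real k" using real_arch_simple by blast
      have "\<bar>x $ i\<bar> < real (Suc k)" for i using component_le_norm_cart[of x i] k by simp
      then have "x \<in> Q k" unfolding Q_def hcube_def by (auto simp: abs_less_iff minus_less_iff less_imp_le simp del: of_nat_Suc)
      then show ?thesis by blast
    qed
    then show "(\<Inter>k. - Q k) = {}" by auto
    show "- Q k \<in> sets lebesgue" for k by (simp add: Compl_in_sets_lebesgue)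
  qed measurable
  \<comment> \<open>\<open>4 * B / \<alpha>\<^sup>2\<close> is the Chebyshev constant at height
    \<open>\<alpha> / 2\<close> times \<open>B\<close>; adding 1 keeps \<open>c\<close> positive
    when \<open>B = 0\<close>.\<close>
  define c where "c = 4 * B / \<alpha>\<^sup>2 + 1"
  have c: "0 < c" "4 * B / \<alpha>\<^sup>2 \<le> c" using B by (auto simp: c_def add_nonneg_pos)
  have "\<forall>\<^sub>F k in sequentially. (\<integral>\<^sup>+x\<in>- Q k. ennreal ((norm (f x))\<^sup>2) \<partial>lebesgue) < ennreal (e / c)"
    using van e c by (intro order_tendstoD) auto
  then obtain k0 where k0: "\<And>k. k0 \<le> k \<Longrightarrow> (\<integral>\<^sup>+x\<in>- Q k. ennreal ((norm (f x))\<^sup>2) \<partial>lebesgue) < ennreal (e / c)"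
    by (auto simp: eventually_sequentially)
  obtain k1 :: nat where k1: "F / (\<alpha> / 2) \<le> real k1" using real_arch_simple by blast
  define k where "k = max k0 k1"
  define u where "u x = indicator (Q k) x *\<^sub>R f x" for x
  have um [measurable]: "u \<in> borel_measurable lebesgue" unfolding u_def by measurable
  have uL2: "L2 u" by (rule L2_mono[OF f um]) (auto simp: u_def indicator_def)
  have vL2: "L2 (\<lambda>x. f x - u x)" by (rule L2_diff[OF f uL2])
  have uF: "L1norm u \<le> L1norm f" unfolding L1norm_def by (intro nn_integral_mono) (auto simp: u_def indicator_def)
  have "ennreal (\<alpha> / 2) * emeasure lebesgue {x. \<alpha> / 2 < norm (T u x)} \<le> ennreal wkC0 * L1norm u"
  proof (rule weak_type_local[OF uL2])
    show "L1norm u \<le> ennreal (\<alpha> / 2) * emeasure lebesgue (hcube (\<chi> i. - real (Suc k)) (2 * real (Suc k)) :: (real ^ 'n) set)"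
    proof -
      have "F \<le> \<alpha> / 2 * real k1" using k1 \<alpha> by (simp add: field_simps)
      also have "\<dots> \<le> \<alpha> / 2 * (2 * real (Suc k))" using \<alpha> by (intro mult_left_mono) (auto simp: k_def)
      also have "\<dots> \<le> \<alpha> / 2 * (2 * real (Suc k)) ^ CARD('n)" using \<alpha> by (intro mult_left_mono self_le_power) auto
      finally have "L1norm u \<le> ennreal (\<alpha> / 2 * (2 * real (Suc k)) ^ CARD('n))"
        using uF F by (auto intro: order_trans ennreal_leI simp del: of_nat_Suc)
      also have "\<dots> = ennreal (\<alpha> / 2) * ennreal ((2 * real (Suc k)) ^ CARD('n))"
        using \<alpha> by (intro ennreal_mult) auto
      finally show ?thesis by (subst emeasure_hcube) simp_all
    qed
  qed (use \<alpha> in \<open>auto simp: u_def Q_def\<close>)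
  also have "\<dots> \<le> ennreal wkC0 * L1norm f" by (intro mult_left_mono uF) simp
  finally have *: "ennreal (\<alpha> / 2) * emeasure lebesgue {x. \<alpha> / 2 < norm (T u x)} \<le> ennreal wkC0 * L1norm f" .
  have 1: "emeasure lebesgue {x. \<alpha> / 2 < norm (T u x)} \<le> ennreal (2 * wkC0 / \<alpha>) * L1norm f"
  proof -
    have "emeasure lebesgue {x. \<alpha> / 2 < norm (T u x)} = ennreal (2 / \<alpha>) * (ennreal (\<alpha> / 2) * emeasure lebesgue {x. \<alpha> / 2 < norm (T u x)})"
      using \<alpha> by (simp add: mult.assoc[symmetric] ennreal_mult[symmetric])
    also have "\<dots> \<le> ennreal (2 / \<alpha>) * (ennreal wkC0 * L1norm f)" by (intro mult_left_mono *) simp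
    also have "\<dots> = ennreal (2 * wkC0 / \<alpha>) * L1norm f" using \<alpha> wkC0 by (simp add: mult.assoc[symmetric] ennreal_mult[symmetric])
    finally show ?thesis .
  qed
  have 2: "emeasure lebesgue {x. \<alpha> / 2 < norm (T (\<lambda>x. f x - u x) x)} \<le> ennreal e"
  proof -
    have "emeasure lebesgue {x. \<alpha> / 2 < norm (T (\<lambda>x. f x - u x) x)} \<le> ennreal (1 / (\<alpha> / 2)\<^sup>2) * (\<integral>\<^sup>+x. ennreal ((norm (T (\<lambda>x. f x - u x) x))\<^sup>2) \<partial>lebesgue)"
      using \<alpha> by (intro Chebyshev_L2 T_measurable vL2) auto
    also have "\<dots> \<le> ennreal (1 / (\<alpha> / 2)\<^sup>2) * (ennreal B * (\<integral>\<^sup>+x. ennreal ((norm (f x - u x))\<^sup>2) \<partial>lebesgue))"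
      by (intro mult_left_mono T_bound vL2) simp
    also have "(\<integral>\<^sup>+x. ennreal ((norm (f x - u x))\<^sup>2) \<partial>lebesgue) = (\<integral>\<^sup>+x\<in>- Q k. ennreal ((norm (f x))\<^sup>2) \<partial>lebesgue)"
      by (intro nn_integral_cong) (auto simp: u_def indicator_def)
    also have "ennreal (1 / (\<alpha> / 2)\<^sup>2) * (ennreal B * (\<integral>\<^sup>+x\<in>- Q k. ennreal ((norm (f x))\<^sup>2) \<partial>lebesgue)) \<le>
       ennreal c * ennreal (e / c)"
    proof -
      have "ennreal (1 / (\<alpha> / 2)\<^sup>2) * ennreal B = ennreal (4 * B / \<alpha>\<^sup>2)" using \<alpha> B by (subst ennreal_mult[symmetric]) (auto simp: power2_eq_square)
      then have "ennreal (1 / (\<alpha> / 2)\<^sup>2) * ennreal B \<le> ennreal c" using c by (simp add: ennreal_leI)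
      moreover have "(\<integral>\<^sup>+x\<in>- Q k. ennreal ((norm (f x))\<^sup>2) \<partial>lebesgue) \<le> ennreal (e / c)" using k0[of k] by (simp add: k_def less_imp_le)
      ultimately show ?thesis unfolding mult.assoc[symmetric] by (intro mult_mono) auto
    qed
    also have "\<dots> = ennreal e" using c e by (simp add: ennreal_mult[symmetric])
    finally show ?thesis .
  qed
  have "emeasure lebesgue {x. 2 * (\<alpha> / 2) < norm (T f x)} \<le> emeasure lebesgue {x. \<alpha> / 2 < norm (T u x)} + emeasure lebesgue {x. \<alpha> / 2 < norm (T (\<lambda>x. f x - u x) x)}"
  proof (rule superlevel_add)
    show "AE x in lebesgue. norm (T f x) \<le> norm (T u x) + norm (T (\<lambda>x. f x - u x) x)"
      using T_diff[OF f uL2]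
    proof eventually_elim
      case (elim x)
      then have "T f x = T u x + T (\<lambda>x. f x - u x) x" by simp
      then show ?case by (simp add: norm_triangle_ineq)
    qed
  qed (use T_measurable f uL2 vL2 in auto)
  also have "\<dots> \<le> ennreal (2 * wkC0 / \<alpha>) * L1norm f + ennreal e" by (intro add_mono 1 2)
  finally show "emeasure lebesgue {x. \<alpha> < norm (T f x)} \<le> ennreal (2 * wkC0 / \<alpha>) * L1norm f + ennreal e" by simp
qed

section \<open>The extension of the operator to integrable functions\<close>

text \<open>Twice the constant of \<open>weak_type_L2\<close>, because comparing with an
  approximating sequence halves the height once more.\<close>

definition wk :: real where "wk = 4 * wkC0"

lemma wk: "0 < wk" using wkC0 by (simp add: wk_def)

text \<open>A quantitative form of \<open>extends_to\<close>: in place of a limit along sequences,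
  an error bound by the L1 distance for each single approximant. Weak type, linearity and kernel
  formula of the extension are derived from it.\<close>

definition is_ext :: "(real ^ 'n \<Rightarrow> complex) \<Rightarrow> (real ^ 'n \<Rightarrow> complex) \<Rightarrow> bool" where
  "is_ext g h \<longleftrightarrow> h \<in> borel_measurable lebesgue \<and> (\<forall>G \<epsilon>. L2 G \<longrightarrow> integrable lebesgue G \<longrightarrow> 0 < \<epsilon> \<longrightarrow>
     emeasure lebesgue {x. \<epsilon> < norm (T G x - h x)} \<le> ennreal (wk / \<epsilon>) * L1norm (\<lambda>x. G x - g x))"

lemma T_diff_weak:
  assumes "L2 F" "L2 G" "integrable lebesgue F" "integrable lebesgue G" "0 < \<alpha>"
  shows "emeasure lebesgue {x. \<alpha> < norm (T F x - T G x)} \<le> ennreal (2 * wkC0 / \<alpha>) * L1norm (\<lambda>x. F x - G x)"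
proof -
  note [measurable] = T_measurable[OF assms(1)] T_measurable[OF assms(2)] T_measurable[OF L2_diff[OF assms(1,2)]]
  have "emeasure lebesgue {x. \<alpha> < norm (T F x - T G x)} = emeasure lebesgue {x. \<alpha> < norm (T (\<lambda>x. F x - G x) x)}"
  proof (rule emeasure_eq_AE)
    show "AE x in lebesgue. (x \<in> {x. \<alpha> < norm (T F x - T G x)}) = (x \<in> {x. \<alpha> < norm (T (\<lambda>x. F x - G x) x)})"
      using T_diff[OF assms(1,2)] by eventually_elim simp
  qed measurable
  also have "\<dots> \<le> ennreal (2 * wkC0 / \<alpha>) * L1norm (\<lambda>x. F x - G x)"
    by (intro weak_type_L2 L2_diff assms Bochner_Integration.integrable_diff)
  finally show ?thesis .
qed

text \<open>For approximants with L1 error \<open>4^(-k)\<close> consecutive images differ by more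
  than \<open>2^(-k)\<close> only on a set whose measure is of the order \<open>2^(-k)\<close>. Off
  the union of these sets from an index on, the images converge geometrically. The bound for an
  arbitrary \<open>H\<close> follows by comparing it with a late member of the sequence.\<close>

lemma ext_exists:
  assumes g: "integrable lebesgue g" shows "\<exists>h. is_ext g h"
proof -
  have gm [measurable]: "g \<in> borel_measurable lebesgue" using g by auto
  have "\<forall>k. \<exists>G. L2 G \<and> integrable lebesgue G \<and> L1norm (\<lambda>x. G x - g x) < ennreal ((1 / 4) ^ k)"
    using L1_approx[OF g] by (meson zero_less_power zero_less_divide_1_iff zero_less_numeral)
  from choice[OF this] obtain G where G: "\<And>k. L2 (G k)" "\<And>k. integrable lebesgue (G k)"
    "\<And>k. L1norm (\<lambda>x. G k x - g x) < ennreal ((1 / 4) ^ k)" by blast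
  have Gm [measurable]: "G k \<in> borel_measurable lebesgue" for k using G(2)[of k] by auto
  have TGm [measurable]: "T (G k) \<in> borel_measurable lebesgue" for k by (rule T_measurable[OF G(1)])
  define h where "h x = lim (\<lambda>k. T (G k) x)" for x
  have hm [measurable]: "h \<in> borel_measurable lebesgue" unfolding h_def by measurable
  define D where "D k = {x. (1 / 2) ^ k < norm (T (G (Suc k)) x - T (G k) x)}" for k
  have [measurable]: "D k \<in> sets lebesgue" for k unfolding D_def by measurable
  have Dk: "emeasure lebesgue (D k) \<le> ennreal (4 * wkC0 * (1 / 2) ^ k)" for k
  proof -
    have "L1norm (\<lambda>x. G (Suc k) x - G k x) \<le> L1norm (\<lambda>x. G (Suc k) x - g x) + L1norm (\<lambda>x. g x - G k x)"
      by (rule L1norm_triangle) measurable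
    also have "\<dots> \<le> ennreal ((1 / 4) ^ Suc k) + ennreal ((1 / 4) ^ k)"
      using G(3)[of "Suc k"] G(3)[of k] by (intro add_mono) (auto simp: L1norm_commute[of g] less_imp_le)
    also have "\<dots> \<le> ennreal (2 * (1 / 4) ^ k)" by (simp add: ennreal_plus[symmetric] del: ennreal_plus)
    finally have le: "L1norm (\<lambda>x. G (Suc k) x - G k x) \<le> ennreal (2 * (1 / 4) ^ k)" .
    have "emeasure lebesgue (D k) \<le> ennreal (2 * wkC0 / (1 / 2) ^ k) * L1norm (\<lambda>x. G (Suc k) x - G k x)"
      unfolding D_def by (rule T_diff_weak) (use G in auto)
    also have "\<dots> \<le> ennreal (2 * wkC0 / (1 / 2) ^ k) * ennreal (2 * (1 / 4) ^ k)" by (intro mult_left_mono le) simp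
    also have "\<dots> = ennreal (4 * wkC0 * (1 / 2) ^ k)"
    proof -
      have "(1 / 4) ^ k = (1 / 2) ^ k * ((1 / 2) ^ k :: real)" by (simp add: power_mult_distrib[symmetric])
      then show ?thesis using wkC0 by (simp add: ennreal_mult[symmetric])
    qed
    finally show ?thesis .
  qed
  define E where "E m = (\<Union>k. D (k + m))" for m
  have [measurable]: "E m \<in> sets lebesgue" for m unfolding E_def by measurable
  have Em: "emeasure lebesgue (E m) \<le> ennreal (8 * wkC0 * (1 / 2) ^ m)" for m
  proof -
    have "emeasure lebesgue (E m) \<le> (\<Sum>k. emeasure lebesgue (D (k + m)))"
      unfolding E_def by (rule emeasure_subadditive_countably) auto
    also have "\<dots> \<le> (\<Sum>k. ennreal (4 * wkC0 * (1 / 2) ^ (k + m)))" by (intro suminf_le Dk) auto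
    also have "\<dots> = ennreal (8 * wkC0 * (1 / 2) ^ m)"
    proof (rule suminf_ennreal_eq)
      have "(\<lambda>k. (4 * wkC0 * (1 / 2) ^ m) * (1 / 2) ^ k) sums ((4 * wkC0 * (1 / 2) ^ m) * (1 / (1 - 1 / 2)))"
        by (intro sums_mult geometric_sums) auto
      then show "(\<lambda>k. 4 * wkC0 * (1 / 2) ^ (k + m)) sums (8 * wkC0 * (1 / 2) ^ m)" by (simp add: power_add mult_ac)
    qed (use wkC0 in auto)
    finally show ?thesis .
  qed
  have close: "norm (h x - T (G m) x) \<le> 2 * (1 / 2) ^ m" if "x \<notin> E m" for x m
    unfolding h_def
  proof (rule geometric_Cauchy_limit)
    fix k assume "m \<le> k"
    then have "x \<notin> D k" using that unfolding E_def by (metis UNIV_I UN_I le_add_diff_inverse2)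
    then show "norm (T (G (Suc k)) x - T (G k) x) \<le> (1 / 2) ^ k" by (simp add: D_def not_less)
  qed
  have "is_ext g h"
    unfolding is_ext_def
  proof (intro conjI allI impI hm)
    fix H :: "real ^ 'n \<Rightarrow> complex" and \<epsilon> :: real assume H: "L2 H" "integrable lebesgue H" and \<epsilon>: "0 < \<epsilon>"
    note [measurable] = T_measurable[OF H(1)]
    have Hm [measurable]: "H \<in> borel_measurable lebesgue" using H by auto
    show "emeasure lebesgue {x. \<epsilon> < norm (T H x - h x)} \<le> ennreal (wk / \<epsilon>) * L1norm (\<lambda>x. H x - g x)"
    proof (rule ennreal_le_epsilon)
      fix e :: real assume e: "0 < e"
      define c where "c = wk / \<epsilon> + 8 * wkC0 + 1"
      have c: "0 < c" using wk wkC0 \<epsilon> by (simp add: c_def add_pos_pos)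
      obtain n where n: "(1 / 2) ^ n < min (e / c) (\<epsilon> / 4)" using real_arch_pow_inv[of "min (e / c) (\<epsilon> / 4)" "1 / 2"] e c \<epsilon> by auto
      have "emeasure lebesgue {x. 2 * (\<epsilon> / 2) < norm (T H x - h x)} \<le>
        emeasure lebesgue {x. \<epsilon> / 2 < norm (T H x - T (G n) x)} + emeasure lebesgue {x. \<epsilon> / 2 < norm (T (G n) x - h x)}"
      proof (rule superlevel_add)
        show "AE x in lebesgue. norm (T H x - h x) \<le> norm (T H x - T (G n) x) + norm (T (G n) x - h x)"
        proof (rule AE_I2)
          show "norm (T H x - h x) \<le> norm (T H x - T (G n) x) + norm (T (G n) x - h x)" for x
            using norm_triangle_ineq[of "T H x - T (G n) x" "T (G n) x - h x"] by simp
        qed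
      qed measurable
      also have "\<dots> \<le> ennreal (wk / \<epsilon>) * (L1norm (\<lambda>x. H x - g x) + ennreal ((1 / 4) ^ n)) + ennreal (8 * wkC0 * (1 / 2) ^ n)"
      proof (rule add_mono)
        have "emeasure lebesgue {x. \<epsilon> / 2 < norm (T H x - T (G n) x)} \<le> ennreal (2 * wkC0 / (\<epsilon> / 2)) * L1norm (\<lambda>x. H x - G n x)"
          by (rule T_diff_weak) (use H G \<epsilon> in auto)
        also have "2 * wkC0 / (\<epsilon> / 2) = wk / \<epsilon>" by (simp add: wk_def)
        also have "ennreal (wk / \<epsilon>) * L1norm (\<lambda>x. H x - G n x) \<le> ennreal (wk / \<epsilon>) * (L1norm (\<lambda>x. H x - g x) + ennreal ((1 / 4) ^ n))"
        proof (rule mult_left_mono)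
          have "L1norm (\<lambda>x. H x - G n x) \<le> L1norm (\<lambda>x. H x - g x) + L1norm (\<lambda>x. g x - G n x)"
            by (rule L1norm_triangle) measurable
          also have "\<dots> \<le> L1norm (\<lambda>x. H x - g x) + ennreal ((1 / 4) ^ n)"
            using G(3)[of n] by (intro add_left_mono) (auto simp: L1norm_commute[of g] less_imp_le)
          finally show "L1norm (\<lambda>x. H x - G n x) \<le> L1norm (\<lambda>x. H x - g x) + ennreal ((1 / 4) ^ n)" .
        qed simp
        finally show "emeasure lebesgue {x. \<epsilon> / 2 < norm (T H x - T (G n) x)} \<le> ennreal (wk / \<epsilon>) * (L1norm (\<lambda>x. H x - g x) + ennreal ((1 / 4) ^ n))" .
        have "{x. \<epsilon> / 2 < norm (T (G n) x - h x)} \<subseteq> E n"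
        proof
          fix x assume x: "x \<in> {x. \<epsilon> / 2 < norm (T (G n) x - h x)}"
          show "x \<in> E n"
          proof (rule ccontr)
            assume "x \<notin> E n"
            from close[OF this] show False using x n by (simp add: norm_minus_commute)
          qed
        qed
        then have "emeasure lebesgue {x. \<epsilon> / 2 < norm (T (G n) x - h x)} \<le> emeasure lebesgue (E n)"
          by (intro emeasure_mono) auto
        then show "emeasure lebesgue {x. \<epsilon> / 2 < norm (T (G n) x - h x)} \<le> ennreal (8 * wkC0 * (1 / 2) ^ n)"
          using Em[of n] by (rule order_trans)
      qed
      also have "\<dots> = ennreal (wk / \<epsilon>) * L1norm (\<lambda>x. H x - g x) + (ennreal (wk / \<epsilon>) * ennreal ((1 / 4) ^ n) + ennreal (8 * wkC0 * (1 / 2) ^ n))"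
        by (simp add: distrib_left add.assoc)
      also have "\<dots> \<le> ennreal (wk / \<epsilon>) * L1norm (\<lambda>x. H x - g x) + ennreal e"
      proof (rule add_left_mono)
        have "(1 / 4) ^ n \<le> (1 / 2 :: real) ^ n" by (rule power_mono) auto
        then have "wk / \<epsilon> * (1 / 4) ^ n + 8 * wkC0 * (1 / 2) ^ n \<le> wk / \<epsilon> * (1 / 2) ^ n + 8 * wkC0 * (1 / 2) ^ n"
          using wk \<epsilon> by (intro add_right_mono mult_left_mono) auto
        also have "\<dots> \<le> c * (1 / 2) ^ n" by (simp add: c_def algebra_simps)
        also have "\<dots> \<le> e" using n c by (simp add: field_simps)
        finally have "ennreal (wk / \<epsilon> * (1 / 4) ^ n + 8 * wkC0 * (1 / 2) ^ n) \<le> ennreal e" by (rule ennreal_leI)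
        then show "ennreal (wk / \<epsilon>) * ennreal ((1 / 4) ^ n) + ennreal (8 * wkC0 * (1 / 2) ^ n) \<le> ennreal e"
          using wk wkC0 \<epsilon> by (simp add: ennreal_mult[symmetric] ennreal_plus[symmetric] del: ennreal_plus)
      qed
      finally show "emeasure lebesgue {x. \<epsilon> < norm (T H x - h x)} \<le> ennreal (wk / \<epsilon>) * L1norm (\<lambda>x. H x - g x) + ennreal e" by simp
    qed
  qed
  then show ?thesis by blast
qed

definition T1 :: "(real ^ 'n \<Rightarrow> complex) \<Rightarrow> real ^ 'n \<Rightarrow> complex" where
  "T1 g = L1_extension T g"

lemma L1_L2_space_iff: "G \<in> Lp_space 1 (\<lambda>_. 1) \<inter> Lp_space 2 (\<lambda>_. 1) \<longleftrightarrow> integrable lebesgue G \<and> L2 G"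
  by (auto simp: integrable_iff_L1norm Lp_space_def Lp_norm_1 Lp_norm_2 L2_def)

lemma is_ext_extends_to:
  assumes "is_ext g h" shows "extends_to T g h"
  unfolding extends_to_def
proof (intro conjI allI impI)
  show "h \<in> borel_measurable lebesgue" using assms by (simp add: is_ext_def)
  fix G :: "nat \<Rightarrow> real ^ 'n \<Rightarrow> complex" and \<epsilon> :: real
  assume G: "(\<forall>k. G k \<in> Lp_space 1 (\<lambda>_. 1) \<inter> Lp_space 2 (\<lambda>_. 1)) \<and> (\<lambda>k. Lp_norm 1 (\<lambda>_. 1) (\<lambda>x. G k x - g x)) \<longlonglongrightarrow> 0"
    and \<epsilon>: "0 < \<epsilon>"
  show "(\<lambda>k. emeasure lebesgue {x. \<epsilon> < norm (T (G k) x - h x)}) \<longlonglongrightarrow> 0"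
  proof (rule tendsto_sandwich[OF _ _ tendsto_const])
    have "(\<lambda>k. ennreal (wk / \<epsilon>) * L1norm (\<lambda>x. G k x - g x)) \<longlonglongrightarrow> ennreal (wk / \<epsilon>) * 0"
      using G by (intro ennreal_tendsto_cmult) (auto simp: Lp_norm_1)
    then show "(\<lambda>k. ennreal (wk / \<epsilon>) * L1norm (\<lambda>x. G k x - g x)) \<longlonglongrightarrow> 0" by simp
    show "\<forall>\<^sub>F k in sequentially. emeasure lebesgue {x. \<epsilon> < norm (T (G k) x - h x)} \<le> ennreal (wk / \<epsilon>) * L1norm (\<lambda>x. G k x - g x)"
      using assms G \<epsilon> unfolding is_ext_def L1_L2_space_iff by (intro always_eventually) auto
  qed simp
qed

lemma L1_approx_sequence:
  assumes g: "integrable lebesgue g"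
  shows "\<exists>G. (\<forall>k::nat. L2 (G k) \<and> integrable lebesgue (G k)) \<and> (\<lambda>k. L1norm (\<lambda>x. G k x - g x)) \<longlonglongrightarrow> 0"
proof -
  have "\<forall>k::nat. \<exists>G. L2 G \<and> integrable lebesgue G \<and> L1norm (\<lambda>x. G x - g x) < ennreal ((1 / 2) ^ k)"
    using L1_approx[OF g] by (meson zero_less_power zero_less_divide_1_iff zero_less_numeral)
  from choice[OF this] obtain G where G: "\<And>k. L2 (G k)" "\<And>k. integrable lebesgue (G k)"
    "\<And>k. L1norm (\<lambda>x. G k x - g x) < ennreal ((1 / 2) ^ k)" by blast
  have "(\<lambda>k. L1norm (\<lambda>x. G k x - g x)) \<longlonglongrightarrow> 0"
  proof (rule tendsto_sandwich[OF _ _ tendsto_const])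
    have "(\<lambda>k. ennreal ((1 / 2) ^ k)) \<longlonglongrightarrow> ennreal 0"
      by (intro tendsto_ennrealI LIMSEQ_power_zero) auto
    then show "(\<lambda>k. ennreal ((1 / 2) ^ k)) \<longlonglongrightarrow> 0" by simp
  qed (use G(3) in \<open>auto simp: less_imp_le intro!: always_eventually\<close>)
  then show ?thesis using G(1,2) by blast
qed

text \<open>Both functions are limits in measure of the images of one and the same sequence.\<close>

lemma ext_unique:
  assumes g: "integrable lebesgue g" and h: "extends_to T g h" "extends_to T g h'"
  shows "AE x in lebesgue. h x = h' x"
proof -
  have [measurable]: "h \<in> borel_measurable lebesgue" "h' \<in> borel_measurable lebesgue" using h by (auto simp: extends_to_def)
  obtain G where G: "\<And>k::nat. L2 (G k)" "\<And>k. integrable lebesgue (G k)" "(\<lambda>k. L1norm (\<lambda>x. G k x - g x)) \<longlonglongrightarrow> 0"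
    using L1_approx_sequence[OF g] by blast
  note [measurable] = T_measurable[OF G(1)]
  have lim: "(\<lambda>k. emeasure lebesgue {x. \<epsilon> < norm (T (G k) x - u x)}) \<longlonglongrightarrow> 0" if "extends_to T g u" "0 < \<epsilon>" for u and \<epsilon> :: real
    using that G unfolding extends_to_def L1_L2_space_iff Lp_norm_1 by blast
  have "AE x in lebesgue. True \<longrightarrow> h x = h' x"
  proof (rule AE_eq_if_small_cover)
    fix \<epsilon> e :: real assume \<epsilon>: "0 < \<epsilon>" and e: "0 < e"
    have "\<forall>\<^sub>F k in sequentially. emeasure lebesgue {x. \<epsilon> / 2 < norm (T (G k) x - h x)} < ennreal (e / 2)"
      "\<forall>\<^sub>F k in sequentially. emeasure lebesgue {x. \<epsilon> / 2 < norm (T (G k) x - h' x)} < ennreal (e / 2)"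
      using lim[OF h(1), of "\<epsilon> / 2"] lim[OF h(2), of "\<epsilon> / 2"] \<epsilon> e by (auto intro: order_tendstoD)
    then have "\<forall>\<^sub>F k in sequentially. emeasure lebesgue {x. \<epsilon> / 2 < norm (T (G k) x - h x)} < ennreal (e / 2) \<and>
       emeasure lebesgue {x. \<epsilon> / 2 < norm (T (G k) x - h' x)} < ennreal (e / 2)" by (rule eventually_conj)
    then obtain k where k: "emeasure lebesgue {x. \<epsilon> / 2 < norm (T (G k) x - h x)} < ennreal (e / 2)"
      "emeasure lebesgue {x. \<epsilon> / 2 < norm (T (G k) x - h' x)} < ennreal (e / 2)" by (auto simp: eventually_sequentially)
    let ?Z = "{x. \<epsilon> / 2 < norm (T (G k) x - h x)} \<union> {x. \<epsilon> / 2 < norm (T (G k) x - h' x)}"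
    have "emeasure lebesgue ?Z \<le> emeasure lebesgue {x. \<epsilon> / 2 < norm (T (G k) x - h x)} + emeasure lebesgue {x. \<epsilon> / 2 < norm (T (G k) x - h' x)}"
      by (rule emeasure_subadditive) measurable
    also have "\<dots> \<le> ennreal (e / 2) + ennreal (e / 2)" using k by (intro add_mono) auto
    also have "\<dots> = ennreal e" using e by (simp add: ennreal_plus[symmetric] del: ennreal_plus)
    finally have "emeasure lebesgue ?Z \<le> ennreal e" .
    moreover have "x \<in> ?Z" if "\<epsilon> < norm (h x - h' x)" for x
      using that norm_triangle_ineq[of "h x - T (G k) x" "T (G k) x - h' x"] by (auto simp: norm_minus_commute)
    moreover have "?Z \<in> sets lebesgue" by measurable
    ultimately show "\<exists>Z\<in>sets lebesgue. emeasure lebesgue Z \<le> ennreal e \<and> (AE x in lebesgue. True \<longrightarrow> \<epsilon> < norm (h x - h' x) \<longrightarrow> x \<in> Z)"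
      by (intro bexI[of _ ?Z]) auto
  qed
  then show ?thesis by simp
qed

text \<open>The limit from \<open>ext_exists\<close> shows that the choice in
  \<open>L1_extension\<close> has a candidate; uniqueness almost everywhere carries the error bound
  over to the function actually chosen.\<close>

lemma T1_is_ext:
  assumes g: "integrable lebesgue g" shows "is_ext g (T1 g)"
proof -
  obtain h where h: "is_ext g h" using ext_exists[OF g] by blast
  have ex: "extends_to T g (T1 g)"
    unfolding T1_def L1_extension_def by (rule someI[of "extends_to T g", OF is_ext_extends_to[OF h]])
  have ae: "AE x in lebesgue. T1 g x = h x" by (rule ext_unique[OF g ex is_ext_extends_to[OF h]])
  have [measurable]: "h \<in> borel_measurable lebesgue" "T1 g \<in> borel_measurable lebesgue"
    using h ex by (auto simp: is_ext_def extends_to_def)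
  show ?thesis
    unfolding is_ext_def
  proof (intro conjI allI impI)
    fix G :: "real ^ 'n \<Rightarrow> complex" and \<epsilon> :: real assume G: "L2 G" "integrable lebesgue G" "0 < \<epsilon>"
    note [measurable] = T_measurable[OF G(1)]
    have "emeasure lebesgue {x. \<epsilon> < norm (T G x - T1 g x)} = emeasure lebesgue {x. \<epsilon> < norm (T G x - h x)}"
    proof (rule emeasure_eq_AE)
      show "AE x in lebesgue. (x \<in> {x. \<epsilon> < norm (T G x - T1 g x)}) = (x \<in> {x. \<epsilon> < norm (T G x - h x)})"
        using ae by eventually_elim simp
    qed measurable
    then show "emeasure lebesgue {x. \<epsilon> < norm (T G x - T1 g x)} \<le> ennreal (wk / \<epsilon>) * L1norm (\<lambda>x. G x - g x)"
      using h G by (simp add: is_ext_def)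
  qed measurable
qed

lemma T1_measurable: "integrable lebesgue g \<Longrightarrow> T1 g \<in> borel_measurable lebesgue"
  using T1_is_ext by (simp add: is_ext_def)

lemma T1_approx:
  assumes "integrable lebesgue g" "L2 G" "integrable lebesgue G" "0 < \<epsilon>"
  shows "emeasure lebesgue {x. \<epsilon> < norm (T G x - T1 g x)} \<le> ennreal (wk / \<epsilon>) * L1norm (\<lambda>x. G x - g x)"
  using T1_is_ext[OF assms(1)] assms by (simp add: is_ext_def)

text \<open>With \<open>f\<close> as its own approximant the error bound is zero.\<close>

lemma T1_eq_T:
  assumes f: "L2 f" "integrable lebesgue f"
  shows "AE x in lebesgue. T1 f x = T f x"
proof -
  note [measurable] = T_measurable[OF f(1)] T1_measurable[OF f(2)]
  have "AE x in lebesgue. True \<longrightarrow> T1 f x = T f x"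
  proof (rule AE_eq_if_small_cover)
    fix \<epsilon> e :: real assume \<epsilon>: "0 < \<epsilon>" and e: "0 < e"
    have "emeasure lebesgue {x. \<epsilon> < norm (T f x - T1 f x)} \<le> ennreal (wk / \<epsilon>) * L1norm (\<lambda>x. f x - f x)"
      by (rule T1_approx[OF f(2) f \<epsilon>])
    also have "\<dots> = 0" by (simp add: L1norm_def)
    finally show "\<exists>Z\<in>sets lebesgue. emeasure lebesgue Z \<le> ennreal e \<and> (AE x in lebesgue. True \<longrightarrow> \<epsilon> < norm (T1 f x - T f x) \<longrightarrow> x \<in> Z)"
      by (intro bexI[of _ "{x. \<epsilon> < norm (T f x - T1 f x)}"]) (auto simp: norm_minus_commute)
  qed
  then show ?thesis by simp
qed

text \<open>Compare with the approximant 0, whose image vanishes almost everywhere.\<close>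

lemma T1_weak_type:
  assumes g: "integrable lebesgue g" and \<alpha>: "0 < \<alpha>"
  shows "emeasure lebesgue {x. \<alpha> < norm (T1 g x)} \<le> ennreal (wk / \<alpha>) * L1norm g"
proof -
  note [measurable] = T1_measurable[OF g]
  have 0: "L2 (\<lambda>_. 0 :: complex)" "integrable lebesgue (\<lambda>_. 0 :: complex)" by (auto simp: L2_def)
  note [measurable] = T_measurable[OF 0(1)]
  have "emeasure lebesgue {x. \<alpha> < norm (T1 g x)} = emeasure lebesgue {x. \<alpha> < norm (T (\<lambda>_. 0) x - T1 g x)}"
  proof (rule emeasure_eq_AE)
    show "AE x in lebesgue. (x \<in> {x. \<alpha> < norm (T1 g x)}) = (x \<in> {x. \<alpha> < norm (T (\<lambda>_. 0) x - T1 g x)})"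
      using T_null[OF 0(1)] by simp (elim eventually_mono, simp)
  qed measurable
  also have "\<dots> \<le> ennreal (wk / \<alpha>) * L1norm (\<lambda>x. 0 - g x)" by (rule T1_approx[OF g 0 \<alpha>])
  also have "L1norm (\<lambda>x. 0 - g x) = L1norm g" by (simp add: L1norm_def)
  finally show ?thesis .
qed

text \<open>Linearity is inherited from L2 through approximants: off three sets of small total
  measure, each of the three errors is at most \<open>\<epsilon> / 3\<close>.\<close>

lemma T1_lincomb:
  assumes f: "integrable lebesgue f" and g: "integrable lebesgue g"
  shows "AE x in lebesgue. T1 (\<lambda>y. \<alpha> * f y + \<beta> * g y) x = \<alpha> * T1 f x + \<beta> * T1 g x"
proof -
  have fg: "integrable lebesgue (\<lambda>y. \<alpha> * f y + \<beta> * g y)" using f g by simp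
  note [measurable] = T1_measurable[OF f] T1_measurable[OF g] T1_measurable[OF fg]
  have [measurable]: "f \<in> borel_measurable lebesgue" "g \<in> borel_measurable lebesgue" using f g by auto
  define A where "A = norm \<alpha> + norm \<beta> + 1"
  have A: "0 < A" "norm \<alpha> \<le> A" "norm \<beta> \<le> A" by (auto simp: A_def add_nonneg_pos)
  have "AE x in lebesgue. True \<longrightarrow> T1 (\<lambda>y. \<alpha> * f y + \<beta> * g y) x = \<alpha> * T1 f x + \<beta> * T1 g x"
  proof (rule AE_eq_if_small_cover)
    fix \<epsilon> e :: real assume \<epsilon>: "0 < \<epsilon>" and e: "0 < e"
    \<comment> \<open>The sum of the weak type constants of the three exceptional sets, so that L1
      errors \<open>d = e / c\<close> make their total measure at most \<open>e\<close>.\<close>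
    define c where "c = 3 * wk / \<epsilon> * (2 * A) + 2 * (wk / (\<epsilon> / (3 * A)))"
    have c: "0 < c" using wk \<epsilon> A by (simp add: c_def add_pos_pos)
    define d where "d = e / c"
    have d: "0 < d" using e c by (simp add: d_def)
    obtain F where F: "L2 F" "integrable lebesgue F" "L1norm (\<lambda>x. F x - f x) < ennreal d" using L1_approx[OF f d] by blast
    obtain G where G: "L2 G" "integrable lebesgue G" "L1norm (\<lambda>x. G x - g x) < ennreal d" using L1_approx[OF g d] by blast
    define H where "H = (\<lambda>y. \<alpha> * F y + \<beta> * G y)"
    have H: "L2 H" "integrable lebesgue H" unfolding H_def using F G by (auto intro: L2_lincomb)
    have [measurable]: "F \<in> borel_measurable lebesgue" "G \<in> borel_measurable lebesgue" using F G by auto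
    note [measurable] = T_measurable[OF F(1)] T_measurable[OF G(1)] T_measurable[OF H(1)]
    let ?Z1 = "{x. \<epsilon> / 3 < norm (T H x - T1 (\<lambda>y. \<alpha> * f y + \<beta> * g y) x)}"
    let ?Z2 = "{x. \<epsilon> / (3 * A) < norm (T F x - T1 f x)}"
    let ?Z3 = "{x. \<epsilon> / (3 * A) < norm (T G x - T1 g x)}"
    let ?Z = "?Z1 \<union> (?Z2 \<union> ?Z3)"
    have LH: "L1norm (\<lambda>x. H x - (\<alpha> * f x + \<beta> * g x)) \<le> ennreal (2 * A * d)"
    proof -
      have "L1norm (\<lambda>x. H x - (\<alpha> * f x + \<beta> * g x)) \<le> (\<integral>\<^sup>+x. ennreal A * ennreal (norm (F x - f x)) + ennreal A * ennreal (norm (G x - g x)) \<partial>lebesgue)"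
        unfolding L1norm_def
      proof (rule nn_integral_mono)
        fix x
        have "H x - (\<alpha> * f x + \<beta> * g x) = \<alpha> * (F x - f x) + \<beta> * (G x - g x)" by (simp add: H_def algebra_simps)
        then have "norm (H x - (\<alpha> * f x + \<beta> * g x)) \<le> norm \<alpha> * norm (F x - f x) + norm \<beta> * norm (G x - g x)"
          by (metis norm_mult norm_triangle_ineq)
        also have "\<dots> \<le> A * norm (F x - f x) + A * norm (G x - g x)" using A by (intro add_mono mult_right_mono) auto
        finally show "ennreal (norm (H x - (\<alpha> * f x + \<beta> * g x))) \<le> ennreal A * ennreal (norm (F x - f x)) + ennreal A * ennreal (norm (G x - g x))"
          using A by (simp add: ennreal_mult[symmetric] ennreal_plus[symmetric] del: ennreal_plus)
      qed
      also have "\<dots> = ennreal A * L1norm (\<lambda>x. F x - f x) + ennreal A * L1norm (\<lambda>x. G x - g x)"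
        unfolding L1norm_def by (simp add: nn_integral_add nn_integral_cmult)
      also have "\<dots> \<le> ennreal A * ennreal d + ennreal A * ennreal d" using F G by (intro add_mono mult_left_mono) auto
      also have "\<dots> = ennreal (2 * A * d)" using A d by (simp add: ennreal_mult[symmetric] ennreal_plus[symmetric] del: ennreal_plus)
      finally show ?thesis .
    qed
    have "emeasure lebesgue ?Z \<le> emeasure lebesgue ?Z1 + emeasure lebesgue (?Z2 \<union> ?Z3)"
      by (rule emeasure_subadditive) measurable
    also have "\<dots> \<le> emeasure lebesgue ?Z1 + (emeasure lebesgue ?Z2 + emeasure lebesgue ?Z3)"
      by (intro add_left_mono emeasure_subadditive) measurable
    also have "\<dots> \<le> ennreal (wk / (\<epsilon> / 3)) * ennreal (2 * A * d) + (ennreal (wk / (\<epsilon> / (3 * A))) * ennreal d + ennreal (wk / (\<epsilon> / (3 * A))) * ennreal d)"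
    proof (intro add_mono)
      show "emeasure lebesgue ?Z1 \<le> ennreal (wk / (\<epsilon> / 3)) * ennreal (2 * A * d)"
        by (rule order_trans[OF T1_approx[OF fg H]]) (use \<epsilon> LH in \<open>auto intro: mult_left_mono\<close>)
      show "emeasure lebesgue ?Z2 \<le> ennreal (wk / (\<epsilon> / (3 * A))) * ennreal d"
        by (rule order_trans[OF T1_approx[OF f F(1,2)]]) (use \<epsilon> A F in \<open>auto intro!: mult_left_mono divide_pos_pos simp: less_imp_le\<close>)
      show "emeasure lebesgue ?Z3 \<le> ennreal (wk / (\<epsilon> / (3 * A))) * ennreal d"
        by (rule order_trans[OF T1_approx[OF g G(1,2)]]) (use \<epsilon> A G in \<open>auto intro!: mult_left_mono divide_pos_pos simp: less_imp_le\<close>)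
    qed
    also have "\<dots> = ennreal (wk / (\<epsilon> / 3) * (2 * A * d) + (wk / (\<epsilon> / (3 * A)) * d + wk / (\<epsilon> / (3 * A)) * d))"
      using wk \<epsilon> A d by (subst ennreal_mult[symmetric], simp, simp)+ (simp add: ennreal_plus[symmetric] del: ennreal_plus)
    also have "wk / (\<epsilon> / 3) * (2 * A * d) + (wk / (\<epsilon> / (3 * A)) * d + wk / (\<epsilon> / (3 * A)) * d) = c * d"
      by (simp add: c_def algebra_simps)
    also have "c * d = e" using c by (simp add: d_def)
    finally have Ze: "emeasure lebesgue ?Z \<le> ennreal e" .
    have ae: "AE x in lebesgue. True \<longrightarrow> \<epsilon> < norm (T1 (\<lambda>y. \<alpha> * f y + \<beta> * g y) x - (\<alpha> * T1 f x + \<beta> * T1 g x)) \<longrightarrow> x \<in> ?Z"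
      using T_lin[OF F(1) G(1), of \<alpha> \<beta>]
    proof eventually_elim
      case (elim x)
      show ?case
      proof (intro impI, rule ccontr)
        assume gt: "\<epsilon> < norm (T1 (\<lambda>y. \<alpha> * f y + \<beta> * g y) x - (\<alpha> * T1 f x + \<beta> * T1 g x))" and "x \<notin> ?Z"
        then have z: "norm (T H x - T1 (\<lambda>y. \<alpha> * f y + \<beta> * g y) x) \<le> \<epsilon> / 3" "norm (T F x - T1 f x) \<le> \<epsilon> / (3 * A)" "norm (T G x - T1 g x) \<le> \<epsilon> / (3 * A)"
          by auto
        have "norm \<alpha> * norm (T F x - T1 f x) \<le> A * (\<epsilon> / (3 * A))" using A z by (intro mult_mono) auto
        then have 1: "norm (\<alpha> * (T F x - T1 f x)) \<le> \<epsilon> / 3" using A by (simp add: norm_mult)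
        have "norm \<beta> * norm (T G x - T1 g x) \<le> A * (\<epsilon> / (3 * A))" using A z by (intro mult_mono) auto
        then have 2: "norm (\<beta> * (T G x - T1 g x)) \<le> \<epsilon> / 3" using A by (simp add: norm_mult)
        define X Y Z where "X = T H x - T1 (\<lambda>y. \<alpha> * f y + \<beta> * g y) x" and "Y = \<alpha> * (T F x - T1 f x)" and "Z = \<beta> * (T G x - T1 g x)"
        have "T1 (\<lambda>y. \<alpha> * f y + \<beta> * g y) x - (\<alpha> * T1 f x + \<beta> * T1 g x) = (Y + Z) - X"
          using elim unfolding X_def Y_def Z_def by (simp add: H_def algebra_simps)
        moreover have "norm ((Y + Z) - X) \<le> (norm Y + norm Z) + norm X"
          by (intro order_trans[OF norm_triangle_ineq4] add_right_mono norm_triangle_ineq)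
        ultimately show False using gt z(1) 1 2 unfolding X_def[symmetric] Y_def[symmetric] Z_def[symmetric] by simp
      qed
    qed
    have "?Z \<in> sets lebesgue" by measurable
    then show "\<exists>Z\<in>sets lebesgue. emeasure lebesgue Z \<le> ennreal e \<and> (AE x in lebesgue. True \<longrightarrow> \<epsilon> < norm (T1 (\<lambda>y. \<alpha> * f y + \<beta> * g y) x - (\<alpha> * T1 f x + \<beta> * T1 g x)) \<longrightarrow> x \<in> Z)"
      using Ze ae by (intro bexI[of _ ?Z] conjI) assumption+
  qed
  then show ?thesis by simp
qed

section \<open>Kernel formula and oscillation of the extension\<close>

lemma integrable_kernel_away:
  assumes g: "integrable lebesgue g" and l: "0 < l" and x: "x \<in> hcube a l" and 0: "\<And>y. y \<in> dil m a l \<Longrightarrow> g y = 0"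
  shows "integrable lebesgue (\<lambda>y. K x y * g y)"
    and "ennreal (norm (\<integral>y. K x y * g y \<partial>lebesgue)) \<le> ennreal (C / l ^ CARD('n)) * L1norm g"
proof -
  have [measurable]: "g \<in> borel_measurable lebesgue" using g by auto
  have le: "norm (K x y * g y) \<le> norm (of_real (C / l ^ CARD('n)) * g y)" for y
  proof (cases "y \<in> dil m a l")
    case False
    have "norm (K x y) \<le> C / l ^ CARD('n)" by (rule kernel_size_outside(1)[OF l x False])
    also have "\<dots> = norm (of_real (C / l ^ CARD('n)) :: complex)" using C l by (subst norm_of_real) simp
    finally show ?thesis by (simp only: norm_mult) (rule mult_right_mono, auto)
  qed (simp add: 0)
  show int: "integrable lebesgue (\<lambda>y. K x y * g y)"
  proof (rule Bochner_Integration.integrable_bound[where f = "\<lambda>y. of_real (C / l ^ CARD('n)) * g y"])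
    show "integrable lebesgue (\<lambda>y. of_real (C / l ^ CARD('n)) * g y)" using g by (rule integrable_mult_right)
  qed (use le in auto)
  have "ennreal (norm (\<integral>y. K x y * g y \<partial>lebesgue)) \<le> (\<integral>\<^sup>+y. ennreal (norm (K x y * g y)) \<partial>lebesgue)"
    by (rule integral_norm_bound_ennreal[OF int])
  also have "\<dots> \<le> (\<integral>\<^sup>+y. ennreal (C / l ^ CARD('n)) * ennreal (norm (g y)) \<partial>lebesgue)"
  proof (rule nn_integral_mono)
    fix y
    have "norm (of_real (C / l ^ CARD('n)) * g y) = C / l ^ CARD('n) * norm (g y)"
      using C l by (simp only: norm_mult norm_of_real) simp
    then show "ennreal (norm (K x y * g y)) \<le> ennreal (C / l ^ CARD('n)) * ennreal (norm (g y))"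
      using le[of y] C l by (subst ennreal_mult[symmetric]) (auto intro: ennreal_leI)
  qed
  also have "\<dots> = ennreal (C / l ^ CARD('n)) * L1norm g" unfolding L1norm_def by (rule nn_integral_cmult) measurable
  finally show "ennreal (norm (\<integral>y. K x y * g y \<partial>lebesgue)) \<le> ennreal (C / l ^ CARD('n)) * L1norm g" .
qed

text \<open>Approximants can be chosen to inherit the zeros of \<open>g\<close>, so the cube is off
  their essential support and their images are kernel integrals there. The images converge in
  measure, and the kernel integrals converge uniformly on the cube, the kernel being at most
  \<open>C / l ^ CARD('n)\<close> off the dilate.\<close>

lemma T1_kernel:
  assumes g: "integrable lebesgue g" and l: "0 < l" and 0: "\<And>y. y \<in> dil m a l \<Longrightarrow> g y = 0"
  shows "AE x in lebesgue. x \<in> hcube a l \<longrightarrow> T1 g x = (\<integral>y. K x y * g y \<partial>lebesgue)"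
proof (rule AE_eq_if_small_cover)
  fix \<epsilon> e :: real assume \<epsilon>: "0 < \<epsilon>" and e: "0 < e"
  note [measurable] = T1_measurable[OF g]
  define D where "D = C / l ^ CARD('n) + 1"
  have D: "0 < D" "C / l ^ CARD('n) \<le> D" using C l by (auto simp: D_def add_nonneg_pos)
  define d where "d = min (e / (wk / (\<epsilon> / 2))) (\<epsilon> / 2 / D)"
  have d: "0 < d" using e \<epsilon> wk D by (simp add: d_def)
  obtain G where G: "L2 G" "integrable lebesgue G" "L1norm (\<lambda>x. G x - g x) < ennreal d" "\<And>x. g x = 0 \<Longrightarrow> G x = 0"
    using L1_approx[OF g d] by blast
  note [measurable] = T_measurable[OF G(1)]
  let ?Z = "{x. \<epsilon> / 2 < norm (T G x - T1 g x)}"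
  have "emeasure lebesgue ?Z \<le> ennreal (wk / (\<epsilon> / 2)) * L1norm (\<lambda>x. G x - g x)"
    by (rule T1_approx[OF g G(1,2)]) (use \<epsilon> in simp)
  also have "\<dots> \<le> ennreal (wk / (\<epsilon> / 2)) * ennreal d" using G(3) by (intro mult_left_mono) auto
  also have "\<dots> \<le> ennreal (wk / (\<epsilon> / 2)) * ennreal (e / (wk / (\<epsilon> / 2)))" by (intro mult_left_mono ennreal_leI) (auto simp: d_def)
  also have "\<dots> = ennreal e" using wk \<epsilon> e by (subst ennreal_mult[symmetric]) auto
  finally have Ze: "emeasure lebesgue ?Z \<le> ennreal e" .
  have ae: "AE x in lebesgue. x \<in> hcube a l \<longrightarrow> \<epsilon> < norm (T1 g x - (\<integral>y. K x y * g y \<partial>lebesgue)) \<longrightarrow> x \<in> ?Z"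
    using T_kernel[OF G(1)]
  proof eventually_elim
    case (elim x)
    show ?case
    proof (intro impI)
      assume x: "x \<in> hcube a l" and gt: "\<epsilon> < norm (T1 g x - (\<integral>y. K x y * g y \<partial>lebesgue))"
      have xd: "x \<in> dil m a l" using x hcube_subset_dil[OF l m(2)] by blast
      have G0: "\<And>y. y \<in> dil m a l \<Longrightarrow> G y = 0" using 0 G(4) by blast
      have "x \<notin> ess_support G"
        unfolding ess_support_def using xd G0 open_dil by (auto intro!: exI[of _ "dil m a l"])
      then have TG: "T G x = (\<integral>y. K x y * G y \<partial>lebesgue)" using elim by simp
      have int: "integrable lebesgue (\<lambda>y. K x y * g y)" "integrable lebesgue (\<lambda>y. K x y * G y)"
        using integrable_kernel_away(1)[OF g l x 0] integrable_kernel_away(1)[OF G(2) l x G0] by auto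
      have "T G x - (\<integral>y. K x y * g y \<partial>lebesgue) = (\<integral>y. K x y * (G y - g y) \<partial>lebesgue)"
        unfolding TG right_diff_distrib using int by (subst Bochner_Integration.integral_diff) auto
      then have "ennreal (norm (T G x - (\<integral>y. K x y * g y \<partial>lebesgue))) \<le> ennreal (C / l ^ CARD('n)) * L1norm (\<lambda>y. G y - g y)"
        using integrable_kernel_away(2)[OF Bochner_Integration.integrable_diff[OF G(2) g] l x] 0 G0 by simp
      also have "\<dots> \<le> ennreal D * ennreal (\<epsilon> / 2 / D)"
      proof (intro mult_mono ennreal_leI D)
        show "L1norm (\<lambda>y. G y - g y) \<le> ennreal (\<epsilon> / 2 / D)"
          by (rule order_trans[OF less_imp_le[OF G(3)] ennreal_leI]) (simp add: d_def)
      qed auto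
      also have "\<dots> = ennreal (\<epsilon> / 2)" using D \<epsilon> by (subst ennreal_mult[symmetric]) auto
      finally have "norm (T G x - (\<integral>y. K x y * g y \<partial>lebesgue)) \<le> \<epsilon> / 2" using \<epsilon> by simp
      then show "x \<in> ?Z"
        using gt norm_triangle_ineq[of "T1 g x - T G x" "T G x - (\<integral>y. K x y * g y \<partial>lebesgue)"] by (auto simp: norm_minus_commute)
    qed
  qed
  have "?Z \<in> sets lebesgue" by measurable
  then show "\<exists>Z\<in>sets lebesgue. emeasure lebesgue Z \<le> ennreal e \<and> (AE x in lebesgue. x \<in> hcube a l \<longrightarrow> \<epsilon> < norm (T1 g x - (\<integral>y. K x y * g y \<partial>lebesgue)) \<longrightarrow> x \<in> Z)"
    using Ze ae by (intro bexI[of _ ?Z] conjI) assumption+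
qed

text \<open>The maximal function is evaluated at the reference point \<open>x'\<close>, which
  \<open>far_bound\<close> selects where it is small, while \<open>x\<close> runs through the whole
  cube.\<close>

lemma T1_oscillation:
  assumes g: "integrable lebesgue g" and l: "0 < l" and 0: "\<And>y. y \<in> dil m a l \<Longrightarrow> g y = 0"
    and x: "x \<in> hcube a l" "x' \<in> hcube a l"
  shows "ennreal (norm ((\<integral>y. K x' y * g y \<partial>lebesgue) - (\<integral>y. K x y * g y \<partial>lebesgue))) \<le>
    ennreal (C' * annC) * Mx lebesgue (\<lambda>y. ennreal (norm (g y))) x'"
proof -
  have [measurable]: "g \<in> borel_measurable lebesgue" using g by auto
  have int: "integrable lebesgue (\<lambda>y. K x y * g y)" "integrable lebesgue (\<lambda>y. K x' y * g y)"
    using integrable_kernel_away(1)[OF g l x(1) 0] integrable_kernel_away(1)[OF g l x(2) 0] by auto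
  have "ennreal (norm ((\<integral>y. K x' y * g y \<partial>lebesgue) - (\<integral>y. K x y * g y \<partial>lebesgue))) =
    ennreal (norm (\<integral>y. K x' y * g y - K x y * g y \<partial>lebesgue))"
    using int by (subst Bochner_Integration.integral_diff) auto
  also have "\<dots> \<le> (\<integral>\<^sup>+y. ennreal (norm (K x' y * g y - K x y * g y)) \<partial>lebesgue)"
    using int by (intro integral_norm_bound_ennreal Bochner_Integration.integrable_diff)
  also have "\<dots> \<le> (\<integral>\<^sup>+y. ennreal C' * (ennreal (l powr \<delta> / norm (x - y) powr (CARD('n) + \<delta>)) * ennreal (norm (g y)) * indicator (- dil m a l) y) \<partial>lebesgue)"
  proof (rule nn_integral_mono)
    fix y
    show "ennreal (norm (K x' y * g y - K x y * g y)) \<le> ennreal C' * (ennreal (l powr \<delta> / norm (x - y) powr (CARD('n) + \<delta>)) * ennreal (norm (g y)) * indicator (- dil m a l) y)"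
    proof (cases "y \<in> dil m a l")
      case False
      have "norm (K x' y * g y - K x y * g y) = norm (K x' y - K x y) * norm (g y)" by (simp add: norm_mult[symmetric] left_diff_distrib)
      also have "\<dots> \<le> C' * (l powr \<delta> / norm (x - y) powr (real CARD('n) + \<delta>)) * norm (g y)"
        by (intro mult_right_mono kernel_oscillation(1)[OF l x False]) simp
      finally have "ennreal (norm (K x' y * g y - K x y * g y)) \<le> ennreal (C' * (l powr \<delta> / norm (x - y) powr (real CARD('n) + \<delta>)) * norm (g y))"
        by (rule ennreal_leI)
      also have "\<dots> = ennreal C' * (ennreal (l powr \<delta> / norm (x - y) powr (CARD('n) + \<delta>)) * ennreal (norm (g y)))"
        by (simp only: mult.assoc ennreal_mult'[OF C'] ennreal_mult''[OF norm_ge_zero])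
      finally show ?thesis using False by simp
    qed (simp add: 0)
  qed
  also have "\<dots> = ennreal C' * (\<integral>\<^sup>+y\<in>- dil m a l. ennreal (l powr \<delta> / norm (x - y) powr (CARD('n) + \<delta>)) * ennreal (norm (g y)) \<partial>lebesgue)"
  proof (rule nn_integral_cmult)
    have [measurable]: "(\<lambda>y. norm (x - y)) \<in> borel_measurable lebesgue"
      by (intro measurable_lebesgue_continuous continuous_intros)
    show "(\<lambda>y. ennreal (l powr \<delta> / norm (x - y) powr (CARD('n) + \<delta>)) * ennreal (norm (g y)) * indicator (- dil m a l) y) \<in> borel_measurable lebesgue"
      by measurable
  qed
  also have "\<dots> \<le> ennreal C' * (ennreal annC * Mx lebesgue (\<lambda>y. ennreal (norm (g y))) x')"
    unfolding annC_def by (intro mult_left_mono annuli_bound[OF l m(1) \<delta> x]) auto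
  also have "\<dots> = ennreal (C' * annC) * Mx lebesgue (\<lambda>y. ennreal (norm (g y))) x'"
    using C' annC by (simp add: ennreal_mult mult.assoc)
  finally show ?thesis .
qed

section \<open>Exceptional sets and the far part\<close>

text \<open>\<open>A1\<close> is so large that the exceptional sets of two functions, measured
  against their averages over the dilate of a cube, fill together at most \<open>2^(-(n+2))\<close>
  of the cube. \<open>A3\<close> leaves a quarter of a cube for the exceptional set of the near
  part. \<open>A2\<close> adds up, in \<open>far_bound\<close>, the contributions of
  \<open>T1 g\<close>, of the near part and of the oscillation.\<close>

definition A1 :: real where "A1 = 2 * (wk + 3 ^ CARD('n)) * (2 * m + 1) ^ CARD('n) * 2 ^ (CARD('n) + 2)"
definition A3 :: real where "A3 = 4 * wk * (2 * m + 1) ^ CARD('n)"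
definition A2 :: real where "A2 = A1 * (1 + A3 + C' * annC)"

lemma A_pos: "0 < A1" "0 < A3" "A1 \<le> A2"
proof -
  show 1: "0 < A1" unfolding A1_def using wk m by (intro mult_pos_pos add_pos_pos zero_less_power) auto
  show 3: "0 < A3" unfolding A3_def using wk m by (intro mult_pos_pos add_pos_pos zero_less_power) auto
  show "A1 \<le> A2" unfolding A2_def using 1 3 C' annC by (simp add: mult_le_cancel_left1)
qed

definition Eset :: "(real ^ 'n \<Rightarrow> complex) \<Rightarrow> real \<Rightarrow> (real ^ 'n) set" where
  "Eset g \<gamma> = {x. A1 * \<gamma> < norm (T1 g x)} \<union> {x. ennreal (A1 * \<gamma>) < Mx lebesgue (\<lambda>y. ennreal (norm (g y))) x}"

lemma Eset_sets: "integrable lebesgue g \<Longrightarrow> Eset g \<gamma> \<in> sets lebesgue"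
proof -
  assume g: "integrable lebesgue g"
  note [measurable] = T1_measurable[OF g]
  show ?thesis unfolding Eset_def by measurable
qed

text \<open>For \<open>\<gamma> = 0\<close> there is no positive height at which to use the weak
  type bound. Then \<open>L = 0\<close>, each set where \<open>u\<close> exceeds
  \<open>1 / (k + 1)\<close> is null, and these sets exhaust the set where \<open>u\<close> is
  positive.\<close>

lemma superlevel_from_weak:
  fixes u :: "real ^ 'n \<Rightarrow> ennreal"
  assumes um: "u \<in> borel_measurable lebesgue"
    and weak: "\<And>\<alpha>::real. 0 < \<alpha> \<Longrightarrow> emeasure lebesgue {x. ennreal \<alpha> < u x} \<le> ennreal (\<kappa> / \<alpha>) * L"
    and L: "L \<le> ennreal (\<gamma> * r)" and pos: "0 \<le> \<gamma>" "0 < r" "0 < A" "0 \<le> \<kappa>"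
  shows "emeasure lebesgue {x. ennreal (A * \<gamma>) < u x} \<le> ennreal (\<kappa> * r / A)"
proof (cases "\<gamma> = 0")
  case True
  then have L0: "L = 0" using L by simp
  have "{x. ennreal (1 / real (Suc k)) < u x} \<in> null_sets lebesgue" for k
    using weak[of "1 / real (Suc k)"] L0 superlevel_sets_ennreal[OF um] by (auto simp: null_sets_def)
  then have "(\<Union>k. {x. ennreal (1 / real (Suc k)) < u x}) \<in> null_sets lebesgue" by (intro null_sets_UN) auto
  moreover have "{x. ennreal (A * \<gamma>) < u x} \<subseteq> (\<Union>k. {x. ennreal (1 / real (Suc k)) < u x})"
  proof
    fix x assume "x \<in> {x. ennreal (A * \<gamma>) < u x}"
    then have "0 < u x" using True by simp
    then obtain e where e: "0 < e" "ennreal e < u x"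
      by (metis ennreal_cases ennreal_less_top ennreal_lessI dense field_lbound_gt_zero gt_ex zero_less_one less_ennreal.rep_eq ennreal_less_zero_iff le_less_trans less_imp_le zero_le)
    obtain n where "1 / real (Suc n) < e" using nat_approx_posE[OF e(1)] by blast
    then have "ennreal (1 / real (Suc n)) \<le> ennreal e" by (intro ennreal_leI) simp
    then show "x \<in> (\<Union>k. {x. ennreal (1 / real (Suc k)) < u x})" using e(2) by (auto intro: le_less_trans)
  qed
  ultimately have "emeasure lebesgue {x. ennreal (A * \<gamma>) < u x} = 0"
    by (metis (no_types, lifting) emeasure_eq_0 null_setsD1 null_setsD2)
  then show ?thesis by simp
next
  case False
  then have g: "0 < \<gamma>" using pos by simp
  have "emeasure lebesgue {x. ennreal (A * \<gamma>) < u x} \<le> ennreal (\<kappa> / (A * \<gamma>)) * L"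
    using weak[of "A * \<gamma>"] g pos by simp
  also have "\<dots> \<le> ennreal (\<kappa> / (A * \<gamma>)) * ennreal (\<gamma> * r)" by (intro mult_left_mono L) simp
  also have "\<dots> = ennreal (\<kappa> * r / A)" using g pos by (simp add: ennreal_mult[symmetric])
  finally show ?thesis .
qed

lemma T1_superlevel:
  assumes g: "integrable lebesgue g" and L: "L1norm g \<le> ennreal (\<gamma> * r)" and pos: "0 \<le> \<gamma>" "0 < r" "0 < A"
  shows "emeasure lebesgue {x. A * \<gamma> < norm (T1 g x)} \<le> ennreal (wk * r / A)"
proof -
  note [measurable] = T1_measurable[OF g]
  have eq: "{x. \<alpha> < norm (T1 g x)} = {x. ennreal \<alpha> < ennreal (norm (T1 g x))}" if "0 \<le> \<alpha>" for \<alpha>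
    using that by (auto simp: ennreal_less_iff)
  have "emeasure lebesgue {x. ennreal (A * \<gamma>) < ennreal (norm (T1 g x))} \<le> ennreal (wk * r / A)"
  proof (rule superlevel_from_weak[OF _ _ L pos])
    fix \<alpha> :: real assume "0 < \<alpha>"
    then show "emeasure lebesgue {x. ennreal \<alpha> < ennreal (norm (T1 g x))} \<le> ennreal (wk / \<alpha>) * L1norm g"
      using T1_weak_type[OF g \<open>0 < \<alpha>\<close>] eq[of \<alpha>] by simp
  qed (use wk in auto)
  then show ?thesis using eq[of "A * \<gamma>"] pos by simp
qed

lemma Eset_small:
  assumes g: "integrable lebesgue g" and L: "L1norm g \<le> ennreal (\<gamma> * r)" and pos: "0 \<le> \<gamma>" "0 < r"
  shows "emeasure lebesgue (Eset g \<gamma>) \<le> ennreal ((wk + 3 ^ CARD('n)) * r / A1)"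
proof -
  have [measurable]: "g \<in> borel_measurable lebesgue" using g by auto
  note [measurable] = T1_measurable[OF g]
  have M: "emeasure lebesgue {x. ennreal (A1 * \<gamma>) < Mx lebesgue (\<lambda>y. ennreal (norm (g y))) x} \<le> ennreal (3 ^ CARD('n) * r / A1)"
  proof (rule superlevel_from_weak[OF _ _ L pos A_pos(1)])
    fix \<alpha> :: real assume \<alpha>: "0 < \<alpha>"
    let ?S = "{x. ennreal \<alpha> < Mx lebesgue (\<lambda>y. ennreal (norm (g y))) x}"
    have "emeasure lebesgue ?S = ennreal (1 / \<alpha>) * (ennreal \<alpha> * emeasure lebesgue ?S)"
      using \<alpha> by (simp add: mult.assoc[symmetric] ennreal_mult[symmetric])
    also have "\<dots> \<le> ennreal (1 / \<alpha>) * (ennreal (3 ^ CARD('n)) * L1norm g)"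
      unfolding L1norm_def by (intro mult_left_mono Mx_weak_type[OF doubling_lebesgue]) measurable
    also have "\<dots> = ennreal (3 ^ CARD('n) / \<alpha>) * L1norm g" using \<alpha> by (simp add: mult.assoc[symmetric] ennreal_mult[symmetric])
    finally show "emeasure lebesgue ?S \<le> ennreal (3 ^ CARD('n) / \<alpha>) * L1norm g" .
  qed measurable
  have "emeasure lebesgue (Eset g \<gamma>) \<le> emeasure lebesgue {x. A1 * \<gamma> < norm (T1 g x)} + emeasure lebesgue {x. ennreal (A1 * \<gamma>) < Mx lebesgue (\<lambda>y. ennreal (norm (g y))) x}"
    unfolding Eset_def by (rule emeasure_subadditive) measurable
  also have "\<dots> \<le> ennreal (wk * r / A1) + ennreal (3 ^ CARD('n) * r / A1)"
    by (intro add_mono M T1_superlevel[OF g L pos A_pos(1)])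
  also have "\<dots> = ennreal ((wk + 3 ^ CARD('n)) * r / A1)"
    using wk pos A_pos by (simp add: ennreal_plus[symmetric] add_divide_distrib distrib_right del: ennreal_plus)
  finally show ?thesis .
qed

lemma Mx_mono: "(\<And>y. h y \<le> h' y) \<Longrightarrow> Mx N h x \<le> Mx N h' x"
  unfolding Mx_def by (intro SUP_mono') (auto split: prod.splits intro!: divide_right_mono_ennreal nn_integral_mono mult_right_mono)

text \<open>A point of the cube outside the exceptional sets at which the far part is small exists because
  the exceptional sets do not fill the cube; the kernel oscillation transfers the bound to the whole cube.\<close>

lemma far_bound:
  assumes g: "integrable lebesgue g" and s: "0 < s" and \<gamma>: "0 \<le> \<gamma>"
    and half: "2 * emeasure lebesgue (hcube c s \<inter> Eset g \<gamma>) \<le> emeasure lebesgue (hcube c s)"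
  shows "AE x in lebesgue. x \<in> hcube c s \<longrightarrow> norm (T1 (\<lambda>y. indicator (- hdil m c s) y *\<^sub>R g y) x) \<le> A2 * \<gamma>"
proof -
  have gm [measurable]: "g \<in> borel_measurable lebesgue" using g by auto
  have hdm [measurable]: "hdil m c s \<in> sets lebesgue" by (simp add: hdil_def)
  define near where "near = (\<lambda>y. indicator (hdil m c s) y *\<^sub>R g y)"
  define far where "far = (\<lambda>y. indicator (- hdil m c s) y *\<^sub>R g y)"
  have near: "integrable lebesgue near" unfolding near_def by (intro integrable_mult_indicator g) auto
  have far: "integrable lebesgue far" unfolding far_def by (intro integrable_mult_indicator g) (simp add: Compl_in_sets_lebesgue)
  have far_eq: "far = (\<lambda>y. 1 * g y + (-1) * near y)" by (auto simp: far_def near_def indicator_def)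
  note [measurable] = T1_measurable[OF near] T1_measurable[OF far] T1_measurable[OF g] Eset_sets[OF g]
  define r where "r = ((2 * m + 1) * s) ^ CARD('n)"
  have r: "0 < r" unfolding r_def using s m by (intro zero_less_power mult_pos_pos) auto
  have dilr: "emeasure lebesgue (dil m c s) = ennreal r" unfolding r_def using s m by (intro emeasure_dil) auto
  have dil_hdil: "dil m c s \<subseteq> hdil m c s" by (simp add: dil_def hdil_def ocube_subset_hcube)
  have "L1norm near < top" using near by (simp add: integrable_iff_L1norm)
  then obtain r0 where r0: "L1norm near = ennreal r0" "0 \<le> r0" by (cases "L1norm near") auto
  \<comment> \<open>The average of \<open>\<bar>g\<bar>\<close> over the dilate. It is at most the
    maximal function of \<open>g\<close> at every point of the cube, hence at most
    \<open>A1 * \<gamma>\<close> as soon as one point off \<open>Eset g \<gamma>\<close> is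
    found.\<close>
  define \<gamma>' where "\<gamma>' = r0 / r"
  have \<gamma>': "0 \<le> \<gamma>'" "L1norm near \<le> ennreal (\<gamma>' * r)" using r0 r by (auto simp: \<gamma>'_def)
  define Z where "Z = {x. A3 * \<gamma>' < norm (T1 near x)}"
  have Zm [measurable]: "Z \<in> sets lebesgue" unfolding Z_def by measurable
  have Zle: "emeasure lebesgue Z \<le> ennreal (s ^ CARD('n) / 4)"
  proof -
    have "emeasure lebesgue Z \<le> ennreal (wk * r / A3)"
      unfolding Z_def by (rule T1_superlevel[OF near \<gamma>'(2,1) r A_pos(2)])
    also have "wk * r / A3 = s ^ CARD('n) / 4"
      using wk m unfolding A3_def r_def by (simp add: power_mult_distrib)
    finally show ?thesis .
  qed
  have avg_M: "ennreal \<gamma>' \<le> Mx lebesgue (\<lambda>y. ennreal (norm (g y))) x" if x: "x \<in> hcube c s" for x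
  proof -
    have xd: "x \<in> dil m c s" using x hcube_subset_dil[OF s m(2)] by blast
    have "L1norm near = (\<integral>\<^sup>+y\<in>dil m c s. ennreal (norm (g y)) \<partial>lebesgue)"
      unfolding L1norm_def near_def hdil_def dil_def
      by (rule nn_integral_cong_AE, use AE_ccube_hcube_ocube[of "\<chi> i. c $ i - m * s" "(2 * m + 1) * s"] in eventually_elim) (auto simp: indicator_def)
    then have "ennreal \<gamma>' = (\<integral>\<^sup>+y\<in>dil m c s. ennreal (norm (g y)) \<partial>lebesgue) / emeasure lebesgue (dil m c s)"
      using r0 r unfolding dilr \<gamma>'_def by (simp add: divide_ennreal[symmetric])
    also have "\<dots> \<le> Mx lebesgue (\<lambda>y. ennreal (norm (g y))) x"
      using xd s m unfolding dil_def by (intro Mx_ge mult_pos_pos) auto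
    finally show ?thesis .
  qed
  have far0: "far y = 0" if "y \<in> dil m c s" for y using that dil_hdil by (auto simp: far_def)
  have kern: "AE x in lebesgue. x \<in> hcube c s \<longrightarrow> T1 far x = (\<integral>y. K x y * far y \<partial>lebesgue)"
    by (rule T1_kernel[OF far s far0])
  have lin: "AE x in lebesgue. T1 far x = T1 g x - T1 near x"
    using T1_lincomb[OF g near, of 1 "-1"] unfolding far_eq by simp
  have "AE x in lebesgue. (x \<in> hcube c s \<longrightarrow> T1 far x = (\<integral>y. K x y * far y \<partial>lebesgue)) \<and> T1 far x = T1 g x - T1 near x"
    using kern lin by eventually_elim simp
  \<comment> \<open>The kernel formula and linearity hold off a null set, but are used at one
    particular point; so the null set joins the sets that this point must avoid.\<close>
  then obtain W where W0: "{x \<in> space lebesgue. \<not> ((x \<in> hcube c s \<longrightarrow> T1 far x = (\<integral>y. K x y * far y \<partial>lebesgue)) \<and> T1 far x = T1 g x - T1 near x)} \<subseteq> W"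
    "emeasure lebesgue W = 0" "W \<in> sets lebesgue"
    by (rule AE_E)
  then have W: "W \<in> null_sets lebesgue" "{x. \<not> ((x \<in> hcube c s \<longrightarrow> T1 far x = (\<integral>y. K x y * far y \<partial>lebesgue)) \<and> T1 far x = T1 g x - T1 near x)} \<subseteq> W"
    by auto
  \<comment> \<open>The three sets exclude at most one half, one quarter and nothing of the volume
    of the cube.\<close>
  have "\<exists>x'. x' \<in> hcube c s \<and> x' \<notin> Eset g \<gamma> \<and> x' \<notin> Z \<and> x' \<notin> W"
  proof (rule ccontr)
    assume "\<not> ?thesis"
    then have "hcube c s \<subseteq> (hcube c s \<inter> Eset g \<gamma>) \<union> (Z \<union> W)" by blast
    then have "emeasure lebesgue (hcube c s) \<le> emeasure lebesgue ((hcube c s \<inter> Eset g \<gamma>) \<union> (Z \<union> W))"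
      using W by (intro emeasure_mono) auto
    also have "\<dots> \<le> emeasure lebesgue (hcube c s \<inter> Eset g \<gamma>) + (emeasure lebesgue Z + emeasure lebesgue W)"
      using W by (intro order_trans[OF emeasure_subadditive] add_left_mono emeasure_subadditive) auto
    also have "\<dots> \<le> emeasure lebesgue (hcube c s \<inter> Eset g \<gamma>) + ennreal (s ^ CARD('n) / 4)"
      using Zle W by (intro add_left_mono) (auto simp: null_setsD1)
    finally have le: "ennreal (s ^ CARD('n)) \<le> emeasure lebesgue (hcube c s \<inter> Eset g \<gamma>) + ennreal (s ^ CARD('n) / 4)"
      using s by (simp add: emeasure_hcube)
    have "emeasure lebesgue (hcube c s \<inter> Eset g \<gamma>) \<le> emeasure lebesgue (hcube c s)" by (intro emeasure_mono) auto
    then obtain v where v: "emeasure lebesgue (hcube c s \<inter> Eset g \<gamma>) = ennreal v" "0 \<le> v"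
      using s by (cases "emeasure lebesgue (hcube c s \<inter> Eset g \<gamma>)") (auto simp: emeasure_hcube top_unique)
    have "2 * v \<le> s ^ CARD('n)"
      using half s v by (simp add: emeasure_hcube ennreal_numeral[symmetric] ennreal_mult[symmetric] del: ennreal_numeral)
    moreover have "s ^ CARD('n) \<le> v + s ^ CARD('n) / 4"
      using le v s by (simp add: ennreal_plus[symmetric] del: ennreal_plus)
    moreover have "0 < s ^ CARD('n)" using s by simp
    ultimately show False by linarith
  qed
  then obtain x' where x': "x' \<in> hcube c s" "x' \<notin> Eset g \<gamma>" "x' \<notin> Z" "x' \<notin> W" by blast
  have M': "Mx lebesgue (\<lambda>y. ennreal (norm (g y))) x' \<le> ennreal (A1 * \<gamma>)" and T': "norm (T1 g x') \<le> A1 * \<gamma>"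
    using x'(2) by (auto simp: Eset_def not_less)
  have "ennreal \<gamma>' \<le> ennreal (A1 * \<gamma>)" using avg_M[OF x'(1)] M' by (rule order_trans)
  then have g': "\<gamma>' \<le> A1 * \<gamma>" using A_pos \<gamma> by simp
  have "norm (T1 near x') \<le> A3 * \<gamma>'" using x'(3) by (simp add: Z_def not_less)
  also have "\<dots> \<le> A3 * (A1 * \<gamma>)" using g' A_pos by (intro mult_left_mono) auto
  finally have n': "norm (T1 near x') \<le> A3 * (A1 * \<gamma>)" .
  have far': "T1 far x' = T1 g x' - T1 near x'" "T1 far x' = (\<integral>y. K x' y * far y \<partial>lebesgue)"
    using W(2) x'(1,4) by auto
  have f': "norm (T1 far x') \<le> A1 * \<gamma> + A3 * (A1 * \<gamma>)"
    unfolding far'(1) using norm_triangle_ineq4[of "T1 g x'" "T1 near x'"] T' n' by linarith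
  show ?thesis
    using kern unfolding far_def[symmetric]
  proof eventually_elim
    case (elim x)
    show ?case
    proof
      assume x: "x \<in> hcube c s"
      have "ennreal (norm ((\<integral>y. K x' y * far y \<partial>lebesgue) - (\<integral>y. K x y * far y \<partial>lebesgue))) \<le> ennreal (C' * annC) * Mx lebesgue (\<lambda>y. ennreal (norm (far y))) x'"
        by (rule T1_oscillation[OF far s far0 x x'(1)])
      also have "\<dots> \<le> ennreal (C' * annC) * ennreal (A1 * \<gamma>)"
        by (intro mult_left_mono order_trans[OF Mx_mono M']) (auto simp: far_def indicator_def)
      also have "\<dots> = ennreal (C' * annC * (A1 * \<gamma>))" using C' annC A_pos \<gamma> by (simp add: ennreal_mult[symmetric])
      finally have "norm (T1 far x' - T1 far x) \<le> C' * annC * (A1 * \<gamma>)"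
        using elim x far'(2) C' annC A_pos \<gamma> by simp
      then have "norm (T1 far x) \<le> C' * annC * (A1 * \<gamma>) + (A1 * \<gamma> + A3 * (A1 * \<gamma>))"
        using f' norm_triangle_ineq2[of "T1 far x" "T1 far x'"] by (simp add: norm_minus_commute)
      then show "norm (T1 far x) \<le> A2 * \<gamma>" by (simp add: A2_def algebra_simps)
    qed
  qed
qed

text \<open>Ensures that a function restricted to the large dilate and then cut off on the small one
  is the difference of two restrictions.\<close>

lemma hdil_mono:
  fixes a c :: "real ^ 'n"
  assumes s: "0 < s" and sub: "hcube c s \<subseteq> hcube a l"
  shows "hdil m c s \<subseteq> hdil m a l"
proof
  fix x assume x: "x \<in> hdil m c s"
  have l: "s \<le> l" and ca: "a $ i \<le> c $ i" "c $ i + s \<le> a $ i + l" for i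
  proof -
    have "c \<in> hcube a l" using sub corner_in_hcube[OF s] by blast
    then show lo: "a $ i \<le> c $ i" for i by (simp add: hcube_def)
    show up: "c $ i + s \<le> a $ i + l" for i
    proof (rule ccontr)
      assume n: "\<not> c $ i + s \<le> a $ i + l"
      \<comment> \<open>The corner with its i-th coordinate moved to the upper face of the large
        cube, which is excluded there, unless it is already beyond. The point still belongs to the
        small cube.\<close>
      define y where "y = (\<chi> j. if j = i then max (c $ i) (a $ i + l) else c $ j)"
      have "y \<in> hcube c s" using n s by (auto simp: hcube_def y_def)
      then have "y \<in> hcube a l" using sub by blast
      then have "y $ i < a $ i + l" by (simp add: hcube_def)
      then show False by (simp add: y_def)
    qed
    \<comment> \<open>The side lengths can be compared along any coordinate;
      \<open>undefined\<close> names one.\<close>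
    show "s \<le> l" using lo[of undefined] up[of undefined] by linarith
  qed
  have "m * s \<le> m * l" using m l by simp
  moreover have "c $ i - m * s \<le> x $ i" "x $ i < c $ i + s + m * s" for i
    using x by (auto simp: hdil_def hcube_def algebra_simps)
  ultimately have "a $ i - m * l \<le> x $ i" "x $ i < a $ i + l + m * l" for i
    using ca[of i] by (meson add_mono diff_mono le_less_trans less_le_trans order_trans)+
  then show "x \<in> hdil m a l" by (auto simp: hdil_def hcube_def algebra_simps)
qed

section \<open>The sparse bound for the commutator\<close>

definition restr :: "(real ^ 'n) set \<Rightarrow> (real ^ 'n \<Rightarrow> complex) \<Rightarrow> real ^ 'n \<Rightarrow> complex" where
  "restr S f y = indicator S y *\<^sub>R f y"

text \<open>With \<open>T1\<close> in both terms, linearity on L1 applies throughout. For bounded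
  \<open>f\<close> of compact support it equals \<open>commutator b T f\<close> almost
  everywhere.\<close>

definition comm :: "(real ^ 'n \<Rightarrow> complex) \<Rightarrow> (real ^ 'n \<Rightarrow> complex) \<Rightarrow> real ^ 'n \<Rightarrow> complex" where
  "comm b f x = b x * T1 f x - T1 (\<lambda>y. b y * f y) x"

text \<open>Multiplication by a constant commutes with \<open>T1\<close>. With \<open>c\<close> the
  average of \<open>b\<close> over the dilate, only the oscillation of \<open>b\<close> remains in
  the estimates.\<close>

lemma comm_shift:
  assumes f: "integrable lebesgue f" and bf: "integrable lebesgue (\<lambda>y. b y * f y)"
  shows "AE x in lebesgue. comm b f x = (b x - c) * T1 f x - T1 (\<lambda>y. (b y - c) * f y) x"
proof -
  have eq: "(\<lambda>y. (b y - c) * f y) = (\<lambda>y. 1 * (b y * f y) + (- c) * f y)" by (auto simp: algebra_simps)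
  show ?thesis
    using T1_lincomb[OF bf f, of 1 "- c"] unfolding eq[symmetric] comm_def
    by eventually_elim (simp add: algebra_simps)
qed

text \<open>A bounded \<open>f\<close> on a cube is dominated by a constant, and its product with
  \<open>b\<close> by a multiple of \<open>b\<close>, which is integrable there.\<close>

lemma restr_integrable:
  fixes a' :: "real ^ 'n"
  assumes b: "integrable_on_cubes b" and fm: "f \<in> borel_measurable lebesgue" and fb: "\<And>x. norm (f x) \<le> Mf"
    and S: "S = hcube a' l'" "0 < l'"
  shows "integrable lebesgue (restr S f)" "integrable lebesgue (\<lambda>y. b y * restr S f y)" "integrable lebesgue (\<lambda>y. (b y - c) * restr S f y)"
proof -
  have bm [measurable]: "b \<in> borel_measurable lebesgue" and bi: "\<And>a l. set_integrable lebesgue (hcube a l) b"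
    using b by (auto simp: integrable_on_cubes_def)
  note [measurable] = fm
  have Mf: "0 \<le> Mf" using fb[of 0] norm_ge_zero order_trans by blast
  have Sm [measurable]: "S \<in> sets lebesgue" unfolding S by simp
  have one: "integrable lebesgue (\<lambda>y. indicator S y *\<^sub>R (of_real Mf :: complex))"
    using S by (intro integrable_scaleR_left) (auto simp: integrable_indicator_iff emeasure_hcube)
  show 1: "integrable lebesgue (restr S f)"
  proof (rule Bochner_Integration.integrable_bound[OF one])
    show "restr S f \<in> borel_measurable lebesgue" unfolding restr_def by measurable
    show "AE x in lebesgue. norm (restr S f x) \<le> norm (indicator S x *\<^sub>R (of_real Mf :: complex))"
      using fb Mf by (intro AE_I2) (auto simp: restr_def indicator_def)
  qed
  have bS: "integrable lebesgue (\<lambda>y. of_real Mf * (indicator S y *\<^sub>R b y))"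
    using bi[of a' l'] unfolding S set_integrable_def by (rule integrable_mult_right)
  show 2: "integrable lebesgue (\<lambda>y. b y * restr S f y)"
  proof (rule Bochner_Integration.integrable_bound[OF bS])
    show "(\<lambda>y. b y * restr S f y) \<in> borel_measurable lebesgue" unfolding restr_def by measurable
    show "AE x in lebesgue. norm (b x * restr S f x) \<le> norm (of_real Mf * (indicator S x *\<^sub>R b x))"
    proof (rule AE_I2)
      fix x
      show "norm (b x * restr S f x) \<le> norm (of_real Mf * (indicator S x *\<^sub>R b x))"
        using mult_left_mono[OF fb[of x] norm_ge_zero[of "b x"]] Mf by (auto simp: restr_def indicator_def norm_mult mult.commute)
    qed
  qed
  show "integrable lebesgue (\<lambda>y. (b y - c) * restr S f y)"
    using Bochner_Integration.integrable_diff[OF 2 integrable_mult_right[OF 1, of c]] by (simp add: left_diff_distrib)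
qed

text \<open>Stop at the dyadic cubes in which the exceptional set has density above
  \<open>2^(-(n+1))\<close>. Its total measure, at most \<open>2^(-(n+2))\<close> of the cube,
  confines the stopping cubes to half of the cube; and since parents are good, its density in a
  stopping cube is at most one half, as \<open>far_bound\<close> requires. There \<open>f\<close> on
  the large dilate splits into \<open>f\<close> on the small dilate, which continues the recursion,
  and a far part.\<close>

lemma comm_recursion:
  fixes a :: "real ^ 'n"
  assumes b: "integrable_on_cubes b" and fm: "f \<in> borel_measurable lebesgue" and fb: "\<And>x. norm (f x) \<le> Mf" and l: "0 < l"
  defines "R \<equiv> hdil m a l"
  defines "\<gamma>1 \<equiv> enn2real (L1norm (restr R f)) / ((2 * m + 1) * l) ^ CARD('n)"
  defines "\<gamma>2 \<equiv> enn2real (L1norm (\<lambda>y. (b y - average R b) * restr R f y)) / ((2 * m + 1) * l) ^ CARD('n)"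
  shows "\<exists>\<G>. countable \<G> \<and> disjoint_family_on (\<lambda>(c, s). hcube c s) \<G> \<and>
      (\<forall>(c, s)\<in>\<G>. 0 < s \<and> hcube c s \<subseteq> hcube a l) \<and>
      2 * emeasure lebesgue (\<Union>(c, s)\<in>\<G>. hcube c s) \<le> emeasure lebesgue (hcube a l) \<and>
      (AE x in lebesgue. x \<in> hcube a l - (\<Union>(c, s)\<in>\<G>. hcube c s) \<longrightarrow>
         norm (comm b (restr R f) x) \<le> A2 * (norm (b x - average R b) * \<gamma>1 + \<gamma>2)) \<and>
      (\<forall>(c, s)\<in>\<G>. AE x in lebesgue. x \<in> hcube c s \<longrightarrow>
         norm (comm b (restr R f) x) \<le> A2 * (norm (b x - average R b) * \<gamma>1 + \<gamma>2) + norm (comm b (restr (hdil m c s) f) x))"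
proof -
  note restr_int = restr_integrable[OF b fm fb]
  define cR where "cR = average R b"
  define s0 where "s0 = (2 * m + 1) * l"
  define r where "r = s0 ^ CARD('n)"
  have s0: "0 < s0" unfolding s0_def using m l by (intro mult_pos_pos) auto
  have r: "0 < r" unfolding r_def using s0 by simp
  have Rh: "R = hcube (\<chi> i. a $ i - m * l) s0" by (simp add: R_def hdil_def s0_def)
  define g1 where "g1 = restr R f"
  define g2 where "g2 = (\<lambda>y. (b y - cR) * restr R f y)"
  have g1: "integrable lebesgue g1" unfolding g1_def by (rule restr_int(1)[OF Rh s0])
  have g2: "integrable lebesgue g2" unfolding g2_def by (rule restr_int(3)[OF Rh s0])
  have \<gamma>1: "0 \<le> \<gamma>1" "L1norm g1 \<le> ennreal (\<gamma>1 * r)"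
  proof -
    have "L1norm g1 < top" using g1 by (simp add: integrable_iff_L1norm)
    then show "0 \<le> \<gamma>1" "L1norm g1 \<le> ennreal (\<gamma>1 * r)"
      using r unfolding \<gamma>1_def g1_def[symmetric] s0_def[symmetric] r_def[symmetric] by auto
  qed
  have \<gamma>2: "0 \<le> \<gamma>2" "L1norm g2 \<le> ennreal (\<gamma>2 * r)"
  proof -
    have "L1norm g2 < top" using g2 by (simp add: integrable_iff_L1norm)
    then show "0 \<le> \<gamma>2" "L1norm g2 \<le> ennreal (\<gamma>2 * r)"
      using r unfolding \<gamma>2_def cR_def[symmetric] g2_def[symmetric] s0_def[symmetric] r_def[symmetric] by auto
  qed
  \<comment> \<open>The shifted commutator has two terms, in which \<open>T1\<close> acts on
    \<open>f\<close> and on \<open>(b - cR) f\<close>; both images must be under control.\<close>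
  define E where "E = Eset g1 \<gamma>1 \<union> Eset g2 \<gamma>2"
  have Em [measurable]: "E \<in> sets lebesgue" unfolding E_def using Eset_sets[OF g1] Eset_sets[OF g2] by auto
  define u where "u = l ^ CARD('n)"
  have u: "0 < u" "emeasure lebesgue (hcube a l) = ennreal u" using l by (auto simp: u_def emeasure_hcube)
  have Ele: "emeasure lebesgue E \<le> ennreal (u / 2 ^ (CARD('n) + 2))"
  proof -
    have "emeasure lebesgue E \<le> emeasure lebesgue (Eset g1 \<gamma>1) + emeasure lebesgue (Eset g2 \<gamma>2)"
      unfolding E_def using Eset_sets[OF g1] Eset_sets[OF g2] by (intro emeasure_subadditive) auto
    also have "\<dots> \<le> ennreal ((wk + 3 ^ CARD('n)) * r / A1) + ennreal ((wk + 3 ^ CARD('n)) * r / A1)"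
      by (intro add_mono Eset_small g1 g2 \<gamma>1 \<gamma>2 r)
    also have "\<dots> = ennreal (2 * ((wk + 3 ^ CARD('n)) * r / A1))"
      using wk r A_pos by (simp add: ennreal_plus[symmetric] del: ennreal_plus)
    also have "2 * ((wk + 3 ^ CARD('n)) * r / A1) = u / 2 ^ (CARD('n) + 2)"
    proof -
      define w M where "w = wk + 3 ^ CARD('n)" and "M = (2 * m + 1) ^ CARD('n)"
      have "0 < w" using wk zero_less_power[of "3::real" "CARD('n)"] unfolding w_def by linarith
      moreover have "0 < M" using m unfolding M_def by (intro zero_less_power) auto
      moreover have "A1 = 2 * w * M * 2 ^ (CARD('n) + 2)" by (simp add: A1_def w_def M_def)
      moreover have "r = M * u" by (simp add: r_def s0_def M_def u_def power_mult_distrib)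
      ultimately show ?thesis unfolding w_def[symmetric] by (simp add: field_simps)
    qed
    finally show ?thesis .
  qed
  define bad where "bad P \<longleftrightarrow> \<not> 2 ^ (CARD('n) + 1) * emeasure lebesgue (P \<inter> E) \<le> emeasure lebesgue P" for P
  have two: "(2::ennreal) ^ k = ennreal (2 ^ k)" for k by (simp add: ennreal_power[symmetric])
  have EP: "2 ^ (CARD('n) + 1) * emeasure lebesgue E \<le> ennreal (u / 2)"
  proof -
    have "2 ^ (CARD('n) + 1) * emeasure lebesgue E \<le> ennreal (2 ^ (CARD('n) + 1)) * ennreal (u / 2 ^ (CARD('n) + 2))"
      unfolding two by (intro mult_left_mono Ele) simp
    also have "\<dots> = ennreal (u / 2)" using u by (subst ennreal_mult[symmetric]) (auto simp: field_simps)
    finally show ?thesis .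
  qed
  have nb: "\<not> bad (hcube a l)"
  proof -
    have "2 ^ (CARD('n) + 1) * emeasure lebesgue (hcube a l \<inter> E) \<le> 2 ^ (CARD('n) + 1) * emeasure lebesgue E"
      by (intro mult_left_mono emeasure_mono) auto
    also have "\<dots> \<le> ennreal (u / 2)" by (rule EP)
    also have "\<dots> \<le> emeasure lebesgue (hcube a l)" using u by (auto intro: ennreal_leI)
    finally show ?thesis by (simp add: bad_def)
  qed
  obtain \<G> where SG: "stopping_family a l bad \<G>" using stopping_cubes[OF l] by blast
  note G = stopping_familyD[OF SG]
  define h where "h = (\<lambda>(c, s). hcube c s :: (real ^ 'n) set)"
  define V where "V = (\<Union>P\<in>\<G>. h P)"
  have Vh: "(\<Union>(c, s)\<in>\<G>. hcube c s) = V" by (simp add: V_def h_def)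
  have hm [measurable]: "h P \<in> sets lebesgue" for P by (simp add: h_def split: prod.splits)
  have Vm [measurable]: "V \<in> sets lebesgue" unfolding V_def using G(1) by (intro sets.countable_UN') auto
  have hdisj: "disjoint_family_on h \<G>" using G(2) by (simp add: h_def)
  have half: "2 * emeasure lebesgue V \<le> emeasure lebesgue (hcube a l)"
  proof -
    have disjE: "disjoint_family_on (\<lambda>P. h P \<inter> E) \<G>" using hdisj unfolding disjoint_family_on_def by blast
    have "emeasure lebesgue V = (\<integral>\<^sup>+P. emeasure lebesgue (h P) \<partial>count_space \<G>)"
      unfolding V_def using G(1) hdisj by (subst emeasure_UN_countable) auto
    also have "\<dots> \<le> (\<integral>\<^sup>+P. 2 ^ (CARD('n) + 1) * emeasure lebesgue (h P \<inter> E) \<partial>count_space \<G>)"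
    proof (rule nn_integral_mono)
      fix P assume "P \<in> space (count_space \<G>)"
      then have "bad (h P)" using G(5)[of "fst P" "snd P"] unfolding h_def case_prod_beta by simp
      then show "emeasure lebesgue (h P) \<le> 2 ^ (CARD('n) + 1) * emeasure lebesgue (h P \<inter> E)"
        by (simp add: bad_def less_imp_le not_le)
    qed
    also have "\<dots> = 2 ^ (CARD('n) + 1) * emeasure lebesgue (\<Union>P\<in>\<G>. h P \<inter> E)"
      using G(1) disjE by (subst emeasure_UN_countable) (auto simp: nn_integral_cmult)
    also have "\<dots> \<le> 2 ^ (CARD('n) + 1) * emeasure lebesgue E"
      by (intro mult_left_mono emeasure_mono) auto
    also have "\<dots> \<le> ennreal (u / 2)" by (rule EP)
    finally have "2 * emeasure lebesgue V \<le> ennreal 2 * ennreal (u / 2)" by (simp add: mult_left_mono)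
    also have "\<dots> = emeasure lebesgue (hcube a l)" using u by (subst ennreal_mult[symmetric]) auto
    finally show ?thesis .
  qed
  have shift: "AE x in lebesgue. comm b (restr S f) x = (b x - cR) * T1 (restr S f) x - T1 (\<lambda>y. (b y - cR) * restr S f y) x"
    if S: "S = hcube a' l'" "0 < l'" for S a' l'
    by (rule comm_shift[OF restr_int(1,2)[OF S]])
  have off: "AE x in lebesgue. x \<in> hcube a l - V \<longrightarrow> norm (comm b (restr R f) x) \<le> A2 * (norm (b x - cR) * \<gamma>1 + \<gamma>2)"
  proof -
    \<comment> \<open>Off \<open>V\<close> no dyadic average of \<open>indicator E\<close> exceeds
      this value. As it is below 1, almost every such point lies outside \<open>E\<close>.\<close>
    have "AE x in lebesgue. x \<in> hcube a l - V \<longrightarrow> indicator E x \<le> ennreal (1 / 2 ^ (CARD('n) + 1))"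
    proof (rule dyadic_differentiation[OF l])
      fix x k assume x: "x \<in> hcube a l - V"
      have Dm: "dcube a l k x \<in> sets lebesgue" by (simp add: dcube_def)
      have nb': "ennreal (2 ^ (CARD('n) + 1)) * emeasure lebesgue (dcube a l k x \<inter> E) \<le> emeasure lebesgue (dcube a l k x)"
        using x G(7)[of x k] unfolding bad_def Vh two by simp
      have "(\<integral>\<^sup>+y\<in>dcube a l k x. indicator E y \<partial>lebesgue) = (\<integral>\<^sup>+y. indicator (dcube a l k x \<inter> E) y \<partial>lebesgue)"
        by (intro nn_integral_cong) (auto simp: indicator_def)
      also have "\<dots> = emeasure lebesgue (dcube a l k x \<inter> E)"
        using Dm by (intro nn_integral_indicator) auto
      also have "\<dots> = ennreal (1 / 2 ^ (CARD('n) + 1)) * (ennreal (2 ^ (CARD('n) + 1)) * emeasure lebesgue (dcube a l k x \<inter> E))"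
        unfolding mult.assoc[symmetric] by (subst ennreal_mult[symmetric]) auto
      also have "\<dots> \<le> ennreal (1 / 2 ^ (CARD('n) + 1)) * emeasure lebesgue (dcube a l k x)"
        by (intro mult_left_mono nb') simp
      finally show "(\<integral>\<^sup>+y\<in>dcube a l k x. indicator E y \<partial>lebesgue) \<le> ennreal (1 / 2 ^ (CARD('n) + 1)) * emeasure lebesgue (dcube a l k x)" .
    qed auto
    then show ?thesis using shift[OF Rh s0]
    proof eventually_elim
      case (elim x)
      show ?case
      proof
        assume x: "x \<in> hcube a l - V"
        have "x \<notin> E"
        proof
          assume "x \<in> E"
          then have "ennreal 1 \<le> ennreal (1 / 2 ^ (CARD('n) + 1))" using elim(1) x by simp
          then have "1 \<le> 1 / (2 ^ (CARD('n) + 1) :: real)" by (subst (asm) ennreal_le_iff) auto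
          moreover have "(2::real) ^ (CARD('n) + 1) > 1" by (rule one_less_power) auto
          ultimately show False by (simp add: field_simps)
        qed
        then have n1: "norm (T1 g1 x) \<le> A1 * \<gamma>1" and n2: "norm (T1 g2 x) \<le> A1 * \<gamma>2"
          by (auto simp: E_def Eset_def not_less)
        have "norm (comm b (restr R f) x) \<le> norm (b x - cR) * norm (T1 g1 x) + norm (T1 g2 x)"
          using elim(2) norm_triangle_ineq4[of "(b x - cR) * T1 g1 x" "T1 g2 x"] unfolding g1_def g2_def by (simp add: norm_mult)
        also have "\<dots> \<le> norm (b x - cR) * (A2 * \<gamma>1) + A2 * \<gamma>2"
          using n1 n2 mult_right_mono[OF A_pos(3) \<gamma>1(1)] mult_right_mono[OF A_pos(3) \<gamma>2(1)]
          by (intro add_mono mult_left_mono) auto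
        finally show "norm (comm b (restr R f) x) \<le> A2 * (norm (b x - cR) * \<gamma>1 + \<gamma>2)" by (simp add: algebra_simps)
      qed
    qed
  qed
  have on: "AE x in lebesgue. x \<in> hcube c s \<longrightarrow>
      norm (comm b (restr R f) x) \<le> A2 * (norm (b x - cR) * \<gamma>1 + \<gamma>2) + norm (comm b (restr (hdil m c s) f) x)"
    if cs: "(c, s) \<in> \<G>" for c s
  proof -
    have s: "0 < s" using G(3)[OF cs] .
    obtain c' where c': "hcube c s \<subseteq> hcube c' (2 * s)" "\<not> bad (hcube c' (2 * s))"
      using G(6)[OF cs nb] by blast
    define v where "v = s ^ CARD('n)"
    have v: "0 < v" using s by (simp add: v_def)
    have Pe: "emeasure lebesgue (hcube c s) = ennreal v" "emeasure lebesgue (hcube c' (2 * s)) = ennreal (2 ^ CARD('n) * v)"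
      using s by (auto simp: emeasure_hcube v_def power_mult_distrib)
    have PE: "2 * emeasure lebesgue (hcube c s \<inter> E) \<le> emeasure lebesgue (hcube c s)"
    proof -
      have "2 ^ (CARD('n) + 1) * emeasure lebesgue (hcube c s \<inter> E) \<le> 2 ^ (CARD('n) + 1) * emeasure lebesgue (hcube c' (2 * s) \<inter> E)"
        using c' by (intro mult_left_mono emeasure_mono) auto
      also have "\<dots> \<le> ennreal (2 ^ CARD('n) * v)" using c'(2) Pe by (simp add: bad_def)
      finally have le: "2 ^ (CARD('n) + 1) * emeasure lebesgue (hcube c s \<inter> E) \<le> ennreal (2 ^ CARD('n) * v)" .
      have "emeasure lebesgue (hcube c s \<inter> E) \<le> emeasure lebesgue (hcube c s)" by (intro emeasure_mono) auto
      then obtain w where w: "emeasure lebesgue (hcube c s \<inter> E) = ennreal w" "0 \<le> w"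
        using Pe by (cases "emeasure lebesgue (hcube c s \<inter> E)") (auto simp: top_unique)
      have "2 ^ (CARD('n) + 1) * w \<le> 2 ^ CARD('n) * v"
        using le w v unfolding two by (simp add: ennreal_mult[symmetric])
      then have "2 * w \<le> v" by simp
      then show ?thesis using w Pe by (simp add: ennreal_numeral[symmetric] ennreal_mult[symmetric] del: ennreal_numeral)
    qed
    have PE1: "2 * emeasure lebesgue (hcube c s \<inter> Eset g1 \<gamma>1) \<le> emeasure lebesgue (hcube c s)"
      by (rule order_trans[OF mult_left_mono[OF emeasure_mono] PE]) (auto simp: E_def[symmetric], auto simp: E_def)
    have PE2: "2 * emeasure lebesgue (hcube c s \<inter> Eset g2 \<gamma>2) \<le> emeasure lebesgue (hcube c s)"
      by (rule order_trans[OF mult_left_mono[OF emeasure_mono] PE]) (auto simp: E_def[symmetric], auto simp: E_def)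
    define R' where "R' = hdil m c s"
    define s1 where "s1 = (2 * m + 1) * s"
    have s1: "0 < s1" unfolding s1_def using m s by (intro mult_pos_pos) auto
    have R'h: "R' = hcube (\<chi> i. c $ i - m * s) s1" by (simp add: R'_def hdil_def s1_def)
    have RR: "R' \<subseteq> R" unfolding R_def R'_def by (rule hdil_mono[OF s G(4)[OF cs]])
    define h1 where "h1 = restr R' f"
    define h2 where "h2 = (\<lambda>y. (b y - cR) * restr R' f y)"
    have h1: "integrable lebesgue h1" unfolding h1_def by (rule restr_int(1)[OF R'h s1])
    have h2: "integrable lebesgue h2" unfolding h2_def by (rule restr_int(3)[OF R'h s1])
    \<comment> \<open>The far part as the linear combination to which \<open>T1_lincomb\<close>
      applies.\<close>
    have k1: "(\<lambda>y. indicator (- R') y *\<^sub>R g1 y) = (\<lambda>y. 1 * g1 y + (-1) * h1 y)"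
      using RR by (auto simp: g1_def h1_def restr_def indicator_def fun_eq_iff)
    have k2: "(\<lambda>y. indicator (- R') y *\<^sub>R g2 y) = (\<lambda>y. 1 * g2 y + (-1) * h2 y)"
      using RR by (auto simp: g2_def h2_def restr_def indicator_def fun_eq_iff)
    show ?thesis
      using far_bound[OF g1 s \<gamma>1(1) PE1] far_bound[OF g2 s \<gamma>2(1) PE2] T1_lincomb[OF g1 h1, of 1 "-1"] T1_lincomb[OF g2 h2, of 1 "-1"]
        shift[OF Rh s0] shift[OF R'h s1]
      unfolding R'_def[symmetric]
      unfolding k1 k2 g2_def[symmetric] h2_def[symmetric]
      unfolding g1_def[symmetric] h1_def[symmetric]
    proof eventually_elim
      case (elim x)
      show ?case
      proof
        assume x: "x \<in> hcube c s"
        have e1: "T1 g1 x = T1 h1 x + T1 (\<lambda>y. 1 * g1 y + - 1 * h1 y) x" and e2: "T1 g2 x = T1 h2 x + T1 (\<lambda>y. 1 * g2 y + - 1 * h2 y) x"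
          using elim(3,4) by simp_all
        define X where "X = T1 (\<lambda>y. 1 * g1 y + - 1 * h1 y) x"
        define Y where "Y = T1 (\<lambda>y. 1 * g2 y + - 1 * h2 y) x"
        have XY: "norm X \<le> A2 * \<gamma>1" "norm Y \<le> A2 * \<gamma>2" using elim(1,2) x unfolding X_def Y_def by auto
        have "comm b g1 x = comm b h1 x + ((b x - cR) * X - Y)"
          unfolding elim(5,6) e1 e2 X_def[symmetric] Y_def[symmetric] by (simp add: algebra_simps)
        then have "norm (comm b g1 x) \<le> norm (comm b h1 x) + (norm (b x - cR) * norm X + norm Y)"
          using norm_triangle_ineq[of "comm b h1 x" "(b x - cR) * X - Y"] norm_triangle_ineq4[of "(b x - cR) * X" Y]
          by (simp add: norm_mult)
        also have "\<dots> \<le> norm (comm b h1 x) + (norm (b x - cR) * (A2 * \<gamma>1) + A2 * \<gamma>2)"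
          using XY by (intro add_left_mono add_mono mult_left_mono) auto
        finally show "norm (comm b g1 x) \<le> A2 * (norm (b x - cR) * \<gamma>1 + \<gamma>2) + norm (comm b h1 x)" by (simp add: algebra_simps)
      qed
    qed
  qed
  have "\<forall>(c, s)\<in>\<G>. 0 < s \<and> hcube c s \<subseteq> hcube a l" using G(3,4) by blast
  moreover have "\<forall>(c, s)\<in>\<G>. AE x in lebesgue. x \<in> hcube c s \<longrightarrow>
      norm (comm b (restr R f) x) \<le> A2 * (norm (b x - cR) * \<gamma>1 + \<gamma>2) + norm (comm b (restr (hdil m c s) f) x)"
    using on by blast
  ultimately show ?thesis using G(1,2) half off
    unfolding cR_def[symmetric] by (intro exI[of _ \<G>], unfold Vh, intro conjI) assumption+
qed

section \<open>The bilinear estimate and duality\<close>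

text \<open>The error of the recursion has one term with the oscillation of \<open>b\<close> against
  \<open>g\<close> and one with the oscillation against \<open>f\<close>. \<open>Bloom_form\<close>
  bounds the first. For the second it is used at the exponent q for the dual weights of \<kappa> and
  \<mu>, with \<open>f\<close> and \<open>g\<close> exchanged: the Bloom weight of this dual pair is
  again \<nu>, because \<open>(p - 1) * q = p\<close>.\<close>

lemma Bloom_bilinear:
  fixes \<mu> \<kappa> :: "real ^ 'n \<Rightarrow> real"
  assumes p: "1 < p" and \<mu>: "strict_Ap p C1 \<mu>" and \<kappa>: "strict_Ap p C2 \<kappa>"
  defines "\<nu> \<equiv> (\<lambda>x. \<mu> x powr (1 / p) * \<kappa> x powr (- (1 / p)))"
  shows "\<exists>M\<ge>0. \<forall>B b f Mf g a l. bmo_le \<nu> B b \<longrightarrow> f \<in> borel_measurable lebesgue \<longrightarrow> (\<forall>x. norm (f x) \<le> Mf) \<longrightarrow>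
    g \<in> borel_measurable lebesgue \<longrightarrow> 0 < l \<longrightarrow>
    (\<integral>\<^sup>+x\<in>hcube a l. ennreal (norm (comm b (restr (hdil m a l) f) x)) * g x \<partial>lebesgue) \<le>
      ennreal M * B * (ennpow (\<integral>\<^sup>+x. ennpow (ennreal (norm (f x))) p * ennreal (\<mu> x) \<partial>lebesgue) (1 / p) *
       ennpow (\<integral>\<^sup>+x. ennpow (g x) (conj_exp p) * ennreal (dual_weight p \<kappa> x) \<partial>lebesgue) (1 / conj_exp p))"
proof -
  define q where "q = conj_exp p"
  note q = conj_exp_props[OF p, folded q_def]
  have pos: "\<And>x. 0 < \<mu> x" "\<And>x. 0 < \<kappa> x" using \<mu> \<kappa> by (auto simp: strict_Ap_def)
  have \<mu>': "strict_Ap q (C1 powr (q - 1)) (dual_weight p \<mu>)" using strict_Ap_dual[OF p \<mu>] by (simp add: q_def)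
  have \<kappa>': "strict_Ap q (C2 powr (q - 1)) (dual_weight p \<kappa>)" using strict_Ap_dual[OF p \<kappa>] by (simp add: q_def)
  have \<nu>': "(\<lambda>x. dual_weight p \<kappa> x powr (1 / q) * dual_weight p \<mu> x powr (- (1 / q))) = \<nu>"
  proof
    fix x
    have "1 / (p - 1) * (1 / q) = 1 / p"
    proof -
      have "(p - 1) * q = p" by (rule q(3))
      then show ?thesis by simp
    qed
    then have e: "- (1 / (p - 1)) * (1 / q) = - (1 / p)" "- (1 / (p - 1)) * - (1 / q) = 1 / p" by simp_all
    show "dual_weight p \<kappa> x powr (1 / q) * dual_weight p \<mu> x powr (- (1 / q)) = \<nu> x"
      unfolding dual_weight_def \<nu>_def powr_powr e by (rule mult.commute)
  qed
  have dd: "dual_weight q (dual_weight p \<mu>) = \<mu>" unfolding q_def by (rule dual_dual_weight[OF p pos(1)])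
  obtain M1 where M1: "0 \<le> M1" "\<forall>f\<in>borel_measurable lebesgue. \<forall>g\<in>borel_measurable lebesgue. \<exists>\<psi>\<in>borel_measurable lebesgue.
    (\<forall>B b a l E. bmo_le \<nu> B b \<longrightarrow> 0 < l \<longrightarrow> E \<in> sets lebesgue \<longrightarrow> E \<subseteq> hcube a l \<longrightarrow>
       emeasure lebesgue (hcube a l) \<le> 2 * emeasure lebesgue E \<longrightarrow>
       (\<integral>\<^sup>+x\<in>hdil m a l. f x \<partial>lebesgue) * (\<integral>\<^sup>+x\<in>hdil m a l. ennreal (norm (b x - average (hdil m a l) b)) * g x \<partial>lebesgue)
         \<le> ennreal M1 * B * emeasure lebesgue (hcube a l) * (\<integral>\<^sup>+x\<in>E. \<psi> x \<partial>lebesgue)) \<and>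
    (\<integral>\<^sup>+x. \<psi> x \<partial>lebesgue) \<le> ennreal M1 * (ennpow (\<integral>\<^sup>+x. ennpow (f x) p * ennreal (\<mu> x) \<partial>lebesgue) (1 / p) *
       ennpow (\<integral>\<^sup>+x. ennpow (g x) q * ennreal (dual_weight p \<kappa> x) \<partial>lebesgue) (1 / q))"
    using Bloom_form[OF p \<mu> \<kappa> m(2)] unfolding q_def[symmetric] \<nu>_def[symmetric] by blast
  obtain M2 where M2: "0 \<le> M2" "\<forall>f\<in>borel_measurable lebesgue. \<forall>g\<in>borel_measurable lebesgue. \<exists>\<psi>\<in>borel_measurable lebesgue.
    (\<forall>B b a l E. bmo_le \<nu> B b \<longrightarrow> 0 < l \<longrightarrow> E \<in> sets lebesgue \<longrightarrow> E \<subseteq> hcube a l \<longrightarrow>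
       emeasure lebesgue (hcube a l) \<le> 2 * emeasure lebesgue E \<longrightarrow>
       (\<integral>\<^sup>+x\<in>hdil m a l. f x \<partial>lebesgue) * (\<integral>\<^sup>+x\<in>hdil m a l. ennreal (norm (b x - average (hdil m a l) b)) * g x \<partial>lebesgue)
         \<le> ennreal M2 * B * emeasure lebesgue (hcube a l) * (\<integral>\<^sup>+x\<in>E. \<psi> x \<partial>lebesgue)) \<and>
    (\<integral>\<^sup>+x. \<psi> x \<partial>lebesgue) \<le> ennreal M2 * (ennpow (\<integral>\<^sup>+x. ennpow (f x) q * ennreal (dual_weight p \<kappa> x) \<partial>lebesgue) (1 / q) *
       ennpow (\<integral>\<^sup>+x. ennpow (g x) p * ennreal (\<mu> x) \<partial>lebesgue) (1 / p))"
    using Bloom_form[OF q(1) \<kappa>' \<mu>' m(2)] unfolding \<nu>' dd q(4) by blast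
  show ?thesis unfolding q_def[symmetric]
  \<comment> \<open>Each constant of \<open>Bloom_form\<close> enters twice, through the estimate on
    a single cube and through the total integral of its \<psi>.\<close>
  proof (intro exI[of _ "A2 * (M1 * M1 + M2 * M2)"] conjI allI impI)
    show "0 \<le> A2 * (M1 * M1 + M2 * M2)" using A_pos M1(1) M2(1) by simp
    fix B and b f :: "real ^ 'n \<Rightarrow> complex" and Mf :: real and g :: "real ^ 'n \<Rightarrow> ennreal" and a :: "real ^ 'n" and l :: real
    assume b: "bmo_le \<nu> B b" and fm [measurable]: "f \<in> borel_measurable lebesgue" and fb: "\<forall>x. norm (f x) \<le> Mf"
      and gm [measurable]: "g \<in> borel_measurable lebesgue" and l: "0 < l"
    have bc: "integrable_on_cubes b" using b by (simp add: bmo_le_def)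
    have bm [measurable]: "b \<in> borel_measurable lebesgue" using bc by (simp add: integrable_on_cubes_def)
    define fa where "fa = (\<lambda>x. ennreal (norm (f x)))"
    have [measurable]: "fa \<in> borel_measurable lebesgue" unfolding fa_def by measurable
    define Nf where "Nf = ennpow (\<integral>\<^sup>+x. ennpow (fa x) p * ennreal (\<mu> x) \<partial>lebesgue) (1 / p)"
    define Ng where "Ng = ennpow (\<integral>\<^sup>+x. ennpow (g x) q * ennreal (dual_weight p \<kappa> x) \<partial>lebesgue) (1 / q)"
    obtain \<psi>1 where \<psi>1m [measurable]: "\<psi>1 \<in> borel_measurable lebesgue" and \<psi>1: "(\<forall>B b a l E. bmo_le \<nu> B b \<longrightarrow> 0 < l \<longrightarrow> E \<in> sets lebesgue \<longrightarrow> E \<subseteq> hcube a l \<longrightarrow>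
       emeasure lebesgue (hcube a l) \<le> 2 * emeasure lebesgue E \<longrightarrow>
       (\<integral>\<^sup>+x\<in>hdil m a l. fa x \<partial>lebesgue) * (\<integral>\<^sup>+x\<in>hdil m a l. ennreal (norm (b x - average (hdil m a l) b)) * g x \<partial>lebesgue)
         \<le> ennreal M1 * B * emeasure lebesgue (hcube a l) * (\<integral>\<^sup>+x\<in>E. \<psi>1 x \<partial>lebesgue)) \<and> (\<integral>\<^sup>+x. \<psi>1 x \<partial>lebesgue) \<le> ennreal M1 * (Nf * Ng)"
      using bspec[OF bspec[OF M1(2) \<open>fa \<in> _\<close>] gm] unfolding Nf_def[symmetric] Ng_def[symmetric] by (elim bexE)
    obtain \<psi>2 where \<psi>2m [measurable]: "\<psi>2 \<in> borel_measurable lebesgue" and \<psi>2: "(\<forall>B b a l E. bmo_le \<nu> B b \<longrightarrow> 0 < l \<longrightarrow> E \<in> sets lebesgue \<longrightarrow> E \<subseteq> hcube a l \<longrightarrow>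
       emeasure lebesgue (hcube a l) \<le> 2 * emeasure lebesgue E \<longrightarrow>
       (\<integral>\<^sup>+x\<in>hdil m a l. g x \<partial>lebesgue) * (\<integral>\<^sup>+x\<in>hdil m a l. ennreal (norm (b x - average (hdil m a l) b)) * fa x \<partial>lebesgue)
         \<le> ennreal M2 * B * emeasure lebesgue (hcube a l) * (\<integral>\<^sup>+x\<in>E. \<psi>2 x \<partial>lebesgue)) \<and> (\<integral>\<^sup>+x. \<psi>2 x \<partial>lebesgue) \<le> ennreal M2 * (Ng * Nf)"
      using bspec[OF bspec[OF M2(2) gm] \<open>fa \<in> _\<close>] unfolding Nf_def[symmetric] Ng_def[symmetric] by (elim bexE)
    define \<psi> where "\<psi> x = ennreal A2 * B * (ennreal M1 * \<psi>1 x + ennreal M2 * \<psi>2 x)" for x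
    define F where "F a l x = ennreal (norm (comm b (restr (hdil m a l) f) x)) * g x" for a l x
    define av where "av a l = average (hdil m a l) b" for a l
    define \<gamma>1 where "\<gamma>1 a l = enn2real (L1norm (restr (hdil m a l) f)) / ((2 * m + 1) * l) ^ CARD('n)" for a l
    define \<gamma>2 where "\<gamma>2 a l = enn2real (L1norm (\<lambda>y. (b y - av a l) * restr (hdil m a l) f y)) / ((2 * m + 1) * l) ^ CARD('n)" for a l
    define A where "A a l x = ennreal (A2 * (norm (b x - av a l) * \<gamma>1 a l + \<gamma>2 a l)) * g x" for a l x
    have "(\<integral>\<^sup>+x\<in>hcube a l. F a l x \<partial>lebesgue) \<le> (\<integral>\<^sup>+x\<in>hcube a l. \<psi> x \<partial>lebesgue)"
    proof (rule sparse_iteration[where A = A])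
      show "0 < l" by (rule l)
      show "A a l \<in> borel_measurable lebesgue" for a l unfolding A_def by measurable
      show "\<psi> \<in> borel_measurable lebesgue" unfolding \<psi>_def by measurable
      fix a :: "real ^ 'n" and l :: real assume l: "0 < l"
      define s0 where "s0 = (2 * m + 1) * l"
      define r where "r = s0 ^ CARD('n)"
      have s0: "0 < s0" unfolding s0_def using m l by (intro mult_pos_pos) auto
      have r: "0 < r" unfolding r_def using s0 by simp
      define R where "R = hdil m a l"
      have Rh: "R = hcube (\<chi> i. a $ i - m * l) s0" by (simp add: R_def hdil_def s0_def)
      have [measurable]: "R \<in> sets lebesgue" unfolding Rh by simp
      note ri = restr_integrable[OF bc fm spec[OF fb] Rh s0]
      note [measurable] = T1_measurable[OF ri(1)] T1_measurable[OF ri(2)]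
      show "F a l \<in> borel_measurable lebesgue" unfolding F_def comm_def R_def[symmetric] by measurable
      obtain \<G> where G: "countable \<G>" "disjoint_family_on (\<lambda>(c, s). hcube c s) \<G>"
        "\<forall>(c, s)\<in>\<G>. 0 < s \<and> hcube c s \<subseteq> hcube a l"
        "2 * emeasure lebesgue (\<Union>(c, s)\<in>\<G>. hcube c s) \<le> emeasure lebesgue (hcube a l)"
        "AE x in lebesgue. x \<in> hcube a l - (\<Union>(c, s)\<in>\<G>. hcube c s) \<longrightarrow>
         norm (comm b (restr (hdil m a l) f) x) \<le> A2 * (norm (b x - av a l) * \<gamma>1 a l + \<gamma>2 a l)"
        "\<forall>(c, s)\<in>\<G>. AE x in lebesgue. x \<in> hcube c s \<longrightarrow>
         norm (comm b (restr (hdil m a l) f) x) \<le> A2 * (norm (b x - av a l) * \<gamma>1 a l + \<gamma>2 a l) + norm (comm b (restr (hdil m c s) f) x)"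
        using comm_recursion[OF bc fm spec[OF fb] l, where a = a, folded av_def, folded \<gamma>1_def \<gamma>2_def] by (elim exE conjE)
      define V where "V = (\<Union>(c, s)\<in>\<G>. hcube c s)"
      have Vm [measurable]: "V \<in> sets lebesgue" unfolding V_def using G(1) by (intro sets.countable_UN') auto
      have VQ: "V \<subseteq> hcube a l" unfolding V_def using G(3) by auto
      have \<gamma>0: "0 \<le> \<gamma>1 a l" "0 \<le> \<gamma>2 a l" using r unfolding \<gamma>1_def \<gamma>2_def s0_def[symmetric] r_def[symmetric] by auto
      have off: "AE x in lebesgue. x \<in> hcube a l - V \<longrightarrow> F a l x \<le> A a l x"
        using G(5) unfolding V_def[symmetric] F_def A_def by eventually_elim (auto intro!: mult_right_mono ennreal_leI)
      have on: "\<forall>(c, s)\<in>\<G>. AE x in lebesgue. x \<in> hcube c s \<longrightarrow> F a l x \<le> A a l x + F c s x"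
      proof (intro ballI, unfold case_prod_beta)
        fix P assume "P \<in> \<G>"
        from bspec[OF G(6) this, unfolded case_prod_beta]
        show "AE x in lebesgue. x \<in> hcube (fst P) (snd P) \<longrightarrow> F a l x \<le> A a l x + F (fst P) (snd P) x"
        proof eventually_elim
          case (elim x)
          show ?case
          proof
            assume "x \<in> hcube (fst P) (snd P)"
            with elim have "ennreal (norm (comm b (restr (hdil m a l) f) x)) \<le>
               ennreal (A2 * (norm (b x - av a l) * \<gamma>1 a l + \<gamma>2 a l) + norm (comm b (restr (hdil m (fst P) (snd P)) f) x))"
              by (auto intro: ennreal_leI)
            also have "\<dots> = ennreal (A2 * (norm (b x - av a l) * \<gamma>1 a l + \<gamma>2 a l)) + ennreal (norm (comm b (restr (hdil m (fst P) (snd P)) f) x))"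
              using A_pos \<gamma>0 by (intro ennreal_plus mult_nonneg_nonneg add_nonneg_nonneg) auto
            finally have "ennreal (norm (comm b (restr (hdil m a l) f) x)) * g x \<le>
              (ennreal (A2 * (norm (b x - av a l) * \<gamma>1 a l + \<gamma>2 a l)) + ennreal (norm (comm b (restr (hdil m (fst P) (snd P)) f) x))) * g x"
              by (rule mult_right_mono) simp
            then show "F a l x \<le> A a l x + F (fst P) (snd P) x" unfolding F_def A_def by (simp add: distrib_right)
          qed
        qed
      qed
      have int: "(\<integral>\<^sup>+x\<in>hcube a l. A a l x \<partial>lebesgue) \<le> (\<integral>\<^sup>+x\<in>hcube a l - V. \<psi> x \<partial>lebesgue)"
      proof -
        have rem: "emeasure lebesgue (hcube a l) \<le> 2 * emeasure lebesgue (hcube a l - V)"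
          using emeasure_remainder[OF l Vm VQ] G(4) unfolding V_def[symmetric] by simp
        have Em: "hcube a l - V \<in> sets lebesgue" by simp
        define X where "X = (\<integral>\<^sup>+x\<in>R. ennreal (norm (b x - av a l)) * g x \<partial>lebesgue)"
        define Y where "Y = (\<integral>\<^sup>+x\<in>R. g x \<partial>lebesgue)"
        define X' where "X' = (\<integral>\<^sup>+x\<in>R. fa x \<partial>lebesgue)"
        define Y' where "Y' = (\<integral>\<^sup>+x\<in>R. ennreal (norm (b x - av a l)) * fa x \<partial>lebesgue)"
        define I1 where "I1 = (\<integral>\<^sup>+x\<in>hcube a l - V. \<psi>1 x \<partial>lebesgue)"
        define I2 where "I2 = (\<integral>\<^sup>+x\<in>hcube a l - V. \<psi>2 x \<partial>lebesgue)"
        define Q where "Q = emeasure lebesgue (hcube a l)"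
        \<comment> \<open>The recursion averages over the dilate, whose volume \<open>r\<close>
          dominates the volume of the cube that \<open>Bloom_form\<close> puts on the right.\<close>
        have QR: "ennreal (1 / r) * Q \<le> 1"
        proof -
          have "l ^ CARD('n) \<le> r"
            unfolding r_def s0_def using m l by (intro power_mono) (auto simp: algebra_simps)
          then have "1 / r * l ^ CARD('n) \<le> 1" using r by (simp add: field_simps)
          then have "ennreal (1 / r * l ^ CARD('n)) \<le> ennreal 1" by (rule ennreal_leI)
          then show ?thesis unfolding Q_def using r l by (simp add: emeasure_hcube ennreal_mult[symmetric])
        qed
        have b1: "X' * X \<le> ennreal M1 * B * Q * I1"
          using \<psi>1[THEN conjunct1, rule_format, OF b l Em Diff_subset rem] unfolding X_def X'_def I1_def Q_def av_def R_def .
        have b2: "Y * Y' \<le> ennreal M2 * B * Q * I2"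
          using \<psi>2[THEN conjunct1, rule_format, OF b l Em Diff_subset rem] unfolding Y_def Y'_def I2_def Q_def av_def R_def .
        have L1: "L1norm (restr R f) = X'"
          unfolding L1norm_def X'_def restr_def fa_def by (intro nn_integral_cong) (auto simp: indicator_def)
        have L2: "L1norm (\<lambda>y. (b y - av a l) * restr R f y) = Y'"
          unfolding L1norm_def Y'_def restr_def fa_def by (intro nn_integral_cong) (auto simp: indicator_def norm_mult ennreal_mult)
        have fin: "X' < top" "Y' < top" using ri(1) ri(3)[of "av a l"] unfolding integrable_iff_L1norm L1 L2 by auto
        have g1: "ennreal (\<gamma>1 a l) = ennreal (1 / r) * X'"
          using fin(1) r unfolding \<gamma>1_def R_def[symmetric] s0_def[symmetric] r_def[symmetric] L1
          by (cases X') (auto simp: ennreal_mult[symmetric])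
        have g2: "ennreal (\<gamma>2 a l) = ennreal (1 / r) * Y'"
          using fin(2) r unfolding \<gamma>2_def R_def[symmetric] s0_def[symmetric] r_def[symmetric] L2
          by (cases Y') (auto simp: ennreal_mult[symmetric])
        have AA: "A a l x = ennreal A2 * (ennreal (\<gamma>1 a l) * (ennreal (norm (b x - av a l)) * g x) + ennreal (\<gamma>2 a l) * g x)" for x
        proof -
          have "ennreal (A2 * (norm (b x - av a l) * \<gamma>1 a l + \<gamma>2 a l)) = ennreal A2 * (ennreal (norm (b x - av a l)) * ennreal (\<gamma>1 a l) + ennreal (\<gamma>2 a l))"
            using A_pos \<gamma>0 by (simp add: ennreal_mult ennreal_plus)
          then show ?thesis unfolding A_def by (simp add: algebra_simps)
        qed
        have "(\<integral>\<^sup>+x\<in>hcube a l. A a l x \<partial>lebesgue) \<le> (\<integral>\<^sup>+x\<in>R. A a l x \<partial>lebesgue)"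
          using hcube_subset_dil[OF l m(2), of a] ocube_subset_hcube unfolding R_def dil_def hdil_def by (intro nn_set_integral_set_mono) blast
        also have "\<dots> = (\<integral>\<^sup>+x. ennreal A2 * (ennreal (\<gamma>1 a l) * (ennreal (norm (b x - av a l)) * g x * indicator R x) + ennreal (\<gamma>2 a l) * (g x * indicator R x)) \<partial>lebesgue)"
          unfolding AA by (intro nn_integral_cong) (simp add: algebra_simps)
        also have "\<dots> = ennreal A2 * (ennreal (\<gamma>1 a l) * X + ennreal (\<gamma>2 a l) * Y)"
          unfolding X_def Y_def by (simp add: nn_integral_cmult nn_integral_add)
        also have "\<dots> = ennreal A2 * (ennreal (1 / r) * (X' * X) + ennreal (1 / r) * (Y * Y'))"
          unfolding g1 g2 by (simp only: mult_ac)
        also have "\<dots> \<le> ennreal A2 * (ennreal (1 / r) * (ennreal M1 * B * Q * I1) + ennreal (1 / r) * (ennreal M2 * B * Q * I2))"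
          by (intro mult_left_mono add_mono b1 b2) auto
        also have "\<dots> = (ennreal (1 / r) * Q) * (ennreal A2 * B * (ennreal M1 * I1 + ennreal M2 * I2))"
          by (simp only: distrib_left mult_ac)
        also have "\<dots> \<le> 1 * (ennreal A2 * B * (ennreal M1 * I1 + ennreal M2 * I2))"
          by (intro mult_right_mono QR) auto
        also have "\<dots> = (\<integral>\<^sup>+x. ennreal A2 * B * (ennreal M1 * (\<psi>1 x * indicator (hcube a l - V) x) + ennreal M2 * (\<psi>2 x * indicator (hcube a l - V) x)) \<partial>lebesgue)"
          unfolding I1_def I2_def by (simp add: nn_integral_cmult nn_integral_add)
        also have "\<dots> = (\<integral>\<^sup>+x\<in>hcube a l - V. \<psi> x \<partial>lebesgue)"
          unfolding \<psi>_def by (intro nn_integral_cong) (simp add: indicator_def)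
        finally show ?thesis .
      qed
      show "\<exists>\<G>. countable \<G> \<and> disjoint_family_on (\<lambda>(c, s). hcube c s) \<G> \<and>
        (\<forall>(c, s)\<in>\<G>. 0 < s \<and> hcube c s \<subseteq> hcube a l) \<and>
        2 * emeasure lebesgue (\<Union>(c, s)\<in>\<G>. hcube c s) \<le> emeasure lebesgue (hcube a l) \<and>
        (AE x in lebesgue. x \<in> hcube a l - (\<Union>(c, s)\<in>\<G>. hcube c s) \<longrightarrow> F a l x \<le> A a l x) \<and>
        (\<forall>(c, s)\<in>\<G>. AE x in lebesgue. x \<in> hcube c s \<longrightarrow> F a l x \<le> A a l x + F c s x) \<and>
        (\<integral>\<^sup>+x\<in>hcube a l. A a l x \<partial>lebesgue) \<le> (\<integral>\<^sup>+x\<in>hcube a l - (\<Union>(c, s)\<in>\<G>. hcube c s). \<psi> x \<partial>lebesgue)"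
        using G(1-4) off on int unfolding V_def by (intro exI[of _ \<G>] conjI) assumption+
    qed
    also have "\<dots> \<le> (\<integral>\<^sup>+x. \<psi> x \<partial>lebesgue)" by (intro nn_integral_mono) (auto simp: indicator_def)
    also have "\<dots> = ennreal A2 * B * (ennreal M1 * (\<integral>\<^sup>+x. \<psi>1 x \<partial>lebesgue) + ennreal M2 * (\<integral>\<^sup>+x. \<psi>2 x \<partial>lebesgue))"
      unfolding \<psi>_def by (simp add: nn_integral_cmult nn_integral_add)
    also have "\<dots> \<le> ennreal A2 * B * (ennreal M1 * (ennreal M1 * (Nf * Ng)) + ennreal M2 * (ennreal M2 * (Ng * Nf)))"
      by (intro mult_left_mono add_mono \<psi>1[THEN conjunct2] \<psi>2[THEN conjunct2]) auto
    also have "\<dots> = ennreal A2 * B * ((ennreal M1 * ennreal M1 + ennreal M2 * ennreal M2) * (Nf * Ng))"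
      by (simp only: distrib_right distrib_left mult_ac)
    also have "\<dots> = ennreal (A2 * (M1 * M1 + M2 * M2)) * B * (Nf * Ng)"
    proof -
      have "ennreal (A2 * (M1 * M1 + M2 * M2)) = ennreal A2 * (ennreal M1 * ennreal M1 + ennreal M2 * ennreal M2)"
        using A_pos M1(1) M2(1) by (simp add: ennreal_mult ennreal_plus)
      then show ?thesis by (simp only: mult_ac)
    qed
    finally show "(\<integral>\<^sup>+x\<in>hcube a l. ennreal (norm (comm b (restr (hdil m a l) f) x)) * g x \<partial>lebesgue) \<le>
      ennreal (A2 * (M1 * M1 + M2 * M2)) * B * (ennpow (\<integral>\<^sup>+x. ennpow (ennreal (norm (f x))) p * ennreal (\<mu> x) \<partial>lebesgue) (1 / p) *
       ennpow (\<integral>\<^sup>+x. ennpow (g x) q * ennreal (dual_weight p \<kappa> x) \<partial>lebesgue) (1 / q))"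
      unfolding F_def Nf_def Ng_def fa_def .
  qed
qed

text \<open>The test function is extremal in Hoelder's inequality: its pairing with \<open>H\<close>
  and the q-th power of its dual norm are the same integral \<open>I k\<close>, so a power of
  \<open>I k\<close> cancels. Cancelling requires \<open>I k\<close> to be finite, which is why the
  test function lives on \<open>E k\<close>, inside a bounded cube and where \<open>H\<close> and
  \<kappa> are at most \<open>k\<close>. Fatou's lemma removes this restriction.\<close>

lemma comm_Lp_bound:
  fixes \<mu> \<kappa> :: "real ^ 'n \<Rightarrow> real"
  assumes p: "1 < p" and \<mu>: "strict_Ap p C1 \<mu>" and \<kappa>: "strict_Ap p C2 \<kappa>"
  defines "\<nu> \<equiv> (\<lambda>x. \<mu> x powr (1 / p) * \<kappa> x powr (- (1 / p)))"
  shows "\<exists>M\<ge>0. \<forall>B b f. bmo_le \<nu> B b \<longrightarrow> f \<in> bounded_compact_support \<longrightarrow>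
    integrable lebesgue f \<and> L2 f \<and> integrable lebesgue (\<lambda>y. b y * f y) \<and>
    ennpow (\<integral>\<^sup>+x. ennpow (ennreal (norm (comm b f x))) p * ennreal (\<kappa> x) \<partial>lebesgue) (1 / p) \<le>
      ennreal M * B * ennpow (\<integral>\<^sup>+x. ennpow (ennreal (norm (f x))) p * ennreal (\<mu> x) \<partial>lebesgue) (1 / p)"
proof -
  have \<kappa>m [measurable]: "\<kappa> \<in> borel_measurable lebesgue" and \<kappa>pos: "\<And>x. 0 < \<kappa> x" using \<kappa> by (auto simp: strict_Ap_def)
  define q where "q = conj_exp p"
  note q = conj_exp_props[OF p, folded q_def]
  obtain M where M: "0 \<le> M" "\<forall>B b f Mf g a l. bmo_le \<nu> B b \<longrightarrow> f \<in> borel_measurable lebesgue \<longrightarrow> (\<forall>x. norm (f x) \<le> Mf) \<longrightarrow>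
    g \<in> borel_measurable lebesgue \<longrightarrow> 0 < l \<longrightarrow>
    (\<integral>\<^sup>+x\<in>hcube a l. ennreal (norm (comm b (restr (hdil m a l) f) x)) * g x \<partial>lebesgue) \<le>
      ennreal M * B * (ennpow (\<integral>\<^sup>+x. ennpow (ennreal (norm (f x))) p * ennreal (\<mu> x) \<partial>lebesgue) (1 / p) *
       ennpow (\<integral>\<^sup>+x. ennpow (g x) q * ennreal (dual_weight p \<kappa> x) \<partial>lebesgue) (1 / q))"
    using Bloom_bilinear[OF p \<mu> \<kappa>] unfolding q_def[symmetric] \<nu>_def[symmetric] by (elim exE conjE) (rule that)
  show ?thesis
  proof (intro exI[of _ M] conjI allI impI)
    show "0 \<le> M" by (rule M(1))
    fix B :: ennreal and b f :: "real ^ 'n \<Rightarrow> complex"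
    assume b: "bmo_le \<nu> B b" and f: "f \<in> bounded_compact_support"
    have bc: "integrable_on_cubes b" using b by (simp add: bmo_le_def)
    have bm [measurable]: "b \<in> borel_measurable lebesgue" using bc by (simp add: integrable_on_cubes_def)
    have fm [measurable]: "f \<in> borel_measurable lebesgue" using f by (simp add: bounded_compact_support_def)
    have "bounded (range f)" using f by (simp add: bounded_compact_support_def)
    then obtain Mf where fb: "\<forall>x. norm (f x) \<le> Mf" by (auto simp: bounded_iff)
    obtain S where S: "compact S" "\<And>x. x \<notin> S \<Longrightarrow> f x = 0" using f by (auto simp: bounded_compact_support_def)
    obtain r0 where r0: "\<And>x. x \<in> S \<Longrightarrow> norm x \<le> r0" using compact_imp_bounded[OF S(1)] by (auto simp: bounded_iff)
    obtain j0 :: nat where j0: "r0 \<le> real j0" using real_arch_simple by blast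
    define Q :: "nat \<Rightarrow> (real ^ 'n) set" where "Q k = hcube (\<chi> i. - real (Suc k)) (2 * real (Suc k))" for k
    have [measurable]: "Q k \<in> sets lebesgue" for k by (simp add: Q_def)
    have memQ: "x \<in> Q k" if "norm x \<le> real k" for x k
    proof -
      have "\<bar>x $ i\<bar> < real (Suc k)" for i using component_le_norm_cart[of x i] that by simp
      then show ?thesis unfolding Q_def hcube_def by (auto simp: abs_less_iff minus_less_iff less_imp_le simp del: of_nat_Suc)
    qed
    have Qdil: "Q k \<subseteq> hdil m (\<chi> i. - real (Suc k)) (2 * real (Suc k))" for k
    proof -
      have "Q k \<subseteq> dil m (\<chi> i. - real (Suc k)) (2 * real (Suc k))" unfolding Q_def by (rule hcube_subset_dil) (use m in auto)
      then show ?thesis using ocube_subset_hcube unfolding dil_def hdil_def by blast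
    qed
    \<comment> \<open>Once the cube contains the support of \<open>f\<close> the restriction changes
      nothing, and the bilinear estimate speaks of \<open>comm b f\<close> itself.\<close>
    have restrf: "restr (hdil m (\<chi> i. - real (Suc k)) (2 * real (Suc k))) f = f" if "j0 \<le> k" for k
    proof
      fix x
      have "x \<in> Q k" if "f x \<noteq> 0"
      proof -
        have "x \<in> S" using S(2) that by blast
        then show ?thesis using r0[of x] j0 \<open>j0 \<le> k\<close> by (intro memQ) auto
      qed
      then show "restr (hdil m (\<chi> i. - real (Suc k)) (2 * real (Suc k))) f x = f x"
        using Qdil[of k] by (cases "f x = 0") (auto simp: restr_def indicator_def)
    qed
    define a0 :: "real ^ 'n" where "a0 = (\<chi> i. - real (Suc j0))"
    define l0 where "l0 = 2 * real (Suc j0)"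
    have l0: "0 < (2 * m + 1) * l0" unfolding l0_def using m by (intro mult_pos_pos) auto
    note ri = restr_integrable[OF bc fm spec[OF fb] hdil_def[of m a0 l0] l0, unfolded a0_def l0_def restrf[OF order_refl]]
    show fi: "integrable lebesgue f" by (rule ri(1))
    show bf: "integrable lebesgue (\<lambda>y. b y * f y)" by (rule ri(2))
    show "L2 f"
      by (rule L2_bounded_integrable[OF fm _ spec[OF fb]]) (use fi in \<open>simp add: integrable_iff_L1norm\<close>)
    note [measurable] = T1_measurable[OF fi] T1_measurable[OF bf]
    define H where "H x = ennreal (norm (comm b f x))" for x
    have Hm [measurable]: "H \<in> borel_measurable lebesgue" unfolding H_def comm_def by measurable
    define Nf where "Nf = ennpow (\<integral>\<^sup>+x. ennpow (ennreal (norm (f x))) p * ennreal (\<mu> x) \<partial>lebesgue) (1 / p)"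
    define E where "E k = Q k \<inter> {x. H x \<le> ennreal (real k)} \<inter> {x. \<kappa> x \<le> real k}" for k
    have Em [measurable]: "E k \<in> sets lebesgue" for k
    proof -
      have "{x \<in> space lebesgue. H x \<le> ennreal (real k)} \<in> sets lebesgue" "{x \<in> space lebesgue. \<kappa> x \<le> real k} \<in> sets lebesgue"
        by measurable
      then show ?thesis unfolding E_def by simp
    qed
    define I where "I k = (\<integral>\<^sup>+x\<in>E k. ennpow (H x) p * ennreal (\<kappa> x) \<partial>lebesgue)" for k
    have Ik: "ennpow (I k) (1 / p) \<le> ennreal M * B * Nf" if k: "j0 \<le> k" for k
    proof -
      have "I k \<le> (\<integral>\<^sup>+x. ennpow (ennreal (real k)) p * ennreal (real k) * indicator (Q k) x \<partial>lebesgue)"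
        unfolding I_def E_def using p by (intro nn_integral_mono) (auto simp: indicator_def intro!: mult_mono ennpow_mono ennreal_leI)
      also have "\<dots> = ennpow (ennreal (real k)) p * ennreal (real k) * emeasure lebesgue (Q k)"
        by (simp add: nn_integral_cmult_indicator)
      also have "\<dots> < top"
        unfolding Q_def by (subst emeasure_hcube) (auto simp: ennpow_ennreal ennreal_mult_less_top)
      finally have Ifin: "I k < top" .
      define g where "g x = ennpow (H x) (p - 1) * ennreal (\<kappa> x) * indicator (E k) x" for x
      have [measurable]: "g \<in> borel_measurable lebesgue" unfolding g_def by measurable
      have "I k = (\<integral>\<^sup>+x\<in>Q k. ennreal (norm (comm b (restr (hdil m (\<chi> i. - real (Suc k)) (2 * real (Suc k))) f) x)) * g x \<partial>lebesgue)"
        unfolding I_def restrf[OF k] H_def[symmetric]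
      proof (rule nn_integral_cong)
        fix x
        have "H x * ennpow (H x) (p - 1) = ennpow (H x) p" using ennpow_add[of "H x" 1 "p - 1"] by simp
        then show "ennpow (H x) p * ennreal (\<kappa> x) * indicator (E k) x = H x * g x * indicator (Q k) x"
          by (auto simp: g_def E_def indicator_def mult.assoc[symmetric])
      qed
      also have "\<dots> \<le> ennreal M * B * (Nf * ennpow (\<integral>\<^sup>+x. ennpow (g x) q * ennreal (dual_weight p \<kappa> x) \<partial>lebesgue) (1 / q))"
        unfolding Q_def Nf_def by (rule M(2)[rule_format, OF b fm spec[OF fb]]) auto
      also have "(\<integral>\<^sup>+x. ennpow (g x) q * ennreal (dual_weight p \<kappa> x) \<partial>lebesgue) = I k"
        unfolding I_def
      proof (rule nn_integral_cong)
        fix x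
        have "\<kappa> x powr q * dual_weight p \<kappa> x = \<kappa> x powr (q + (1 - q))"
          unfolding dual_weight_def powr_add q(8) ..
        also have "\<dots> = \<kappa> x" using \<kappa>pos[of x] by simp
        finally have "ennreal (\<kappa> x powr q) * ennreal (dual_weight p \<kappa> x) = ennreal (\<kappa> x)" by (simp add: ennreal_mult[symmetric] dual_weight_def)
        then show "ennpow (g x) q * ennreal (dual_weight p \<kappa> x) = ennpow (H x) p * ennreal (\<kappa> x) * indicator (E k) x"
          using \<kappa>pos[of x] by (auto simp: g_def indicator_def ennpow_mult ennpow_ennpow q(3) ennpow_ennreal mult.assoc)
      qed
      finally have le: "I k \<le> ennreal M * B * (Nf * ennpow (I k) (1 / q))" .
      show ?thesis
      proof (cases "I k = 0")
        case False
        have "I k = ennpow (I k) (1 / p + 1 / q)" by (simp add: q(2))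
        then have "ennpow (I k) (1 / q) * ennpow (I k) (1 / p) \<le> ennpow (I k) (1 / q) * (ennreal M * B * Nf)"
          using le by (simp only: ennpow_add mult_ac)
        then show ?thesis using False Ifin by (subst (asm) ennreal_mult_le_mult_iff) auto
      qed simp
    qed
    have "(\<integral>\<^sup>+x. ennpow (H x) p * ennreal (\<kappa> x) \<partial>lebesgue) \<le> (\<integral>\<^sup>+x. liminf (\<lambda>k. ennpow (H x) p * ennreal (\<kappa> x) * indicator (E k) x) \<partial>lebesgue)"
    proof (rule nn_integral_mono)
      fix x
      obtain k1 :: nat where k1: "max (norm x) (max (norm (comm b f x)) (\<kappa> x)) \<le> real k1" using real_arch_simple by blast
      have "\<forall>\<^sub>F k in sequentially. x \<in> E k"
        unfolding eventually_sequentially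
      proof (intro exI[of _ k1] allI impI)
        fix k assume "k1 \<le> k"
        then have "norm x \<le> real k" "norm (comm b f x) \<le> real k" "\<kappa> x \<le> real k" using k1 by auto
        then show "x \<in> E k" unfolding E_def H_def by (auto intro: memQ ennreal_leI)
      qed
      then have "\<forall>\<^sub>F k in sequentially. ennpow (H x) p * ennreal (\<kappa> x) \<le> ennpow (H x) p * ennreal (\<kappa> x) * indicator (E k) x"
        by eventually_elim simp
      then show "ennpow (H x) p * ennreal (\<kappa> x) \<le> liminf (\<lambda>k. ennpow (H x) p * ennreal (\<kappa> x) * indicator (E k) x)"
        by (rule Liminf_bounded)
    qed
    also have "\<dots> \<le> liminf I" unfolding I_def by (rule nn_integral_liminf) measurable
    also have "\<dots> \<le> ennpow (ennreal M * B * Nf) p"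
    proof (rule Liminf_le)
      show "\<forall>\<^sub>F k in sequentially. I k \<le> ennpow (ennreal M * B * Nf) p"
        unfolding eventually_sequentially
      proof (intro exI[of _ j0] allI impI)
        fix k assume "j0 \<le> k"
        from ennpow_mono[OF _ Ik[OF this], of p] p show "I k \<le> ennpow (ennreal M * B * Nf) p" by (simp add: ennpow_ennpow)
      qed
    qed simp
    finally have "ennpow (\<integral>\<^sup>+x. ennpow (H x) p * ennreal (\<kappa> x) \<partial>lebesgue) (1 / p) \<le> ennpow (ennpow (ennreal M * B * Nf) p) (1 / p)"
      using p by (intro ennpow_mono) auto
    then show "ennpow (\<integral>\<^sup>+x. ennpow (ennreal (norm (comm b f x))) p * ennreal (\<kappa> x) \<partial>lebesgue) (1 / p) \<le>
      ennreal M * B * ennpow (\<integral>\<^sup>+x. ennpow (ennreal (norm (f x))) p * ennreal (\<mu> x) \<partial>lebesgue) (1 / p)"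
      using p by (simp add: ennpow_ennpow H_def Nf_def)
  qed
qed

end

section \<open>Passage to the definitions of the theorem\<close>

lemma CZ_operator_setup:
  fixes T :: "(real ^ 'n \<Rightarrow> complex) \<Rightarrow> (real ^ 'n \<Rightarrow> complex)"
  assumes "CZ_operator T"
  shows "\<exists>K B C \<delta>. CZ_setup T K B C \<delta>"
proof -
  have bo: "bounded_operator_L2 T" using assms by (simp add: CZ_operator_def)
  obtain K where K: "CZ_kernel K" "\<forall>f\<in>Lp_space 2 (\<lambda>_. 1). AE x in lebesgue. x \<notin> ess_support f \<longrightarrow> T f x = (LINT y|lebesgue. K x y * f y)"
    using assms by (auto simp: CZ_operator_def)
  obtain C \<delta> where C: "0 < \<delta>" "\<And>x y. x \<noteq> y \<Longrightarrow> norm (K x y) \<le> C / norm (x - y) ^ CARD('n)"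
    "\<And>x y h. norm (x - y) > 2 * norm h \<and> 2 * norm h > 0 \<Longrightarrow>
        norm (K (x + h) y - K x y) + norm (K x (y + h) - K x y)
          \<le> C * (norm h powr \<delta> / norm (x - y) powr (real CARD('n) + \<delta>))"
    using K(1) unfolding CZ_kernel_def by blast
  obtain B where B: "\<forall>f\<in>Lp_space 2 (\<lambda>_. 1). Lp_norm 2 (\<lambda>_. 1) (T f) \<le> ennreal B * Lp_norm 2 (\<lambda>_. 1) f"
    using bo by (auto simp: bounded_operator_L2_def)
  \<comment> \<open>The given bound may be a negative real, which counts as 0 in
    \<open>ennreal\<close>; hence \<open>max\<close>. The square turns a bound for norms into one
    for integrals of squares.\<close>
  have "CZ_setup T K ((max 0 B) powr 2) C \<delta>"
  proof
    show "L2 (T f)" if "L2 f" for f using bo that by (simp add: bounded_operator_L2_def Lp_space_2_iff)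
    show "AE x in lebesgue. T (\<lambda>y. \<alpha> * f y + \<beta> * g y) x = \<alpha> * T f x + \<beta> * T g x" if "L2 f" "L2 g" for f g \<alpha> \<beta>
      using bo that by (simp add: bounded_operator_L2_def Lp_space_2_iff)
    show "(\<integral>\<^sup>+x. ennreal ((norm (T f x))\<^sup>2) \<partial>lebesgue) \<le> ennreal ((max 0 B) powr 2) * (\<integral>\<^sup>+x. ennreal ((norm (f x))\<^sup>2) \<partial>lebesgue)" if "L2 f" for f
    proof -
      have "Lp_norm 2 (\<lambda>_. 1) (T f) \<le> ennreal (max 0 B) * Lp_norm 2 (\<lambda>_. 1) f"
        using B that by (auto simp: Lp_space_2_iff max_def ennreal_neg)
      then have "ennpow (Lp_norm 2 (\<lambda>_. 1) (T f)) 2 \<le> ennpow (ennreal (max 0 B) * Lp_norm 2 (\<lambda>_. 1) f) 2"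
        by (intro ennpow_mono) auto
      then show ?thesis unfolding Lp_norm_2 ennpow_mult ennpow_ennpow by (simp add: ennpow_ennreal)
    qed
    \<comment> \<open>The size condition at one pair of distinct points forces the sign.\<close>
    show "0 \<le> C"
    proof -
      define e :: "real ^ 'n" where "e = (\<chi> i. 1)"
      have e: "e \<noteq> 0" by (simp add: e_def vec_eq_iff)
      have "0 \<le> C / norm (e - 0) ^ CARD('n)" using C(2)[OF e] norm_ge_zero order_trans by blast
      moreover have "0 < norm (e - 0) ^ CARD('n)" using e by simp
      ultimately show ?thesis by (simp add: zero_le_divide_iff)
    qed
    show "AE x in lebesgue. x \<notin> ess_support f \<longrightarrow> T f x = (LINT y|lebesgue. K x y * f y)" if "L2 f" for f
      using K(2) that by (simp add: Lp_space_2_iff)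
  qed (use C in auto)
  then show ?thesis by blast
qed

lemma locally_integrable_measurable:
  fixes f :: "real ^ 'n \<Rightarrow> 'b::euclidean_space"
  assumes "locally_integrable f" shows "f \<in> borel_measurable lebesgue"
proof (rule borel_measurable_LIMSEQ_metric)
  show "(\<lambda>x. indicator (cball 0 (real k)) x *\<^sub>R f x) \<in> borel_measurable lebesgue" for k :: nat
    using assms unfolding locally_integrable_def set_integrable_def by (intro borel_measurable_integrable) simp
  fix x :: "real ^ 'n"
  obtain k0 :: nat where k0: "norm x \<le> real k0" using real_arch_simple by blast
  have "\<forall>\<^sub>F k in sequentially. indicator (cball 0 (real k)) x *\<^sub>R f x = f x"
    unfolding eventually_sequentially using k0 by (intro exI[of _ k0]) auto
  then show "(\<lambda>k. indicator (cball 0 (real k)) x *\<^sub>R f x) \<longlonglongrightarrow> f x" by (rule tendsto_eventually)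
qed

lemma wmass_eq_wms:
  assumes "AE x in lebesgue. w x = w' x" "w' \<in> borel_measurable lebesgue"
  shows "wmass w (cbox a (\<chi> i. a $ i + l)) = emeasure (wms w') (ocube a l)"
  unfolding wmass_def emeasure_wms[OF assms(2) ocube_lebesgue]
  by (rule nn_integral_cong_AE, use assms(1) AE_ccube_hcube_ocube[of a l] in eventually_elim) (auto simp: indicator_def)

text \<open>Setting the weight to 1 on the null set where it is not positive affects no integral.
  The dual mass of a cube is finite because the A_p product is finite while the mass of the weight
  is positive.\<close>

lemma Ap_imp_strict_Ap:
  fixes w :: "real ^ 'n \<Rightarrow> real"
  assumes p: "1 < p" and w: "w \<in> Ap p"
  defines "w' \<equiv> (\<lambda>x. if 0 < w x then w x else 1)"
  shows "\<exists>C. strict_Ap p C w'" "AE x in lebesgue. w x = w' x"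
proof -
  have li: "locally_integrable w" and pos: "AE x in lebesgue. w x > 0" and fin: "Ap_char p w < top"
    using w by (auto simp: Ap_def weight_def)
  have [measurable]: "w \<in> borel_measurable lebesgue" by (rule locally_integrable_measurable[OF li])
  have w'm [measurable]: "w' \<in> borel_measurable lebesgue" unfolding w'_def by measurable
  show ae: "AE x in lebesgue. w x = w' x" using pos by eventually_elim (simp add: w'_def)
  then have ae': "AE x in lebesgue. w x powr (1 - conj_exp p) = dual_weight p w' x"
    by eventually_elim (simp add: dual_weight_def conj_exp_props(8)[OF p])
  have w'pos: "0 < w' x" for x by (simp add: w'_def)
  obtain C0 where C0: "Ap_char p w = ennreal C0" "0 \<le> C0" using fin by (cases "Ap_char p w") auto
  \<comment> \<open>Adding 1 makes the constant positive.\<close>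
  have "strict_Ap p (C0 + 1) w'"
    unfolding strict_Ap_def
  proof (intro conjI allI impI w'm w'pos)
    show "0 < C0 + 1" using C0 by simp
    fix a :: "real ^ 'n" and l :: real assume l: "0 < l"
    define r where "r = l ^ CARD('n)"
    have r: "0 < r" "emeasure lebesgue (ocube a l) = ennreal r" using l by (auto simp: r_def emeasure_ocube)
    let ?W = "emeasure (wms w') (ocube a l)" and ?S = "emeasure (wms (dual_weight p w')) (ocube a l)"
    have Q: "cbox a (\<chi> i. a $ i + l) \<in> cubes" using l by (auto simp: cubes_def)
    have mW: "wmass w (cbox a (\<chi> i. a $ i + l)) = ?W" by (rule wmass_eq_wms[OF ae w'm])
    have mS: "wmass (\<lambda>x. w x powr (1 - conj_exp p)) (cbox a (\<chi> i. a $ i + l)) = ?S"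
      by (rule wmass_eq_wms[OF ae']) measurable
    have "wavg w (cbox a (\<chi> i. a $ i + l)) * ennpow (wavg (\<lambda>x. w x powr (1 - conj_exp p)) (cbox a (\<chi> i. a $ i + l))) (p - 1) \<le> Ap_char p w"
      unfolding Ap_char_def by (rule SUP_upper[OF Q])
    then have le: "(?W / ennreal r) * ennpow (?S / ennreal r) (p - 1) \<le> ennreal C0"
      unfolding wavg_def mW mS C0(1) using l by (simp add: emeasure_ccube r_def)
    show Wfin: "?W < top"
    proof -
      have "set_integrable lebesgue (cbox a (\<chi> i. a $ i + l)) w" using li by (simp add: locally_integrable_def)
      then have "(\<integral>\<^sup>+x. ennreal (norm (indicator (cbox a (\<chi> i. a $ i + l)) x *\<^sub>R w x)) \<partial>lebesgue) < top"
        by (simp add: set_integrable_def integrable_iff_bounded)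
      moreover have "wmass w (cbox a (\<chi> i. a $ i + l)) \<le> (\<integral>\<^sup>+x. ennreal (norm (indicator (cbox a (\<chi> i. a $ i + l)) x *\<^sub>R w x)) \<partial>lebesgue)"
        unfolding wmass_def by (intro nn_integral_mono) (auto simp: indicator_def intro: ennreal_leI)
      ultimately show ?thesis unfolding mW by (rule le_less_trans[rotated])
    qed
    have Wpos: "0 < ?W" using emeasure_wms_pos[OF w'm w'pos, of "ocube a l"] r by auto
    have "ennpow (?S / ennreal r) (p - 1) \<noteq> top"
    proof
      assume "ennpow (?S / ennreal r) (p - 1) = top"
      then have "(?W / ennreal r) * ennpow (?S / ennreal r) (p - 1) = top"
        using Wpos r by (simp add: ennreal_mult_top ennreal_divide_eq_0_iff)
      then show False using le by (simp add: top_unique)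
    qed
    then show "?S < top" using r by (auto simp: less_top[symmetric] ennreal_top_divide)
    have "?W * ennpow ?S (p - 1) = ((?W / ennreal r) * ennpow (?S / ennreal r) (p - 1)) * ennreal (r powr p)"
    proof -
      have "?W = (?W / ennreal r) * ennreal r" "?S = (?S / ennreal r) * ennreal r"
        using r by (simp_all add: ennreal_divide_times mult_divide_eq_ennreal)
      then have "?W * ennpow ?S (p - 1) = ((?W / ennreal r) * ennreal r) * (ennpow (?S / ennreal r) (p - 1) * ennpow (ennreal r) (p - 1))"
        by (metis ennpow_mult)
      also have "\<dots> = ((?W / ennreal r) * ennpow (?S / ennreal r) (p - 1)) * (ennpow (ennreal r) 1 * ennpow (ennreal r) (p - 1))"
        by (simp only: ennpow_1 mult_ac)
      also have "ennpow (ennreal r) 1 * ennpow (ennreal r) (p - 1) = ennreal (r powr p)"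
        using r by (simp only: ennpow_add[symmetric]) (simp add: ennpow_ennreal)
      finally show ?thesis .
    qed
    also have "\<dots> \<le> ennreal (C0 + 1) * ennreal (r powr p)"
      by (intro mult_right_mono order_trans[OF le] ennreal_leI) auto
    also have "ennreal (r powr p) = ennpow (emeasure lebesgue (ocube a l)) p" using r by (simp add: ennpow_ennreal)
    finally show "?W * ennpow ?S (p - 1) \<le> ennreal (C0 + 1) * ennpow (emeasure lebesgue (ocube a l)) p" .
  qed
  then show "\<exists>C. strict_Ap p C w'" by blast
qed

text \<open>The quotient in \<open>BMO_norm\<close> can be multiplied out since
  \<open>strict_Ap\<close> makes the mass of a cube positive and finite; closed and half-open cubes
  share averages and integrals.\<close>

lemma BMO_imp_bmo_le:
  fixes b :: "real ^ 'n \<Rightarrow> complex"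
  assumes b: "b \<in> BMO \<nu>" and ae: "AE x in lebesgue. \<nu> x = \<nu>' x" and A: "strict_Ap p C \<nu>'"
  shows "bmo_le \<nu>' (BMO_norm \<nu> b) b"
proof -
  have li: "locally_integrable b" using b by (simp add: BMO_def)
  have [measurable]: "\<nu>' \<in> borel_measurable lebesgue" using A by (simp add: strict_Ap_def)
  have bm [measurable]: "b \<in> borel_measurable lebesgue" by (rule locally_integrable_measurable[OF li])
  have ioc: "integrable_on_cubes b"
    unfolding integrable_on_cubes_def
  proof (intro conjI allI bm)
    fix a :: "real ^ 'n" and l
    have "set_integrable lebesgue (cbox a (\<chi> i. a $ i + l)) b" using li by (simp add: locally_integrable_def)
    then show "set_integrable lebesgue (hcube a l) b"
      by (rule set_integrable_subset) (auto simp: hcube_subset_ccube)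
  qed
  show ?thesis
    unfolding bmo_le_def
  proof (intro conjI allI impI ioc)
    fix a :: "real ^ 'n" and l :: real assume l: "0 < l"
    let ?Q = "cbox a (\<chi> i. a $ i + l)"
    have Q: "?Q \<in> cubes" using l by (auto simp: cubes_def)
    have "(LINT x:hcube a l|lebesgue. b x) = (LINT x:?Q|lebesgue. b x)"
      unfolding set_lebesgue_integral_def
    proof (rule integral_cong_AE)
      show "(\<lambda>x. indicat_real (hcube a l) x *\<^sub>R b x) \<in> borel_measurable lebesgue" "(\<lambda>x. indicat_real ?Q x *\<^sub>R b x) \<in> borel_measurable lebesgue"
        by (intro borel_measurable_scaleR borel_measurable_indicator bm; simp)+
      show "AE x in lebesgue. indicat_real (hcube a l) x *\<^sub>R b x = indicat_real ?Q x *\<^sub>R b x"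
        using AE_ccube_hcube_ocube[of a l] by eventually_elim (auto simp: indicator_def)
    qed
    then have avg: "average (hcube a l) b = average ?Q b"
      unfolding average_def measure_def using l by (simp add: emeasure_hcube emeasure_ccube)
    have eq: "(\<integral>\<^sup>+x\<in>hcube a l. ennreal (norm (b x - average (hcube a l) b)) \<partial>lebesgue) = (\<integral>\<^sup>+x\<in>?Q. ennreal (norm (b x - average ?Q b)) \<partial>lebesgue)"
      unfolding avg by (rule nn_integral_cong_AE, use AE_ccube_hcube_ocube[of a l] in eventually_elim) (auto simp: indicator_def)
    have W: "wmass \<nu> ?Q = emeasure (wms \<nu>') (hcube a l)"
      by (simp add: wmass_eq_wms[OF ae] emeasure_wms_hcube)
    have "0 < emeasure (wms \<nu>') (ocube a l)" "emeasure (wms \<nu>') (ocube a l) < top"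
      using emeasure_wms_pos[of \<nu>' "ocube a l"] A l emeasure_ocube[OF l, of a] unfolding strict_Ap_def by auto
    then have W0: "0 < wmass \<nu> ?Q" "wmass \<nu> ?Q < top" by (simp_all add: wmass_eq_wms[OF ae])
    have "(\<integral>\<^sup>+x\<in>?Q. ennreal (norm (b x - average ?Q b)) \<partial>lebesgue) = (\<integral>\<^sup>+x\<in>?Q. ennreal (norm (b x - average ?Q b)) \<partial>lebesgue) / wmass \<nu> ?Q * wmass \<nu> ?Q"
      using W0 by (simp add: ennreal_divide_times mult_divide_eq_ennreal)
    also have "\<dots> \<le> BMO_norm \<nu> b * wmass \<nu> ?Q"
      unfolding BMO_norm_def by (intro mult_right_mono SUP_upper[OF Q]) simp
    finally show "(\<integral>\<^sup>+x\<in>hcube a l. ennreal (norm (b x - average (hcube a l) b)) \<partial>lebesgue) \<le> BMO_norm \<nu> b * emeasure (wms \<nu>') (hcube a l)"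
      unfolding eq W .
  qed
qed

lemma Lp_norm_cong_AE:
  assumes "AE x in lebesgue. norm (f x) = norm (f' x) \<and> w x = w' x" "\<And>x. 0 \<le> w' x"
  shows "Lp_norm p w f = ennpow (\<integral>\<^sup>+x. ennpow (ennreal (norm (f' x))) p * ennreal (w' x) \<partial>lebesgue) (1 / p)"
proof -
  have "(\<integral>\<^sup>+x. ennreal (norm (f x) powr p * w x) \<partial>lebesgue) = (\<integral>\<^sup>+x. ennpow (ennreal (norm (f' x))) p * ennreal (w' x) \<partial>lebesgue)"
    by (rule nn_integral_cong_AE, use assms(1) in eventually_elim) (simp add: ennpow_ennreal ennreal_mult assms(2))
  then show ?thesis by (simp add: Lp_norm_def)
qed

theorem theorem1p1:
  fixes T :: "(real ^ 'n \<Rightarrow> complex) \<Rightarrow> (real ^ 'n \<Rightarrow> complex)"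
    and \<mu> \<kappa> \<nu> :: "real ^ 'n \<Rightarrow> real"
    and p :: real
  assumes "CZ_operator T"
    and "1 < p"
    and "\<mu> \<in> Ap p"
    and "\<kappa> \<in> Ap p"
    and "\<nu> = (\<lambda>x. \<mu> x powr (1 / p) * \<kappa> x powr (- (1 / p)))"
  shows "\<exists>c::real. 0 \<le> c \<and>
           (\<forall>b\<in>BMO \<nu>. operator_norm p \<mu> \<kappa> (commutator b T) \<le> ennreal c * BMO_norm \<nu> b)"
proof -
  note p = assms(2)
  define \<mu>' where "\<mu>' = (\<lambda>x. if 0 < \<mu> x then \<mu> x else 1)"
  define \<kappa>' where "\<kappa>' = (\<lambda>x. if 0 < \<kappa> x then \<kappa> x else 1)"
  obtain C1 where \<mu>': "strict_Ap p C1 \<mu>'" using Ap_imp_strict_Ap(1)[OF p assms(3)] by (auto simp: \<mu>'_def)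
  obtain C2 where \<kappa>': "strict_Ap p C2 \<kappa>'" using Ap_imp_strict_Ap(1)[OF p assms(4)] by (auto simp: \<kappa>'_def)
  have ae\<mu>: "AE x in lebesgue. \<mu> x = \<mu>' x" unfolding \<mu>'_def by (rule Ap_imp_strict_Ap(2)[OF p assms(3)])
  have ae\<kappa>: "AE x in lebesgue. \<kappa> x = \<kappa>' x" unfolding \<kappa>'_def by (rule Ap_imp_strict_Ap(2)[OF p assms(4)])
  have pos: "0 \<le> \<mu>' x" "0 \<le> \<kappa>' x" for x by (auto simp: \<mu>'_def \<kappa>'_def)
  define \<nu>' where "\<nu>' = (\<lambda>x. \<mu>' x powr (1 / p) * \<kappa>' x powr (- (1 / p)))"
  have ae\<nu>: "AE x in lebesgue. \<nu> x = \<nu>' x"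
    using ae\<mu> ae\<kappa> by eventually_elim (simp add: assms(5) \<nu>'_def)
  have A2: "strict_Ap 2 ((C1 * C2) powr (1 / p)) \<nu>'" unfolding \<nu>'_def by (rule Bloom_weight_A2[OF p \<mu>' \<kappa>'])
  obtain K B C \<delta> where CZ: "CZ_setup T K B C \<delta>" using CZ_operator_setup[OF assms(1)] by blast
  interpret CZ_setup T K B C \<delta> by (rule CZ)
  \<comment> \<open>Obtained before \<open>b\<close> is introduced, from \<open>p\<close>, the
    weights and the data of \<open>T\<close>; it is the constant of the theorem.\<close>
  obtain M where M: "0 \<le> M" "\<forall>B b f. bmo_le \<nu>' B b \<longrightarrow> f \<in> bounded_compact_support \<longrightarrow>
    integrable lebesgue f \<and> L2 f \<and> integrable lebesgue (\<lambda>y. b y * f y) \<and>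
    ennpow (\<integral>\<^sup>+x. ennpow (ennreal (norm (comm b f x))) p * ennreal (\<kappa>' x) \<partial>lebesgue) (1 / p) \<le>
      ennreal M * B * ennpow (\<integral>\<^sup>+x. ennpow (ennreal (norm (f x))) p * ennreal (\<mu>' x) \<partial>lebesgue) (1 / p)"
    using comm_Lp_bound[OF p \<mu>' \<kappa>'] unfolding \<nu>'_def[symmetric] by (elim exE conjE) (rule that)
  show ?thesis
  proof (intro exI[of _ M] conjI ballI M(1))
    fix b assume b: "b \<in> BMO \<nu>"
    have bb: "bmo_le \<nu>' (BMO_norm \<nu> b) b" by (rule BMO_imp_bmo_le[OF b ae\<nu> A2])
    show "operator_norm p \<mu> \<kappa> (commutator b T) \<le> ennreal M * BMO_norm \<nu> b"
      unfolding operator_norm_def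
    \<comment> \<open>The operator norm is an infimum of admissible constants, so membership of this
      one suffices.\<close>
    proof (rule Inf_lower, rule CollectI, rule ballI)
      fix f :: "real ^ 'n \<Rightarrow> complex" assume f: "f \<in> bounded_compact_support"
      note Mf = M(2)[rule_format, OF bb f]
      \<comment> \<open>\<open>commutator\<close> contains \<open>T f\<close> and
        \<open>comm\<close> contains \<open>T1 f\<close>; they agree almost everywhere as
        \<open>f\<close> is integrable and square integrable.\<close>
      have "AE x in lebesgue. norm (commutator b T f x) = norm (comm b f x) \<and> \<kappa> x = \<kappa>' x"
        using T1_eq_T[of f] Mf ae\<kappa> unfolding commutator_def comm_def T1_def[symmetric]
        by (auto elim!: eventually_mono[OF eventually_conj])
      then have 1: "Lp_norm p \<kappa> (commutator b T f) = ennpow (\<integral>\<^sup>+x. ennpow (ennreal (norm (comm b f x))) p * ennreal (\<kappa>' x) \<partial>lebesgue) (1 / p)"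
        by (rule Lp_norm_cong_AE) (rule pos)
      have "AE x in lebesgue. norm (f x) = norm (f x) \<and> \<mu> x = \<mu>' x" using ae\<mu> by simp
      then have 2: "Lp_norm p \<mu> f = ennpow (\<integral>\<^sup>+x. ennpow (ennreal (norm (f x))) p * ennreal (\<mu>' x) \<partial>lebesgue) (1 / p)"
        by (rule Lp_norm_cong_AE) (rule pos)
      show "Lp_norm p \<kappa> (commutator b T f) \<le> ennreal M * BMO_norm \<nu> b * Lp_norm p \<mu> f"
        unfolding 1 2 using Mf by blast
    qed
  qed
qed

end
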